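(* Let $\nu>-1$. The maximal operators $\mathfrak{H}_*^\nu$ and $\mathfrak{H}_*^{\nu,M}$ are bounded on $L^p(d\eta_\nu)$, $1<p\le\infty$, and from $L^1(d\eta_\nu)$ to weak $L^1(d\eta_\nu)$.
   Context: All $L^p$ spaces are over the interval $(0,1)$. For $\nu>-1$ let $J_\nu$ be the Bessel function of the first kind of order $\nu$ on $(0,\infty)$, and let $0<\lambda_{1,\nu}<\lambda_{2,\nu}<\dots$ be its successive positive zeros. For $n\ge1$ and $x\in(0,1)$ set $$\phi_n^\nu(x)=\frac{\sqrt2}{|J_{\nu+1}(\lambda_{n,\nu})|}x^{-\nu}J_\nu(\lambda_{n,\nu}x),\qquad \varphi_n^\nu(x)=\frac{\phi_n^\nu(x)}{\phi_1^\nu(x)},\qquad d\eta_\nu(x)=x^{2\nu+1}[\phi_1^\nu(x)]^2dx.$$ Let $d_\nu=\frac{d}{dx}$. The system $\{d_\nu\varphi_n^\nu:n\ge2\}$ is an orthogonal basis of $L^2(d\eta_\nu)$ with $\|d_\nu\varphi_n^\nu\|_{L^2(d\eta_\nu)}^2=\lambda_{n,\nu}^2-\lambda_{1,\nu}^2$. For $t>0$ and $x,y\in(0,1)$ let $$\mathfrak{H}_t^\nu(x,y)=\sum_{n=2}^\infty e^{-\lambda_{n,\nu}^2t}\frac{d_\nu\varphi_n^\nu(x)\,d_\nu\varphi_n^\nu(y)}{\lambda_{n,\nu}^2-\lambda_{1,\nu}^2},\qquad \mathfrak{H}_t^{\nu,M}(x,y)=e^{\lambda_{1,\nu}^2t}\mathfrak{H}_t^\nu(x,y),$$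 and for $f\in L^1(d\eta_\nu)$ $$\mathfrak{H}_t^\nu f(x)=\int_0^1\mathfrak{H}_t^\nu(x,y)f(y)\,d\eta_\nu(y),\qquad \mathfrak{H}_t^{\nu,M}f(x)=\int_0^1\mathfrak{H}_t^{\nu,M}(x,y)f(y)\,d\eta_\nu(y),$$ $$\mathfrak{H}_*^\nu f=\sup_{t>0}|\mathfrak{H}_t^\nu f|,\qquad \mathfrak{H}_*^{\nu,M}f=\sup_{t>0}|\mathfrak{H}_t^{\nu,M}f|.$$ *)

theory Defs
  imports "HOL-Probability.Essential_Supremum"
begin

text \<open>The Bessel function of the first kind, for real order \<open>\<nu> > -1\<close> and \<open>x > 0\<close>.\<close>

definition bessel_J :: "real \<Rightarrow> real \<Rightarrow> real" where
  "bessel_J \<nu> x =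
     (\<Sum>k. (-1) ^ k / (fact k * Gamma (real k + \<nu> + 1)) * (x / 2) powr (2 * real k + \<nu>))"

text \<open>For \<open>n \<ge> 1\<close>, \<open>bessel_zero \<nu> n\<close> is the \<open>n\<close>-th positive zero; index \<open>0\<close> only starts
  the recursion. The infima are attained, since the positive zeros form a closed discrete
  subset of \<open>(0, \<infinity>)\<close> that does not accumulate at \<open>0\<close>.\<close>

primrec bessel_zero :: "real \<Rightarrow> nat \<Rightarrow> real" where
  "bessel_zero \<nu> 0 = 0"
| "bessel_zero \<nu> (Suc n) = Inf {x. bessel_zero \<nu> n < x \<and> bessel_J \<nu> x = 0}"

definition bessel_phi :: "real \<Rightarrow> nat \<Rightarrow> real \<Rightarrow> real" where
  "bessel_phi \<nu> n x =
     sqrt 2 / \<bar>bessel_J (\<nu> + 1) (bessel_zero \<nu> n)\<bar> * x powr (-\<nu>) * bessel_J \<nu> (bessel_zero \<nu> n * x)"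

definition bessel_varphi :: "real \<Rightarrow> nat \<Rightarrow> real \<Rightarrow> real" where
  "bessel_varphi \<nu> n x = bessel_phi \<nu> n x / bessel_phi \<nu> 1 x"

definition eta :: "real \<Rightarrow> real measure" where
  "eta \<nu> = density (lebesgue_on {0<..<1}) (\<lambda>x. ennreal (x powr (2 * \<nu> + 1) * (bessel_phi \<nu> 1 x)\<^sup>2))"

definition H_kernel :: "real \<Rightarrow> real \<Rightarrow> real \<Rightarrow> real \<Rightarrow> real" where
  "H_kernel \<nu> t x y =
     (\<Sum>m. let n = m + 2 in
        exp (- (bessel_zero \<nu> n)\<^sup>2 * t) *
        (deriv (bessel_varphi \<nu> n) x * deriv (bessel_varphi \<nu> n) y) /
        ((bessel_zero \<nu> n)\<^sup>2 - (bessel_zero \<nu> 1)\<^sup>2))"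

definition HM_kernel :: "real \<Rightarrow> real \<Rightarrow> real \<Rightarrow> real \<Rightarrow> real" where
  "HM_kernel \<nu> t x y = exp ((bessel_zero \<nu> 1)\<^sup>2 * t) * H_kernel \<nu> t x y"

definition H_op :: "real \<Rightarrow> real \<Rightarrow> (real \<Rightarrow> complex) \<Rightarrow> real \<Rightarrow> complex" where
  "H_op \<nu> t f x = (LINT y|eta \<nu>. H_kernel \<nu> t x y *\<^sub>R f y)"

definition HM_op :: "real \<Rightarrow> real \<Rightarrow> (real \<Rightarrow> complex) \<Rightarrow> real \<Rightarrow> complex" where
  "HM_op \<nu> t f x = (LINT y|eta \<nu>. HM_kernel \<nu> t x y *\<^sub>R f y)"

text \<open>A maximal function is a priori only \<open>[0, \<infinity>]\<close>-valued.\<close>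

definition H_max :: "real \<Rightarrow> (real \<Rightarrow> complex) \<Rightarrow> real \<Rightarrow> ennreal" where
  "H_max \<nu> f x = (SUP t\<in>{0<..}. ennreal (cmod (H_op \<nu> t f x)))"

definition HM_max :: "real \<Rightarrow> (real \<Rightarrow> complex) \<Rightarrow> real \<Rightarrow> ennreal" where
  "HM_max \<nu> f x = (SUP t\<in>{0<..}. ennreal (cmod (HM_op \<nu> t f x)))"

text \<open>\<open>enn_powr\<close> is used for exponents \<open>r > 0\<close> only.\<close>

definition enn_powr :: "ennreal \<Rightarrow> real \<Rightarrow> ennreal" where
  "enn_powr a r = (if a = \<infinity> then \<infinity> else ennreal (enn2real a powr r))"

text \<open>The \<open>L\<^sup>p\<close> norm of a \<open>[0, \<infinity>]\<close>-valued measurable function, for \<open>1 \<le> p \<le> \<infinity>\<close>.\<close>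

definition Lp_norm :: "'a measure \<Rightarrow> ennreal \<Rightarrow> ('a \<Rightarrow> ennreal) \<Rightarrow> ennreal" where
  "Lp_norm M p g =
     (if p = \<infinity> then esssup M g
      else enn_powr (\<integral>\<^sup>+x. enn_powr (g x) (enn2real p) \<partial>M) (1 / enn2real p))"

definition Lp :: "'a measure \<Rightarrow> ennreal \<Rightarrow> ('a \<Rightarrow> complex) set" where
  "Lp M p = {f \<in> borel_measurable M. Lp_norm M p (\<lambda>x. ennreal (cmod (f x))) < \<infinity>}"

text \<open>Boundedness of an operator \<open>T\<close> of maximal type. Measurability of \<open>T f\<close> is part of the
  claim: without it the integral of a power of \<open>T f\<close> would be a mere lower integral.\<close>

definition bounded_on_Lp ::
    "'a measure \<Rightarrow> ennreal \<Rightarrow> (('a \<Rightarrow> complex) \<Rightarrow> 'a \<Rightarrow> ennreal) \<Rightarrow> bool" where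
  "bounded_on_Lp M p T \<longleftrightarrow>
     (\<exists>C::real. 0 \<le> C \<and> (\<forall>f\<in>Lp M p. T f \<in> borel_measurable M \<and>
        Lp_norm M p (T f) \<le> ennreal C * Lp_norm M p (\<lambda>x. ennreal (cmod (f x)))))"

definition bounded_L1_weak_L1 ::
    "'a measure \<Rightarrow> (('a \<Rightarrow> complex) \<Rightarrow> 'a \<Rightarrow> ennreal) \<Rightarrow> bool" where
  "bounded_L1_weak_L1 M T \<longleftrightarrow>
     (\<exists>C::real. 0 \<le> C \<and> (\<forall>f\<in>Lp M 1. T f \<in> borel_measurable M \<and>
        (\<forall>\<alpha>>0. ennreal \<alpha> * emeasure M {x \<in> space M. ennreal \<alpha> < T f x}
           \<le> ennreal C * Lp_norm M 1 (\<lambda>x. ennreal (cmod (f x))))))"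

end

theory Submission
  imports Defs
begin

text \<open>
  Write \<open>e n\<close> for the quotients \<open>\<phi>\<^sub>n\<^sub>+\<^sub>1 / \<phi>\<^sub>1\<close>, \<open>w\<close> for the density of \<open>\<eta>\<close>, \<open>\<mu> n\<close> for the eigenvalue
  differences and \<open>S n\<close> for the primitive of \<open>w * e n\<close> vanishing at \<open>0\<close>. Then \<open>w * (e n)' = - \<mu> n * S n\<close>, so
  that the modified heat kernel of the derivatives is \<open>k t x y / (w x * w y)\<close> with
  \<open>k t x y = (\<Sum>n. \<mu> n * exp (- t * \<mu> n) * S n x * S n y)\<close>. The \<open>S n\<close> with \<open>n \<ge> 1\<close> are the Dirichlet
  eigenfunctions of the dual Sturm-Liouville operator, with ground state \<open>S 1 > 0\<close>, and
  \<open>K = k / (S 1 x * S 1 y)\<close> is the kernel of a sub-Markovian semigroup with respect to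
  \<open>dm = (S 1 / w)\<^sup>2 d\<eta>\<close>.

  No Gaussian bounds are needed. The flux of a solution of the resolvent equation vanishes at both
  endpoints, so by a maximum principle the resolvent preserves non-negative quasi-concave functions
  (those that first increase and then decrease). By the exponential formula so does the semigroup;
  applied to hat functions shrinking to a point mass this shows that every \<open>K t x\<close> is non-negative and
  quasi-concave. A symmetric, positive definite, sub-Markovian kernel with this property is
  dominated by the uncentred maximal function over intervals: its mode need not be at \<open>x\<close>, but positive
  definiteness bounds the part of the kernel lying above its diagonal value. The maximal function is
  of weak type (1,1) for every finite measure without atoms because a finite cover by intervals has
  a subcover of overlap 2.

  Completeness enters only as \<open>S 0 (min x y) = (\<Sum>n. S n x * S n y)\<close>. It follows from Jacobi's
  form of the oscillation argument: by Picone's identity a function vanishing at the \<open>N\<close> zeros of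
  \<open>e N\<close> has Rayleigh quotient at least \<open>\<mu> N\<close>.
\<close>

section \<open>Maximal functions over intervals\<close>

text \<open>Division by \<open>S 1\<close> makes a maximum principle possible: it turns the
  Dirichlet conditions at the two singular endpoints into the vanishing of a flux, the only boundary
  information that the comparison arguments use. The transformed kernel is controlled with respect
  to \<open>m\<close>, whereas the bounds are wanted for \<eta>. The bridge is elementary:
  \<open>\<rho> = S 1 / w\<close> is comparable to \<open>x * (1 - x)\<close>, so
  \<open>\<rho> x * \<rho> y\<close> times the \<eta>-measure of an interval containing x and y is
  at most a constant times its \<open>m\<close>-measure. No quantitative asymptotics of Bessel
  functions or of their zeros enter. Convergence of the series rests on two soft facts:
  \<open>\<bar>S n x\<bar> \<le> 1\<close>, from Parseval's formula for indicators of intervals, and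
  the summability of \<open>1 / \<mu> n\<close>, a trace computation whose diagonal
  \<open>S 0 x * (1 - S 0 x) / w x\<close> is bounded. Each single operator maps integrable
  functions to continuous ones, so the supremum over uncountably many times is measurable. The
  unmodified operators are the modified ones times a factor at most 1.\<close>

lemma interval_subcover_overlap_2:
  fixes F :: "(real \<times> real) set"
  assumes "finite F"
  obtains G where "G \<subseteq> F" "(\<Union>(a,b)\<in>G. {a<..<b}) = (\<Union>(a,b)\<in>F. {a<..<b})"
    "\<And>x. card {p\<in>G. x \<in> {fst p<..<snd p}} \<le> 2"
proof -
  define U where "U G = (\<Union>p\<in>G. {fst p<..<snd p})" for G :: "(real \<times> real) set"
  have U_eq: "(\<Union>(a,b)\<in>G. {a<..<b}) = U G" for G
    by (auto simp: U_def)
  \<comment> \<open>A subfamily with the same union and least cardinality contains no redundant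
    interval.\<close>
  obtain G where G: "G \<subseteq> F \<and> U G = U F"
    and min: "\<And>H. H \<subseteq> F \<and> U H = U F \<Longrightarrow> card G \<le> card H"
    using ex_has_least_nat[of "\<lambda>G. G \<subseteq> F \<and> U G = U F" F card] by auto
  have fG: "finite G" using G assms finite_subset by blast
  have "card {p\<in>G. x \<in> {fst p<..<snd p}} \<le> 2" for x
  proof (rule ccontr)
    let ?X = "{p\<in>G. x \<in> {fst p<..<snd p}}"
    assume "\<not> card ?X \<le> 2"
    then have c3: "card ?X > 2" by simp
    have fX: "finite ?X" using fG by simp
    have neX: "?X \<noteq> {}" using c3 by (metis (lifting) card.empty not_less0)
    \<comment> \<open>Among intervals through a common point, the one reaching furthest left and the
      one reaching furthest right cover all others, so a third one would be redundant.\<close>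
    define p where "p = arg_min_on fst ?X"
    define q where "q = arg_min_on (\<lambda>z. - snd z) ?X"
    have p: "p \<in> ?X" "\<And>z. z \<in> ?X \<Longrightarrow> fst p \<le> fst z"
      using arg_min_if_finite(1)[OF fX neX, of fst] arg_min_least[OF fX neX, of _ fst] by (auto simp: p_def)
    have q: "q \<in> ?X" "\<And>z. z \<in> ?X \<Longrightarrow> snd z \<le> snd q"
      using arg_min_if_finite(1)[OF fX neX, of "\<lambda>z. - snd z"]
        arg_min_least[OF fX neX, of _ "\<lambda>z. - snd z"] by (auto simp: q_def)
    have "\<not> ?X \<subseteq> {p, q}"
    proof
      assume "?X \<subseteq> {p, q}"
      then have "card ?X \<le> card {p,q}" by (intro card_mono) auto
      also have "\<dots> \<le> 2" by (simp add: card_insert_if)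
      finally show False using c3 by simp
    qed
    then obtain r where r: "r \<in> ?X" "r \<noteq> p" "r \<noteq> q" by blast
    have sub: "{fst r<..<snd r} \<subseteq> {fst p<..<snd p} \<union> {fst q<..<snd q}"
    proof
      fix y assume y: "y \<in> {fst r<..<snd r}"
      show "y \<in> {fst p<..<snd p} \<union> {fst q<..<snd q}"
        using p(1) q(1) p(2)[OF r(1)] q(2)[OF r(1)] y by (cases "y \<le> x") auto
    qed
    have "U (G - {r}) = U G"
    proof -
      have "p \<in> G - {r}" "q \<in> G - {r}" using p q r by auto
      then have "{fst r<..<snd r} \<subseteq> U (G - {r})" using sub unfolding U_def by blast
      moreover have "U G = U (G - {r}) \<union> {fst r<..<snd r}"
        using r(1) unfolding U_def by blast
      ultimately show ?thesis by blast
    qed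
    then have "card G \<le> card (G - {r})" using min G by blast
    moreover have "card (G - {r}) < card G" using r(1) fG by (intro psubset_card_mono) auto
    ultimately show False by simp
  qed
  with G that[of G] show thesis by (simp add: U_eq)
qed

text \<open>Uncentred, so that superlevel sets are unions of open intervals and hence open.\<close>

definition interval_maximal :: "real measure \<Rightarrow> (real \<Rightarrow> ennreal) \<Rightarrow> real \<Rightarrow> ennreal" where
  "interval_maximal M f x =
     (SUP (a,b)\<in>{(a,b). 0 \<le> a \<and> a < x \<and> x < b \<and> b \<le> 1}.
        (\<integral>\<^sup>+y\<in>{a<..<b}. f y \<partial>M) / emeasure M {a<..<b})"

lemma ennreal_divide_mult_cancel:
  fixes a b :: ennreal
  assumes "b \<noteq> 0" "b \<noteq> \<infinity>"
  shows "a / b * b = a"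
  using assms by (metis infinity_ennreal_def mult.commute ennreal_times_divide mult_divide_eq_ennreal)

text \<open>Two measures are instances: \<eta> itself and its ground state transform
  \<open>m\<close>. Positive mass of intervals makes averages meaningful, and the absence of atoms
  lets endpoints of intervals be ignored.\<close>

locale interval_measure = finite_measure M for M :: "real measure" +
  assumes space_M: "space M = {0<..<1}"
    and sets_M: "\<And>a b. 0 \<le> a \<Longrightarrow> b \<le> 1 \<Longrightarrow> {a<..<b} \<in> sets M"
    and pos_M: "\<And>a b. 0 \<le> a \<Longrightarrow> a < b \<Longrightarrow> b \<le> 1 \<Longrightarrow> 0 < emeasure M {a<..<b}"
    and atomless: "\<And>x. x \<in> {0<..<1} \<Longrightarrow> {x} \<in> sets M \<and> emeasure M {x} = 0"
begin

lemma interval_integral_le_maximal: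
  assumes "0 \<le> a" "a < x" "x < b" "b \<le> 1"
  shows "(\<integral>\<^sup>+y\<in>{a<..<b}. f y \<partial>M) \<le> interval_maximal M f x * emeasure M {a<..<b}"
proof -
  let ?I = "\<integral>\<^sup>+y\<in>{a<..<b}. f y \<partial>M" and ?m = "emeasure M {a<..<b}"
  have m: "?m \<noteq> 0" "?m \<noteq> \<infinity>" using pos_M[of a b] assms by (auto simp: less_top)
  have "?I / ?m \<le> interval_maximal M f x"
    unfolding interval_maximal_def using assms by (intro SUP_upper2[of "(a,b)"]) auto
  then have "?I / ?m * ?m \<le> interval_maximal M f x * ?m" by (rule mult_right_mono) simp
  moreover have "?I / ?m * ?m = ?I"
    using m by (simp add: ennreal_divide_mult_cancel)
  ultimately show ?thesis by simp
qed

lemma sum_interval_integrals_le: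
  assumes "finite G" "\<And>x. card {p\<in>G. x \<in> {fst p<..<snd p}} \<le> 2" "f \<in> borel_measurable M"
    "\<And>p. p \<in> G \<Longrightarrow> 0 \<le> fst p \<and> snd p \<le> 1"
  shows "(\<Sum>p\<in>G. \<integral>\<^sup>+y\<in>{fst p<..<snd p}. f y \<partial>M) \<le> 2 * (\<integral>\<^sup>+y. f y \<partial>M)"
proof -
  have [measurable]: "f \<in> borel_measurable M" by fact
  have [measurable]: "p \<in> G \<Longrightarrow> {fst p<..<snd p} \<in> sets M" for p using assms(4) sets_M by auto
  have "(\<Sum>p\<in>G. \<integral>\<^sup>+y\<in>{fst p<..<snd p}. f y \<partial>M) = (\<integral>\<^sup>+y. (\<Sum>p\<in>G. f y * indicator {fst p<..<snd p} y) \<partial>M)"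
    by (subst nn_integral_sum) auto
  also have "\<dots> \<le> (\<integral>\<^sup>+y. 2 * f y \<partial>M)"
  proof (rule nn_integral_mono)
    fix y
    have "(\<Sum>p\<in>G. f y * indicator {fst p<..<snd p} y) = f y * (\<Sum>p\<in>G. indicator {fst p<..<snd p} y)"
      by (simp add: sum_distrib_left)
    also have "(\<Sum>p\<in>G. indicator {fst p<..<snd p} y :: ennreal) = of_nat (card {p\<in>G. y \<in> {fst p<..<snd p}})"
      using \<open>finite G\<close> by (simp add: indicator_def sum.If_cases Int_def conj_commute)
    also have "f y * \<dots> \<le> f y * of_nat 2" using assms(2)[of y]
      by (intro mult_left_mono) (simp_all only: of_nat_le_iff zero_le)
    finally show "(\<Sum>p\<in>G. f y * indicator {fst p<..<snd p} y) \<le> 2 * f y" by (simp add: mult.commute)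
  qed
  also have "\<dots> = 2 * (\<integral>\<^sup>+y. f y \<partial>M)" by (rule nn_integral_cmult) simp
  finally show ?thesis .
qed

text \<open>The assumptions put only intervals and points into \<open>sets M\<close>; Lindelof's
  theorem writes an open set as a countable union of intervals.\<close>

lemma open_Int_sets: "open U \<Longrightarrow> U \<subseteq> {0<..<1} \<Longrightarrow> U \<in> sets M"
proof -
  assume U: "open U" "U \<subseteq> {0<..<1}"
  define \<F> where "\<F> = {{a<..<b} |a b. 0 \<le> a \<and> b \<le> 1 \<and> {a<..<b} \<subseteq> U}"
  have "\<Union>\<F> = U"
  proof
    show "\<Union>\<F> \<subseteq> U" by (auto simp: \<F>_def)
    show "U \<subseteq> \<Union>\<F>"
    proof
      fix x assume x: "x \<in> U"
      then obtain e where e: "e > 0" "ball x e \<subseteq> U" using U(1) open_contains_ball by blast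
      have "{x - e<..<x + e} \<subseteq> U" using e by (simp add: ball_eq_greaterThanLessThan)
      then have "{max 0 (x-e)<..<min 1 (x+e)} \<in> \<F>" unfolding \<F>_def by force
      moreover have "x \<in> {max 0 (x-e)<..<min 1 (x+e)}" using x U e by force
      ultimately show "x \<in> \<Union>\<F>" by blast
    qed
  qed
  moreover obtain \<F>' where "\<F>' \<subseteq> \<F>" "countable \<F>'" "\<Union>\<F>' = \<Union>\<F>"
    using Lindelof[of \<F>] by (force simp: \<F>_def)
  moreover have "\<F> \<subseteq> sets M" using sets_M by (force simp: \<F>_def)
  ultimately show "U \<in> sets M" using sets.countable_Union[of \<F>'] by auto
qed

lemma interval_maximal_superlevel:
  fixes \<alpha> :: ennreal
  shows "{x\<in>space M. \<alpha> < interval_maximal M f x} =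
    (\<Union>(a,b)\<in>{(a,b). 0 \<le> a \<and> a < b \<and> b \<le> 1 \<and> \<alpha> < (\<integral>\<^sup>+y\<in>{a<..<b}. f y \<partial>M) / emeasure M {a<..<b}}. {a<..<b})"
proof (intro set_eqI iffI)
  fix x assume "x \<in> {x\<in>space M. \<alpha> < interval_maximal M f x}"
  then obtain p where p: "p \<in> {(a,b). 0 \<le> a \<and> a < x \<and> x < b \<and> b \<le> 1}"
      "\<alpha> < (case p of (a,b) \<Rightarrow> (\<integral>\<^sup>+y\<in>{a<..<b}. f y \<partial>M) / emeasure M {a<..<b})"
    unfolding interval_maximal_def less_SUP_iff by blast
  then show "x \<in> (\<Union>(a,b)\<in>{(a,b). 0 \<le> a \<and> a < b \<and> b \<le> 1 \<and> \<alpha> < (\<integral>\<^sup>+y\<in>{a<..<b}. f y \<partial>M) / emeasure M {a<..<b}}. {a<..<b})"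
    by (intro UN_I[of p]) auto
next
  fix x assume "x \<in> (\<Union>(a,b)\<in>{(a,b). 0 \<le> a \<and> a < b \<and> b \<le> 1 \<and> \<alpha> < (\<integral>\<^sup>+y\<in>{a<..<b}. f y \<partial>M) / emeasure M {a<..<b}}. {a<..<b})"
  then obtain a b where ab: "0 \<le> a" "b \<le> 1" "a < x" "x < b" "\<alpha> < (\<integral>\<^sup>+y\<in>{a<..<b}. f y \<partial>M) / emeasure M {a<..<b}"
    by auto
  have "\<alpha> < interval_maximal M f x"
    unfolding interval_maximal_def less_SUP_iff using ab by (intro bexI[of _ "(a,b)"]) auto
  then show "x \<in> {x\<in>space M. \<alpha> < interval_maximal M f x}" using ab by (simp add: space_M)
qed

lemma interval_maximal_measurable [measurable]:
  "interval_maximal M f \<in> borel_measurable M"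
proof (rule borel_measurableI_greater)
  fix \<alpha> :: ennreal
  have "{x\<in>space M. \<alpha> < interval_maximal M f x} \<in> sets M"
  proof (rule open_Int_sets)
    show "open {x\<in>space M. \<alpha> < interval_maximal M f x}"
      unfolding interval_maximal_superlevel by (intro open_UN) auto
  qed (auto simp: space_M)
  then show "{x\<in>space M. interval_maximal M f x > \<alpha>} \<in> sets M" .
qed

text \<open>A superlevel set is a union of intervals whose averages exceed \<alpha>. A finite
  subfamily can be thinned to overlap 2, which is the constant; Lindelof's theorem and continuity
  from below then pass to the full union.\<close>

lemma interval_maximal_weak_type:
  fixes \<alpha> :: ennreal
  assumes f: "f \<in> borel_measurable M"
  shows "\<alpha> * emeasure M {x\<in>space M. \<alpha> < interval_maximal M f x} \<le> 2 * (\<integral>\<^sup>+y. f y \<partial>M)"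
proof -
  define P where "P = {(a,b). 0 \<le> a \<and> a < b \<and> b \<le> 1 \<and> \<alpha> < (\<integral>\<^sup>+y\<in>{a<..<b}. f y \<partial>M) / emeasure M {a<..<b}}"
  define I where "I p = {fst p<..<snd p}" for p :: "real \<times> real"
  have U: "{x\<in>space M. \<alpha> < interval_maximal M f x} = (\<Union>p\<in>P. I p)"
    unfolding interval_maximal_superlevel P_def I_def by auto
  have P1: "\<alpha> * emeasure M (I p) \<le> (\<integral>\<^sup>+y\<in>I p. f y \<partial>M)" if "p \<in> P" for p
  proof -
    obtain a b where p: "p = (a,b)" by force
    let ?I = "\<integral>\<^sup>+y\<in>{a<..<b}. f y \<partial>M" and ?m = "emeasure M {a<..<b}"
    have ab: "0 \<le> a" "a < b" "b \<le> 1" "\<alpha> < ?I / ?m" using that by (auto simp: P_def p)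
    have m: "?m \<noteq> 0" "?m \<noteq> \<infinity>" using pos_M[of a b] ab by (auto simp: less_top)
    have "\<alpha> * ?m \<le> ?I / ?m * ?m" using ab(4) by (intro mult_right_mono) auto
    moreover have "?I / ?m * ?m = ?I"
      using m by (simp add: ennreal_divide_mult_cancel)
    ultimately show ?thesis by (simp add: p I_def)
  qed
  have fin: "\<alpha> * emeasure M (\<Union>p\<in>F. I p) \<le> 2 * (\<integral>\<^sup>+y. f y \<partial>M)" if F: "finite F" "F \<subseteq> P" for F
  proof -
    obtain G where G: "G \<subseteq> F" "(\<Union>(a,b)\<in>G. {a<..<b}) = (\<Union>(a,b)\<in>F. {a<..<b})"
      "\<And>x. card {p\<in>G. x \<in> {fst p<..<snd p}} \<le> 2"
      using interval_subcover_overlap_2[OF F(1)] by blast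
    have eq: "(\<Union>p\<in>F. I p) = (\<Union>p\<in>G. I p)" using G(2) by (simp add: I_def case_prod_beta)
    have fG: "finite G" using G F finite_subset by blast
    have GP: "G \<subseteq> P" using G F by blast
    have sI: "I p \<in> sets M" if "p \<in> G" for p
      using that GP sets_M[of "fst p" "snd p"] unfolding I_def P_def by fastforce
    have "\<alpha> * emeasure M (\<Union>p\<in>F. I p) \<le> \<alpha> * (\<Sum>p\<in>G. emeasure M (I p))"
      unfolding eq by (intro mult_left_mono emeasure_subadditive_finite fG) (use sI in auto)
    also have "\<dots> = (\<Sum>p\<in>G. \<alpha> * emeasure M (I p))" by (simp add: sum_distrib_left)
    also have "\<dots> \<le> (\<Sum>p\<in>G. \<integral>\<^sup>+y\<in>I p. f y \<partial>M)" using P1 GP by (intro sum_mono) blast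
    also have "\<dots> \<le> 2 * (\<integral>\<^sup>+y. f y \<partial>M)" unfolding I_def
      using GP by (intro sum_interval_integrals_le fG G f) (auto simp: P_def)
    finally show ?thesis .
  qed
  obtain \<F>' where \<F>': "\<F>' \<subseteq> I ` P" "countable \<F>'" "\<Union>\<F>' = (\<Union>p\<in>P. I p)"
    using Lindelof[of "I ` P"] by (force simp: I_def)
  obtain Q where Q: "Q \<subseteq> P" "countable Q" "\<F>' = I ` Q"
    using \<F>' countable_subset_image[of \<F>' I P] by blast
  have UQ: "(\<Union>p\<in>P. I p) = (\<Union>p\<in>Q. I p)" using \<F>' Q by auto
  show ?thesis
  proof (cases "Q = {}")
    case True
    then show ?thesis unfolding U UQ by simp
  next
    case False
    define q where "q = from_nat_into Q"
    have q: "range q = Q" using False Q(2) by (simp add: q_def range_from_nat_into)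
    define A where "A n = (\<Union>k\<le>n. I (q k))" for n :: nat
    have A_eq: "A n = (\<Union>p\<in>q ` {..n}. I p)" for n by (simp add: A_def)
    have "I p \<in> sets M" if "p \<in> P" for p
      using that sets_M[of "fst p" "snd p"] unfolding I_def P_def by fastforce
    then have "I (q k) \<in> sets M" for k using q Q(1) by blast
    then have sA: "range A \<subseteq> sets M" by (auto simp: A_def)
    have incA: "incseq A" by (auto simp: A_def incseq_def intro: order_trans)
    have "(\<Union>n. A n) = (\<Union>p\<in>Q. I p)" unfolding A_def q[symmetric] by auto
    then have "emeasure M (\<Union>p\<in>Q. I p) = (SUP n. emeasure M (A n))"
      using SUP_emeasure_incseq[OF sA incA] by simp
    then have "\<alpha> * emeasure M (\<Union>p\<in>Q. I p) = (SUP n. \<alpha> * emeasure M (A n))"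
      by (simp add: SUP_mult_left_ennreal)
    also have "\<dots> \<le> 2 * (\<integral>\<^sup>+y. f y \<partial>M)"
    proof (rule SUP_least)
      fix n
      have "q ` {..n} \<subseteq> P" using q Q(1) by auto
      then show "\<alpha> * emeasure M (A n) \<le> 2 * (\<integral>\<^sup>+y. f y \<partial>M)" unfolding A_eq by (intro fin) auto
    qed
    finally show ?thesis unfolding U UQ .
  qed
qed

text \<open>Split f at the height c: the part below c has averages at most c.\<close>

lemma interval_maximal_le_truncated:
  fixes f :: "real \<Rightarrow> real"
  assumes f[measurable]: "f \<in> borel_measurable M" and "0 \<le> c"
  shows "interval_maximal M (\<lambda>y. ennreal (f y)) x \<le> interval_maximal M (\<lambda>y. ennreal (f y) * indicator {y. c < f y} y) x + ennreal c"
proof -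
  have "(\<integral>\<^sup>+y\<in>{a<..<b}. ennreal (f y) \<partial>M) / emeasure M {a<..<b}
     \<le> interval_maximal M (\<lambda>y. ennreal (f y) * indicator {y. c < f y} y) x + ennreal c"
    if ab: "0 \<le> a" "a < x" "x < b" "b \<le> 1" for a b
  proof -
    let ?m = "emeasure M {a<..<b}" and ?g = "\<lambda>y. ennreal (f y) * indicator {y. c < f y} y"
    have [measurable]: "{a<..<b} \<in> sets M" using ab sets_M by auto
    have m: "?m \<noteq> 0" "?m \<noteq> \<infinity>" using pos_M[of a b] ab by (auto simp: less_top)
    have "(\<integral>\<^sup>+y\<in>{a<..<b}. ennreal (f y) \<partial>M) \<le> (\<integral>\<^sup>+y. ?g y * indicator {a<..<b} y + ennreal c * indicator {a<..<b} y \<partial>M)"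
      using \<open>0 \<le> c\<close> by (intro nn_integral_mono) (auto simp: indicator_def intro: ennreal_leI)
    also have "\<dots> = (\<integral>\<^sup>+y. ?g y * indicator {a<..<b} y \<partial>M) + ennreal c * ?m"
      by (subst nn_integral_add) (auto simp: nn_integral_cmult_indicator)
    finally have "(\<integral>\<^sup>+y\<in>{a<..<b}. ennreal (f y) \<partial>M) / ?m \<le> ((\<integral>\<^sup>+y. ?g y * indicator {a<..<b} y \<partial>M) + ennreal c * ?m) / ?m"
      by (rule divide_right_mono_ennreal)
    also have "\<dots> = (\<integral>\<^sup>+y\<in>{a<..<b}. ?g y \<partial>M) / ?m + ennreal c"
      using m by (simp add: add_divide_distrib_ennreal mult_divide_eq_ennreal)
    also have "(\<integral>\<^sup>+y\<in>{a<..<b}. ?g y \<partial>M) / ?m \<le> interval_maximal M ?g x"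
      unfolding interval_maximal_def using ab by (intro SUP_upper2[of "(a,b)"]) auto
    finally show ?thesis by (simp add: add_right_mono)
  qed
  then show ?thesis unfolding interval_maximal_def[of M "\<lambda>y. ennreal (f y)"] by (intro SUP_least) auto
qed

text \<open>Truncation at half the level. One factor 2 is the overlap constant, the other comes from
  passing from s to \<open>s / 2\<close>.\<close>

lemma interval_maximal_truncated_weak_type:
  fixes f :: "real \<Rightarrow> real"
  assumes f[measurable]: "f \<in> borel_measurable M" and "0 \<le> s"
  shows "ennreal s * emeasure M {x\<in>space M. ennreal s < interval_maximal M (\<lambda>y. ennreal (f y)) x}
     \<le> 4 * (\<integral>\<^sup>+y. ennreal (f y) * indicator {y. s < 2 * f y} y \<partial>M)"
proof -
  let ?g = "\<lambda>y. ennreal (f y) * indicator {y. s / 2 < f y} y"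
  have [measurable]: "?g \<in> borel_measurable M" by measurable
  have s2: "ennreal s = 2 * ennreal (s/2)" "ennreal s = ennreal (s/2) + ennreal (s/2)"
    using \<open>0 \<le> s\<close> by (simp_all add: ennreal_mult'[symmetric] ennreal_plus[symmetric] del: ennreal_plus flip: ennreal_numeral)
  have "{x\<in>space M. ennreal s < interval_maximal M (\<lambda>y. ennreal (f y)) x} \<subseteq> {x\<in>space M. ennreal (s/2) < interval_maximal M ?g x}"
  proof safe
    fix x assume *: "ennreal s < interval_maximal M (\<lambda>y. ennreal (f y)) x"
    have "ennreal s < interval_maximal M ?g x + ennreal (s/2)"
      using * interval_maximal_le_truncated[OF f, of "s/2" x] \<open>0 \<le> s\<close> by (simp add: less_le_trans)
    then show "ennreal (s/2) < interval_maximal M ?g x"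
      unfolding s2(2) by (meson add_right_mono leD leI)
  qed
  then have "ennreal s * emeasure M {x\<in>space M. ennreal s < interval_maximal M (\<lambda>y. ennreal (f y)) x}
    \<le> 2 * (ennreal (s/2) * emeasure M {x\<in>space M. ennreal (s/2) < interval_maximal M ?g x})"
    unfolding mult.assoc[symmetric] s2(1)[symmetric] by (intro mult_left_mono emeasure_mono) auto
  also have "\<dots> \<le> 2 * (2 * (\<integral>\<^sup>+y. ?g y \<partial>M))"
    by (intro mult_left_mono interval_maximal_weak_type) auto
  also have "\<dots> = 4 * (\<integral>\<^sup>+y. ?g y \<partial>M)" by (simp flip: mult.assoc)
  also have "?g = (\<lambda>y. ennreal (f y) * indicator {y. s < 2 * f y} y)"
    by (auto simp: indicator_def fun_eq_iff)
  finally show ?thesis .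
qed

end

section \<open>Layer cake formula and interpolation\<close>

lemma nn_integral_powr_interval:
  fixes q c :: real
  assumes "q > 0" "c \<ge> 0"
  shows "(\<integral>\<^sup>+s. ennreal (q * s powr (q - 1)) * indicator {0<..<c} s \<partial>lborel) = ennreal (c powr q)"
proof -
  have "((\<lambda>s. q * s powr (q - 1)) has_integral q * (c powr (q - 1 + 1) / (q - 1 + 1))) {0..c}"
    using assms by (intro has_integral_mult_right has_integral_powr_from_0) auto
  then have "((\<lambda>s. q * s powr (q - 1)) has_integral c powr q) {0<..<c}"
    using assms by (simp add: has_integral_Icc_iff_Ioo)
  then have "(\<integral>\<^sup>+s. ennreal (indicator {0<..<c} s * (q * s powr (q - 1))) \<partial>lborel) = ennreal (c powr q)"
  proof (intro nn_integral_has_integral_lborel)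
    assume "((\<lambda>s. q * s powr (q - 1)) has_integral c powr q) {0<..<c}"
    moreover have "(\<lambda>s. indicator {0<..<c} s * (q * s powr (q - 1))) = (\<lambda>s. if s \<in> {0<..<c} then q * s powr (q - 1) else 0)"
      by (auto simp: indicator_def fun_eq_iff)
    ultimately show "((\<lambda>s. indicator {0<..<c} s * (q * s powr (q - 1))) has_integral c powr q) UNIV"
      by (simp only: has_integral_restrict_UNIV)
  qed (use assms in auto)
  moreover have "(\<lambda>s. ennreal (q * s powr (q - 1)) * indicator {0<..<c} s) = (\<lambda>s. ennreal (indicator {0<..<c} s * (q * s powr (q - 1))))"
    using assms by (auto simp: indicator_def fun_eq_iff)
  ultimately show ?thesis by simp
qed

text \<open>The right-hand side dominates \<open>c powr q\<close> for every finite c below a, which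
  covers the value \<infinity> as well; this inequality is the direction that the strong type bound
  uses.\<close>

lemma enn_powr_le_layer_cake:
  fixes q :: real
  assumes "q > 0"
  shows "enn_powr a q \<le> (\<integral>\<^sup>+s. ennreal (q * s powr (q - 1)) * indicator {s. 0 < s \<and> ennreal s < a} s \<partial>lborel)"
    (is "_ \<le> ?R")
proof -
  have le: "ennreal (c powr q) \<le> ?R" if "c \<ge> 0" "ennreal c \<le> a" for c
  proof -
    have "ennreal (c powr q) = (\<integral>\<^sup>+s. ennreal (q * s powr (q - 1)) * indicator {0<..<c} s \<partial>lborel)"
      using nn_integral_powr_interval[OF assms that(1)] by simp
    also have "\<dots> \<le> ?R"
      using that by (intro nn_integral_mono mult_left_mono) (auto simp: indicator_def ennreal_lessI intro: less_le_trans[of _ "ennreal c"])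
    finally show ?thesis .
  qed
  show ?thesis
  proof (cases a)
    case (real r)
    then show ?thesis using le[of r] by (simp add: enn_powr_def)
  next
    case top
    have "?R = \<infinity>"
    proof (rule ccontr)
      assume "?R \<noteq> \<infinity>"
      then obtain r where r: "?R = ennreal r" "r \<ge> 0" by (cases ?R) auto
      \<comment> \<open>Chosen so that \<open>c powr q\<close> exceeds the supposedly finite value
        r.\<close>
      define c where "c = (r + 1) powr (1 / q)"
      have "c powr q = r + 1" using r(2) assms by (simp add: c_def powr_powr)
      then have "ennreal (r + 1) \<le> ?R" using le[of c] top by (simp add: c_def)
      then show False using r by (simp add: ennreal_le_iff)
    qed
    then show ?thesis by simp
  qed
qed

context interval_measure
begin

text \<open>Marcinkiewicz interpolation: insert the truncated weak type bound into the layer cake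
  formula and exchange the integrals. The constant is what \<open>4 * q * f y\<close> times the
  integral of \<open>s powr (q - 2)\<close> over \<open>{0<..<2 * f y}\<close> leaves in front of
  \<open>f y powr q\<close>.\<close>

theorem interval_maximal_strong_type:
  fixes f :: "real \<Rightarrow> real" and q :: real
  assumes f[measurable]: "f \<in> borel_measurable M" and nonneg: "\<And>x. 0 \<le> f x" and q: "1 < q"
  shows "(\<integral>\<^sup>+x. enn_powr (interval_maximal M (\<lambda>y. ennreal (f y)) x) q \<partial>M)
    \<le> ennreal (4 * q * 2 powr (q - 1) / (q - 1)) * (\<integral>\<^sup>+x. ennreal (f x powr q) \<partial>M)"
proof -
  let ?m = "interval_maximal M (\<lambda>y. ennreal (f y))"
  interpret pair_sigma_finite M lborel ..
  have "(\<integral>\<^sup>+x. enn_powr (?m x) q \<partial>M)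
    \<le> (\<integral>\<^sup>+x. (\<integral>\<^sup>+s. ennreal (q * s powr (q - 1)) * indicator {s. 0 < s \<and> ennreal s < ?m x} s \<partial>lborel) \<partial>M)"
    using q by (intro nn_integral_mono enn_powr_le_layer_cake) auto
  also have "\<dots> = (\<integral>\<^sup>+s. (\<integral>\<^sup>+x. ennreal (q * s powr (q - 1)) * indicator {s. 0 < s \<and> ennreal s < ?m x} s \<partial>M) \<partial>lborel)"
    by (rule Fubini'[symmetric]) measurable
  also have "\<dots> \<le> (\<integral>\<^sup>+s. (\<integral>\<^sup>+y. 4 * ennreal (q * s powr (q - 2)) * ennreal (f y) * indicator {s. 0 < s \<and> s < 2 * f y} s \<partial>M) \<partial>lborel)"
  proof (rule nn_integral_mono)
    fix s :: real
    show "(\<integral>\<^sup>+x. ennreal (q * s powr (q - 1)) * indicator {s. 0 < s \<and> ennreal s < ?m x} s \<partial>M)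
      \<le> (\<integral>\<^sup>+y. 4 * ennreal (q * s powr (q - 2)) * ennreal (f y) * indicator {s. 0 < s \<and> s < 2 * f y} s \<partial>M)"
    proof (cases "0 < s")
      case True
      have "s powr (q - 1) = s powr (q - 2) * s" using True powr_add[of s "q - 2" 1] by simp
      then have e: "ennreal (q * s powr (q - 1)) = ennreal (q * s powr (q - 2)) * ennreal s"
        using q True by (simp add: ennreal_mult'[symmetric])
      have "(\<integral>\<^sup>+x. ennreal (q * s powr (q - 1)) * indicator {s. 0 < s \<and> ennreal s < ?m x} s \<partial>M)
        = (\<integral>\<^sup>+x. ennreal (q * s powr (q - 1)) * indicator {x\<in>space M. ennreal s < ?m x} x \<partial>M)"
        using True by (intro nn_integral_cong) (auto simp: indicator_def)
      also have "\<dots> = ennreal (q * s powr (q - 2)) * (ennreal s * emeasure M {x\<in>space M. ennreal s < ?m x})"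
        by (subst nn_integral_cmult_indicator) (auto simp: e mult.assoc)
      also have "\<dots> \<le> ennreal (q * s powr (q - 2)) * (4 * (\<integral>\<^sup>+y. ennreal (f y) * indicator {y. s < 2 * f y} y \<partial>M))"
        using True by (intro mult_left_mono interval_maximal_truncated_weak_type) auto
      also have "\<dots> = (\<integral>\<^sup>+y. 4 * ennreal (q * s powr (q - 2)) * (ennreal (f y) * indicator {y. s < 2 * f y} y) \<partial>M)"
        by (subst nn_integral_cmult) (auto simp: mult_ac)
      also have "\<dots> = (\<integral>\<^sup>+y. 4 * ennreal (q * s powr (q - 2)) * ennreal (f y) * indicator {s. 0 < s \<and> s < 2 * f y} s \<partial>M)"
        using True by (intro nn_integral_cong) (auto simp: indicator_def)
      finally show ?thesis .
    qed simp
  qed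
  also have "\<dots> = (\<integral>\<^sup>+y. (\<integral>\<^sup>+s. 4 * ennreal (q * s powr (q - 2)) * ennreal (f y) * indicator {s. 0 < s \<and> s < 2 * f y} s \<partial>lborel) \<partial>M)"
    by (rule Fubini') measurable
  also have "\<dots> = (\<integral>\<^sup>+y. ennreal (4 * q * 2 powr (q - 1) / (q - 1)) * ennreal (f y powr q) \<partial>M)"
  proof (rule nn_integral_cong)
    fix y
    have "(\<integral>\<^sup>+s. 4 * ennreal (q * s powr (q - 2)) * ennreal (f y) * indicator {s. 0 < s \<and> s < 2 * f y} s \<partial>lborel)
      = (\<integral>\<^sup>+s. ennreal (4 * f y * q / (q - 1)) * (ennreal ((q - 1) * s powr (q - 1 - 1)) * indicator {0<..<2 * f y} s) \<partial>lborel)"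
      using q nonneg[of y] by (intro nn_integral_cong) (auto simp: indicator_def ennreal_mult'[symmetric] mult_ac simp flip: ennreal_numeral)
    also have "\<dots> = ennreal (4 * f y * q / (q - 1)) * ennreal ((2 * f y) powr (q - 1))"
      using q nonneg[of y] nn_integral_powr_interval[of "q - 1" "2 * f y"] by (subst nn_integral_cmult) auto
    also have "\<dots> = ennreal (4 * f y * q / (q - 1) * (2 * f y) powr (q - 1))"
      using q nonneg[of y] by (simp add: ennreal_mult'[symmetric])
    also have "4 * f y * q / (q - 1) * (2 * f y) powr (q - 1) = 4 * q * 2 powr (q - 1) / (q - 1) * f y powr q"
    proof (cases "f y = 0")
      case False
      then have "f y > 0" using nonneg[of y] by simp
      then have "f y powr q = f y powr (q - 1) * f y" using powr_add[of "f y" "q - 1" 1] by simp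
      then show ?thesis using \<open>f y > 0\<close> q by (simp add: powr_mult)
    qed simp
    also have "ennreal (4 * q * 2 powr (q - 1) / (q - 1) * f y powr q) = ennreal (4 * q * 2 powr (q - 1) / (q - 1)) * ennreal (f y powr q)"
      using q by (intro ennreal_mult') simp
    finally show "(\<integral>\<^sup>+s. 4 * ennreal (q * s powr (q - 2)) * ennreal (f y) * indicator {s. 0 < s \<and> s < 2 * f y} s \<partial>lborel)
      = ennreal (4 * q * 2 powr (q - 1) / (q - 1)) * ennreal (f y powr q)" .
  qed
  also have "\<dots> = ennreal (4 * q * 2 powr (q - 1) / (q - 1)) * (\<integral>\<^sup>+x. ennreal (f x powr q) \<partial>M)"
    by (rule nn_integral_cmult) measurable
  finally show ?thesis .
qed

text \<open>The bound B is available only for intervals with x strictly inside, while x may be an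
  endpoint of the hull of J. Enlarge the hull by \<open>1 / Suc k\<close> and let k grow: beyond
  \<open>{c<..<d}\<close> at most the two endpoints remain, and they have no mass.\<close>

lemma set_integral_le_closure:
  assumes J: "J \<in> sets M" "J \<subseteq> {c..d}" and f[measurable]: "f \<in> borel_measurable M"
    and cd: "0 \<le> c" "c \<le> x" "x \<le> d" "d \<le> 1" "x \<in> {0<..<1}"
    and B: "\<And>a b. 0 \<le> a \<Longrightarrow> a < x \<Longrightarrow> x < b \<Longrightarrow> b \<le> 1 \<Longrightarrow> (\<integral>\<^sup>+y\<in>{a<..<b}. f y \<partial>M) \<le> B * emeasure M {a<..<b}"
    and "B < \<infinity>"
  shows "(\<integral>\<^sup>+y\<in>J. f y \<partial>M) \<le> B * emeasure M {c<..<d}"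
proof -
  define A where "A k = {max 0 (c - 1 / real (Suc k))<..<min 1 (d + 1 / real (Suc k))}" for k
  have sA: "A k \<in> sets M" for k unfolding A_def using sets_M by simp
  have decA: "decseq A"
  proof (unfold decseq_def, intro allI impI subsetI)
    fix m n :: nat and y assume "m \<le> n" "y \<in> A n"
    moreover from \<open>m \<le> n\<close> have "1 / real (Suc n) \<le> 1 / real (Suc m)" by (simp add: frac_le)
    ultimately show "y \<in> A m" unfolding A_def by (auto simp del: of_nat_Suc)
  qed
  have lim: "(\<lambda>k. emeasure M (A k)) \<longlonglongrightarrow> emeasure M (\<Inter>k. A k)"
    using sA decA by (intro Lim_emeasure_decseq) (auto simp: less_top)
  have sub: "(\<Inter>k. A k) \<subseteq> {c<..<d} \<union> ({c,d} \<inter> {0<..<1})"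
  proof
    fix y assume y: "y \<in> (\<Inter>k. A k)"
    then have y': "0 < y" "y < 1" "c - 1 / real (Suc k) < y" "y < d + 1 / real (Suc k)" for k
      by (auto simp: A_def simp del: of_nat_Suc)
    have "c \<le> y"
    proof (rule ccontr)
      assume "\<not> c \<le> y"
      then obtain k where "1 / real (Suc k) < c - y" using nat_approx_posE[of "c - y"] by auto
      then show False using y'(3)[of k] by simp
    qed
    moreover have "y \<le> d"
    proof (rule ccontr)
      assume "\<not> y \<le> d"
      then obtain k where "1 / real (Suc k) < y - d" using nat_approx_posE[of "y - d"] by auto
      then show False using y'(4)[of k] by simp
    qed
    ultimately show "y \<in> {c<..<d} \<union> ({c,d} \<inter> {0<..<1})" using y' by auto
  qed
  have null: "{c,d} \<inter> {0<..<1} \<in> null_sets M"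
  proof -
    have "{c} \<inter> {0<..<1} \<in> null_sets M" "{d} \<inter> {0<..<1} \<in> null_sets M"
      using atomless[of c] atomless[of d] by (auto simp: null_sets_def Int_insert_left)
    then have "({c} \<inter> {0<..<1}) \<union> ({d} \<inter> {0<..<1}) \<in> null_sets M" by (rule null_sets.Un)
    then show ?thesis by (simp add: Int_Un_distrib2[symmetric] insert_commute)
  qed
  have scd: "{c<..<d} \<in> sets M" using sets_M cd by auto
  have "emeasure M (\<Inter>k. A k) \<le> emeasure M ({c<..<d} \<union> ({c,d} \<inter> {0<..<1}))"
    using sub scd null by (intro emeasure_mono) auto
  also have "\<dots> = emeasure M {c<..<d}" using emeasure_Un_null_set[OF scd null] .
  finally have le1: "emeasure M (\<Inter>k. A k) \<le> emeasure M {c<..<d}" .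
  have "(\<integral>\<^sup>+y\<in>J. f y \<partial>M) \<le> B * emeasure M (A k)" for k
  proof -
    have k: "0 < 1 / real (Suc k)" by simp
    have J01: "J \<subseteq> {0<..<1}" using J(1) sets.sets_into_space space_M by blast
    have "J \<subseteq> A k"
    proof
      fix y assume "y \<in> J"
      then have "c \<le> y" "y \<le> d" "0 < y" "y < 1" using J01 J(2) by auto
      then have "c - 1 / real (Suc k) < y" "y < d + 1 / real (Suc k)" using k by linarith+
      then show "y \<in> A k" using \<open>0 < y\<close> \<open>y < 1\<close> unfolding A_def by (simp del: of_nat_Suc)
    qed
    then have "(\<integral>\<^sup>+y\<in>J. f y \<partial>M) \<le> (\<integral>\<^sup>+y\<in>A k. f y \<partial>M)"
      by (intro nn_integral_mono mult_left_mono) (auto simp: indicator_def)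
    also have "\<dots> \<le> B * emeasure M (A k)"
      unfolding A_def
    proof (intro B)
      have "c - 1 / real (Suc k) < x" "x < d + 1 / real (Suc k)" using cd k by linarith+
      then show "max 0 (c - 1 / real (Suc k)) < x" "x < min 1 (d + 1 / real (Suc k))"
        using cd by (simp_all del: of_nat_Suc)
    qed auto
    finally show ?thesis .
  qed
  moreover have "(\<lambda>k. B * emeasure M (A k)) \<longlonglongrightarrow> B * emeasure M (\<Inter>k. A k)"
    using lim \<open>B < \<infinity>\<close> by (intro ennreal_tendsto_cmult) auto
  ultimately have "(\<integral>\<^sup>+y\<in>J. f y \<partial>M) \<le> B * emeasure M (\<Inter>k. A k)"
    by (intro LIMSEQ_le_const) auto
  also have "\<dots> \<le> B * emeasure M {c<..<d}" using le1 by (rule mult_left_mono) simp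
  finally show ?thesis .
qed

end

section \<open>Unimodal kernels\<close>

text \<open>Convexity of all superlevel sets. No mode is named, so the property passes to pointwise
  limits without tracking where the maximum sits.\<close>

definition quasi_concave_on :: "real set \<Rightarrow> (real \<Rightarrow> real) \<Rightarrow> bool" where
  "quasi_concave_on A g \<longleftrightarrow> (\<forall>x\<in>A. \<forall>z\<in>A. \<forall>y. x < y \<and> y < z \<longrightarrow> min (g x) (g z) \<le> g y)"

text \<open>\<open>K_CS\<close> is positive definiteness on pairs of points, the form in which it is
  used.\<close>

locale unimodal_kernel = interval_measure M for M +
  fixes K :: "real \<Rightarrow> real \<Rightarrow> real"
  assumes K_measurable: "\<And>x. x \<in> {0<..<1} \<Longrightarrow> K x \<in> borel_measurable M"
    and K_nonneg: "\<And>x y. x \<in> {0<..<1} \<Longrightarrow> y \<in> {0<..<1} \<Longrightarrow> 0 \<le> K x y"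
    and K_sym: "\<And>x y. x \<in> {0<..<1} \<Longrightarrow> y \<in> {0<..<1} \<Longrightarrow> K x y = K y x"
    and K_qc: "\<And>x. x \<in> {0<..<1} \<Longrightarrow> quasi_concave_on {0<..<1} (K x)"
    and K_CS: "\<And>x y. x \<in> {0<..<1} \<Longrightarrow> y \<in> {0<..<1} \<Longrightarrow> (K x y)\<^sup>2 \<le> K x x * K y y"
    and K_mass: "\<And>x. x \<in> {0<..<1} \<Longrightarrow> (\<integral>\<^sup>+y. ennreal (K x y) \<partial>M) \<le> 1"
begin

text \<open>If \<open>K x\<close> is larger at \<open>z\<close> than at \<open>x\<close>, positive definiteness gives \<open>K z z \<ge> K x z\<close>, so that by
  unimodality \<open>K z \<ge> K x z\<close> all the way between \<open>x\<close> and \<open>z\<close>.\<close>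

lemma kernel_gap:
  assumes x: "x \<in> {0<..<1}" and z: "z \<in> {0<..<1}" and less: "K x x < K x z"
  shows "ennreal (K x z) * emeasure M {min x z<..<max x z} \<le> 1"
proof -
  have [measurable]: "{min x z<..<max x z} \<in> sets M" using sets_M x z by auto
  have [measurable]: "K z \<in> borel_measurable M" using K_measurable z .
  \<comment> \<open>Otherwise \<open>K_CS\<close> would force \<open>K x z = 0\<close>, against
    \<open>less\<close>.\<close>
  have "K x x \<noteq> 0"
    using K_CS[OF x z] K_nonneg[OF x x] less by (auto simp: power2_eq_square mult_le_0_iff)
  then have "K x x > 0" using K_nonneg[OF x x] by simp
  have "K x x * K x z \<le> K x z * K x z" using less K_nonneg[OF x z] by (intro mult_right_mono) auto
  also have "\<dots> \<le> K x x * K z z" using K_CS[OF x z] by (simp add: power2_eq_square)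
  finally have zz: "K x z \<le> K z z" using \<open>K x x > 0\<close> by simp
  have "K x z \<le> K z y" if y: "y \<in> {min x z<..<max x z}" for y
  proof (cases "x < z")
    case True
    then have "min (K z x) (K z z) \<le> K z y"
      using K_qc[OF z] x z y unfolding quasi_concave_on_def by auto
    then show ?thesis using zz K_sym[OF x z] by simp
  next
    case False
    then have "min (K z z) (K z x) \<le> K z y"
      using K_qc[OF z] x z y unfolding quasi_concave_on_def by auto
    then show ?thesis using zz K_sym[OF x z] by simp
  qed
  then have "ennreal (K x z) * emeasure M {min x z<..<max x z} \<le> (\<integral>\<^sup>+y. ennreal (K z y) \<partial>M)"
    unfolding nn_integral_cmult_indicator[OF \<open>{min x z<..<max x z} \<in> sets M\<close>, symmetric]
    by (intro nn_integral_mono) (auto simp: indicator_def intro: ennreal_leI)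
  also have "\<dots> \<le> 1" using K_mass z .
  finally show ?thesis .
qed

text \<open>Slice the kernel into its superlevel sets \<open>J s\<close>, which are intervals by
  unimodality. If x lies outside \<open>J s\<close>, the interval must be extended to x, and
  \<open>kernel_gap\<close> bounds the mass of the extension by \<open>1 / V\<close> with V the
  supremum of \<open>K x\<close>. Integrated over the levels, the sets \<open>J s\<close> contribute
  the mass of the kernel, at most 1, and the extensions at most \<open>V * (1 / V)\<close>; hence
  the factor 2.\<close>

theorem kernel_integral_le:
  assumes x: "x \<in> {0<..<1}" and f[measurable]: "f \<in> borel_measurable M"
    and B: "\<And>a b. 0 \<le> a \<Longrightarrow> a < x \<Longrightarrow> x < b \<Longrightarrow> b \<le> 1 \<Longrightarrow> (\<integral>\<^sup>+y\<in>{a<..<b}. f y \<partial>M) \<le> B * emeasure M {a<..<b}"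
  shows "(\<integral>\<^sup>+y. ennreal (K x y) * f y \<partial>M) \<le> 2 * B"
proof (cases "B < \<infinity>")
  case False
  then show ?thesis by (simp add: less_top[symmetric] ennreal_mult_top)
next
  case True
  note [measurable] = K_measurable[OF x]
  interpret pair_sigma_finite M lborel ..
  define J where "J s = {y\<in>space M. s < K x y}" for s
  have [measurable]: "J s \<in> sets M" for s unfolding J_def by measurable
  \<comment> \<open>V may be infinite, in which case \<open>1 / V\<close> is 0.\<close>
  define V where "V = (SUP y\<in>{0<..<1}. ennreal (K x y))"
  have main: "(\<integral>\<^sup>+y\<in>J s. f y \<partial>M) \<le> B * (emeasure M (J s) + (1 / V) * indicator {s. ennreal s < V} s)"
    if s: "0 < s" for s
  proof (cases "J s = {}")
    case False
    \<comment> \<open>The hull of the superlevel set together with x, since x itself may lie outside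
      \<open>J s\<close>.\<close>
    define c where "c = Inf (insert x (J s))"
    define d where "d = Sup (insert x (J s))"
    have Jsub: "J s \<subseteq> {0<..<1}" by (auto simp: J_def space_M)
    have bdd: "bdd_below (insert x (J s))" "bdd_above (insert x (J s))"
      using Jsub x by (auto intro!: bdd_belowI[of _ 0] bdd_aboveI[of _ 1])
    have c: "0 \<le> c" "c \<le> x" unfolding c_def
      using Jsub x bdd by (auto intro!: cInf_greatest cInf_lower)
    have d: "x \<le> d" "d \<le> 1" unfolding d_def
      using Jsub x bdd by (auto intro!: cSup_least cSup_upper)
    have Jcd: "J s \<subseteq> {c..d}" unfolding c_def d_def
      using bdd by (auto intro!: cInf_lower cSup_upper)
    have conv: "y \<in> J s" if "u \<in> J s" "v \<in> J s" "u \<le> y" "y \<le> v" for u v y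
    proof (cases "u = y \<or> y = v")
      case False
      then have "min (K x u) (K x v) \<le> K x y"
        using that K_qc[OF x] Jsub unfolding quasi_concave_on_def by (metis (full_types) order_less_le subsetD)
      then show ?thesis using that by (auto simp: J_def space_M)
    qed (use that in auto)
    have hull: "\<exists>u\<in>insert x (J s). \<exists>v\<in>insert x (J s). u < y \<and> y < v" if y: "y \<in> {c<..<d}" for y
    proof -
      have "c < y" "y < d" using y by auto
      then have "\<exists>u\<in>insert x (J s). u < y" "\<exists>v\<in>insert x (J s). y < v" unfolding c_def d_def
        by (simp_all only: cInf_less_iff[OF insert_not_empty bdd(1)] less_cSup_iff[OF insert_not_empty bdd(2)])
      then show ?thesis by fast
    qed
    \<comment> \<open>If x belongs to \<open>J s\<close>, the open hull is contained in
      \<open>J s\<close> by convexity. Otherwise everything in the hull but outside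
      \<open>J s\<close> lies between x and z, whichever z in \<open>J s\<close> is taken.\<close>
    have m: "emeasure M {c<..<d} \<le> emeasure M (J s) + 1 / ennreal (K x z)" if z: "z \<in> J s" for z
    proof (cases "x \<in> J s")
      case True
      have "{c<..<d} \<subseteq> J s"
      proof
        fix y assume "y \<in> {c<..<d}"
        then obtain u v where "u \<in> insert x (J s)" "v \<in> insert x (J s)" "u < y" "y < v"
          using hull by blast
        then show "y \<in> J s" using conv[of u v y] True by (auto simp: insert_absorb)
      qed
      then have "emeasure M {c<..<d} \<le> emeasure M (J s)" by (intro emeasure_mono) auto
      then show ?thesis by (simp add: add_increasing2)
    next
      case False
      have less: "K x x < K x z" using False z x by (auto simp: J_def space_M)
      have z01: "z \<in> {0<..<1}" using z Jsub by blast
      have "K x z > 0" using z s by (auto simp: J_def)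
      have [measurable]: "{min x z<..<max x z} \<in> sets M" using sets_M x z01 by auto
      have "{c<..<d} \<subseteq> J s \<union> {min x z<..<max x z}"
      proof
        fix y assume "y \<in> {c<..<d}"
        then obtain u v where uv: "u \<in> insert x (J s)" "v \<in> insert x (J s)" "u < y" "y < v"
          using hull by blast
        have side: "\<not> (p \<le> x \<and> x \<le> q)" if "p \<in> J s" "q \<in> J s" for p q using conv that False by blast
        show "y \<in> J s \<union> {min x z<..<max x z}"
        proof (rule ccontr)
          assume n: "y \<notin> J s \<union> {min x z<..<max x z}"
          have yx: "y \<noteq> x"
          proof
            assume "y = x"
            then have "u \<in> J s" "v \<in> J s" using uv by auto
            then show False using side[of u v] uv \<open>y = x\<close> by auto
          qed
          have nb: "\<not> (p \<le> y \<and> y \<le> q)" if "p \<in> J s" "q \<in> J s" for p q using conv that n by blast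
          consider "x < y" | "y < x" using yx by linarith
          then show False
          proof cases
            case 1
            then have "v \<in> J s" using uv by auto
            then have "x < z" using side[of z v] z uv 1 by linarith
            then have "z \<le> y" using n 1 by (auto simp: not_less)
            then show False using nb[OF z \<open>v \<in> J s\<close>] uv by simp
          next
            case 2
            then have "u \<in> J s" using uv by auto
            then have "z < x" using side[of u z] z uv 2 by linarith
            then have "y \<le> z" using n 2 by (auto simp: not_less)
            then show False using nb[OF \<open>u \<in> J s\<close> z] uv by simp
          qed
        qed
      qed
      then have "emeasure M {c<..<d} \<le> emeasure M (J s) + emeasure M {min x z<..<max x z}"
        by (intro order_trans[OF emeasure_mono emeasure_subadditive]) auto
      also have "emeasure M {min x z<..<max x z} = (ennreal (K x z) * emeasure M {min x z<..<max x z}) / ennreal (K x z)"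
        using \<open>K x z > 0\<close> mult_divide_eq_ennreal[of "ennreal (K x z)" "emeasure M {min x z<..<max x z}"]
        by (simp add: mult.commute)
      also have "\<dots> \<le> 1 / ennreal (K x z)" by (intro divide_right_mono_ennreal kernel_gap x z01 less)
      finally show ?thesis by (simp add: add_left_mono)
    qed
    \<comment> \<open>Values off \<open>J s\<close> are at most s and thus below all values on
      \<open>J s\<close>.\<close>
    have V: "V = (SUP z\<in>J s. ennreal (K x z))" unfolding V_def
    proof (rule antisym)
      obtain z0 where z0: "z0 \<in> J s" using False by blast
      show "(SUP y\<in>{0<..<1}. ennreal (K x y)) \<le> (SUP z\<in>J s. ennreal (K x z))"
      proof (rule SUP_mono)
        fix y :: real assume y: "y \<in> {0<..<1}"
        show "\<exists>z\<in>J s. ennreal (K x y) \<le> ennreal (K x z)"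
        proof (cases "y \<in> J s")
          case False
          then have "K x y \<le> K x z0" using z0 y by (auto simp: J_def space_M)
          then show ?thesis using z0 by (auto intro: ennreal_leI)
        qed auto
      qed
      show "(SUP z\<in>J s. ennreal (K x z)) \<le> (SUP y\<in>{0<..<1}. ennreal (K x y))"
        using Jsub by (rule SUP_subset_mono) simp
    qed
    have sV: "ennreal s < V"
    proof -
      obtain z where "z \<in> J s" using False by blast
      then have "ennreal s < ennreal (K x z)" using s by (auto simp: J_def intro: ennreal_lessI)
      also have "\<dots> \<le> V" unfolding V using \<open>z \<in> J s\<close> by (rule SUP_upper)
      finally show ?thesis .
    qed
    \<comment> \<open>The excess of the hull over \<open>J s\<close> does not depend on z, so the
      supremum over z can be taken in \<open>D * K x z \<le> 1\<close>.\<close>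
    define D where "D = emeasure M {c<..<d} - emeasure M (J s)"
    have "D * ennreal (K x z) \<le> 1" if z: "z \<in> J s" for z
    proof -
      have K0: "ennreal (K x z) \<noteq> 0" using z s by (auto simp: J_def)
      have "D \<le> 1 / ennreal (K x z)" using m[OF z] by (simp add: D_def ennreal_minus_le_iff)
      then have "D * ennreal (K x z) \<le> 1 / ennreal (K x z) * ennreal (K x z)" by (rule mult_right_mono) simp
      then show ?thesis using ennreal_divide_mult_cancel[OF K0] by simp
    qed
    then have DV: "D * V \<le> 1" unfolding V SUP_mult_left_ennreal by (rule SUP_least)
    have V0: "V \<noteq> 0" using sV by auto
    have "D \<le> 1 / V"
    proof (cases "V = \<infinity>")
      case True
      then have "D = 0" using DV by (cases "D = 0") (auto simp: ennreal_mult_top top_unique)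
      then show ?thesis by simp
    next
      case False
      then have "D = D * V / V" using V0 by (simp add: mult_divide_eq_ennreal)
      also have "\<dots> \<le> 1 / V" using DV by (rule divide_right_mono_ennreal)
      finally show ?thesis .
    qed
    then have cdV: "emeasure M {c<..<d} \<le> emeasure M (J s) + 1 / V"
      by (simp add: D_def ennreal_minus_le_iff)
    have "(\<integral>\<^sup>+y\<in>J s. f y \<partial>M) \<le> B * emeasure M {c<..<d}"
      by (rule set_integral_le_closure[OF \<open>J s \<in> sets M\<close> Jcd f c d x B True])
    also have "\<dots> \<le> B * (emeasure M (J s) + 1 / V)" using cdV by (rule mult_left_mono) simp
    finally show ?thesis using sV by simp
  qed simp
  have ioo: "{s. 0 < s \<and> s < r} = {0<..<r}" for r :: real by auto
  have "(\<integral>\<^sup>+y. ennreal (K x y) * f y \<partial>M) = (\<integral>\<^sup>+y. (\<integral>\<^sup>+s. f y * indicator {s. 0 < s \<and> s < K x y} s \<partial>lborel) \<partial>M)"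
  proof (rule nn_integral_cong)
    fix y assume "y \<in> space M"
    then have "0 \<le> K x y" using K_nonneg x space_M by auto
    then have "(\<integral>\<^sup>+s. f y * indicator {s. 0 < s \<and> s < K x y} s \<partial>lborel) = f y * ennreal (K x y)"
      by (subst nn_integral_cmult) (auto simp: ioo)
    then show "ennreal (K x y) * f y = (\<integral>\<^sup>+s. f y * indicator {s. 0 < s \<and> s < K x y} s \<partial>lborel)"
      by (simp add: mult.commute)
  qed
  also have "\<dots> = (\<integral>\<^sup>+s. (\<integral>\<^sup>+y. f y * indicator {s. 0 < s \<and> s < K x y} s \<partial>M) \<partial>lborel)"
    by (rule Fubini'[symmetric]) measurable
  also have "\<dots> \<le> (\<integral>\<^sup>+s. B * ((\<integral>\<^sup>+y. indicator {s. 0 < s \<and> s < K x y} s \<partial>M) + (1 / V) * indicator {s. 0 < s \<and> ennreal s < V} s) \<partial>lborel)"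
  proof (rule nn_integral_mono)
    fix s :: real
    show "(\<integral>\<^sup>+y. f y * indicator {s. 0 < s \<and> s < K x y} s \<partial>M) \<le> B * ((\<integral>\<^sup>+y. indicator {s. 0 < s \<and> s < K x y} s \<partial>M) + (1 / V) * indicator {s. 0 < s \<and> ennreal s < V} s)"
    proof (cases "0 < s")
      case True
      have "(\<integral>\<^sup>+y. f y * indicator {s. 0 < s \<and> s < K x y} s \<partial>M) = (\<integral>\<^sup>+y\<in>J s. f y \<partial>M)"
        using True by (intro nn_integral_cong) (auto simp: J_def indicator_def)
      moreover have "(\<integral>\<^sup>+y. indicator {s. 0 < s \<and> s < K x y} s \<partial>M) = emeasure M (J s)"
      proof -
        have "(\<integral>\<^sup>+y. indicator {s. 0 < s \<and> s < K x y} s \<partial>M) = (\<integral>\<^sup>+y. indicator (J s) y \<partial>M)"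
          using True by (intro nn_integral_cong) (auto simp: J_def indicator_def)
        then show ?thesis by simp
      qed
      ultimately show ?thesis using main[OF True] True by (simp add: indicator_def)
    qed simp
  qed
  also have "\<dots> = B * ((\<integral>\<^sup>+s. (\<integral>\<^sup>+y. indicator {s. 0 < s \<and> s < K x y} s \<partial>M) \<partial>lborel) + (1 / V) * (\<integral>\<^sup>+s. indicator {s. 0 < s \<and> ennreal s < V} s \<partial>lborel))"
    by (subst nn_integral_cmult, measurable, subst nn_integral_add, measurable, subst nn_integral_cmult, measurable)
  also have "(\<integral>\<^sup>+s. (\<integral>\<^sup>+y. indicator {s. 0 < s \<and> s < K x y} s \<partial>M) \<partial>lborel) = (\<integral>\<^sup>+y. (\<integral>\<^sup>+s. indicator {s. 0 < s \<and> s < K x y} s \<partial>lborel) \<partial>M)"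
    by (rule Fubini') measurable
  also have "\<dots> = (\<integral>\<^sup>+y. ennreal (K x y) \<partial>M)"
    using K_nonneg[OF x] by (intro nn_integral_cong) (auto simp: space_M ioo)
  also have "\<dots> \<le> 1" using K_mass x .
  \<comment> \<open>The constant \<open>1 / V\<close> is integrated over the levels between 0 and
    V.\<close>
  also have "(1 / V) * (\<integral>\<^sup>+s. indicator {s. 0 < s \<and> ennreal s < V} s \<partial>lborel) \<le> 1"
  proof (cases V)
    case (real r)
    then have "{s. 0 < s \<and> ennreal s < V} = {0<..<r}" by (auto simp: ennreal_less_iff)
    then have "(\<integral>\<^sup>+s. indicator {s. 0 < s \<and> ennreal s < V} s \<partial>lborel) = V" using real by simp
    then show ?thesis by (cases "V = 0") (auto simp: real ennreal_divide_times ennreal_divide_self)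
  qed simp
  finally have "(\<integral>\<^sup>+y. ennreal (K x y) * f y \<partial>M) \<le> B * (1 + 1)"
    by (simp add: mult_left_mono add_mono)
  then show ?thesis by (simp add: mult.commute)
qed

end

section \<open>Homogeneous linear systems and the Cauchy-Schwarz inequality\<close>

lemma nontrivial_homogeneous_solution:
  fixes g :: "'i \<Rightarrow> 'z \<Rightarrow> real"
  assumes "finite Z" "finite I" "card Z < card I"
  shows "\<exists>c. (\<exists>k\<in>I. c k \<noteq> 0) \<and> (\<forall>z\<in>Z. (\<Sum>k\<in>I. c k * g k z) = 0)"
  using assms
proof (induction Z arbitrary: I g rule: finite_induct)
  case empty
  then have "I \<noteq> {}" by auto
  then show ?case by (intro exI[of _ "\<lambda>_. 1"]) auto
next
  case (insert z0 Z)
  show ?case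
  proof (cases "\<forall>k\<in>I. g k z0 = 0")
    case True
    have "card Z < card I" using insert by simp
    from insert.IH[OF insert.prems(1) this, of g] obtain c where
      c: "\<exists>k\<in>I. c k \<noteq> 0" "\<forall>z\<in>Z. (\<Sum>k\<in>I. c k * g k z) = 0" by blast
    then show ?thesis using True by (intro exI[of _ c]) auto
  next
    case False
    then obtain k0 where k0: "k0 \<in> I" "g k0 z0 \<noteq> 0" by blast
    \<comment> \<open>Gaussian elimination: the equation at \<open>z0\<close> is solved for the
      unknown with index \<open>k0\<close>, and the remaining equations are reduced by it.\<close>
    define g' where "g' k z = g k z - g k z0 / g k0 z0 * g k0 z" for k z
    have "finite (I - {k0})" "card Z < card (I - {k0})" using insert k0 by auto
    from insert.IH[OF this, of g'] obtain c where
      c: "\<exists>k\<in>I - {k0}. c k \<noteq> 0" "\<forall>z\<in>Z. (\<Sum>k\<in>I - {k0}. c k * g' k z) = 0" by blast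
    define d where "d = (\<lambda>k. if k = k0 then - (\<Sum>k\<in>I - {k0}. c k * g k z0) / g k0 z0 else c k)"
    have sum_d: "(\<Sum>k\<in>I. d k * g k z) = d k0 * g k0 z + (\<Sum>k\<in>I - {k0}. c k * g k z)" for z
      using insert.prems(1) k0(1) by (subst sum.remove[of _ k0]) (auto simp: d_def)
    have "(\<Sum>k\<in>I. d k * g k z) = 0" if "z \<in> Z" for z
    proof -
      have "0 = (\<Sum>k\<in>I - {k0}. c k * g' k z)" using c(2) that by simp
      also have "\<dots> = (\<Sum>k\<in>I - {k0}. c k * g k z) - (\<Sum>k\<in>I - {k0}. c k * g k z0 * (g k0 z / g k0 z0))"
        unfolding sum_subtractf[symmetric] by (intro sum.cong) (auto simp: g'_def field_simps)
      also have "\<dots> = (\<Sum>k\<in>I - {k0}. c k * g k z) - (\<Sum>k\<in>I - {k0}. c k * g k z0) * (g k0 z / g k0 z0)"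
        unfolding sum_distrib_right ..
      also have "\<dots> = (\<Sum>k\<in>I. d k * g k z)" unfolding sum_d by (simp add: d_def)
      finally show ?thesis by simp
    qed
    moreover have "(\<Sum>k\<in>I. d k * g k z0) = 0" unfolding sum_d using k0 by (simp add: d_def)
    moreover have "\<exists>k\<in>I. d k \<noteq> 0" using c(1) unfolding d_def by (metis (full_types) DiffE singletonI)
    ultimately show ?thesis by blast
  qed
qed

lemma abs_sum_mult_le_sqrt:
  fixes a b :: "nat \<Rightarrow> real"
  shows "(\<Sum>n\<in>I. \<bar>a n * b n\<bar>) \<le> sqrt (\<Sum>n\<in>I. (a n)\<^sup>2) * sqrt (\<Sum>n\<in>I. (b n)\<^sup>2)"
  using L2_set_mult_ineq[of a b I] by (simp add: abs_mult L2_set_def)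

section \<open>A maximum principle\<close>

text \<open>The equation \<open>- (r' / p)' / q + \<kappa> * r = f\<close> in first-order form with
  flux \<open>\<Phi> = r' / p\<close>. Boundary conditions bear on the flux alone; r and the
  coefficients may be unbounded near 0 and 1.\<close>

locale flux_system =
  fixes r \<Phi> p q f :: "real \<Rightarrow> real" and \<kappa> :: real
  assumes r_deriv: "\<And>x. x \<in> {0<..<1} \<Longrightarrow> (r has_real_derivative p x * \<Phi> x) (at x)"
    and flux_deriv: "\<And>x. x \<in> {0<..<1} \<Longrightarrow> (\<Phi> has_real_derivative q x * (\<kappa> * r x - f x)) (at x)"
    and p_pos: "\<And>x. x \<in> {0<..<1} \<Longrightarrow> 0 < p x"
    and q_pos: "\<And>x. x \<in> {0<..<1} \<Longrightarrow> 0 < q x"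
    and \<kappa>_pos: "0 < \<kappa>"
    and flux_0: "(\<Phi> \<longlongrightarrow> 0) (at_right 0)"
    and flux_1: "(\<Phi> \<longlongrightarrow> 0) (at_left 1)"
begin

text \<open>Moving left from \<xi>, r grows as long as the flux is negative. If
  \<open>\<kappa> * r\<close> exceeded f all the while, the flux would be increasing in x, hence at
  most \<open>\<Phi> \<xi>\<close> further left, and could not return to 0 at the endpoint.\<close>

lemma flux_neg_left:
  assumes \<xi>: "\<xi> \<in> {0<..<1}" and neg: "\<Phi> \<xi> < 0"
  shows "\<exists>a\<in>{0<..\<xi>}. r \<xi> \<le> r a \<and> \<kappa> * r a \<le> f a"
proof (rule ccontr)
  assume "\<not> ?thesis"
  then have H: "f a < \<kappa> * r a" if "a \<in> {0<..\<xi>}" "r \<xi> \<le> r a" for a using that by force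
  define c where "c = \<Phi> \<xi> / 2"
  have c: "\<Phi> \<xi> < c" "c < 0" using neg by (auto simp: c_def)
  have "eventually (\<lambda>z. c < \<Phi> z) (at_right 0)" using order_tendstoD(1)[OF flux_0 c(2)] .
  moreover have "eventually (\<lambda>z. z \<in> {0<..<\<xi>}) (at_right 0)" using \<xi> by (intro eventually_at_right_real) auto
  ultimately obtain z0 where z0: "c < \<Phi> z0" "z0 \<in> {0<..<\<xi>}"
    using eventually_happens'[OF _ eventually_conj] by (metis (no_types, lifting) trivial_limit_at_right_real)
  have cont: "continuous_on {z0..\<xi>} \<Phi>"
    using z0 \<xi> by (intro continuous_at_imp_continuous_on ballI DERIV_isCont[OF flux_deriv]) auto
  \<comment> \<open>The supremum of A is the last point before \<xi> at which the flux is still at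
    least half of its negative value at \<xi>.\<close>
  define A where "A = {z0..\<xi>} \<inter> \<Phi> -` {c..}"
  have "closed A" unfolding A_def using cont by (intro continuous_closed_preimage) auto
  moreover have "z0 \<in> A" using z0 by (auto simp: A_def)
  moreover have "bdd_above A" by (auto simp: A_def)
  ultimately have SA: "Sup A \<in> A" by (intro closed_contains_Sup) auto
  define z1 where "z1 = Sup A"
  have z1: "z0 \<le> z1" "z1 < \<xi>" "c \<le> \<Phi> z1"
    using SA c by (auto simp: A_def z1_def order_less_le)
  have below: "\<Phi> z < c" if "z1 < z" "z \<le> \<xi>" for z
  proof (rule ccontr)
    assume "\<not> \<Phi> z < c"
    then have "z \<in> A" using that z1 by (auto simp: A_def)
    then have "z \<le> z1" unfolding z1_def using \<open>bdd_above A\<close> by (rule cSup_upper)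
    then show False using that by simp
  qed
  have rz: "r \<xi> \<le> r z" if "z1 < z" "z \<le> \<xi>" for z
  proof (rule DERIV_nonpos_imp_nonincreasing[OF that(2)])
    fix x assume x: "z \<le> x" "x \<le> \<xi>"
    then have "x \<in> {0<..<1}" using that z1 z0 \<xi> by auto
    moreover have "p x * \<Phi> x \<le> 0"
      using p_pos[OF \<open>x \<in> {0<..<1}\<close>] below[of x] x that c by (intro mult_nonneg_nonpos) auto
    ultimately show "\<exists>y. (r has_real_derivative y) (at x) \<and> y \<le> 0" using r_deriv by blast
  qed
  have "\<Phi> z1 \<le> \<Phi> \<xi>"
  proof (rule DERIV_nonneg_imp_increasing_open[where f = \<Phi>])
    fix x assume x: "z1 < x" "x < \<xi>"
    then have "x \<in> {0<..<1}" using z1 z0 \<xi> by auto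
    moreover have "0 \<le> q x * (\<kappa> * r x - f x)"
      using q_pos[OF \<open>x \<in> {0<..<1}\<close>] H[of x] rz[of x] x \<open>x \<in> {0<..<1}\<close> by (intro mult_nonneg_nonneg) auto
    ultimately show "\<exists>y. (\<Phi> has_real_derivative y) (at x) \<and> 0 \<le> y" using flux_deriv by blast
  qed (use z1 continuous_on_subset[OF cont] in auto)
  then show False using z1 c by simp
qed

text \<open>Reflection of the interval and, below, a change of sign yield the other three one-sided
  statements from \<open>flux_neg_left\<close>.\<close>

lemma reflected: "flux_system (\<lambda>x. r (1 - x)) (\<lambda>x. - \<Phi> (1 - x)) (\<lambda>x. p (1 - x)) (\<lambda>x. q (1 - x)) (\<lambda>x. f (1 - x)) \<kappa>"
proof
  fix x :: real assume "x \<in> {0<..<1}"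
  then have x: "1 - x \<in> {0<..<1}" by auto
  have d: "((\<lambda>x. 1 - x) has_real_derivative -1) (at x)" by (auto intro!: derivative_eq_intros)
  show "((\<lambda>x. r (1 - x)) has_real_derivative p (1 - x) * - \<Phi> (1 - x)) (at x)"
    using DERIV_chain2[OF r_deriv[OF x] d] by simp
  have "((\<lambda>x. \<Phi> (1 - x)) has_real_derivative q (1 - x) * (\<kappa> * r (1 - x) - f (1 - x)) * -1) (at x)"
    by (rule DERIV_chain2[OF flux_deriv[OF x] d])
  then show "((\<lambda>x. - \<Phi> (1 - x)) has_real_derivative q (1 - x) * (\<kappa> * r (1 - x) - f (1 - x))) (at x)"
    by (auto intro!: derivative_eq_intros)
  show "0 < p (1 - x)" "0 < q (1 - x)" using p_pos q_pos x by auto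
next
  have "filterlim (\<lambda>x::real. 1 - x) (at_left 1) (at_right 0)"
    unfolding filterlim_at by (auto intro!: tendsto_eq_intros eventually_mono[OF eventually_at_right_less])
  from filterlim_compose[OF flux_1 this] show "((\<lambda>x. - \<Phi> (1 - x)) \<longlongrightarrow> 0) (at_right 0)"
    using tendsto_minus by fastforce
  have "filterlim (\<lambda>x::real. 1 - x) (at_right 0) (at_left 1)"
    unfolding filterlim_at by (auto intro!: tendsto_eq_intros eventually_mono[OF eventually_at_left_real[of 0 1]])
  from filterlim_compose[OF flux_0 this] show "((\<lambda>x. - \<Phi> (1 - x)) \<longlongrightarrow> 0) (at_left 1)"
    using tendsto_minus by fastforce
qed (rule \<kappa>_pos)

lemma negated: "flux_system (\<lambda>x. - r x) (\<lambda>x. - \<Phi> x) p q (\<lambda>x. - f x) \<kappa>"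
proof
  fix x :: real assume x: "x \<in> {0<..<1}"
  show "((\<lambda>x. - r x) has_real_derivative p x * - \<Phi> x) (at x)"
    using DERIV_minus[OF r_deriv[OF x]] by simp
  show "((\<lambda>x. - \<Phi> x) has_real_derivative q x * (\<kappa> * - r x - - f x)) (at x)"
    using DERIV_minus[OF flux_deriv[OF x]] by (simp add: algebra_simps)
qed (use p_pos q_pos \<kappa>_pos tendsto_minus[OF flux_0] tendsto_minus[OF flux_1] in auto)

lemma flux_pos_right:
  assumes "\<xi> \<in> {0<..<1}" "\<Phi> \<xi> > 0"
  shows "\<exists>b\<in>{\<xi>..<1}. r \<xi> \<le> r b \<and> \<kappa> * r b \<le> f b"
proof -
  obtain a where "a \<in> {0<..1 - \<xi>}" "r \<xi> \<le> r (1 - a) \<and> \<kappa> * r (1 - a) \<le> f (1 - a)"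
    using flux_system.flux_neg_left[OF reflected, of "1 - \<xi>"] assms by auto
  then show ?thesis by (intro bexI[of _ "1 - a"]) auto
qed

lemma flux_pos_left:
  assumes "\<xi> \<in> {0<..<1}" "\<Phi> \<xi> > 0"
  shows "\<exists>a\<in>{0<..\<xi>}. r a \<le> r \<xi> \<and> f a \<le> \<kappa> * r a"
  using flux_system.flux_neg_left[OF negated, of \<xi>] assms by auto

lemma flux_neg_right:
  assumes "\<xi> \<in> {0<..<1}" "\<Phi> \<xi> < 0"
  shows "\<exists>b\<in>{\<xi>..<1}. r b \<le> r \<xi> \<and> f b \<le> \<kappa> * r b"
  using flux_system.flux_pos_right[OF negated, of \<xi>] assms by auto

text \<open>This replaces the second derivative test: p is merely positive, so r need not be twice
  differentiable, but the flux is differentiable.\<close>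

lemma flux_zero_decrease:
  assumes x: "x \<in> {0<..<1}" and "\<Phi> x = 0" "\<kappa> * r x < f x" "x < b"
  obtains y where "x < y" "y < b" "y < 1" "\<Phi> y < 0" "r y < r x"
proof -
  have "q x * (\<kappa> * r x - f x) < 0" using q_pos[OF x] assms by (intro mult_pos_neg) auto
  from DERIV_neg_dec_right[OF flux_deriv[OF x] this] obtain d where
    d: "d > 0" "\<And>h. 0 < h \<Longrightarrow> h < d \<Longrightarrow> \<Phi> (x + h) < \<Phi> x" by blast
  define h where "h = min (d / 2) (min ((b - x) / 2) ((1 - x) / 2))"
  have h: "0 < h" "h < d" "x + h < b" "x + h < 1" using d x assms by (auto simp: h_def min_def field_simps)
  have neg: "\<Phi> z < 0" if "x < z" "z \<le> x + h" for z
    using d(2)[of "z - x"] that h assms(2) by auto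
  have "r (x + h) < r x"
  proof (rule DERIV_neg_imp_decreasing_open[where f = r])
    fix z assume z: "x < z" "z < x + h"
    then have z01: "z \<in> {0<..<1}" using x h by auto
    then have "p z * \<Phi> z < 0" using p_pos neg[of z] z by (intro mult_pos_neg) auto
    then show "\<exists>y. (r has_real_derivative y) (at z) \<and> y < 0" using r_deriv[OF z01] by blast
  next
    show "continuous_on {x..x + h} r"
      using x h by (intro continuous_at_imp_continuous_on ballI DERIV_isCont[OF r_deriv]) auto
  qed (use h in auto)
  then show thesis using that[of "x + h"] h neg[of "x + h"] by auto
qed

text \<open>From a negative value with non-zero flux, r can be followed to a point where r is no
  larger and \<open>f \<le> \<kappa> * r < 0\<close>. If the flux is zero, it becomes negative on
  moving slightly to the right, with r still negative.\<close>

lemma solution_nonneg: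
  assumes f: "\<And>x. x \<in> {0<..<1} \<Longrightarrow> 0 \<le> f x" and x: "x \<in> {0<..<1}"
  shows "0 \<le> r x"
proof (rule ccontr)
  assume "\<not> 0 \<le> r x"
  then have rx: "r x < 0" by simp
  have neg: False if "y \<in> {0<..<1}" "r y < 0" "\<Phi> y < 0" for y
  proof -
    from flux_neg_right[OF that(1,3)] obtain b where b: "b \<in> {y..<1}" "r b \<le> r y" "f b \<le> \<kappa> * r b" by blast
    then have "\<kappa> * r b < 0" using that \<kappa>_pos by (intro mult_pos_neg) auto
    then show False using b f[of b] that by auto
  qed
  have pos: False if "\<Phi> x > 0"
  proof -
    from flux_pos_left[OF x that] obtain b where b: "b \<in> {0<..x}" "r b \<le> r x" "f b \<le> \<kappa> * r b" by blast
    then have "\<kappa> * r b < 0" using rx \<kappa>_pos by (intro mult_pos_neg) auto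
    then show False using b f[of b] x by auto
  qed
  have "\<Phi> x = 0" using neg[OF x rx] pos by (cases "\<Phi> x" "0::real" rule: linorder_cases) auto
  moreover have "\<kappa> * r x < f x"
    using f[OF x] mult_pos_neg[OF \<kappa>_pos rx] by simp
  ultimately obtain y where "x < y" "y < 1" "\<Phi> y < 0" "r y < r x"
    using flux_zero_decrease[OF x, of 1] x by auto
  then show False using neg[of y] rx x by auto
qed

text \<open>At an interior minimum \<open>m\<close> between two larger values, \<open>\<kappa> r m \<ge> f m\<close>, while on either side there are
  points with larger \<open>r\<close> and \<open>f \<ge> \<kappa> r\<close>; so \<open>f\<close> would dip below both.\<close>

lemma solution_quasi_concave:
  assumes f: "quasi_concave_on {0<..<1} f"
  shows "quasi_concave_on {0<..<1} r"
  unfolding quasi_concave_on_def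
proof (intro ballI allI impI, rule ccontr)
  fix x y z assume x: "x \<in> {0<..<1::real}" and y: "y \<in> {0<..<1::real}" and z: "x < z \<and> z < y"
    and "\<not> min (r x) (r y) \<le> r z"
  then have less: "r z < r x" "r z < r y" by auto
  have cont: "continuous_on {u..v} r" if "0 < u" "v < 1" for u v
    using that by (intro continuous_at_imp_continuous_on ballI DERIV_isCont[OF r_deriv]) auto
  obtain m where m: "m \<in> {x..y}" "\<And>u. u \<in> {x..y} \<Longrightarrow> r m \<le> r u"
    using continuous_attains_inf[of "{x..y}" r] cont[of x y] x y z by auto
  have mz: "r m \<le> r z" using m(2)[of z] z by auto
  then have mxy: "x < m" "m < y" using less m(1) by (auto simp: order_less_le)
  have m01: "m \<in> {0<..<1}" using mxy x y by auto
  \<comment> \<open>Interior minimisers are critical. Hence a point with non-zero flux between x and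
    y has a value strictly above the minimum.\<close>
  have crit: "\<Phi> u = 0" if "x < u" "u < y" "r u = r m" for u
  proof -
    have u01: "u \<in> {0<..<1}" using that x y by auto
    have "p u * \<Phi> u = 0"
    proof (rule DERIV_local_min[OF r_deriv[OF u01]])
      show "0 < min (u - x) (y - u)" using that by simp
      show "\<forall>v. \<bar>u - v\<bar> < min (u - x) (y - u) \<longrightarrow> r u \<le> r v"
        using m(2) that by (auto simp: abs_if split: if_splits)
    qed
    then show ?thesis using p_pos[OF u01] by simp
  qed
  have fm: "f m \<le> \<kappa> * r m"
  proof (rule ccontr)
    assume "\<not> f m \<le> \<kappa> * r m"
    then obtain v where "m < v" "v < y" "r v < r m"
      using flux_zero_decrease[OF m01 crit[OF mxy refl], of y] mxy by auto
    then show False using m(2)[of v] mxy by auto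
  qed
  have "\<exists>a. 0 < a \<and> a < m \<and> f m < f a"
  proof -
    \<comment> \<open>A mean value point at which r decreases, so that the flux is negative and
      \<open>flux_neg_left\<close> leads to a point a with
      \<open>\<kappa> * r a \<le> f a\<close>.\<close>
    obtain \<xi> where \<xi>: "x < \<xi>" "\<xi> < m" "r m - r x = (m - x) * (p \<xi> * \<Phi> \<xi>)"
      using MVT2[of x m r "\<lambda>t. p t * \<Phi> t"] mxy r_deriv x m01 by (force simp: Ball_def)
    have \<xi>01: "\<xi> \<in> {0<..<1}" using \<xi> x m01 by auto
    have "(m - x) * (p \<xi> * \<Phi> \<xi>) < 0" using \<xi>(3) less mz by linarith
    then have neg: "\<Phi> \<xi> < 0" using p_pos[OF \<xi>01] mxy by (simp add: mult_less_0_iff)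
    then have "r \<xi> \<noteq> r m" using crit[of \<xi>] \<xi> mxy by auto
    then have "r m < r \<xi>" using m(2)[of \<xi>] \<xi> mxy by auto
    moreover obtain a where a: "a \<in> {0<..\<xi>}" "r \<xi> \<le> r a" "\<kappa> * r a \<le> f a"
      using flux_neg_left[OF \<xi>01 neg] by blast
    ultimately have "\<kappa> * r m < \<kappa> * r a" using \<kappa>_pos by simp
    then show ?thesis using a fm \<xi> by (intro exI[of _ a]) auto
  qed
  then obtain a where a: "0 < a" "a < m" "f m < f a" by blast
  have "\<exists>b. m < b \<and> b < 1 \<and> f m < f b"
  proof -
    obtain \<xi> where \<xi>: "m < \<xi>" "\<xi> < y" "r y - r m = (y - m) * (p \<xi> * \<Phi> \<xi>)"
      using MVT2[of m y r "\<lambda>t. p t * \<Phi> t"] mxy r_deriv y m01 by (force simp: Ball_def)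
    have \<xi>01: "\<xi> \<in> {0<..<1}" using \<xi> y m01 by auto
    have "(y - m) * (p \<xi> * \<Phi> \<xi>) > 0" using \<xi>(3) less mz by linarith
    then have pos: "\<Phi> \<xi> > 0" using p_pos[OF \<xi>01] mxy by (simp add: zero_less_mult_iff)
    then have "r \<xi> \<noteq> r m" using crit[of \<xi>] \<xi> mxy by auto
    then have "r m < r \<xi>" using m(2)[of \<xi>] \<xi> mxy by auto
    moreover obtain b where b: "b \<in> {\<xi>..<1}" "r \<xi> \<le> r b" "\<kappa> * r b \<le> f b"
      using flux_pos_right[OF \<xi>01 pos] by blast
    ultimately have "\<kappa> * r m < \<kappa> * r b" using \<kappa>_pos by simp
    then show ?thesis using b fm \<xi> by (intro exI[of _ b]) auto
  qed
  then obtain b where b: "m < b" "b < 1" "f m < f b" by blast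
  have "min (f a) (f b) \<le> f m"
    using f a b unfolding quasi_concave_on_def by (auto simp del: min_less_iff_conj)
  then show False using a b by auto
qed

end

section \<open>Completeness for Sturm-Liouville systems\<close>

text \<open>\<open>e n\<close> solves \<open>(w * e')' = - \<mu> n * w * e\<close>, written as a
  first-order system with \<open>S n\<close>. All data on \<open>w\<close> concern the open
  interval, since \<open>w\<close> may degenerate at both ends. The values of \<open>S n\<close> at
  1 say that \<open>e n\<close> integrates to 0 against \<open>w\<close> for n \<ge> 1 and to 1 for
  n = 0.\<close>

locale dual_sturm_liouville =
  fixes w :: "real \<Rightarrow> real" and e S :: "nat \<Rightarrow> real \<Rightarrow> real" and \<mu> :: "nat \<Rightarrow> real" and A \<beta> :: real
  assumes A_pos: "0 < A" and \<beta>: "-1 < \<beta>"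
    and w_cont: "continuous_on {0<..<1} w"
    and w_lower: "\<And>x. x \<in> {0<..<1} \<Longrightarrow> x powr \<beta> * (1 - x)\<^sup>2 \<le> A * w x"
    and w_upper: "\<And>x. x \<in> {0<..<1} \<Longrightarrow> w x \<le> A * (x powr \<beta> * (1 - x)\<^sup>2)"
    and e_cont: "\<And>n. continuous_on {0..1} (e n)"
    and e_0: "\<And>x. x \<in> {0..1} \<Longrightarrow> e 0 x = 1"
    and e_left: "\<And>n. 0 < e n 0" and e_right: "\<And>n. e n 1 \<noteq> 0"
    and S_cont: "\<And>n. continuous_on {0..1} (S n)"
    and S_0: "\<And>n. S n 0 = 0" and S_1: "\<And>n. S n 1 = (if n = 0 then 1 else 0)"
    and S_deriv: "\<And>n x. x \<in> {0<..<1} \<Longrightarrow> (S n has_real_derivative w x * e n x) (at x)"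
    and e_deriv: "\<And>n x. x \<in> {0<..<1} \<Longrightarrow> (e n has_real_derivative - (\<mu> n * S n x / w x)) (at x)"
    and e_norm: "\<And>n. ((\<lambda>x. w x * (e n x)\<^sup>2) has_integral 1) {0..1}"
    and \<mu>_0: "\<mu> 0 = 0" and \<mu>_strict: "strict_mono \<mu>" and \<mu>_top: "filterlim \<mu> at_top sequentially"
    and e_zeros: "\<And>n. 1 \<le> n \<Longrightarrow> card {x\<in>{0<..<1}. e n x = 0} = n"
    and e_simple: "\<And>n x. 1 \<le> n \<Longrightarrow> x \<in> {0<..<1} \<Longrightarrow> e n x = 0 \<Longrightarrow> S n x \<noteq> 0"
begin

section \<open>Integration against the weight\<close>

abbreviation "Leb \<equiv> lebesgue_on {0<..<1::real}"

definition "M = density Leb (\<lambda>x. ennreal (w x))"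

lemma w_pos: "x \<in> {0<..<1} \<Longrightarrow> 0 < w x"
proof -
  assume x: "x \<in> {0<..<1}"
  then have "0 < x powr \<beta> * (1 - x)\<^sup>2" by auto
  then have "0 < A * w x" using w_lower[OF x] by linarith
  then show "0 < w x" using A_pos by (simp add: zero_less_mult_iff)
qed

lemma \<mu>_pos: "1 \<le> n \<Longrightarrow> 0 < \<mu> n"
  using strict_monoD[OF \<mu>_strict, of 0 n] \<mu>_0 by simp

lemma \<mu>_nonneg: "0 \<le> \<mu> n"
  using \<mu>_pos[of n] \<mu>_0 by (cases "n = 0") auto

lemma w_measurable [measurable]: "w \<in> borel_measurable Leb"
  by (intro continuous_imp_measurable_on_sets_lebesgue w_cont) auto

lemma space_M: "space M = {0<..<1}" by (simp add: M_def)

lemma sets_M: "sets M = sets Leb" by (simp add: M_def)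

lemma measurable_M: "f \<in> borel_measurable M \<longleftrightarrow> f \<in> borel_measurable Leb"
  by (simp add: M_def)

lemma w_has_integral: "(w has_integral 1) {0<..<1}"
proof -
  have "(w has_integral 1) {0..1}"
    by (rule has_integral_eq[OF _ e_norm[of 0]]) (simp add: e_0)
  then show ?thesis by (simp add: has_integral_Icc_iff_Ioo)
qed

lemma w_integrable: "integrable Leb w"
proof -
  have "w absolutely_integrable_on {0<..<1}"
    using w_has_integral w_pos by (intro nonnegative_absolutely_integrable_1) (auto intro: less_imp_le)
  then show ?thesis by (intro absolutely_integrable_imp_integrable) auto
qed

lemma emeasure_M_space: "emeasure M (space M) = 1"
proof -
  have "emeasure M (space M) = (\<integral>\<^sup>+x. ennreal (w x) \<partial>Leb)"
    unfolding M_def by (subst emeasure_density) (auto intro!: nn_integral_cong simp: indicator_def)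
  also have "\<dots> = ennreal (integral\<^sup>L Leb w)"
    using w_pos by (intro nn_integral_eq_integral w_integrable) (auto simp: less_imp_le)
  also have "integral\<^sup>L Leb w = 1"
    using w_has_integral by (subst lebesgue_integral_eq_integral[OF w_integrable]) auto
  finally show ?thesis by simp
qed

sublocale M: finite_measure M
  by (rule finite_measureI) (simp add: emeasure_M_space)

text \<open>On a finite measure space these functions form an algebra of integrable functions, so
  that integrability can be read off the shape of an integrand.\<close>

definition bm :: "(real \<Rightarrow> real) \<Rightarrow> bool" where
  "bm f \<longleftrightarrow> f \<in> borel_measurable Leb \<and> (\<exists>C. \<forall>x\<in>{0<..<1}. \<bar>f x\<bar> \<le> C)"

lemma bmI: "f \<in> borel_measurable Leb \<Longrightarrow> (\<And>x. x \<in> {0<..<1} \<Longrightarrow> \<bar>f x\<bar> \<le> C) \<Longrightarrow> bm f"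
  unfolding bm_def by (intro conjI exI[of _ C] ballI)

lemma bm_const [intro, simp]: "bm (\<lambda>x. c)"
  by (rule bmI[of _ "\<bar>c\<bar>"]) auto

lemma bm_add [intro]: assumes "bm f" "bm g" shows "bm (\<lambda>x. f x + g x)"
proof -
  from assms obtain C D where "\<forall>x\<in>{0<..<1}. \<bar>f x\<bar> \<le> C" "\<forall>x\<in>{0<..<1}. \<bar>g x\<bar> \<le> D" by (auto simp: bm_def)
  then show ?thesis using assms by (intro bmI[of _ "C + D"]) (auto simp: bm_def intro: order_trans[OF abs_triangle_ineq add_mono])
qed

lemma bm_mult [intro]: assumes "bm f" "bm g" shows "bm (\<lambda>x. f x * g x)"
proof -
  from assms obtain C D where CD: "\<forall>x\<in>{0<..<1}. \<bar>f x\<bar> \<le> C" "\<forall>x\<in>{0<..<1}. \<bar>g x\<bar> \<le> D" by (auto simp: bm_def)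
  have "\<bar>f x * g x\<bar> \<le> C * D" if "x \<in> {0<..<1}" for x
    unfolding abs_mult using CD that by (intro mult_mono) (auto intro: order_trans[OF abs_ge_zero])
  then show ?thesis using assms by (intro bmI[of _ "C * D"]) (auto simp: bm_def)
qed

lemma bm_uminus [intro]: "bm f \<Longrightarrow> bm (\<lambda>x. - f x)"
  using bm_mult[of "\<lambda>_. -1" f] by simp

lemma bm_diff [intro]: "bm f \<Longrightarrow> bm g \<Longrightarrow> bm (\<lambda>x. f x - g x)"
  using bm_add[of f "\<lambda>x. - g x"] by auto

lemma bm_power [intro]: "bm f \<Longrightarrow> bm (\<lambda>x. f x ^ n)"
  by (induction n) auto

lemma bm_sum [intro]: "(\<And>i. i \<in> I \<Longrightarrow> bm (f i)) \<Longrightarrow> bm (\<lambda>x. \<Sum>i\<in>I. f i x)"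
  by (induction I rule: infinite_finite_induct) auto

lemma bm_continuous: "continuous_on {0..1} f \<Longrightarrow> bm f"
proof -
  assume f: "continuous_on {0..1} f"
  then have "compact (f ` {0..1})" by (intro compact_continuous_image) auto
  then obtain C where "\<forall>y\<in>f ` {0..1}. \<bar>y\<bar> \<le> C" using compact_imp_bounded bounded_real by metis
  moreover have "f \<in> borel_measurable Leb"
    using f by (intro continuous_imp_measurable_on_sets_lebesgue) (auto intro: continuous_on_subset)
  ultimately show "bm f" by (intro bmI[of _ C]) auto
qed

lemma bm_indicator [intro]: "B \<in> sets borel \<Longrightarrow> bm (indicator B)"
proof (rule bmI[of _ 1])
  assume "B \<in> sets borel"
  then show "indicator B \<in> borel_measurable Leb"
    by (intro measurable_restrict_space1 borel_measurable_indicator) auto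
qed (auto simp: indicator_def)

lemma bm_e [intro]: "bm (e n)" by (intro bm_continuous e_cont)
lemma bm_S [intro]: "bm (S n)" by (intro bm_continuous S_cont)

lemma bm_integrable: "bm f \<Longrightarrow> integrable M f"
  unfolding bm_def by (auto intro!: M.integrable_const_bound AE_I2 simp: measurable_M space_M)

lemma bm_LINT:
  assumes "bm f"
  shows "(LINT x|M. f x) = integral {0<..<1} (\<lambda>x. w x * f x)"
    and "integrable Leb (\<lambda>x. w x * f x)"
proof -
  have f: "f \<in> borel_measurable Leb" using assms by (simp add: bm_def)
  have w0: "AE x in Leb. 0 \<le> w x" using w_pos by (auto simp: less_imp_le)
  show i: "integrable Leb (\<lambda>x. w x * f x)"
    using bm_integrable[OF assms] f w0 by (simp add: M_def integrable_density)
  have "(LINT x|M. f x) = (LINT x|Leb. w x * f x)"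
    using f w0 unfolding M_def by (simp add: integral_density)
  also have "\<dots> = integral {0<..<1} (\<lambda>x. w x * f x)" using i by (intro lebesgue_integral_eq_integral) auto
  finally show "(LINT x|M. f x) = integral {0<..<1} (\<lambda>x. w x * f x)" .
qed

text \<open>The density \<open>w\<close> may be unbounded near 0, so the antiderivative is only
  asked to be continuous on the closed interval and differentiable inside.\<close>

lemma integral_bm_FTC:
  assumes g: "bm g" and ab: "0 \<le> a" "a \<le> b" "b \<le> 1" and G: "continuous_on {a..b} G" and T: "finite T"
    and G': "\<And>x. x \<in> {a<..<b} - T \<Longrightarrow> (G has_real_derivative w x * g x) (at x)"
  shows "(LINT x|M. indicator {a<..<b} x * g x) = G b - G a"
proof -
  have "((\<lambda>x. w x * g x) has_integral (G b - G a)) {a..b}"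
    using G' by (intro fundamental_theorem_of_calculus_interior_strong[OF T]) (auto simp: G ab has_real_derivative_iff_has_vector_derivative)
  then have "((\<lambda>x. w x * g x) has_integral (G b - G a)) {a<..<b}" by (simp add: has_integral_Icc_iff_Ioo)
  then have "((\<lambda>x. if x \<in> {a<..<b} then w x * g x else 0) has_integral (G b - G a)) {0<..<1}"
    using ab by (subst has_integral_restrict) auto
  moreover have "(\<lambda>x. if x \<in> {a<..<b} then w x * g x else 0) = (\<lambda>x. w x * (indicator {a<..<b} x * g x))"
    by (auto simp: indicator_def fun_eq_iff)
  ultimately have "((\<lambda>x. w x * (indicator {a<..<b} x * g x)) has_integral (G b - G a)) {0<..<1}" by simp
  then show ?thesis by (subst bm_LINT(1)[OF bm_mult[OF bm_indicator g]]) (auto simp: integral_unique)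
qed

lemma integral_bm_FTC_01:
  assumes g: "bm g" and G: "continuous_on {0..1} G" and T: "finite T"
    and G': "\<And>x. x \<in> {0<..<1} - T \<Longrightarrow> (G has_real_derivative w x * g x) (at x)"
  shows "(LINT x|M. g x) = G 1 - G 0"
proof -
  have "(LINT x|M. g x) = (LINT x|M. indicator {0<..<1} x * g x)"
    by (intro Bochner_Integration.integral_cong) (auto simp: space_M)
  also have "\<dots> = G 1 - G 0" using assms by (intro integral_bm_FTC) auto
  finally show ?thesis .
qed

lemma integral_indicator_e:
  assumes "0 \<le> a" "a \<le> b" "b \<le> 1"
  shows "(LINT x|M. indicator {a<..<b} x * e n x) = S n b - S n a"
  using assms by (intro integral_bm_FTC[where T = "{}"] bm_e continuous_on_subset[OF S_cont] S_deriv) auto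

lemma measure_M_interval:
  assumes "0 \<le> a" "a \<le> b" "b \<le> 1"
  shows "measure M {a<..<b} = S 0 b - S 0 a"
proof -
  have [simp]: "{a<..<b} \<in> sets M" using assms by (auto simp: sets_M sets_restrict_space_iff)
  have "measure M {a<..<b} = (LINT x|M. indicator {a<..<b} x)"
    using assms by (simp add: space_M Int_absorb1)
  also have "\<dots> = (LINT x|M. indicator {a<..<b} x * e 0 x)"
    by (intro Bochner_Integration.integral_cong) (auto simp: space_M e_0)
  also have "\<dots> = S 0 b - S 0 a" using assms by (rule integral_indicator_e)
  finally show ?thesis .
qed

section \<open>Size of the weight and of its primitive\<close>

lemma W_mono: "0 \<le> a \<Longrightarrow> a \<le> b \<Longrightarrow> b \<le> 1 \<Longrightarrow> S 0 a \<le> S 0 b"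
  using measure_M_interval[of a b] measure_nonneg[of M "{a<..<b}"] by simp

lemma W_strict_mono: "0 \<le> a \<Longrightarrow> a < b \<Longrightarrow> b \<le> 1 \<Longrightarrow> S 0 a < S 0 b"
proof (rule DERIV_pos_imp_increasing_open[where f = "S 0"])
  fix x assume "0 \<le> a" "b \<le> 1" "a < x" "x < b"
  then have "x \<in> {0<..<1}" by auto
  then show "\<exists>y. (S 0 has_real_derivative y) (at x) \<and> 0 < y"
    using S_deriv[of x 0] w_pos[of x] e_0[of x] by auto
qed (auto intro: continuous_on_subset[OF S_cont])

lemma W_bounds: "x \<in> {0..1} \<Longrightarrow> 0 \<le> S 0 x \<and> S 0 x \<le> 1"
  using W_mono[of 0 x] W_mono[of x 1] S_0[of 0] S_1[of 0] by auto

lemma e_bound: obtains C where "0 < C" "\<And>x. x \<in> {0<..<1} \<Longrightarrow> \<bar>e n x\<bar> \<le> C"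
  using bm_e[of n] unfolding bm_def by (metis abs_ge_zero le_less_trans less_add_one linorder_not_less nle_le)

text \<open>Since \<open>e n\<close> is bounded, increments of \<open>S n\<close> are dominated by
  those of \<open>S 0\<close>; start from either endpoint, where \<open>S n\<close>
  vanishes.\<close>

lemma S_bound:
  assumes n: "1 \<le> n"
  obtains C where "0 < C" "\<And>x. x \<in> {0..1} \<Longrightarrow> \<bar>S n x\<bar> \<le> C * S 0 x"
    "\<And>x. x \<in> {0..1} \<Longrightarrow> \<bar>S n x\<bar> \<le> C * (1 - S 0 x)"
proof -
  obtain C where C: "0 < C" "\<And>x. x \<in> {0<..<1} \<Longrightarrow> \<bar>e n x\<bar> \<le> C" using e_bound[of n] by blast
  have D: "\<bar>S n b - S n a\<bar> \<le> C * (S 0 b - S 0 a)" if ab: "0 \<le> a" "a \<le> b" "b \<le> 1" for a b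
  proof -
    have "\<bar>S n b - S n a\<bar> = \<bar>LINT x|M. indicator {a<..<b} x * e n x\<bar>" using integral_indicator_e[OF ab] by simp
    also have "\<dots> \<le> (LINT x|M. \<bar>indicator {a<..<b} x * e n x\<bar>)" by (rule integral_abs_bound)
    also have "\<dots> \<le> (LINT x|M. C * (indicator {a<..<b} x * e 0 x))"
      using C by (intro integral_mono bm_integrable integrable_abs bm_mult bm_const bm_indicator bm_e) (auto simp: space_M indicator_def e_0)
    also have "\<dots> = C * (S 0 b - S 0 a)" using integral_indicator_e[OF ab, of 0] by simp
    finally show ?thesis .
  qed
  show thesis
  proof (rule that[OF C(1)])
    fix x :: real assume "x \<in> {0..1}"
    then show "\<bar>S n x\<bar> \<le> C * S 0 x" "\<bar>S n x\<bar> \<le> C * (1 - S 0 x)"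
      using D[of 0 x] D[of x 1] S_0 S_1 n by auto
  qed
qed

text \<open>For \<beta> \<ge> 0 the integrand is at most \<open>b powr \<beta>\<close>. For negative
  \<beta> it is unbounded at 0, but \<open>b powr \<beta> * a \<le> a powr \<beta> * a\<close> gives
  the estimate for the primitive itself, at the cost of the factor
  \<open>1 / (\<beta> + 1)\<close>.\<close>

lemma powr_increment_le:
  assumes "0 \<le> a" "a \<le> b"
  shows "b powr (\<beta> + 1) / (\<beta> + 1) - a powr (\<beta> + 1) / (\<beta> + 1) \<le> max 1 (1 / (\<beta> + 1)) * (b powr \<beta> * (b - a))"
proof (cases "a = b")
  case False
  then have ab: "a < b" "0 < b" using assms by auto
  show ?thesis
  proof (cases "0 \<le> \<beta>")
    case True
    define P where "P x = b powr \<beta> * x - x powr (\<beta> + 1) / (\<beta> + 1)" for x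
    have "P a \<le> P b"
    proof (rule DERIV_nonneg_imp_increasing_open[where f = P])
      fix x assume x: "a < x" "x < b"
      have "(P has_real_derivative b powr \<beta> - x powr \<beta>) (at x)"
        unfolding P_def using x assms \<beta> by (auto intro!: derivative_eq_intros)
      moreover have "x powr \<beta> \<le> b powr \<beta>" using x assms True by (intro powr_mono2) auto
      ultimately show "\<exists>y. (P has_real_derivative y) (at x) \<and> 0 \<le> y" by auto
    next
      show "continuous_on {a..b} P"
        unfolding P_def using assms \<beta> by (intro continuous_intros continuous_on_powr') auto
    qed (use ab in simp)
    then have "b powr (\<beta> + 1) / (\<beta> + 1) - a powr (\<beta> + 1) / (\<beta> + 1) \<le> 1 * (b powr \<beta> * (b - a))"
      by (simp add: P_def algebra_simps)
    also have "\<dots> \<le> max 1 (1 / (\<beta> + 1)) * (b powr \<beta> * (b - a))"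
      using ab by (intro mult_right_mono) auto
    finally show ?thesis .
  next
    case False
    have "b powr (\<beta> + 1) - a powr (\<beta> + 1) \<le> b powr \<beta> * (b - a)"
    proof (cases "a = 0")
      case True
      then show ?thesis using ab \<beta> by (simp add: powr_add)
    next
      case a0: False
      then have "b powr \<beta> \<le> a powr \<beta>" using assms False by (intro powr_mono2') auto
      then have "b powr \<beta> * a \<le> a powr \<beta> * a" using assms by (intro mult_right_mono) auto
      then show ?thesis using ab a0 assms by (simp add: powr_add algebra_simps)
    qed
    from divide_right_mono[OF this, of "\<beta> + 1"]
    have "b powr (\<beta> + 1) / (\<beta> + 1) - a powr (\<beta> + 1) / (\<beta> + 1) \<le> 1 / (\<beta> + 1) * (b powr \<beta> * (b - a))"
      using \<beta> by (simp add: diff_divide_distrib)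
    also have "\<dots> \<le> max 1 (1 / (\<beta> + 1)) * (b powr \<beta> * (b - a))"
      using ab by (intro mult_right_mono) auto
    finally show ?thesis .
  qed
qed simp

text \<open>On the interval \<open>(1 - x)\<^sup>2\<close> is at most its value at a, and the
  remaining power is integrated by \<open>powr_increment_le\<close>. The matching lower bound is
  \<open>W_lower\<close>.\<close>

lemma W_upper:
  obtains C where "0 < C"
    "\<And>a b. 0 \<le> a \<Longrightarrow> a \<le> b \<Longrightarrow> b \<le> 1 \<Longrightarrow> S 0 b - S 0 a \<le> C * (b powr \<beta> * (1 - a)\<^sup>2 * (b - a))"
proof
  define C where "C = A * max 1 (1 / (\<beta> + 1))"
  show "0 < C" using A_pos by (auto simp: C_def)
  fix a b :: real assume ab: "0 \<le> a" "a \<le> b" "b \<le> 1"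
  define P where "P x = A * (1 - a)\<^sup>2 * (x powr (\<beta> + 1) / (\<beta> + 1)) - S 0 x" for x
  have "P a \<le> P b"
  proof (rule DERIV_nonneg_imp_increasing_open[where f = P])
    fix x assume x: "a < x" "x < b"
    then have x01: "x \<in> {0<..<1}" using ab by auto
    have "(P has_real_derivative A * (1 - a)\<^sup>2 * x powr \<beta> - w x * e 0 x) (at x)"
      unfolding P_def using \<beta> x01 by (auto intro!: derivative_eq_intros S_deriv)
    moreover have "w x \<le> A * (1 - a)\<^sup>2 * x powr \<beta>"
    proof -
      have "(1 - x)\<^sup>2 \<le> (1 - a)\<^sup>2" using x ab by (intro power_mono) auto
      then have "A * (x powr \<beta> * (1 - x)\<^sup>2) \<le> A * (x powr \<beta> * (1 - a)\<^sup>2)"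
        using A_pos by (intro mult_left_mono) auto
      then show ?thesis using w_upper[OF x01] by (simp add: mult_ac)
    qed
    ultimately show "\<exists>y. (P has_real_derivative y) (at x) \<and> 0 \<le> y" using e_0[of x] x01 by auto
  next
    show "continuous_on {a..b} P" unfolding P_def using ab \<beta>
      by (intro continuous_intros continuous_on_powr' continuous_on_subset[OF S_cont]) auto
  qed (rule ab)
  then have "S 0 b - S 0 a \<le> A * (1 - a)\<^sup>2 * (b powr (\<beta> + 1) / (\<beta> + 1) - a powr (\<beta> + 1) / (\<beta> + 1))"
    by (simp add: P_def algebra_simps)
  also have "\<dots> \<le> A * (1 - a)\<^sup>2 * (max 1 (1 / (\<beta> + 1)) * (b powr \<beta> * (b - a)))"
    using A_pos ab by (intro mult_left_mono powr_increment_le) auto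
  finally show "S 0 b - S 0 a \<le> C * (b powr \<beta> * (1 - a)\<^sup>2 * (b - a))" by (simp add: C_def mult_ac)
qed

text \<open>Away from the outer quarters x is comparable to b and \<open>1 - x\<close> to
  \<open>1 - a\<close>. The constant \<open>4 powr (- \<bar>\<beta>\<bar>)\<close> comes from
  \<open>b / 4 \<le> x \<le> b\<close>, the 16 from squaring \<open>(1 - a) / 4\<close>.\<close>

lemma middle_half_bounds:
  assumes ab: "0 \<le> a" "a < b" "b \<le> 1" and x: "a + (b - a) / 4 \<le> x" "x \<le> b - (b - a) / 4"
  shows "b / 4 \<le> x" "x \<le> b" "(1 - a) / 4 \<le> 1 - x" "4 powr (- \<bar>\<beta>\<bar>) * b powr \<beta> \<le> x powr \<beta>" "x \<in> {0<..<1}"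
    "4 powr (- \<bar>\<beta>\<bar>) / (16 * A) * (b powr \<beta> * (1 - a)\<^sup>2) \<le> w x"
proof -
  show b4: "b / 4 \<le> x" and xb: "x \<le> b" and a4: "(1 - a) / 4 \<le> 1 - x" using assms by (auto simp: field_simps)
  show x01: "x \<in> {0<..<1}" using assms by (auto simp: field_simps)
  show p: "4 powr (- \<bar>\<beta>\<bar>) * b powr \<beta> \<le> x powr \<beta>"
  proof (cases "0 \<le> \<beta>")
    case True
    have "4 powr (- \<bar>\<beta>\<bar>) * b powr \<beta> = (b / 4) powr \<beta>" using True ab by (simp add: powr_divide powr_minus_divide)
    also have "\<dots> \<le> x powr \<beta>" using True b4 ab by (intro powr_mono2) auto
    finally show ?thesis .
  next
    case False
    have "4 powr (- \<bar>\<beta>\<bar>) * b powr \<beta> \<le> 1 * b powr \<beta>"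
      by (intro mult_right_mono) (auto simp: powr_minus_divide ge_one_powr_ge_zero)
    also have "\<dots> \<le> x powr \<beta>" using False x01 xb by (simp add: powr_mono2')
    finally show ?thesis .
  qed
  have "((1 - a) / 4)\<^sup>2 \<le> (1 - x)\<^sup>2" using a4 ab by (intro power_mono) auto
  then have "4 powr (- \<bar>\<beta>\<bar>) * b powr \<beta> * ((1 - a) / 4)\<^sup>2 \<le> x powr \<beta> * (1 - x)\<^sup>2"
    using p by (intro mult_mono) auto
  also have "\<dots> \<le> A * w x" using w_lower[OF x01] .
  finally show "4 powr (- \<bar>\<beta>\<bar>) / (16 * A) * (b powr \<beta> * (1 - a)\<^sup>2) \<le> w x"
    using A_pos by (simp add: field_simps power2_eq_square)
qed

text \<open>Near 0 the primitive gains one power of x over \<open>w\<close>, near 1 its complement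
  gains one power of \<open>1 - x\<close>. This bounds the diagonal of the Green function divided by
  \<open>w\<close>, and thereby the trace; it also bounds \<open>S n / w\<close>.\<close>

lemma min_W_le:
  obtains C where "0 < C" "\<And>x. x \<in> {0<..<1} \<Longrightarrow> min (S 0 x) (1 - S 0 x) \<le> C * (x * (1 - x) * w x)"
proof -
  obtain C where C: "0 < C"
    "\<And>a b. 0 \<le> a \<Longrightarrow> a \<le> b \<Longrightarrow> b \<le> 1 \<Longrightarrow> S 0 b - S 0 a \<le> C * (b powr \<beta> * (1 - a)\<^sup>2 * (b - a))"
    using W_upper by blast
  define K where "K = 2 powr \<bar>\<beta>\<bar>"
  have K1: "1 \<le> K" by (simp add: K_def ge_one_powr_ge_zero)
  show thesis
  proof (rule that[of "8 * A * C * K"])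
    show "0 < 8 * A * C * K" using A_pos C(1) K1 by simp
    fix x :: real assume x: "x \<in> {0<..<1}"
    have w0: "0 < w x" using w_pos[OF x] .
    show "min (S 0 x) (1 - S 0 x) \<le> 8 * A * C * K * (x * (1 - x) * w x)"
    proof (cases "x \<le> 1 / 2")
      case True
      have "(1/2)\<^sup>2 \<le> (1 - x)\<^sup>2" using True by (intro power_mono) auto
      then have "x powr \<beta> * (1/2)\<^sup>2 \<le> x powr \<beta> * (1 - x)\<^sup>2" by (intro mult_left_mono) auto
      also have "\<dots> \<le> A * w x" using w_lower[OF x] .
      finally have *: "x powr \<beta> \<le> 4 * A * w x" by (simp add: power2_eq_square)
      have "S 0 x \<le> C * (x powr \<beta> * x)" using C(2)[of 0 x] x S_0[of 0] by auto
      also have "\<dots> \<le> C * (4 * A * w x * x)" using * C x by (intro mult_left_mono mult_right_mono) auto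
      also have "\<dots> \<le> C * (4 * A * w x * (2 * K * (x * (1 - x))))"
      proof -
        have "1 * x \<le> K * (2 * (1 - x)) * x" using True x K1 mult_mono[of 1 K 1 "2 * (1 - x)"] by (intro mult_right_mono) auto
        then show ?thesis using C A_pos w0 by (intro mult_left_mono) (auto simp: mult_ac)
      qed
      finally show ?thesis by (simp add: mult_ac min_le_iff_disj)
    next
      case False
      have "1 / K \<le> x powr \<beta>"
      proof (cases "0 \<le> \<beta>")
        case True
        then have "1 / K = (1/2) powr \<beta>" by (simp add: K_def powr_divide)
        also have "\<dots> \<le> x powr \<beta>" using True False by (intro powr_mono2) auto
        finally show ?thesis .
      next
        case b: False
        have "1 powr \<beta> \<le> x powr \<beta>" using b x by (intro powr_mono2') auto
        moreover have "1 / K \<le> 1" using K1 by simp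
        ultimately show ?thesis by simp
      qed
      then have "1 / K * (1 - x)\<^sup>2 \<le> x powr \<beta> * (1 - x)\<^sup>2" by (intro mult_right_mono) auto
      also have "\<dots> \<le> A * w x" using w_lower[OF x] .
      finally have *: "(1 - x)\<^sup>2 \<le> K * A * w x" using K1 by (simp add: field_simps)
      have "1 - S 0 x \<le> C * ((1 - x)\<^sup>2 * (1 - x))" using C(2)[of x 1] x S_1[of 0] by auto
      also have "\<dots> \<le> C * (K * A * w x * (1 - x))" using * C x by (intro mult_left_mono mult_right_mono) auto
      also have "\<dots> \<le> C * (K * A * w x * (8 * (x * (1 - x))))"
      proof -
        have "1 * (1 - x) \<le> 8 * x * (1 - x)" using False x by (intro mult_right_mono) auto
        then show ?thesis using C A_pos w0 K1 by (intro mult_left_mono) (auto simp: mult_ac)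
      qed
      finally show ?thesis by (simp add: mult_ac min_le_iff_disj)
    qed
  qed
qed

lemma S_le_w:
  assumes "1 \<le> n"
  obtains C where "0 < C" "\<And>x. x \<in> {0<..<1} \<Longrightarrow> \<bar>S n x\<bar> \<le> C * (x * (1 - x) * w x)"
proof -
  obtain B where B: "0 < B" "\<And>x. x \<in> {0..1} \<Longrightarrow> \<bar>S n x\<bar> \<le> B * S 0 x" "\<And>x. x \<in> {0..1} \<Longrightarrow> \<bar>S n x\<bar> \<le> B * (1 - S 0 x)"
    using S_bound[OF assms] by blast
  obtain C where C: "0 < C" "\<And>x. x \<in> {0<..<1} \<Longrightarrow> min (S 0 x) (1 - S 0 x) \<le> C * (x * (1 - x) * w x)"
    using min_W_le by blast
  show thesis
  proof (rule that[of "B * C"])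
    fix x :: real assume x: "x \<in> {0<..<1}"
    have "\<bar>S n x\<bar> \<le> B * min (S 0 x) (1 - S 0 x)" using B x by (simp add: min_def)
    also have "\<dots> \<le> B * (C * (x * (1 - x) * w x))" using B(1) C(2)[OF x] by (intro mult_left_mono) auto
    finally show "\<bar>S n x\<bar> \<le> B * C * (x * (1 - x) * w x)" by (simp add: mult_ac)
  qed (use B C in auto)
qed

lemma bm_S_over_w [intro]:
  assumes "1 \<le> n"
  shows "bm (\<lambda>x. S n x / w x)"
proof -
  obtain C where C: "0 < C" "\<And>x. x \<in> {0<..<1} \<Longrightarrow> \<bar>S n x\<bar> \<le> C * (x * (1 - x) * w x)"
    using S_le_w[OF assms] by blast
  show ?thesis
  proof (rule bmI[of _ C])
    show "(\<lambda>x. S n x / w x) \<in> borel_measurable Leb"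
      using bm_S[of n] by (auto simp: bm_def)
    fix x :: real assume x: "x \<in> {0<..<1}"
    have "x * (1 - x) \<le> 1 * 1" using x by (intro mult_mono) auto
    then have "\<bar>S n x\<bar> \<le> C * (1 * w x)"
      using C(1) w_pos[OF x] by (intro order_trans[OF C(2)[OF x]] mult_left_mono mult_right_mono) auto
    then show "\<bar>S n x / w x\<bar> \<le> C" using w_pos[OF x] by (simp add: abs_div_pos[symmetric] field_simps)
  qed
qed

section \<open>Orthogonality of the eigenfunctions and of their derivatives\<close>

definition De :: "nat \<Rightarrow> real \<Rightarrow> real" where "De n x = - (\<mu> n * S n x / w x)"

lemma De_deriv: "x \<in> {0<..<1} \<Longrightarrow> (e n has_real_derivative De n x) (at x)"
  unfolding De_def by (rule e_deriv)

lemma De_0: "De 0 x = 0" by (simp add: De_def \<mu>_0)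

lemma bm_De [intro]: "bm (De n)"
proof (cases "n = 0")
  case False
  then have "bm (\<lambda>x. (- \<mu> n) * (S n x / w x))" by (intro bm_mult bm_const bm_S_over_w) auto
  then show ?thesis by (simp add: De_def[abs_def])
qed (simp add: De_0[abs_def])

lemma orthonormal: "(LINT x|M. e m x * e n x) = (if m = n then 1 else 0)"
proof (cases "m = n")
  case True
  have "(LINT x|M. e n x * e n x) = integral {0<..<1} (\<lambda>x. w x * (e n x * e n x))"
    by (intro bm_LINT) auto
  also have "\<dots> = 1" using e_norm[of n] by (intro integral_unique) (simp add: has_integral_Icc_iff_Ioo power2_eq_square)
  finally show ?thesis using True by simp
next
  case False
  then have ne: "\<mu> n - \<mu> m \<noteq> 0" using strict_mono_eq[OF \<mu>_strict] by auto
  \<comment> \<open>The Wronskian of \<open>e m\<close> and \<open>e n\<close> times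
    \<open>w\<close>, over the difference of eigenvalues. At 1 the non-zero value
    \<open>S 0 1\<close> comes with the factor \<open>\<mu> 0 = 0\<close>.\<close>
  define G where "G x = (\<mu> n * S n x * e m x - \<mu> m * S m x * e n x) / (\<mu> n - \<mu> m)" for x
  have "(LINT x|M. e m x * e n x) = G 1 - G 0"
  proof (rule integral_bm_FTC_01[where T = "{}"])
    show "continuous_on {0..1} G" unfolding G_def using ne by (intro continuous_intros S_cont e_cont) auto
    fix x :: real assume x: "x \<in> {0<..<1} - {}"
    have "(G has_real_derivative
      ((\<mu> n * (w x * e n x)) * e m x + - (\<mu> m * S m x / w x) * (\<mu> n * S n x)
       - ((\<mu> m * (w x * e m x)) * e n x + - (\<mu> n * S n x / w x) * (\<mu> m * S m x))) / (\<mu> n - \<mu> m)) (at x)"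
      unfolding G_def using x
      by (intro DERIV_cdivide DERIV_diff DERIV_mult DERIV_cmult S_deriv e_deriv) auto
    then show "(G has_real_derivative w x * (e m x * e n x)) (at x)"
      by (rule DERIV_cong) (use ne in \<open>simp add: divide_eq_eq algebra_simps\<close>)
  qed auto
  also have "\<dots> = 0" using \<mu>_0 by (simp add: G_def S_0 S_1)
  finally show ?thesis using False by simp
qed

text \<open>Integrate the derivative of \<open>S n * e m\<close>; its boundary values vanish since n
  \<ge> 1, and the other part is the orthonormality of the \<open>e n\<close>.\<close>

lemma S_orthogonal:
  assumes "1 \<le> m" "1 \<le> n"
  shows "(LINT x|M. S m x / w x * (S n x / w x)) = (if m = n then 1 / \<mu> n else 0)"
proof -
  have "(LINT x|M. e n x * e m x - \<mu> m * (S m x / w x * (S n x / w x))) = S n 1 * e m 1 - S n 0 * e m 0"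
  proof (rule integral_bm_FTC_01[where T = "{}"])
    show "bm (\<lambda>x. e n x * e m x - \<mu> m * (S m x / w x * (S n x / w x)))"
      by (intro bm_diff bm_mult bm_const bm_e bm_S_over_w assms)
    fix x :: real assume "x \<in> {0<..<1} - {}"
    then have x: "x \<in> {0<..<1}" by simp
    have "((\<lambda>x. S n x * e m x) has_real_derivative w x * e n x * e m x + - (\<mu> m * S m x / w x) * S n x) (at x)"
      using x by (intro DERIV_mult S_deriv e_deriv)
    then show "((\<lambda>x. S n x * e m x) has_real_derivative w x * (e n x * e m x - \<mu> m * (S m x / w x * (S n x / w x)))) (at x)"
      by (rule DERIV_cong) (use w_pos[OF x] in \<open>simp add: algebra_simps\<close>)
  qed (auto intro!: continuous_intros S_cont e_cont)
  also have "\<dots> = 0" using assms by (simp add: S_0 S_1)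
  also have "(LINT x|M. e n x * e m x - \<mu> m * (S m x / w x * (S n x / w x)))
    = (LINT x|M. e n x * e m x) - \<mu> m * (LINT x|M. S m x / w x * (S n x / w x))"
  proof -
    have "integrable M (\<lambda>x. e n x * e m x)" "integrable M (\<lambda>x. \<mu> m * (S m x / w x * (S n x / w x)))"
      by (intro bm_integrable bm_mult bm_const bm_e bm_S_over_w assms)+
    then show ?thesis by (simp only: Bochner_Integration.integral_diff integral_mult_right_zero)
  qed
  finally show ?thesis using orthonormal[of n m] \<mu>_pos[OF assms(1)] by (auto simp: field_simps)
qed

lemma De_orthogonal: "(LINT x|M. De m x * De n x) = (if m = n then \<mu> n else 0)"
proof (cases "m = 0 \<or> n = 0")
  case True
  then show ?thesis using \<mu>_0 by (auto simp: De_0)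
next
  case False
  then have "(LINT x|M. De m x * De n x) = (LINT x|M. \<mu> m * \<mu> n * (S m x / w x * (S n x / w x)))"
    by (simp add: De_def mult_ac)
  also have "\<dots> = \<mu> m * \<mu> n * (if m = n then 1 / \<mu> n else 0)"
    using False by (subst integral_mult_right_zero, subst S_orthogonal) auto
  finally show ?thesis using \<mu>_pos[of n] False by auto
qed

text \<open>Stated for an arbitrary orthogonal system because it is applied to \<open>e\<close> with
  square norms 1 and to \<open>De\<close> with square norms \<mu>.\<close>

lemma integral_square_expand:
  assumes f: "bm f" and g: "\<And>k. bm (g k)" and orth: "\<And>j k. (LINT x|M. g j x * g k x) = (if j = k then \<nu> k else 0)"
    and "finite I"
  shows "(LINT x|M. (d * f x + (\<Sum>k\<in>I. b k * g k x))\<^sup>2)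
    = d\<^sup>2 * (LINT x|M. (f x)\<^sup>2) + 2 * d * (\<Sum>k\<in>I. b k * (LINT x|M. f x * g k x)) + (\<Sum>k\<in>I. (b k)\<^sup>2 * \<nu> k)"
proof -
  have i1: "integrable M (\<lambda>x. (f x)\<^sup>2)" using f by (intro bm_integrable) auto
  have i2: "integrable M (\<lambda>x. f x * g k x)" for k using f g by (intro bm_integrable) auto
  have i3: "integrable M (\<lambda>x. g j x * g k x)" for j k using g by (intro bm_integrable) auto
  have "(LINT x|M. (d * f x + (\<Sum>k\<in>I. b k * g k x))\<^sup>2)
    = (LINT x|M. d\<^sup>2 * (f x)\<^sup>2 + 2 * d * (\<Sum>k\<in>I. b k * (f x * g k x)) + (\<Sum>j\<in>I. \<Sum>k\<in>I. b j * b k * (g j x * g k x)))"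
  proof (intro Bochner_Integration.integral_cong refl)
    fix x
    have "(\<Sum>k\<in>I. b k * g k x)\<^sup>2 = (\<Sum>j\<in>I. \<Sum>k\<in>I. b j * b k * (g j x * g k x))"
      unfolding power2_eq_square sum_product by (simp add: mult_ac)
    moreover have "f x * (\<Sum>k\<in>I. b k * g k x) = (\<Sum>k\<in>I. b k * (f x * g k x))"
      by (simp add: sum_distrib_left mult_ac)
    ultimately show "(d * f x + (\<Sum>k\<in>I. b k * g k x))\<^sup>2
      = d\<^sup>2 * (f x)\<^sup>2 + 2 * d * (\<Sum>k\<in>I. b k * (f x * g k x)) + (\<Sum>j\<in>I. \<Sum>k\<in>I. b j * b k * (g j x * g k x))"
      by (simp add: power2_sum power_mult_distrib mult.assoc)
  qed
  also have "\<dots> = d\<^sup>2 * (LINT x|M. (f x)\<^sup>2) + 2 * d * (\<Sum>k\<in>I. b k * (LINT x|M. f x * g k x))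
     + (\<Sum>j\<in>I. \<Sum>k\<in>I. b j * b k * (LINT x|M. g j x * g k x))"
    using i1 i2 i3 by simp
  also have "(\<Sum>j\<in>I. \<Sum>k\<in>I. b j * b k * (LINT x|M. g j x * g k x)) = (\<Sum>k\<in>I. (b k)\<^sup>2 * \<nu> k)"
    using \<open>finite I\<close> by (intro sum.cong refl) (simp add: orth if_distrib[of "\<lambda>t. _ * t"] power2_eq_square cong: if_cong)
  finally show ?thesis .
qed

section \<open>Picone's identity and the spectral gap\<close>

definition node_set :: "nat \<Rightarrow> real set" where "node_set n = {x\<in>{0<..<1}. e n x = 0}"

lemma finite_node_set: "1 \<le> n \<Longrightarrow> finite (node_set n)"
  using e_zeros[of n] by (intro card_ge_0_finite) (simp add: node_set_def)

text \<open>At a node the quotient \<open>G / e N\<close> has a finite limit, since the zero of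
  \<open>e N\<close> is simple, and the remaining factor \<open>G * S N\<close> tends to 0. The
  endpoints are no nodes.\<close>

lemma picone_continuous:
  assumes N: "1 \<le> N" and G: "continuous_on {0..1} G"
    and G': "\<And>x. x \<in> {0<..<1} \<Longrightarrow> (G has_real_derivative G' x) (at x)"
    and zero: "\<And>z. z \<in> node_set N \<Longrightarrow> G z = 0"
  shows "continuous_on {0..1} (\<lambda>x. (G x)\<^sup>2 * S N x / e N x)"
proof (rule continuous_on_eq_continuous_within[THEN iffD2], rule ballI)
  fix x :: real assume x: "x \<in> {0..1}"
  show "continuous (at x within {0..1}) (\<lambda>x. (G x)\<^sup>2 * S N x / e N x)"
  proof (cases "e N x = 0")
    case False
    have "continuous (at x within {0..1}) f" if "continuous_on {0..1} f" for f :: "real \<Rightarrow> real"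
      using that x by (simp add: continuous_on_eq_continuous_within)
    then show ?thesis using False G S_cont[of N] e_cont[of N]
      unfolding continuous_within by (intro tendsto_divide tendsto_mult tendsto_power) auto
  next
    case True
    then have "x \<noteq> 0" "x \<noteq> 1" using e_left[of N] e_right[of N] by auto
    then have x01: "x \<in> {0<..<1}" using x by auto
    then have xz: "x \<in> node_set N" using True by (simp add: node_set_def)
    have D: "De N x \<noteq> 0" using e_simple[OF N x01 True] \<mu>_pos[OF N] w_pos[OF x01] by (simp add: De_def)
    have 1: "((\<lambda>y. (G y - G x) / (y - x)) \<longlongrightarrow> G' x) (at x)"
      using G'[OF x01] by (simp add: has_field_derivative_iff)
    have 2: "((\<lambda>y. (e N y - e N x) / (y - x)) \<longlongrightarrow> De N x) (at x)"
      using De_deriv[OF x01] by (simp add: has_field_derivative_iff)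
    have 3: "(G \<longlongrightarrow> G x) (at x)" "(S N \<longlongrightarrow> S N x) (at x)"
      using DERIV_isCont[OF G'[OF x01]] DERIV_isCont[OF S_deriv[OF x01]] by (auto simp: isCont_def)
    have "((\<lambda>y. G y * S N y * ((G y - G x) / (y - x) / ((e N y - e N x) / (y - x)))) \<longlongrightarrow> G x * S N x * (G' x / De N x)) (at x)"
      by (intro tendsto_mult tendsto_divide 1 2 3 D)
    then have "((\<lambda>y. (G y)\<^sup>2 * S N y / e N y) \<longlongrightarrow> 0) (at x)"
      using zero[OF xz] True
      by (elim filterlim_cong[THEN iffD1, rotated -1]) (auto simp: eventually_at_filter power2_eq_square)
    then have "isCont (\<lambda>y. (G y)\<^sup>2 * S N y / e N y) x" using True by (simp add: isCont_def)
    then show ?thesis by (rule continuous_at_imp_continuous_within)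
  qed
qed

text \<open>Picone's identity writes \<open>w * ((G')^2 - \<mu> N * G^2)\<close> as a derivative
  plus \<open>w\<close> times a square. The antiderivative vanishes at both ends because
  \<open>S N\<close> does.\<close>

lemma picone:
  assumes N: "1 \<le> N" and G: "continuous_on {0..1} G"
    and G': "\<And>x. x \<in> {0<..<1} \<Longrightarrow> (G has_real_derivative G' x) (at x)" and bm: "bm G'"
    and zero: "\<And>z. z \<in> node_set N \<Longrightarrow> G z = 0"
  shows "\<mu> N * (LINT x|M. (G x)\<^sup>2) \<le> (LINT x|M. (G' x)\<^sup>2)"
proof -
  define Q where "Q x = - \<mu> N * ((G x)\<^sup>2 * S N x / e N x)" for x
  \<comment> \<open>This is the derivative of \<open>Q\<close>. As
    \<open>w * De N = - \<mu> N * S N\<close>, the function \<open>Q\<close> is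
    \<open>w * G^2 * De N / e N\<close>, and the square subtracted here is the non-negative
    remainder.\<close>
  define q where "q x = w x * ((G' x)\<^sup>2 - \<mu> N * (G x)\<^sup>2 - (G' x - G x * De N x / e N x)\<^sup>2)" for x
  have "(q has_integral Q 1 - Q 0) {0..1}"
  proof (rule fundamental_theorem_of_calculus_interior_strong[OF finite_node_set[OF N]])
    show "continuous_on {0..1} Q" unfolding Q_def by (intro continuous_intros picone_continuous[OF N G G' zero])
    fix x assume "x \<in> {0<..<1} - node_set N"
    then have x: "x \<in> {0<..<1}" and ex: "e N x \<noteq> 0" by (auto simp: node_set_def)
    have "((\<lambda>x. (G x)\<^sup>2 * S N x / e N x) has_real_derivative
      ((2 * G x * G' x * S N x + w x * e N x * (G x)\<^sup>2) * e N x - (G x)\<^sup>2 * S N x * De N x) / (e N x * e N x)) (at x)"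
      using ex by (intro DERIV_divide DERIV_mult S_deriv De_deriv x) (auto intro!: derivative_eq_intros G'[OF x])
    then have "(Q has_real_derivative
      - \<mu> N * (((2 * G x * G' x * S N x + w x * e N x * (G x)\<^sup>2) * e N x - (G x)\<^sup>2 * S N x * De N x) / (e N x * e N x))) (at x)"
      unfolding Q_def by (rule DERIV_cmult)
    moreover have "\<mu> N * S N x = - (w x * De N x)" using w_pos[OF x] by (simp add: De_def)
    then have "- \<mu> N * (((2 * G x * G' x * S N x + w x * e N x * (G x)\<^sup>2) * e N x - (G x)\<^sup>2 * S N x * De N x) / (e N x * e N x))
      = (2 * G x * G' x * (w x * De N x) * e N x - \<mu> N * w x * e N x * (G x)\<^sup>2 * e N x - (G x)\<^sup>2 * (w x * De N x) * De N x) / (e N x * e N x)"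
    proof -
      assume *: "\<mu> N * S N x = - (w x * De N x)"
      have "- \<mu> N * ((2 * G x * G' x * S N x + w x * e N x * (G x)\<^sup>2) * e N x - (G x)\<^sup>2 * S N x * De N x)
        = - (2 * G x * G' x * e N x * (\<mu> N * S N x)) - \<mu> N * w x * e N x * (G x)\<^sup>2 * e N x + (G x)\<^sup>2 * De N x * (\<mu> N * S N x)"
        by (simp add: algebra_simps)
      then show ?thesis unfolding * by (simp add: algebra_simps)
    qed
    also have "\<dots> = q x" using ex by (simp add: q_def field_simps power2_eq_square)
    finally show "(Q has_vector_derivative q x) (at x)" by (simp add: has_real_derivative_iff_has_vector_derivative)
  qed auto
  moreover have "Q 1 - Q 0 = 0" using N by (simp add: Q_def S_0 S_1)
  ultimately have q: "(q has_integral 0) {0<..<1}" by (simp add: has_integral_Icc_iff_Ioo)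
  have bG: "bm (\<lambda>x. (G' x)\<^sup>2)" "bm (\<lambda>x. (G x)\<^sup>2)" using bm bm_continuous[OF G] by auto
  then have bd: "bm (\<lambda>x. (G' x)\<^sup>2 - \<mu> N * (G x)\<^sup>2)" by (intro bm_diff bm_mult bm_const)
  \<comment> \<open>The fundamental theorem yields only a gauge integral of \<open>q\<close>;
    comparing integrals directly avoids the question whether the square is integrable by
    itself.\<close>
  have "0 \<le> (LINT x|M. (G' x)\<^sup>2 - \<mu> N * (G x)\<^sup>2)"
  proof (rule has_integral_le[OF q])
    show "((\<lambda>x. w x * ((G' x)\<^sup>2 - \<mu> N * (G x)\<^sup>2)) has_integral (LINT x|M. (G' x)\<^sup>2 - \<mu> N * (G x)\<^sup>2)) {0<..<1}"
      using has_integral_integral_lebesgue_on[OF bm_LINT(2)[OF bd]] lebesgue_integral_eq_integral[OF bm_LINT(2)[OF bd]] bm_LINT(1)[OF bd]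
      by simp
    fix x :: real assume "x \<in> {0<..<1}"
    then show "q x \<le> w x * ((G' x)\<^sup>2 - \<mu> N * (G x)\<^sup>2)"
      unfolding q_def using w_pos by (intro mult_left_mono) (auto simp: less_imp_le)
  qed
  also have "\<dots> = (LINT x|M. (G' x)\<^sup>2) - \<mu> N * (LINT x|M. (G x)\<^sup>2)"
    using bG by (simp add: bm_integrable)
  finally show ?thesis by simp
qed

text \<open>Jacobi's argument: some non-trivial combination of \<open>F\<close> and \<open>e 0, \<dots>, e (N - 1)\<close> vanishes at the
  \<open>N\<close> zeros of \<open>e N\<close>, so Picone's identity applies to it.\<close>

theorem spectral_gap:
  assumes F: "continuous_on {0..1} F" and F': "\<And>x. x \<in> {0<..<1} \<Longrightarrow> (F has_real_derivative F' x) (at x)"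
    and bm: "bm F'" and N: "1 \<le> N"
  shows "\<mu> N * ((LINT x|M. (F x)\<^sup>2) - (\<Sum>k<N. (LINT x|M. F x * e k x)\<^sup>2)) \<le> (LINT x|M. (F' x)\<^sup>2)"
proof -
  define c where "c k = (LINT x|M. F x * e k x)" for k
  have bF: "bm F" using bm_continuous[OF F] .
  \<comment> \<open>Integration by parts against \<open>S k\<close>, which for k \<ge> 1 vanishes at
    both ends, so that the boundary values of F do not matter.\<close>
  have cross: "(LINT x|M. F' x * De k x) = \<mu> k * c k" for k
  proof (cases "k = 0")
    case False
    then have k: "1 \<le> k" by simp
    have "(LINT x|M. F' x * (S k x / w x) + F x * e k x) = F 1 * S k 1 - F 0 * S k 0"
    proof (rule integral_bm_FTC_01[where T = "{}"])
      show "bm (\<lambda>x. F' x * (S k x / w x) + F x * e k x)" by (intro bm_add bm_mult bm bF bm_e bm_S_over_w k)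
      fix x :: real assume "x \<in> {0<..<1} - {}"
      then have x: "x \<in> {0<..<1}" by simp
      have "((\<lambda>x. F x * S k x) has_real_derivative F' x * S k x + w x * e k x * F x) (at x)"
        by (intro DERIV_mult F' S_deriv x)
      then show "((\<lambda>x. F x * S k x) has_real_derivative w x * (F' x * (S k x / w x) + F x * e k x)) (at x)"
        by (rule DERIV_cong) (use w_pos[OF x] in \<open>simp add: algebra_simps\<close>)
    qed (auto intro!: continuous_on_mult F S_cont)
    also have "\<dots> = 0" using k by (simp add: S_0 S_1)
    also have "(LINT x|M. F' x * (S k x / w x) + F x * e k x) = (LINT x|M. F' x * (S k x / w x)) + c k"
      unfolding c_def using k bm bF by (intro Bochner_Integration.integral_add bm_integrable bm_mult bm_e bm_S_over_w)
    finally have "(LINT x|M. F' x * (S k x / w x)) = - c k" by simp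
    moreover have "(LINT x|M. F' x * De k x) = (LINT x|M. - \<mu> k * (F' x * (S k x / w x)))"
      by (simp add: De_def mult_ac)
    ultimately show ?thesis by (simp only: integral_mult_right_zero)
  qed (simp add: De_0 \<mu>_0)
  \<comment> \<open>There are N + 1 unknown coefficients, the last one for F, and only N
    zeros.\<close>
  define g where "g k = (if k = N then F else e k)" for k
  obtain b where b: "\<exists>k\<in>{..N}. b k \<noteq> 0" "\<And>z. z \<in> node_set N \<Longrightarrow> (\<Sum>k\<in>{..N}. b k * g k z) = 0"
    using nontrivial_homogeneous_solution[OF finite_node_set[OF N], of "{..N}" g] e_zeros[OF N]
    by (auto simp: node_set_def)
  define d where "d = b N"
  have split: "(\<Sum>k\<in>{..N}. b k * g k z) = d * F z + (\<Sum>k<N. b k * e k z)" for z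
    by (simp add: lessThan_Suc_atMost[symmetric] g_def d_def)
  define I where "I = (LINT x|M. (F x)\<^sup>2)"
  define E where "E = (LINT x|M. (F' x)\<^sup>2)"
  have "\<mu> N * (LINT x|M. (d * F x + (\<Sum>k<N. b k * e k x))\<^sup>2) \<le> (LINT x|M. (d * F' x + (\<Sum>k<N. b k * De k x))\<^sup>2)"
  proof (rule picone[OF N])
    show "continuous_on {0..1} (\<lambda>x. d * F x + (\<Sum>k<N. b k * e k x))" by (intro continuous_intros F e_cont)
    show "bm (\<lambda>x. d * F' x + (\<Sum>k<N. b k * De k x))" by (intro bm_add bm_mult bm_const bm_sum bm bm_De)
    show "((\<lambda>x. d * F x + (\<Sum>k<N. b k * e k x)) has_real_derivative d * F' x + (\<Sum>k<N. b k * De k x)) (at x)"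
      if "x \<in> {0<..<1}" for x
      by (intro DERIV_add DERIV_cmult DERIV_sum F' De_deriv that)
    show "d * F z + (\<Sum>k<N. b k * e k z) = 0" if "z \<in> node_set N" for z using b(2)[OF that] unfolding split .
  qed
  also have "(LINT x|M. (d * F' x + (\<Sum>k<N. b k * De k x))\<^sup>2)
    = d\<^sup>2 * E + 2 * d * (\<Sum>k<N. b k * (\<mu> k * c k)) + (\<Sum>k<N. (b k)\<^sup>2 * \<mu> k)"
    by (subst integral_square_expand[OF bm bm_De De_orthogonal]) (simp_all add: cross E_def)
  also have "(LINT x|M. (d * F x + (\<Sum>k<N. b k * e k x))\<^sup>2)
    = d\<^sup>2 * I + 2 * d * (\<Sum>k<N. b k * c k) + (\<Sum>k<N. (b k)\<^sup>2 * 1)"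
    by (subst integral_square_expand[OF bF bm_e orthonormal]) (simp_all add: c_def I_def)
  finally have main: "\<mu> N * (d\<^sup>2 * I + 2 * d * (\<Sum>k<N. b k * c k) + (\<Sum>k<N. (b k)\<^sup>2))
    \<le> d\<^sup>2 * E + 2 * d * (\<Sum>k<N. b k * (\<mu> k * c k)) + (\<Sum>k<N. (b k)\<^sup>2 * \<mu> k)" by simp
  have gap: "(\<Sum>k<N. (\<mu> N - \<mu> k) * ((b k)\<^sup>2 + 2 * d * b k * c k)) \<le> d\<^sup>2 * (E - \<mu> N * I)"
  proof -
    have "(\<Sum>k<N. (\<mu> N - \<mu> k) * ((b k)\<^sup>2 + 2 * d * b k * c k))
      = \<mu> N * (2 * d * (\<Sum>k<N. b k * c k) + (\<Sum>k<N. (b k)\<^sup>2)) - (2 * d * (\<Sum>k<N. b k * (\<mu> k * c k)) + (\<Sum>k<N. (b k)\<^sup>2 * \<mu> k))"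
      unfolding sum_distrib_left sum.distrib[symmetric] sum_subtractf[symmetric]
      by (intro sum.cong) (auto simp: algebra_simps)
    then show ?thesis using main by (simp add: algebra_simps)
  qed
  have mono: "0 < \<mu> N - \<mu> k" if "k < N" for k using strict_monoD[OF \<mu>_strict that] by simp
  \<comment> \<open>Without F the combination would lie in the span of
    \<open>e 0, ..., e (N - 1)\<close>, where the Rayleigh quotient is below
    \<open>\<mu> N\<close>.\<close>
  have d0: "d \<noteq> 0"
  proof
    assume d: "d = 0"
    then obtain k0 where k0: "k0 < N" "b k0 \<noteq> 0" using b(1) by (auto simp: d_def order_less_le)
    have "0 < (\<mu> N - \<mu> k0) * (b k0)\<^sup>2" using k0 mono[OF k0(1)] by simp
    also have "\<dots> \<le> (\<Sum>k<N. (\<mu> N - \<mu> k) * (b k)\<^sup>2)"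
      using k0 mono by (intro member_le_sum) (auto simp: less_imp_le)
    finally show False using gap d by simp
  qed
  \<comment> \<open>The coefficients b are unknown, so each summand is minimised by completing the
    square, \<open>(b k + d * c k)^2 \<ge> 0\<close>; afterwards \<open>\<mu> N - \<mu> k\<close> is
    enlarged to \<open>\<mu> N\<close>.\<close>
  have "- (d\<^sup>2 * (\<Sum>k<N. \<mu> N * (c k)\<^sup>2)) \<le> (\<Sum>k<N. (\<mu> N - \<mu> k) * ((b k)\<^sup>2 + 2 * d * b k * c k))"
    unfolding sum_distrib_left sum_negf[symmetric]
  proof (rule sum_mono)
    fix k assume "k \<in> {..<N}"
    then have m: "0 < \<mu> N - \<mu> k" using mono by simp
    have "(\<mu> N - \<mu> k) * - (d * c k)\<^sup>2 \<le> (\<mu> N - \<mu> k) * ((b k)\<^sup>2 + 2 * d * b k * c k)"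
    proof (rule mult_left_mono)
      have "0 \<le> (b k + d * c k)\<^sup>2" by simp
      then show "- (d * c k)\<^sup>2 \<le> (b k)\<^sup>2 + 2 * d * b k * c k" by (simp add: power2_sum mult_ac)
    qed (use m in simp)
    moreover have "\<mu> N * - (d * c k)\<^sup>2 \<le> (\<mu> N - \<mu> k) * - (d * c k)\<^sup>2"
      using \<mu>_nonneg[of k] by (intro mult_right_mono_neg) auto
    ultimately show "- (d\<^sup>2 * (\<mu> N * (c k)\<^sup>2)) \<le> (\<mu> N - \<mu> k) * ((b k)\<^sup>2 + 2 * d * b k * c k)"
      by (simp add: power_mult_distrib mult_ac)
  qed
  with gap have "d\<^sup>2 * - (\<Sum>k<N. \<mu> N * (c k)\<^sup>2) \<le> d\<^sup>2 * (E - \<mu> N * I)" by simp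
  then have "- (\<Sum>k<N. \<mu> N * (c k)\<^sup>2) \<le> E - \<mu> N * I" using d0 by (metis mult_le_cancel_left_pos zero_less_power2)
  then show ?thesis by (simp add: I_def E_def c_def sum_distrib_left algebra_simps)
qed

section \<open>Completeness by approximation of indicators\<close>

lemma residual_expand:
  assumes f: "bm f"
  shows "(LINT x|M. (f x - (\<Sum>k<N. b k * e k x))\<^sup>2)
    = (LINT x|M. (f x)\<^sup>2) - (\<Sum>k<N. (LINT x|M. f x * e k x)\<^sup>2) + (\<Sum>k<N. (b k - (LINT x|M. f x * e k x))\<^sup>2)"
proof -
  have "(LINT x|M. (f x - (\<Sum>k<N. b k * e k x))\<^sup>2) = (LINT x|M. (1 * f x + (\<Sum>k<N. (- b k) * e k x))\<^sup>2)"
    by (simp add: sum_negf)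
  also have "\<dots> = 1\<^sup>2 * (LINT x|M. (f x)\<^sup>2) + 2 * 1 * (\<Sum>k<N. (- b k) * (LINT x|M. f x * e k x)) + (\<Sum>k<N. (- b k)\<^sup>2 * 1)"
    by (rule integral_square_expand[OF f bm_e orthonormal]) simp
  also have "\<dots> = (LINT x|M. (f x)\<^sup>2) + (\<Sum>k<N. (b k)\<^sup>2 - 2 * (b k * (LINT x|M. f x * e k x)))"
    by (simp add: sum_subtractf sum_negf sum_distrib_left)
  also have "(\<Sum>k<N. (b k)\<^sup>2 - 2 * (b k * (LINT x|M. f x * e k x)))
    = (\<Sum>k<N. (b k - (LINT x|M. f x * e k x))\<^sup>2 - (LINT x|M. f x * e k x)\<^sup>2)"
    by (intro sum.cong refl) (simp add: power2_diff)
  finally show ?thesis by (simp add: sum_subtractf)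
qed

text \<open>The shift by \<open>- 1\<close> sends the point t = x to the limit 0, in agreement with
  the open interval \<open>{0<..<x}\<close>.\<close>

definition smooth_step :: "real \<Rightarrow> nat \<Rightarrow> real \<Rightarrow> real" where
  "smooth_step x j t = 1 / 2 + arctan (real j * (real j * (x - t) - 1)) / pi"

lemma smooth_step_bounds: "0 < smooth_step x j t" "smooth_step x j t < 1"
  using arctan_bounded[of "real j * (real j * (x - t) - 1)"] by (auto simp: smooth_step_def field_simps)

lemma smooth_step_tendsto:
  "(\<lambda>j. smooth_step x j t) \<longlonglongrightarrow> (if t < x then 1 else 0)"
proof (cases "t < x")
  case True
  have "filterlim (\<lambda>j. real j * (real j * (x - t) - 1)) at_top sequentially"
  proof (rule filterlim_at_top_mult_at_top[OF filterlim_real_sequentially])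
    have "filterlim (\<lambda>j. (x - t) * real j) at_top sequentially"
      using True by (intro filterlim_tendsto_pos_mult_at_top[OF tendsto_const _ filterlim_real_sequentially]) auto
    from filterlim_tendsto_add_at_top[OF tendsto_const this, of "-1"]
    show "filterlim (\<lambda>j. real j * (x - t) - 1) at_top sequentially" by (simp add: mult.commute)
  qed
  from filterlim_compose[OF tendsto_arctan_at_top this]
  have "(\<lambda>j. 1 / 2 + arctan (real j * (real j * (x - t) - 1)) / pi) \<longlonglongrightarrow> 1 / 2 + (pi / 2) / pi"
    by (intro tendsto_intros) auto
  then show ?thesis using True by (simp add: smooth_step_def)
next
  case False
  have "filterlim (\<lambda>j. real j * (real j * (t - x) + 1)) at_top sequentially"
  proof (rule filterlim_at_top_mono[OF filterlim_real_sequentially])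
    show "\<forall>\<^sub>F j in sequentially. real j \<le> real j * (real j * (t - x) + 1)"
      using False by (auto intro!: always_eventually simp: mult_le_cancel_left1 mult_nonneg_nonneg)
  qed
  then have "filterlim (\<lambda>j. - (real j * (real j * (t - x) + 1))) at_bot sequentially"
    by (simp add: filterlim_uminus_at_bot)
  then have "filterlim (\<lambda>j. real j * (real j * (x - t) - 1)) at_bot sequentially"
    by (simp add: algebra_simps)
  from filterlim_compose[OF tendsto_arctan_at_bot this]
  have "(\<lambda>j. 1 / 2 + arctan (real j * (real j * (x - t) - 1)) / pi) \<longlonglongrightarrow> 1 / 2 + (- (pi / 2)) / pi"
    by (intro tendsto_intros) auto
  then show ?thesis using False by (simp add: smooth_step_def)
qed

text \<open>The spectral gap needs a bounded derivative, which an indicator does not have. The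
  derivative of the approximant may be arbitrarily large, since it is fixed before N is
  chosen.\<close>

lemma indicator_approximable:
  assumes "0 < \<epsilon>"
  obtains F F' where "continuous_on {0..1} F" "\<And>t. t \<in> {0<..<1} \<Longrightarrow> (F has_real_derivative F' t) (at t)" "bm F'"
    "(LINT t|M. (indicator {0<..<x} t - F t)\<^sup>2) < \<epsilon>"
proof -
  define h where "h = (indicator {0<..<x} :: real \<Rightarrow> real)"
  have bh: "bm h" unfolding h_def by auto
  have cont: "continuous_on {0..1} (smooth_step x j)" for j
    unfolding smooth_step_def[abs_def] by (intro continuous_intros) auto
  have "(\<lambda>j. LINT t|M. (h t - smooth_step x j t)\<^sup>2) \<longlonglongrightarrow> (LINT t|M. 0)"
  proof (rule integral_dominated_convergence[where w = "\<lambda>_. 1"])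
    show "(\<lambda>t. (h t - smooth_step x j t)\<^sup>2) \<in> borel_measurable M" for j
      by (intro borel_measurable_integrable bm_integrable bm_power bm_diff bh bm_continuous[OF cont])
    show "AE t in M. (\<lambda>j. (h t - smooth_step x j t)\<^sup>2) \<longlonglongrightarrow> 0"
    proof (rule AE_I2)
      fix t assume "t \<in> space M"
      then have "h t = (if t < x then 1 else 0)" by (auto simp: h_def space_M)
      then have "(\<lambda>j. (h t - smooth_step x j t)\<^sup>2) \<longlonglongrightarrow> (h t - h t)\<^sup>2"
        using smooth_step_tendsto[of x t] by (intro tendsto_intros) auto
      then show "(\<lambda>j. (h t - smooth_step x j t)\<^sup>2) \<longlonglongrightarrow> 0" by simp
    qed
    show "AE t in M. norm ((h t - smooth_step x j t)\<^sup>2) \<le> 1" for j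
    proof (rule AE_I2)
      fix t
      have "\<bar>h t - smooth_step x j t\<bar> \<le> 1"
        using smooth_step_bounds[of x j t] by (auto simp: h_def indicator_def)
      then show "norm ((h t - smooth_step x j t)\<^sup>2) \<le> 1" by (simp add: abs_square_le_1)
    qed
  qed auto
  then have "(\<lambda>j. LINT t|M. (h t - smooth_step x j t)\<^sup>2) \<longlonglongrightarrow> 0" by simp
  from order_tendstoD(2)[OF this assms] obtain j where
    j: "(LINT t|M. (h t - smooth_step x j t)\<^sup>2) < \<epsilon>" by (auto simp: eventually_sequentially)
  define F' where "F' t = - (real j)\<^sup>2 / (1 + (real j * (real j * (x - t) - 1))\<^sup>2) / pi" for t
  have pos: "1 + (real j * (real j * (x - t) - 1))\<^sup>2 \<noteq> 0" for t
    using zero_le_power2[of "real j * (real j * (x - t) - 1)"] by linarith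
  show thesis
  proof (rule that[OF cont, of j F'])
    show "(smooth_step x j has_real_derivative F' t) (at t)" for t
    proof -
      define u where "u t = real j * (real j * (x - t) - 1)" for t
      have u: "(u has_real_derivative - (real j)\<^sup>2) (at t)"
        unfolding u_def by (auto intro!: derivative_eq_intros simp: power2_eq_square)
      have "((\<lambda>t. 1 / 2 + arctan (u t) / pi) has_real_derivative 0 + inverse (1 + (u t)\<^sup>2) * (- (real j)\<^sup>2) / pi) (at t)"
        by (intro DERIV_add DERIV_const DERIV_cdivide DERIV_chain2[OF DERIV_arctan u])
      moreover have "0 + inverse (1 + (u t)\<^sup>2) * (- (real j)\<^sup>2) / pi = F' t"
        unfolding F'_def u_def[symmetric] by (simp only: divide_inverse mult.commute add_0)
      moreover have "smooth_step x j = (\<lambda>t. 1 / 2 + arctan (u t) / pi)"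
        unfolding smooth_step_def u_def ..
      ultimately show ?thesis by simp
    qed
    show "bm F'" unfolding F'_def by (intro bm_continuous continuous_intros) (use pos in auto)
    show "(LINT t|M. (indicator {0<..<x} t - smooth_step x j t)\<^sup>2) < \<epsilon>" using j by (simp add: h_def)
  qed
qed

text \<open>The functions \<open>S n\<close> thus are Fourier coefficients of indicators, which
  turns Parseval's formula into a statement about them.\<close>

lemma indicator_coefficient:
  assumes "x \<in> {0..1}" shows "(LINT t|M. indicator {0<..<x} t * e n t) = S n x"
  using integral_indicator_e[of 0 x n] assms S_0 by simp

lemma indicator_product:
  assumes "x \<in> {0..1}" "y \<in> {0..1}"
  shows "(LINT t|M. indicator {0<..<x} t * indicator {0<..<y} t) = S 0 (min x y)"
proof -
  have "(LINT t|M. indicator {0<..<x} t * indicator {0<..<y} t) = (LINT t|M. indicator {0<..<min x y} t * e 0 t)"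
    by (intro Bochner_Integration.integral_cong) (auto simp: indicator_def space_M e_0)
  also have "\<dots> = S 0 (min x y)" using assms by (intro indicator_coefficient) (auto simp: min_def)
  finally show ?thesis .
qed

lemma indicator_residual:
  assumes "x \<in> {0..1}"
  shows "(LINT t|M. (indicator {0<..<x} t - (\<Sum>k<N. S k x * e k t))\<^sup>2) = S 0 x - (\<Sum>k<N. (S k x)\<^sup>2)"
proof -
  have "bm (indicator {0<..<x})" by auto
  from residual_expand[OF this, where N = N and b = "\<lambda>k. S k x"] show ?thesis
    using indicator_product[OF assms assms] by (simp add: indicator_coefficient[OF assms] power2_eq_square)
qed

text \<open>A smooth approximant has residual at most \<open>E / \<mu> N\<close> by the spectral
  gap. The residual of the indicator is its squared distance from the span, hence at most that from
  the projection of the approximant.\<close>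

lemma indicator_residual_tendsto:
  assumes x: "x \<in> {0..1}"
  shows "(\<lambda>N. S 0 x - (\<Sum>k<N. (S k x)\<^sup>2)) \<longlonglongrightarrow> 0"
proof (rule LIMSEQ_I)
  fix r :: real assume r: "0 < r"
  define h where "h = (indicator {0<..<x} :: real \<Rightarrow> real)"
  have bh: "bm h" unfolding h_def by auto
  obtain F F' where F: "continuous_on {0..1} F" "\<And>t. t \<in> {0<..<1} \<Longrightarrow> (F has_real_derivative F' t) (at t)" "bm F'"
    "(LINT t|M. (h t - F t)\<^sup>2) < r / 4"
    using indicator_approximable[of "r / 4" x] r by (auto simp: h_def)
  have bF: "bm F" using bm_continuous[OF F(1)] .
  define E where "E = (LINT t|M. (F' t)\<^sup>2)"
  \<comment> \<open>Two errors below r / 4, each doubled, add up to less than r. The entry 1 in the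
    maximum excludes N = 0.\<close>
  have "eventually (\<lambda>N. max 1 (4 * E / r) < \<mu> N) sequentially"
    using \<mu>_top by (simp only: filterlim_at_top_dense)
  then obtain N0 where N0: "\<And>N. N \<ge> N0 \<Longrightarrow> max 1 (4 * E / r) < \<mu> N" by (auto simp: eventually_sequentially)
  have "norm (S 0 x - (\<Sum>k<N. (S k x)\<^sup>2) - 0) < r" if "N \<ge> N0" for N
  proof -
    have \<mu>: "1 < \<mu> N" "4 * E / r < \<mu> N" using N0[OF that] by auto
    then have N: "1 \<le> N" using \<mu>_0 by (cases "N = 0") auto
    define P where "P t = (\<Sum>k<N. (LINT t|M. F t * e k t) * e k t)" for t
    have bP: "bm P" unfolding P_def by (intro bm_sum bm_mult bm_const bm_e)
    have res: "S 0 x - (\<Sum>k<N. (S k x)\<^sup>2) \<ge> 0"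
      unfolding indicator_residual[OF x, symmetric] by simp
    have "\<mu> N * (LINT t|M. (F t - P t)\<^sup>2) \<le> E"
      using spectral_gap[OF F(1-3) N] residual_expand[OF bF, where N = N and b = "\<lambda>k. LINT t|M. F t * e k t"]
      by (simp add: P_def E_def)
    also have "E < \<mu> N * (r / 4)" using \<mu>(2) r by (simp add: field_simps)
    finally have 1: "(LINT t|M. (F t - P t)\<^sup>2) < r / 4" using \<mu>(1) by simp
    have "S 0 x - (\<Sum>k<N. (S k x)\<^sup>2) = (LINT t|M. (h t)\<^sup>2) - (\<Sum>k<N. (LINT t|M. h t * e k t)\<^sup>2)"
      using indicator_product[OF x x] by (simp add: h_def indicator_coefficient[OF x] power2_eq_square)
    also have "\<dots> \<le> (LINT t|M. (h t - P t)\<^sup>2)"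
      unfolding P_def by (subst residual_expand[OF bh]) (simp add: sum_nonneg)
    also have "\<dots> \<le> (LINT t|M. 2 * (h t - F t)\<^sup>2 + 2 * (F t - P t)\<^sup>2)"
    proof (rule integral_mono)
      fix t
      have "0 \<le> ((h t - F t) - (F t - P t))\<^sup>2" by simp
      moreover have "(h t - P t)\<^sup>2 + ((h t - F t) - (F t - P t))\<^sup>2 = 2 * (h t - F t)\<^sup>2 + 2 * (F t - P t)\<^sup>2"
        by (simp add: power2_eq_square algebra_simps)
      ultimately show "(h t - P t)\<^sup>2 \<le> 2 * (h t - F t)\<^sup>2 + 2 * (F t - P t)\<^sup>2" by linarith
    qed (intro bm_integrable bm_add bm_mult bm_const bm_power bm_diff bh bF bP)+
    also have "\<dots> = 2 * (LINT t|M. (h t - F t)\<^sup>2) + 2 * (LINT t|M. (F t - P t)\<^sup>2)"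
    proof -
      have "integrable M (\<lambda>t. (h t - F t)\<^sup>2)" "integrable M (\<lambda>t. (F t - P t)\<^sup>2)"
        by (intro bm_integrable bm_power bm_diff bh bF bP)+
      then show ?thesis by simp
    qed
    finally show ?thesis using 1 F(4) res by simp
  qed
  then show "\<exists>N0. \<forall>N\<ge>N0. norm (S 0 x - (\<Sum>k<N. (S k x)\<^sup>2) - 0) < r" by blast
qed

text \<open>Pair the small residual of one indicator with the other indicator. Without the term n =
  0 the sum is \<open>S 0 (min x y) - S 0 x * S 0 y\<close>, the Green function of the dual
  problem.\<close>

theorem S_product_sums:
  assumes x: "x \<in> {0..1}" and y: "y \<in> {0..1}"
  shows "(\<lambda>n. S n x * S n y) sums S 0 (min x y)"
  unfolding sums_def
proof (rule LIMSEQ_I)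
  fix r :: real assume r: "0 < r"
  obtain N0 where N0: "\<And>N. N \<ge> N0 \<Longrightarrow> \<bar>S 0 x - (\<Sum>k<N. (S k x)\<^sup>2)\<bar> < r\<^sup>2"
    using LIMSEQ_D[OF indicator_residual_tendsto[OF x], of "r\<^sup>2"] r by auto
  have "norm ((\<Sum>n<N. S n x * S n y) - S 0 (min x y)) < r" if "N \<ge> N0" for N
  proof -
    define R where "R t = indicator {0<..<x} t - (\<Sum>k<N. S k x * e k t)" for t
    have bR: "bm R" unfolding R_def by (intro bm_diff bm_indicator bm_sum bm_mult bm_const bm_e) auto
    have by': "bm (indicator {0<..<y})" by auto
    have "(LINT t|M. indicator {0<..<y} t * R t)
      = (LINT t|M. indicator {0<..<x} t * indicator {0<..<y} t - (\<Sum>k<N. S k x * (indicator {0<..<y} t * e k t)))"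
      by (intro Bochner_Integration.integral_cong) (auto simp: R_def algebra_simps sum_distrib_left)
    also have "\<dots> = S 0 (min x y) - (\<Sum>k<N. S k x * S k y)"
    proof -
      have "integrable M (\<lambda>t. indicator {0<..<x} t * indicator {0<..<y} t :: real)"
        "integrable M (\<lambda>t. indicator {0<..<y} t * e k t)" for k
        by (intro bm_integrable bm_mult bm_indicator bm_e; simp)+
      then show ?thesis by (simp add: indicator_product[OF x y] indicator_coefficient[OF y])
    qed
    finally have eq: "(\<Sum>k<N. S k x * S k y) - S 0 (min x y) = - (LINT t|M. indicator {0<..<y} t * R t)" by simp
    have "\<bar>LINT t|M. indicator {0<..<y} t * R t\<bar> \<le> (LINT t|M. \<bar>indicator {0<..<y} t * R t\<bar>)" by (rule integral_abs_bound)
    \<comment> \<open>Cauchy-Schwarz in additive form: with the weight r, a square integral below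
      \<open>r\<^sup>2\<close> gives an integral below r.\<close>
    also have "\<dots> \<le> (LINT t|M. r / 2 + 1 / (2 * r) * (R t)\<^sup>2)"
    proof (rule integral_mono)
      fix t
      have "\<bar>indicator {0<..<y} t * R t\<bar> \<le> \<bar>R t\<bar>" by (auto simp: indicator_def)
      also have "\<bar>R t\<bar> \<le> r / 2 + 1 / (2 * r) * (R t)\<^sup>2"
      proof -
        have "0 \<le> (\<bar>R t\<bar> - r)\<^sup>2" by simp
        then have "2 * r * \<bar>R t\<bar> \<le> (R t)\<^sup>2 + r * r" by (simp add: power2_diff power2_eq_square algebra_simps)
        then show ?thesis using r by (simp add: field_simps)
      qed
      finally show "\<bar>indicator {0<..<y} t * R t\<bar> \<le> r / 2 + 1 / (2 * r) * (R t)\<^sup>2" .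
    qed (intro bm_integrable integrable_abs bm_add bm_mult bm_const bm_power bR by')+
    also have "\<dots> = r / 2 + 1 / (2 * r) * (LINT t|M. (R t)\<^sup>2)"
    proof -
      have "integrable M (\<lambda>t. (R t)\<^sup>2)" by (intro bm_integrable bm_power bR)
      then show ?thesis using emeasure_M_space by (simp add: measure_def)
    qed
    also have "(LINT t|M. (R t)\<^sup>2) = S 0 x - (\<Sum>k<N. (S k x)\<^sup>2)" unfolding R_def by (rule indicator_residual[OF x])
    also have "\<dots> < r\<^sup>2" using N0[OF that] by simp
    also have "r / 2 + 1 / (2 * r) * r\<^sup>2 = r" using r by (simp add: field_simps power2_eq_square)
    finally have "\<bar>LINT t|M. indicator {0<..<y} t * R t\<bar> < r"
      using r by (simp add: divide_strict_right_mono)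
    then show ?thesis unfolding eq by simp
  qed
  then show "\<exists>N0. \<forall>N\<ge>N0. norm ((\<Sum>n<N. S n x * S n y) - S 0 (min x y)) < r" by blast
qed

section \<open>The trace of the inverse operator\<close>

lemma sum_S_squared_le:
  assumes x: "x \<in> {0..1}"
  shows "(\<Sum>n\<in>{1..<N}. (S n x)\<^sup>2) \<le> S 0 x * (1 - S 0 x)"
proof (cases "N = 0")
  case False
  have "(\<lambda>n. (S n x)\<^sup>2) sums S 0 x" using S_product_sums[OF x x] by (simp add: power2_eq_square)
  then have "(\<Sum>n<N. (S n x)\<^sup>2) \<le> S 0 x" by (metis finite_lessThan sum_le_suminf sums_iff zero_le_power2)
  moreover have "(\<Sum>n<N. (S n x)\<^sup>2) = (S 0 x)\<^sup>2 + (\<Sum>n\<in>{1..<N}. (S n x)\<^sup>2)"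
    using False by (simp add: lessThan_atLeast0 sum.atLeast_Suc_lessThan)
  ultimately show ?thesis by (simp add: power2_eq_square algebra_simps)
qed (use W_bounds[OF x] in simp)

text \<open>\<open>1 / \<mu> n\<close> is the square norm of \<open>S n / w\<close>. Summed over n
  this integrates the diagonal of the Green function over \<open>w\<close>, at most
  \<open>S 0 x * (1 - S 0 x) / w x\<close>, which \<open>min_W_le\<close> bounds.\<close>

theorem summable_inverse_\<mu>: "summable (\<lambda>n. 1 / \<mu> (Suc n))"
proof -
  obtain C where C: "0 < C" "\<And>x. x \<in> {0<..<1} \<Longrightarrow> min (S 0 x) (1 - S 0 x) \<le> C * (x * (1 - x) * w x)"
    using min_W_le by blast
  have "(\<Sum>n\<in>{1..<N}. 1 / \<mu> n) \<le> C" for N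
  proof -
    define T where "T x = (\<Sum>n\<in>{1..<N}. S n x / w x * (S n x / w x))" for x
    have bT: "bm T" unfolding T_def by (intro bm_sum bm_mult bm_S_over_w) auto
    have "(\<Sum>n\<in>{1..<N}. 1 / \<mu> n) = (\<Sum>n\<in>{1..<N}. LINT x|M. S n x / w x * (S n x / w x))"
      using S_orthogonal by (intro sum.cong) auto
    also have "\<dots> = (LINT x|M. T x)" unfolding T_def
      by (intro Bochner_Integration.integral_sum[symmetric] bm_integrable bm_mult bm_S_over_w) auto
    also have "\<dots> \<le> C"
    proof (rule has_integral_le)
      show "((\<lambda>x. w x * T x) has_integral (LINT x|M. T x)) {0<..<1}"
        using has_integral_integral_lebesgue_on[OF bm_LINT(2)[OF bT]] lebesgue_integral_eq_integral[OF bm_LINT(2)[OF bT]] bm_LINT(1)[OF bT]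
        by simp
      have "((\<lambda>x. C) has_integral (1 - 0) *\<^sub>R C) {0..1::real}" by (rule has_integral_const_real[of C 0 1, simplified measure_lborel_Icc content_real])
      then show "((\<lambda>x. C) has_integral C) {0<..<1::real}" by (simp add: has_integral_Icc_iff_Ioo)
      fix x :: real assume x: "x \<in> {0<..<1}"
      have w: "0 < w x" using w_pos[OF x] .
      have W: "0 \<le> S 0 x" "S 0 x \<le> 1" using W_bounds[of x] x by auto
      have "w x * T x = (\<Sum>n\<in>{1..<N}. (S n x)\<^sup>2) / w x"
        unfolding T_def sum_distrib_left sum_divide_distrib
        by (intro sum.cong) (use w in \<open>auto simp: field_simps power2_eq_square\<close>)
      also have "\<dots> \<le> S 0 x * (1 - S 0 x) / w x" using sum_S_squared_le[of x N] x w by (intro divide_right_mono) auto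
      also have "S 0 x * (1 - S 0 x) \<le> min (S 0 x) (1 - S 0 x)"
        using W by (auto intro: mult_left_le mult_left_le_one_le)
      also have "\<dots> \<le> C * (x * (1 - x) * w x)" using C(2)[OF x] .
      also have "C * (x * (1 - x) * w x) / w x = C * (x * (1 - x))" using w by simp
      also have "\<dots> \<le> C * 1" using x C(1) mult_mono[of x 1 "1 - x" 1] by (intro mult_left_mono) auto
      finally show "w x * T x \<le> C" using w by (simp add: divide_right_mono)
    qed
    finally show ?thesis .
  qed
  then have "(\<Sum>n<N. 1 / \<mu> (Suc n)) \<le> C" for N
    using sum.shift_bounds_Suc_ivl[of "\<lambda>n. 1 / \<mu> n" 0 N] by (metis One_nat_def lessThan_atLeast0)
  then show ?thesis
    using \<mu>_nonneg by (intro summableI_nonneg_bounded[of _ C]) (auto simp: less_imp_le)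
qed

end

section \<open>The dual heat semigroup\<close>

text \<open>Cauchy-Schwarz on blocks of the series. A common bound for the square sums of
  \<open>g\<close> suffices, where a termwise majorant may fail to be summable.\<close>

lemma l2_series:
  fixes a :: "nat \<Rightarrow> real" and g :: "nat \<Rightarrow> 'a \<Rightarrow> real"
  assumes a: "summable (\<lambda>n. (a n)\<^sup>2)" and B: "0 \<le> B" "\<And>x N. x \<in> X \<Longrightarrow> (\<Sum>n<N. (g n x)\<^sup>2) \<le> B\<^sup>2"
  shows "x \<in> X \<Longrightarrow> summable (\<lambda>n. \<bar>a n * g n x\<bar>)"
    and "uniformly_convergent_on X (\<lambda>N x. \<Sum>n<N. a n * g n x)"
proof -
  show "summable (\<lambda>n. \<bar>a n * g n x\<bar>)" if x: "x \<in> X"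
  proof (rule summable_comparison_test_ev)
    have "summable (\<lambda>n. (g n x)\<^sup>2)"
      using B(2)[OF x] by (intro summableI_nonneg_bounded[of _ "B\<^sup>2"]) auto
    then show "summable (\<lambda>n. (a n)\<^sup>2 + (g n x)\<^sup>2)" using a by (rule summable_add[rotated])
    have "\<bar>a n * g n x\<bar> \<le> (a n)\<^sup>2 + (g n x)\<^sup>2" for n
      using sum_squares_bound[of "\<bar>a n\<bar>" "\<bar>g n x\<bar>"] abs_ge_zero[of "a n * g n x"]
      by (simp only: abs_mult power2_abs)
    then show "eventually (\<lambda>n. norm \<bar>a n * g n x\<bar> \<le> (a n)\<^sup>2 + (g n x)\<^sup>2) sequentially" by simp
  qed
  show "uniformly_convergent_on X (\<lambda>N x. \<Sum>n<N. a n * g n x)"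
    unfolding uniformly_convergent_eq_Cauchy
  proof (rule uniformly_Cauchy_onI')
    fix \<epsilon> :: real assume \<epsilon>: "0 < \<epsilon>"
    \<comment> \<open>\<open>B + 1\<close> in place of B covers the case B = 0.\<close>
    then have "0 < (\<epsilon> / (B + 1))\<^sup>2" using B(1) by simp
    then obtain K where K: "\<And>m n. K \<le> m \<Longrightarrow> norm (\<Sum>k\<in>{m..<n}. (a k)\<^sup>2) < (\<epsilon> / (B + 1))\<^sup>2"
      using a unfolding summable_Cauchy by blast
    have "dist (\<Sum>k<m. a k * g k x) (\<Sum>k<n. a k * g k x) < \<epsilon>" if x: "x \<in> X" and m: "K \<le> m" and n: "m < n" for x m n
    proof -
      have "dist (\<Sum>k<m. a k * g k x) (\<Sum>k<n. a k * g k x) = \<bar>\<Sum>k\<in>{m..<n}. a k * g k x\<bar>"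
        using n sum_diff_nat_ivl[of 0 m n "\<lambda>k. a k * g k x"] by (simp add: dist_real_def lessThan_atLeast0 abs_minus_commute)
      also have "\<dots> \<le> (\<Sum>k\<in>{m..<n}. \<bar>a k * g k x\<bar>)" by (rule sum_abs)
      also have "\<dots> \<le> sqrt (\<Sum>k\<in>{m..<n}. (a k)\<^sup>2) * sqrt (\<Sum>k\<in>{m..<n}. (g k x)\<^sup>2)" by (rule abs_sum_mult_le_sqrt)
      also have "\<dots> \<le> (\<epsilon> / (B + 1)) * B"
      proof (rule mult_mono)
        show "sqrt (\<Sum>k\<in>{m..<n}. (a k)\<^sup>2) \<le> \<epsilon> / (B + 1)"
          using K[OF m, of n] \<epsilon> B(1) by (intro real_le_lsqrt) (auto simp: sum_nonneg)
        have "(\<Sum>k\<in>{m..<n}. (g k x)\<^sup>2) \<le> (\<Sum>k<n. (g k x)\<^sup>2)" by (intro sum_mono2) auto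
        also have "\<dots> \<le> B\<^sup>2" using B(2)[OF x] .
        finally show "sqrt (\<Sum>k\<in>{m..<n}. (g k x)\<^sup>2) \<le> B" using B(1) by (intro real_le_lsqrt) (auto simp: sum_nonneg)
      qed (use \<epsilon> B(1) in \<open>auto simp: sum_nonneg\<close>)
      also have "\<dots> < \<epsilon>" using \<epsilon> B(1) by (simp add: field_simps)
      finally show ?thesis .
    qed
    then show "\<exists>M. \<forall>x\<in>X. \<forall>m\<ge>M. \<forall>n>m. dist (\<Sum>k<m. a k * g k x) (\<Sum>k<n. a k * g k x) < \<epsilon>" by blast
  qed
qed

text \<open>Applied with the weights \<open>\<mu> n * exp (- t * \<mu> n)\<close>, this is the
  positive definiteness of the heat kernel.\<close>

lemma sum_product_square_le:
  fixes c f g :: "nat \<Rightarrow> real"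
  assumes c: "\<And>n. 0 \<le> c n" and f: "summable (\<lambda>n. c n * (f n)\<^sup>2)" and g: "summable (\<lambda>n. c n * (g n)\<^sup>2)"
    and fg: "summable (\<lambda>n. c n * (f n * g n))"
  shows "(\<Sum>n. c n * (f n * g n))\<^sup>2 \<le> (\<Sum>n. c n * (f n)\<^sup>2) * (\<Sum>n. c n * (g n)\<^sup>2)"
proof (rule LIMSEQ_le)
  show "(\<lambda>N. (\<Sum>n<N. c n * (f n * g n))\<^sup>2) \<longlonglongrightarrow> (\<Sum>n. c n * (f n * g n))\<^sup>2"
    by (intro tendsto_power summable_LIMSEQ fg)
  show "(\<lambda>N. (\<Sum>n<N. c n * (f n)\<^sup>2) * (\<Sum>n<N. c n * (g n)\<^sup>2)) \<longlonglongrightarrow> (\<Sum>n. c n * (f n)\<^sup>2) * (\<Sum>n. c n * (g n)\<^sup>2)"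
    by (intro tendsto_mult summable_LIMSEQ f g)
  have "(\<Sum>n<N. c n * (f n * g n))\<^sup>2 \<le> (\<Sum>n<N. c n * (f n)\<^sup>2) * (\<Sum>n<N. c n * (g n)\<^sup>2)" for N
  proof -
    have "c n * (f n * g n) = (sqrt (c n) * f n) * (sqrt (c n) * g n)" for n
    proof -
      have "(sqrt (c n) * f n) * (sqrt (c n) * g n) = (sqrt (c n) * sqrt (c n)) * (f n * g n)" by (simp only: mult_ac)
      then show ?thesis using c[of n] by simp
    qed
    then have "\<bar>\<Sum>n<N. c n * (f n * g n)\<bar> \<le> (\<Sum>n<N. \<bar>(sqrt (c n) * f n) * (sqrt (c n) * g n)\<bar>)"
      by (simp only: sum_abs)
    also have "\<dots> \<le> sqrt (\<Sum>n<N. (sqrt (c n) * f n)\<^sup>2) * sqrt (\<Sum>n<N. (sqrt (c n) * g n)\<^sup>2)" by (rule abs_sum_mult_le_sqrt)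
    also have "\<dots> = sqrt (\<Sum>n<N. c n * (f n)\<^sup>2) * sqrt (\<Sum>n<N. c n * (g n)\<^sup>2)"
      using c by (simp add: power_mult_distrib)
    finally have "\<bar>\<Sum>n<N. c n * (f n * g n)\<bar>\<^sup>2 \<le> (sqrt (\<Sum>n<N. c n * (f n)\<^sup>2) * sqrt (\<Sum>n<N. c n * (g n)\<^sup>2))\<^sup>2"
      by (intro power_mono) auto
    then show ?thesis using c by (simp add: power_mult_distrib sum_nonneg)
  qed
  then show "\<exists>N0. \<forall>N\<ge>N0. (\<Sum>n<N. c n * (f n * g n))\<^sup>2 \<le> (\<Sum>n<N. c n * (f n)\<^sup>2) * (\<Sum>n<N. c n * (g n)\<^sup>2)" by blast
qed

lemma quasi_concave_on_limit:
  assumes "\<And>n. quasi_concave_on {a<..<b} (f n)" "\<And>x. x \<in> {a<..<b} \<Longrightarrow> (\<lambda>n. f n x) \<longlonglongrightarrow> g x"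
  shows "quasi_concave_on {a<..<b} g"
  unfolding quasi_concave_on_def
proof (intro ballI allI impI)
  fix x z y assume xyz: "x \<in> {a<..<b}" "z \<in> {a<..<b}" "x < y \<and> y < z"
  then have "y \<in> {a<..<b}" by auto
  from xyz have "min (f n x) (f n z) \<le> f n y" for n using assms(1) unfolding quasi_concave_on_def by blast
  then show "min (g x) (g z) \<le> g y"
    using xyz \<open>y \<in> {a<..<b}\<close>
    by (intro LIMSEQ_le[OF tendsto_min[OF assms(2) assms(2)] assms(2)]) auto
qed

section \<open>The ground state of the dual problem\<close>

context dual_sturm_liouville
begin

text \<open>An interior zero of \<open>S 1\<close>, together with those at 0 and 1, would give
  \<open>e 1\<close> two zeros by Rolle's theorem, but it has only one. The sign is read off near 0,
  where \<open>e 1\<close> is positive.\<close>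

lemma S1_pos: assumes x: "x \<in> {0<..<1}" shows "0 < S 1 x"
proof -
  have nz: "S 1 y \<noteq> 0" if y: "y \<in> {0<..<1}" for y
  proof
    assume 0: "S 1 y = 0"
    have rolle: "\<exists>z\<in>{a<..<b}. e 1 z = 0" if ab: "0 \<le> a" "a < b" "b \<le> 1" "S 1 a = 0" "S 1 b = 0" for a b
    proof -
      have "\<exists>z>a. z < b \<and> (S 1 has_real_derivative 0) (at z)"
      proof (rule Rolle[OF ab(2)])
        show "S 1 a = S 1 b" using ab by simp
        show "continuous_on {a..b} (S 1)" using ab by (auto intro: continuous_on_subset[OF S_cont])
        show "S 1 differentiable at z" if "a < z" "z < b" for z
          using S_deriv[of z 1] ab that by (auto simp: real_differentiable_def)
      qed
      then obtain z where z: "a < z" "z < b" "(S 1 has_real_derivative 0) (at z)" by blast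
      then have "w z * e 1 z = 0" using DERIV_unique[OF z(3) S_deriv[of z 1]] ab by auto
      then have "e 1 z = 0" using w_pos[of z] z ab by auto
      then show ?thesis using z by auto
    qed
    obtain z1 z2 where "z1 \<in> {0<..<y}" "e 1 z1 = 0" "z2 \<in> {y<..<1}" "e 1 z2 = 0"
      using rolle[of 0 y] rolle[of y 1] y 0 S_0 S_1[of 1] by auto
    then have "{z1, z2} \<subseteq> node_set 1" "z1 \<noteq> z2" using y by (auto simp: node_set_def)
    then have "card {z1, z2} \<le> card (node_set 1)" by (intro card_mono finite_node_set) auto
    then show False using e_zeros[of 1] \<open>z1 \<noteq> z2\<close> by (simp add: node_set_def)
  qed
  have "(e 1 \<longlongrightarrow> e 1 0) (at 0 within {0..1})" using e_cont[of 1] by (simp add: continuous_on_def)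
  then have "eventually (\<lambda>t. 0 < e 1 t) (at 0 within {0..1})" using e_left[of 1] by (rule order_tendstoD)
  then obtain d where d: "0 < d" "\<And>t. t \<in> {0..1} \<Longrightarrow> t \<noteq> 0 \<Longrightarrow> dist t 0 < d \<Longrightarrow> 0 < e 1 t"
    unfolding eventually_at by blast
  define \<delta> where "\<delta> = min x (min (d / 2) (1 / 2))"
  have \<delta>: "0 < \<delta>" "\<delta> < d" "\<delta> < 1" "\<delta> \<le> x" using d x by (auto simp: \<delta>_def)
  have "S 1 0 < S 1 \<delta>"
  proof (rule DERIV_pos_imp_increasing_open[where f = "S 1"])
    fix t assume t: "0 < t" "t < \<delta>"
    then have t01: "t \<in> {0<..<1}" using \<delta> by auto
    have "0 < e 1 t" using d(2)[of t] t \<delta> by auto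
    then have "0 < w t * e 1 t" using w_pos[OF t01] by simp
    then show "\<exists>y. (S 1 has_real_derivative y) (at t) \<and> 0 < y" using S_deriv[OF t01, of 1] by blast
  qed (use \<delta> in \<open>auto intro: continuous_on_subset[OF S_cont]\<close>)
  then have pos: "0 < S 1 \<delta>" by (simp add: S_0)
  show ?thesis
  proof (rule ccontr)
    assume "\<not> 0 < S 1 x"
    then obtain y where "\<delta> \<le> y" "y \<le> x" "S 1 y = 0"
      using IVT2'[of "S 1" x 0 \<delta>] pos \<delta> x by (force intro: continuous_on_subset[OF S_cont])
    then show False using nz[of y] \<delta> x by auto
  qed
qed

lemma e1_decreasing:
  assumes "0 \<le> a" "a < b" "b \<le> 1" shows "e 1 b < e 1 a"
proof (rule DERIV_neg_imp_decreasing_open[where f = "e 1"])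
  fix x assume "a < x" "x < b"
  then have x: "x \<in> {0<..<1}" using assms by auto
  have "0 < \<mu> 1 * S 1 x / w x" using S1_pos[OF x] w_pos[OF x] \<mu>_pos[of 1] by simp
  then show "\<exists>y. (e 1 has_real_derivative y) (at x) \<and> y < 0" using e_deriv[OF x, of 1] by auto
qed (use assms in \<open>auto intro: continuous_on_subset[OF e_cont]\<close>)

text \<open>\<open>e 1\<close> is the derivative of \<open>S 1\<close> with respect to
  \<open>S 0\<close>, and it decreases: \<open>S 1\<close> is a concave function of
  \<open>S 0\<close>. These are its chord inequalities.\<close>

lemma S1_increment:
  assumes ab: "0 \<le> a" "a \<le> b" "b \<le> 1"
  shows "e 1 b * (S 0 b - S 0 a) \<le> S 1 b - S 1 a" "S 1 b - S 1 a \<le> e 1 a * (S 0 b - S 0 a)"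
proof -
  have mono: "e 1 b \<le> e 1 x \<and> e 1 x \<le> e 1 a" if "a < x" "x < b" for x
    using e1_decreasing[of a x] e1_decreasing[of x b] that ab by auto
  have "S 1 a - e 1 b * S 0 a \<le> S 1 b - e 1 b * S 0 b"
  proof (rule DERIV_nonneg_imp_increasing_open[where f = "\<lambda>x. S 1 x - e 1 b * S 0 x"])
    fix x assume x: "a < x" "x < b"
    then have x01: "x \<in> {0<..<1}" using ab by auto
    have "((\<lambda>x. S 1 x - e 1 b * S 0 x) has_real_derivative w x * e 1 x - e 1 b * (w x * e 0 x)) (at x)"
      by (intro DERIV_diff DERIV_cmult S_deriv x01)
    moreover have "0 \<le> w x * (e 1 x - e 1 b)" using mono[OF x] w_pos[OF x01] by simp
    ultimately show "\<exists>y. ((\<lambda>x. S 1 x - e 1 b * S 0 x) has_real_derivative y) (at x) \<and> 0 \<le> y"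
      using e_0[of x] x01 by (auto simp: algebra_simps)
  qed (use ab in \<open>auto intro!: continuous_intros intro: continuous_on_subset[OF S_cont]\<close>)
  then show "e 1 b * (S 0 b - S 0 a) \<le> S 1 b - S 1 a" by (simp add: algebra_simps)
  have "e 1 a * S 0 a - S 1 a \<le> e 1 a * S 0 b - S 1 b"
  proof (rule DERIV_nonneg_imp_increasing_open[where f = "\<lambda>x. e 1 a * S 0 x - S 1 x"])
    fix x assume x: "a < x" "x < b"
    then have x01: "x \<in> {0<..<1}" using ab by auto
    have "((\<lambda>x. e 1 a * S 0 x - S 1 x) has_real_derivative e 1 a * (w x * e 0 x) - w x * e 1 x) (at x)"
      by (intro DERIV_diff DERIV_cmult S_deriv x01)
    moreover have "0 \<le> w x * (e 1 a - e 1 x)" using mono[OF x] w_pos[OF x01] by simp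
    ultimately show "\<exists>y. ((\<lambda>x. e 1 a * S 0 x - S 1 x) has_real_derivative y) (at x) \<and> 0 \<le> y"
      using e_0[of x] x01 by (auto simp: algebra_simps)
  qed (use ab in \<open>auto intro!: continuous_intros intro: continuous_on_subset[OF S_cont]\<close>)
  then show "S 1 b - S 1 a \<le> e 1 a * (S 0 b - S 0 a)" by (simp add: algebra_simps)
qed

section \<open>Eigenfunction expansions and the resolvent equation\<close>

lemma sum_S_squared_le_1: "x \<in> {0..1} \<Longrightarrow> (\<Sum>n<N. (S n x)\<^sup>2) \<le> 1\<^sup>2"
proof -
  assume x: "x \<in> {0..1}"
  have "(\<lambda>n. (S n x)\<^sup>2) sums S 0 x" using S_product_sums[OF x x] by (simp add: power2_eq_square)
  then have "(\<Sum>n<N. (S n x)\<^sup>2) \<le> S 0 x" by (metis finite_lessThan sum_le_suminf sums_iff zero_le_power2)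
  then show ?thesis using W_bounds[OF x] by simp
qed

lemma abs_S_le_1: "x \<in> {0..1} \<Longrightarrow> \<bar>S n x\<bar> \<le> 1"
proof -
  assume x: "x \<in> {0..1}"
  have "(S n x)\<^sup>2 \<le> (\<Sum>k<Suc n. (S k x)\<^sup>2)" by (rule member_le_sum) auto
  then have "(S n x)\<^sup>2 \<le> 1" using sum_S_squared_le_1[OF x, of "Suc n"] by simp
  then show ?thesis by (simp add: abs_square_le_1)
qed

text \<open>The index \<open>0\<close> carries the constant function, which the dual problem does not see.\<close>

definition l2 :: "(nat \<Rightarrow> real) \<Rightarrow> bool" where "l2 a \<longleftrightarrow> a 0 = 0 \<and> summable (\<lambda>n. (a n)\<^sup>2)"

definition u :: "(nat \<Rightarrow> real) \<Rightarrow> real \<Rightarrow> real" where "u a x = (\<Sum>n. a n * S n x)"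

lemma u_abs_summable: "l2 a \<Longrightarrow> x \<in> {0..1} \<Longrightarrow> summable (\<lambda>n. \<bar>a n * S n x\<bar>)"
  using l2_series(1)[of a 1 "{0..1}" S x] sum_S_squared_le_1 by (auto simp: l2_def)

lemma u_summable: "l2 a \<Longrightarrow> x \<in> {0..1} \<Longrightarrow> summable (\<lambda>n. a n * S n x)"
  using u_abs_summable[of a x] by (intro summable_norm_cancel[of "\<lambda>n. a n * S n x"]) simp

lemma l2_mult:
  assumes "l2 a" "\<And>n. \<bar>c n\<bar> \<le> C" shows "l2 (\<lambda>n. a n * c n)"
proof -
  have "summable (\<lambda>n. C\<^sup>2 * (a n)\<^sup>2)" using assms by (intro summable_mult) (simp add: l2_def)
  moreover have "norm ((a n * c n)\<^sup>2) \<le> C\<^sup>2 * (a n)\<^sup>2" for n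
  proof -
    have "(c n)\<^sup>2 \<le> C\<^sup>2" using assms(2)[of n] by (metis abs_ge_zero power2_abs power_mono)
    then have "(a n)\<^sup>2 * (c n)\<^sup>2 \<le> (a n)\<^sup>2 * C\<^sup>2" by (intro mult_left_mono) auto
    then show ?thesis by (simp add: power_mult_distrib mult.commute)
  qed
  ultimately have "summable (\<lambda>n. (a n * c n)\<^sup>2)" by (rule summable_comparison_test'[where N = 0])
  then show ?thesis using assms by (simp add: l2_def)
qed

text \<open>A Wronskian: the derivative of \<open>S n / S 1\<close> is
  \<open>w * \<Theta> n / (S 1)^2\<close>.\<close>

definition \<Theta> :: "nat \<Rightarrow> real \<Rightarrow> real" where "\<Theta> n x = e n x * S 1 x - S n x * e 1 x"

lemma \<Theta>_deriv:
  assumes x: "x \<in> {0<..<1}"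
  shows "(\<Theta> n has_real_derivative (\<mu> 1 - \<mu> n) * (S n x * S 1 x / w x)) (at x)"
proof -
  have "(\<Theta> n has_real_derivative (- (\<mu> n * S n x / w x) * S 1 x + w x * e 1 x * e n x)
    - (w x * e n x * e 1 x + - (\<mu> 1 * S 1 x / w x) * S n x)) (at x)"
    unfolding \<Theta>_def by (intro DERIV_diff DERIV_mult e_deriv S_deriv x)
  then show ?thesis by (rule DERIV_cong) (use w_pos[OF x] in \<open>simp add: field_simps\<close>)
qed

text \<open>Cauchy-Schwarz on a space of mass 1, as the square norm of \<open>S n / w\<close> is
  \<open>1 / \<mu> n\<close>. The weight \<open>sqrt (\<mu> n)\<close> balances the two
  terms.\<close>

lemma integral_abs_S_over_w:
  assumes n: "1 \<le> n" shows "(LINT x|M. \<bar>S n x / w x\<bar>) \<le> 1 / sqrt (\<mu> n)"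
proof -
  have \<mu>: "0 < \<mu> n" using \<mu>_pos[OF n] .
  have b: "bm (\<lambda>x. S n x / w x)" using n by (rule bm_S_over_w)
  have "(LINT x|M. \<bar>S n x / w x\<bar>) \<le> (LINT x|M. sqrt (\<mu> n) / 2 * (S n x / w x * (S n x / w x)) + 1 / (2 * sqrt (\<mu> n)))"
  proof (rule integral_mono)
    show "integrable M (\<lambda>x. \<bar>S n x / w x\<bar>)" by (intro integrable_abs bm_integrable b)
    show "integrable M (\<lambda>x. sqrt (\<mu> n) / 2 * (S n x / w x * (S n x / w x)) + 1 / (2 * sqrt (\<mu> n)))"
      by (intro bm_integrable bm_add bm_mult bm_const b)
    fix x
    define q where "q = sqrt (\<mu> n)"
    define v where "v = S n x / w x"
    have q: "0 < q" using \<mu> by (simp add: q_def)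
    have "0 \<le> (q * \<bar>v\<bar> - 1)\<^sup>2 / (2 * q)" using q by simp
    also have "\<dots> = q / 2 * (v * v) + 1 / (2 * q) - \<bar>v\<bar>"
      using q by (simp add: field_simps power2_eq_square abs_mult_self_eq)
    finally show "\<bar>S n x / w x\<bar> \<le> sqrt (\<mu> n) / 2 * (S n x / w x * (S n x / w x)) + 1 / (2 * sqrt (\<mu> n))"
      unfolding q_def v_def by simp
  qed
  also have "\<dots> = sqrt (\<mu> n) / 2 * (LINT x|M. S n x / w x * (S n x / w x)) + 1 / (2 * sqrt (\<mu> n))"
  proof -
    have "integrable M (\<lambda>x. S n x / w x * (S n x / w x))" by (intro bm_integrable bm_mult b)
    then have "integrable M (\<lambda>x. sqrt (\<mu> n) / 2 * (S n x / w x * (S n x / w x)))" by (rule integrable_mult_right)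
    then show ?thesis
      using emeasure_M_space
      by (subst Bochner_Integration.integral_add) (simp_all only: integral_mult_right_zero M.integrable_const lebesgue_integral_const measure_def, simp)
  qed
  also have "\<dots> = 1 / sqrt (\<mu> n)"
    unfolding S_orthogonal[OF n n] using \<mu> by (simp add: real_sqrt_divide field_simps real_div_sqrt)
  finally show ?thesis .
qed

lemma \<Theta>_ends: "\<Theta> n 0 = 0" "1 \<le> n \<Longrightarrow> \<Theta> n 1 = 0"
  by (simp_all add: \<Theta>_def S_0 S_1)

text \<open>\<open>\<Theta> n\<close> is the integral of its derivative, in which
  \<open>S 1 / w\<close> is bounded and \<open>S n / w\<close> is small in mean. A direct estimate
  would involve the bound of \<open>e_bound\<close> on \<open>e n\<close>, which depends on
  n.\<close>

lemma \<Theta>_bound: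
  obtains C where "0 < C" "\<And>n x. 1 \<le> n \<Longrightarrow> x \<in> {0..1} \<Longrightarrow> \<bar>\<Theta> n x\<bar> \<le> C * (\<bar>\<mu> 1 - \<mu> n\<bar> / sqrt (\<mu> n))"
proof -
  have b1: "bm (\<lambda>x. S 1 x / w x)" by (intro bm_S_over_w) simp
  then obtain C0 where C0: "\<forall>x\<in>{0<..<1}. \<bar>S 1 x / w x\<bar> \<le> C0" unfolding bm_def by blast
  define C where "C = \<bar>C0\<bar> + 1"
  have C: "0 < C" "\<And>x. x \<in> {0<..<1} \<Longrightarrow> \<bar>S 1 x / w x\<bar> \<le> C" using C0 by (force simp: C_def)+
  have "\<bar>\<Theta> n x\<bar> \<le> C * (\<bar>\<mu> 1 - \<mu> n\<bar> / sqrt (\<mu> n))" if n: "1 \<le> n" and x: "x \<in> {0..1}" for n x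
  proof -
    have bn: "bm (\<lambda>x. S n x / w x)" using n by (rule bm_S_over_w)
    have "(LINT t|M. indicator {0<..<x} t * ((\<mu> 1 - \<mu> n) * (S n t / w t * (S 1 t / w t)))) = \<Theta> n x - \<Theta> n 0"
    proof (rule integral_bm_FTC[where T = "{}"])
      show "bm (\<lambda>t. (\<mu> 1 - \<mu> n) * (S n t / w t * (S 1 t / w t)))" by (intro bm_mult bm_const bn b1)
      show "continuous_on {0..x} (\<Theta> n)" unfolding \<Theta>_def
        using x by (intro continuous_intros continuous_on_subset[OF e_cont] continuous_on_subset[OF S_cont]) auto
      fix t assume "t \<in> {0<..<x} - {}"
      then have t: "t \<in> {0<..<1}" using x by auto
      show "(\<Theta> n has_real_derivative w t * ((\<mu> 1 - \<mu> n) * (S n t / w t * (S 1 t / w t)))) (at t)"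
        by (rule DERIV_cong[OF \<Theta>_deriv[OF t]]) (use w_pos[OF t] in simp)
    qed (use x in auto)
    then have "\<bar>\<Theta> n x\<bar> = \<bar>LINT t|M. indicator {0<..<x} t * ((\<mu> 1 - \<mu> n) * (S n t / w t * (S 1 t / w t)))\<bar>"
      by (simp add: \<Theta>_ends)
    also have "\<dots> \<le> (LINT t|M. \<bar>indicator {0<..<x} t * ((\<mu> 1 - \<mu> n) * (S n t / w t * (S 1 t / w t)))\<bar>)"
      by (rule integral_abs_bound)
    also have "\<dots> \<le> (LINT t|M. \<bar>\<mu> 1 - \<mu> n\<bar> * C * \<bar>S n t / w t\<bar>)"
    proof (rule integral_mono)
      show "integrable M (\<lambda>t. \<bar>indicator {0<..<x} t * ((\<mu> 1 - \<mu> n) * (S n t / w t * (S 1 t / w t)))\<bar>)"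
        by (intro integrable_abs bm_integrable bm_mult bm_const bn b1 bm_indicator) auto
      show "integrable M (\<lambda>t. \<bar>\<mu> 1 - \<mu> n\<bar> * C * \<bar>S n t / w t\<bar>)"
        by (intro integrable_mult_right integrable_abs bm_integrable bn)
      fix t assume "t \<in> space M"
      then have t: "t \<in> {0<..<1}" by (simp add: space_M)
      have "\<bar>indicator {0<..<x} t * ((\<mu> 1 - \<mu> n) * (S n t / w t * (S 1 t / w t)))\<bar>
        \<le> \<bar>\<mu> 1 - \<mu> n\<bar> * (\<bar>S n t / w t\<bar> * \<bar>S 1 t / w t\<bar>)"
        unfolding abs_mult by (auto simp: indicator_def)
      also have "\<dots> \<le> \<bar>\<mu> 1 - \<mu> n\<bar> * (\<bar>S n t / w t\<bar> * C)"
        using C(2)[OF t] by (intro mult_left_mono) auto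
      finally show "\<bar>indicator {0<..<x} t * ((\<mu> 1 - \<mu> n) * (S n t / w t * (S 1 t / w t)))\<bar> \<le> \<bar>\<mu> 1 - \<mu> n\<bar> * C * \<bar>S n t / w t\<bar>"
        by (simp only: mult_ac)
    qed
    also have "\<dots> = \<bar>\<mu> 1 - \<mu> n\<bar> * C * (LINT t|M. \<bar>S n t / w t\<bar>)" by (simp only: integral_mult_right_zero)
    also have "\<dots> \<le> \<bar>\<mu> 1 - \<mu> n\<bar> * C * (1 / sqrt (\<mu> n))"
      using C(1) by (intro mult_left_mono integral_abs_S_over_w n) auto
    finally show ?thesis by (simp add: mult_ac)
  qed
  with C(1) show thesis by (rule that)
qed

lemma summable_inverse_\<mu>': "summable (\<lambda>n. 1 / \<mu> n)"
  using summable_inverse_\<mu> by (simp only: summable_Suc_iff[of "\<lambda>n. 1 / \<mu> n"])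

lemma S1_over_w_bound:
  obtains B where "0 < B" "\<And>x. x \<in> {0<..<1} \<Longrightarrow> \<bar>S 1 x / w x\<bar> \<le> B"
proof -
  have "bm (\<lambda>x. S 1 x / w x)" by (intro bm_S_over_w) simp
  then obtain C0 where C0: "\<forall>x\<in>{0<..<1}. \<bar>S 1 x / w x\<bar> \<le> C0" unfolding bm_def by blast
  have "\<bar>S 1 x / w x\<bar> \<le> \<bar>C0\<bar> + 1" if "x \<in> {0<..<1}" for x
    using C0 that by (smt (verit) abs_ge_self)
  then show thesis using that[of "\<bar>C0\<bar> + 1"] by auto
qed

text \<open>With \<open>b = a / (1 + s \<mu>)\<close> the quotients \<open>u b / S 1\<close> and \<open>u a / S 1\<close> are related by the resolvent of
  the ground state transform of the dual operator, whose flux is \<open>\<Sum>n. b n * \<Theta> n x\<close>.\<close>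

lemma resolvent_flux_system:
  assumes a: "l2 a" and s: "0 < s"
  defines "b \<equiv> \<lambda>n. a n / (1 + s * \<mu> n)"
  shows "flux_system (\<lambda>x. u b x / S 1 x) (\<lambda>x. \<Sum>n. b n * \<Theta> n x) (\<lambda>x. w x / (S 1 x)\<^sup>2)
    (\<lambda>x. (S 1 x)\<^sup>2 / (s * w x)) (\<lambda>x. u a x / S 1 x) (1 + s * \<mu> 1)"
proof -
  have pos: "0 < 1 + s * \<mu> n" for n using s \<mu>_nonneg[of n] by (simp add: add_pos_nonneg)
  \<comment> \<open>A bound, uniform in n, for the multiplier
    \<open>(\<mu> 1 - \<mu> n) / (1 + s * \<mu> n)\<close>, whose modulus tends to
    \<open>1 / s\<close>.\<close>
  define D where "D = \<mu> 1 + 1 / s"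
  have D0: "0 < D" using \<mu>_pos[of 1] s unfolding D_def by (intro add_pos_pos) auto
  have D: "\<bar>\<mu> 1 - \<mu> n\<bar> / (1 + s * \<mu> n) \<le> D" for n
  proof -
    have "\<bar>\<mu> 1 - \<mu> n\<bar> \<le> \<mu> 1 + \<mu> n" using \<mu>_nonneg[of 1] \<mu>_nonneg[of n] by linarith
    also have "\<dots> \<le> D * (1 + s * \<mu> n)"
    proof -
      have "D * (1 + s * \<mu> n) = \<mu> 1 + \<mu> n + (1 / s + \<mu> 1 * s * \<mu> n)" using s by (simp add: D_def field_simps)
      moreover have "0 \<le> 1 / s + \<mu> 1 * s * \<mu> n" using s \<mu>_nonneg by simp
      ultimately show ?thesis by linarith
    qed
    finally show ?thesis using pos[of n] by (simp add: divide_le_eq)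
  qed
  have "b = (\<lambda>n. a n * (1 / (1 + s * \<mu> n)))" by (simp add: b_def)
  then have b: "l2 b" using l2_mult[OF a, of "\<lambda>n. 1 / (1 + s * \<mu> n)" 1] s \<mu>_nonneg pos
    by (simp add: abs_of_nonneg less_imp_le)
  have b0: "b 0 = 0" using b by (simp add: l2_def)
  obtain C where C: "0 < C" "\<And>n x. 1 \<le> n \<Longrightarrow> x \<in> {0..1} \<Longrightarrow> \<bar>\<Theta> n x\<bar> \<le> C * (\<bar>\<mu> 1 - \<mu> n\<bar> / sqrt (\<mu> n))"
    using \<Theta>_bound by blast
  \<comment> \<open>By \<open>\<Theta>_bound\<close> a term of the flux is at most a constant times
    \<open>\<bar>a n\<bar> / sqrt (\<mu> n)\<close>. Splitting this product leaves two summable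
    sequences, the second by the trace bound.\<close>
  define m where "m n = C * D * ((a n)\<^sup>2 + 1 / \<mu> n)" for n
  have sm: "summable m" unfolding m_def using a summable_inverse_\<mu>' by (intro summable_mult summable_add) (auto simp: l2_def)
  have b\<Theta>: "\<bar>b n * \<Theta> n x\<bar> \<le> m n" if x: "x \<in> {0..1}" for n x
  proof (cases "n = 0")
    case False
    then have n: "1 \<le> n" by simp
    have \<mu>: "0 < \<mu> n" using \<mu>_pos[OF n] .
    have "\<bar>b n * \<Theta> n x\<bar> = \<bar>a n\<bar> / (1 + s * \<mu> n) * \<bar>\<Theta> n x\<bar>" using pos[of n] by (simp add: b_def abs_mult)
    also have "\<dots> \<le> \<bar>a n\<bar> / (1 + s * \<mu> n) * (C * (\<bar>\<mu> 1 - \<mu> n\<bar> / sqrt (\<mu> n)))"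
      using C(2)[OF n x] pos[of n] by (intro mult_left_mono) auto
    also have "\<dots> = C * (\<bar>a n\<bar> * (1 / sqrt (\<mu> n))) * (\<bar>\<mu> 1 - \<mu> n\<bar> / (1 + s * \<mu> n))"
      by (simp add: mult_ac)
    also have "\<dots> \<le> C * (\<bar>a n\<bar> * (1 / sqrt (\<mu> n))) * D" using D C(1) \<mu> by (intro mult_left_mono) auto
    also have "\<dots> \<le> C * ((a n)\<^sup>2 + 1 / \<mu> n) * D"
    proof -
      have "2 * \<bar>a n\<bar> * (1 / sqrt (\<mu> n)) \<le> \<bar>a n\<bar>\<^sup>2 + (1 / sqrt (\<mu> n))\<^sup>2" by (rule sum_squares_bound)
      also have "\<dots> = (a n)\<^sup>2 + 1 / \<mu> n" using \<mu> by (simp add: power_divide)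
      finally have *: "2 * (\<bar>a n\<bar> * (1 / sqrt (\<mu> n))) \<le> (a n)\<^sup>2 + 1 / \<mu> n" by simp
      have "0 \<le> \<bar>a n\<bar> * (1 / sqrt (\<mu> n))" using \<mu> by simp
      with * have "\<bar>a n\<bar> * (1 / sqrt (\<mu> n)) \<le> (a n)\<^sup>2 + 1 / \<mu> n" by linarith
      then show ?thesis using C(1) D0 by (intro mult_right_mono mult_left_mono) auto
    qed
    finally show ?thesis by (simp add: m_def mult_ac)
  qed (use b0 C(1) D0 \<mu>_0 in \<open>simp add: m_def\<close>)
  have \<Theta>_cont: "continuous_on {0..1} (\<Theta> n)" for n
    unfolding \<Theta>_def by (intro continuous_intros e_cont S_cont)
  have flux_cont: "continuous_on {0..1} (\<lambda>x. \<Sum>n. b n * \<Theta> n x)"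
  proof (rule uniform_limit_theorem)
    show "uniform_limit {0..1} (\<lambda>N x. \<Sum>n<N. b n * \<Theta> n x) (\<lambda>x. \<Sum>n. b n * \<Theta> n x) sequentially"
      using b\<Theta> sm by (intro Weierstrass_m_test[of _ _ m]) auto
    show "\<forall>\<^sub>F N in sequentially. continuous_on {0..1} (\<lambda>x. \<Sum>n<N. b n * \<Theta> n x)"
      by (intro always_eventually allI continuous_intros \<Theta>_cont)
  qed simp
  have b\<Theta>_summable: "summable (\<lambda>n. b n * \<Theta> n x)" if "x \<in> {0..1}" for x
    using b\<Theta>[OF that] by (intro summable_comparison_test'[OF sm, of 0]) auto
  show ?thesis
  proof
    fix x :: real assume x: "x \<in> {0<..<1}"
    \<comment> \<open>The factor \<open>w / (S 1)^2\<close> is bounded on compact subintervals, so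
      the series are differentiated on one around x.\<close>
    define c d where "c = x / 2" and "d = (x + 1) / 2"
    have cd: "0 < c" "c < x" "x < d" "d < 1" using x by (auto simp: c_def d_def)
    have sub: "{c..d} \<subseteq> {0<..<1}" using cd by auto
    have int: "x \<in> interior {c..d}" using cd by simp
    have S1x: "0 < S 1 x" using S1_pos[OF x] .
    show "((\<lambda>x. u b x / S 1 x) has_real_derivative w x / (S 1 x)\<^sup>2 * (\<Sum>n. b n * \<Theta> n x)) (at x)"
    proof -
      have w_cont': "continuous_on {c..d} w" and S_cont': "continuous_on {c..d} (S 1)"
        using cd by (auto intro!: continuous_on_subset[OF w_cont] continuous_on_subset[OF S_cont])
      have "continuous_on {c..d} (\<lambda>x. w x / (S 1 x)\<^sup>2)"
      proof (intro continuous_intros w_cont' S_cont' ballI)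
        fix y assume "y \<in> {c..d}"
        then have "0 < S 1 y" using sub S1_pos by blast
        then show "(S 1 y)\<^sup>2 \<noteq> 0" by simp
      qed
      then have "compact ((\<lambda>x. w x / (S 1 x)\<^sup>2) ` {c..d})" by (intro compact_continuous_image) auto
      then obtain B where "\<forall>y\<in>(\<lambda>x. w x / (S 1 x)\<^sup>2) ` {c..d}. \<bar>y\<bar> \<le> B" using compact_imp_bounded bounded_real by metis
      then have B: "\<bar>w y / (S 1 y)\<^sup>2\<bar> \<le> B" if "y \<in> {c..d}" for y using that by blast
      have B0: "0 \<le> B" using B[of x] cd by (smt (verit) abs_ge_zero atLeastAtMost_iff)
      have "((\<lambda>x. \<Sum>n. b n * (S n x / S 1 x)) has_real_derivative (\<Sum>n. b n * (w x / (S 1 x)\<^sup>2 * \<Theta> n x))) (at x)"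
      proof (rule has_field_derivative_series'(2)[OF convex_real_interval(5)])
        fix n y assume "y \<in> {c..d}"
        then have y: "y \<in> {0<..<1}" using sub by auto
        have S1y: "0 < S 1 y" using S1_pos[OF y] .
        have "((\<lambda>x. S n x / S 1 x) has_real_derivative (w y * e n y * S 1 y - S n y * (w y * e 1 y)) / (S 1 y * S 1 y)) (at y)"
          using S1y by (intro DERIV_divide S_deriv y) simp
        then have "((\<lambda>x. S n x / S 1 x) has_real_derivative w y / (S 1 y)\<^sup>2 * \<Theta> n y) (at y)"
          by (rule DERIV_cong) (simp only: \<Theta>_def power2_eq_square times_divide_eq_left times_divide_eq_right
              right_diff_distrib diff_divide_distrib mult_ac)
        then show "((\<lambda>x. b n * (S n x / S 1 x)) has_real_derivative b n * (w y / (S 1 y)\<^sup>2 * \<Theta> n y)) (at y within {c..d})"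
          by (rule has_field_derivative_at_within[OF DERIV_cmult])
      next
        show "uniformly_convergent_on {c..d} (\<lambda>N y. \<Sum>n<N. b n * (w y / (S 1 y)\<^sup>2 * \<Theta> n y))"
        proof (rule Weierstrass_m_test'[of _ _ "\<lambda>n. B * m n"])
          fix n y assume y: "y \<in> {c..d}"
          have "\<bar>w y / (S 1 y)\<^sup>2\<bar> * \<bar>b n * \<Theta> n y\<bar> \<le> B * m n"
            using B[OF y] b\<Theta>[of y n] y sub B0 by (intro mult_mono) auto
          moreover have "norm (b n * (w y / (S 1 y)\<^sup>2 * \<Theta> n y)) = \<bar>w y / (S 1 y)\<^sup>2\<bar> * \<bar>b n * \<Theta> n y\<bar>"
            by (simp only: real_norm_def abs_mult mult_ac)
          ultimately show "norm (b n * (w y / (S 1 y)\<^sup>2 * \<Theta> n y)) \<le> B * m n" by (simp only:)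
        qed (intro summable_mult sm)
        show "x \<in> {c..d}" using cd by simp
        show "summable (\<lambda>n. b n * (S n x / S 1 x))"
          using summable_divide[OF u_summable[OF b, of x], of "S 1 x"] x by simp
      qed (rule int)
      moreover have "(\<Sum>n. b n * (w x / (S 1 x)\<^sup>2 * \<Theta> n x)) = w x / (S 1 x)\<^sup>2 * (\<Sum>n. b n * \<Theta> n x)"
        using suminf_mult[OF b\<Theta>_summable[of x], of "w x / (S 1 x)\<^sup>2"] x by (simp add: mult_ac)
      ultimately have "((\<lambda>x. \<Sum>n. b n * (S n x / S 1 x)) has_real_derivative w x / (S 1 x)\<^sup>2 * (\<Sum>n. b n * \<Theta> n x)) (at x)"
        by simp
      then show ?thesis
      proof (rule has_field_derivative_transform_within_open[of _ _ _ "{0<..<1}"])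
        fix y :: real assume y: "y \<in> {0<..<1}"
        show "(\<Sum>n. b n * (S n y / S 1 y)) = u b y / S 1 y"
          using suminf_divide[OF u_summable[OF b, of y], of "S 1 y"] y by (simp add: u_def)
      qed (use x in auto)
    qed
    show "((\<lambda>x. \<Sum>n. b n * \<Theta> n x) has_real_derivative
      (S 1 x)\<^sup>2 / (s * w x) * ((1 + s * \<mu> 1) * (u b x / S 1 x) - u a x / S 1 x)) (at x)"
    proof -
      obtain B where B: "0 < B" "\<And>x. x \<in> {0<..<1} \<Longrightarrow> \<bar>S 1 x / w x\<bar> \<le> B" using S1_over_w_bound by blast
      \<comment> \<open>Coefficients of the differentiated flux. They are merely square-summable, so
        uniform convergence comes from \<open>l2_series\<close> and not from a majorant.\<close>
      define c' where "c' n = b n * (\<mu> 1 - \<mu> n)" for n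
      have "c' = (\<lambda>n. a n * ((\<mu> 1 - \<mu> n) / (1 + s * \<mu> n)))" by (simp add: c'_def[abs_def] b_def)
      moreover have "l2 (\<lambda>n. a n * ((\<mu> 1 - \<mu> n) / (1 + s * \<mu> n)))"
        using D pos by (intro l2_mult[OF a, of _ D]) (simp add: abs_div_pos)
      ultimately have c': "l2 c'" by simp
      have "((\<lambda>x. \<Sum>n. b n * \<Theta> n x) has_real_derivative (\<Sum>n. c' n * (S n x * (S 1 x / w x)))) (at x)"
      proof (rule has_field_derivative_series'(2)[OF convex_real_interval(5)])
        fix n y assume "y \<in> {c..d}"
        then have y: "y \<in> {0<..<1}" using sub by auto
        have "((\<lambda>x. b n * \<Theta> n x) has_real_derivative b n * ((\<mu> 1 - \<mu> n) * (S n y * S 1 y / w y))) (at y)"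
          by (intro DERIV_cmult \<Theta>_deriv y)
        then show "((\<lambda>x. b n * \<Theta> n x) has_real_derivative c' n * (S n y * (S 1 y / w y))) (at y within {c..d})"
          by (simp add: c'_def has_field_derivative_at_within mult.assoc)
      next
        show "uniformly_convergent_on {c..d} (\<lambda>N y. \<Sum>n<N. c' n * (S n y * (S 1 y / w y)))"
        proof (rule l2_series(2)[where B = B])
          show "summable (\<lambda>n. (c' n)\<^sup>2)" using c' by (simp add: l2_def)
          fix y and N :: nat assume "y \<in> {c..d}"
          then have y: "y \<in> {0<..<1}" using sub by auto
          have "(\<Sum>n<N. (S n y * (S 1 y / w y))\<^sup>2) = (\<Sum>n<N. (S n y)\<^sup>2) * (S 1 y / w y)\<^sup>2"
            by (simp only: power_mult_distrib sum_distrib_right)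
          also have "\<dots> \<le> 1\<^sup>2 * B\<^sup>2"
          proof (rule mult_mono)
            show "(\<Sum>n<N. (S n y)\<^sup>2) \<le> 1\<^sup>2" using y by (intro sum_S_squared_le_1) auto
            show "(S 1 y / w y)\<^sup>2 \<le> B\<^sup>2" using B(2)[OF y] B(1) by (metis abs_ge_zero power2_abs power_mono)
          qed auto
          finally show "(\<Sum>n<N. (S n y * (S 1 y / w y))\<^sup>2) \<le> B\<^sup>2" by simp
        qed (use B in simp)
        show "x \<in> {c..d}" using cd by simp
        show "summable (\<lambda>n. b n * \<Theta> n x)" using x by (intro b\<Theta>_summable) auto
      qed (rule int)
      moreover have "(\<Sum>n. c' n * (S n x * (S 1 x / w x))) = (S 1 x)\<^sup>2 / (s * w x) * ((1 + s * \<mu> 1) * (u b x / S 1 x) - u a x / S 1 x)"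
      proof -
        \<comment> \<open>The resolvent equation at the level of coefficients.\<close>
        have c'_eq: "c' n = ((1 + s * \<mu> 1) * b n - a n) / s" for n
        proof -
          have "a n = b n * (1 + s * \<mu> n)" using pos[of n] by (simp add: b_def)
          then show ?thesis using s by (simp add: c'_def field_simps)
        qed
        have "(\<lambda>n. b n * S n x) sums u b x" "(\<lambda>n. a n * S n x) sums u a x"
          unfolding u_def using u_summable a b x by (auto intro: summable_sums)
        then have "(\<lambda>n. S 1 x / (s * w x) * ((1 + s * \<mu> 1) * (b n * S n x) - a n * S n x)) sums (S 1 x / (s * w x) * ((1 + s * \<mu> 1) * u b x - u a x))"
          by (intro sums_mult sums_diff)
        moreover have "(\<lambda>n. S 1 x / (s * w x) * ((1 + s * \<mu> 1) * (b n * S n x) - a n * S n x)) = (\<lambda>n. c' n * (S n x * (S 1 x / w x)))"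
          using s w_pos[OF x] unfolding c'_eq by (intro ext) (simp add: field_simps)
        ultimately have "(\<Sum>n. c' n * (S n x * (S 1 x / w x))) = S 1 x / (s * w x) * ((1 + s * \<mu> 1) * u b x - u a x)"
          by (simp add: sums_iff)
        also have "\<dots> = (S 1 x)\<^sup>2 / (s * w x) * ((1 + s * \<mu> 1) * (u b x / S 1 x) - u a x / S 1 x)"
          using S1x s w_pos[OF x] by (simp add: field_simps power2_eq_square)
        finally show ?thesis .
      qed
      ultimately show ?thesis by simp
    qed
    show "0 < w x / (S 1 x)\<^sup>2" "0 < (S 1 x)\<^sup>2 / (s * w x)" using S1x w_pos[OF x] s by auto
  next
    show "0 < 1 + s * \<mu> 1" by (rule pos)
    have "(\<Sum>n. b n * \<Theta> n 0) = 0" by (simp add: \<Theta>_ends)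
    moreover have "((\<lambda>x. \<Sum>n. b n * \<Theta> n x) \<longlongrightarrow> (\<Sum>n. b n * \<Theta> n 0)) (at 0 within {0..1})"
      using flux_cont by (simp add: continuous_on_def)
    ultimately show "((\<lambda>x. \<Sum>n. b n * \<Theta> n x) \<longlongrightarrow> 0) (at_right 0)"
      by (simp add: at_within_Icc_at_right)
    \<comment> \<open>\<open>\<Theta> 0\<close> does not vanish at 1; the index 0 is removed by
      \<open>b 0 = 0\<close>.\<close>
    have "b n * \<Theta> n 1 = 0" for n using \<Theta>_ends(2)[of n] b0 by (cases "n = 0") auto
    then have "(\<Sum>n. b n * \<Theta> n 1) = 0" by (simp only: suminf_zero)
    moreover have "((\<lambda>x. \<Sum>n. b n * \<Theta> n x) \<longlongrightarrow> (\<Sum>n. b n * \<Theta> n 1)) (at 1 within {0..1})"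
      using flux_cont by (simp add: continuous_on_def)
    ultimately show "((\<lambda>x. \<Sum>n. b n * \<Theta> n x) \<longlongrightarrow> 0) (at_left 1)"
      by (simp add: at_within_Icc_at_left)
  qed
qed

section \<open>The cone preserved by resolvent and semigroup\<close>

definition good :: "(nat \<Rightarrow> real) \<Rightarrow> bool" where
  "good a \<longleftrightarrow> l2 a \<and> (\<forall>x\<in>{0<..<1}. 0 \<le> u a x / S 1 x) \<and> quasi_concave_on {0<..<1} (\<lambda>x. u a x / S 1 x)"

lemma good_resolvent:
  assumes "good a" "0 < s" shows "good (\<lambda>n. a n / (1 + s * \<mu> n))"
proof -
  have a: "l2 a" using assms by (simp add: good_def)
  interpret flux_system "\<lambda>x. u (\<lambda>n. a n / (1 + s * \<mu> n)) x / S 1 x" "\<lambda>x. \<Sum>n. a n / (1 + s * \<mu> n) * \<Theta> n x"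
    "\<lambda>x. w x / (S 1 x)\<^sup>2" "\<lambda>x. (S 1 x)\<^sup>2 / (s * w x)" "\<lambda>x. u a x / S 1 x" "1 + s * \<mu> 1"
    by (rule resolvent_flux_system[OF a assms(2)])
  have "l2 (\<lambda>n. a n * (1 / (1 + s * \<mu> n)))"
  proof (rule l2_mult[OF a])
    fix n
    have "0 \<le> s * \<mu> n" using assms(2) \<mu>_nonneg[of n] by simp
    then show "\<bar>1 / (1 + s * \<mu> n)\<bar> \<le> 1" by (simp add: divide_le_eq)
  qed
  then show ?thesis using solution_nonneg solution_quasi_concave assms(1) by (simp add: good_def)
qed

lemma good_resolvent_power:
  assumes "good a" "0 < s" shows "good (\<lambda>n. a n / (1 + s * \<mu> n) ^ N)"
proof (induction N)
  case (Suc N)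
  from good_resolvent[OF this assms(2)] show ?case by (simp add: mult.commute)
qed (use assms in simp)

text \<open>Exponential formula: \<open>(1 + t \<mu> / N) ^ - N\<close> tends to \<open>exp (- t \<mu>)\<close>.\<close>

lemma good_heat:
  assumes "good a" "0 < t" shows "good (\<lambda>n. a n * exp (- t * \<mu> n))"
proof -
  have a: "l2 a" using assms by (simp add: good_def)
  \<comment> \<open>\<open>Suc N\<close> steps of length \<open>t / Suc N\<close>, so that no
    division by 0 occurs at N = 0.\<close>
  define b where "b N = (\<lambda>n. a n / (1 + t / real (Suc N) * \<mu> n) ^ Suc N)" for N
  have gb: "good (b N)" for N unfolding b_def using assms by (intro good_resolvent_power) auto
  have lim: "(\<lambda>N. u (b N) x) \<longlonglongrightarrow> u (\<lambda>n. a n * exp (- t * \<mu> n)) x" if x: "x \<in> {0<..<1}" for x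
  proof -
    \<comment> \<open>The powers of the resolvent factors lie between 0 and 1, so
      \<open>\<bar>a n * S n x\<bar>\<close> dominates for all N.\<close>
    have "((\<lambda>N. \<Sum>n. b N n * S n x) \<longlongrightarrow> (\<Sum>n. a n * exp (- t * \<mu> n) * S n x)) sequentially"
    proof (rule tannerys_theorem[THEN conjunct2, THEN conjunct2])
      fix n
      have "(\<lambda>N. (1 + t * \<mu> n / real (Suc N)) ^ Suc N) \<longlonglongrightarrow> exp (t * \<mu> n)"
        using LIMSEQ_Suc[OF tendsto_exp_limit_sequentially[of "t * \<mu> n"]] .
      then have "(\<lambda>N. a n / (1 + t * \<mu> n / real (Suc N)) ^ Suc N * S n x) \<longlonglongrightarrow> a n / exp (t * \<mu> n) * S n x"
        by (intro tendsto_intros) auto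
      then show "(\<lambda>N. b N n * S n x) \<longlonglongrightarrow> a n * exp (- t * \<mu> n) * S n x"
        by (simp add: b_def exp_minus divide_inverse mult_ac)
    next
      have "norm (b N n * S n x) \<le> \<bar>a n * S n x\<bar>" for N n
      proof -
        have "1 \<le> (1 + t / real (Suc N) * \<mu> n) ^ Suc N"
          using assms(2) \<mu>_nonneg[of n] by (intro one_le_power) auto
        then have "\<bar>a n\<bar> / \<bar>(1 + t / real (Suc N) * \<mu> n) ^ Suc N\<bar> \<le> \<bar>a n\<bar> / 1"
          by (intro divide_left_mono) auto
        then have "\<bar>b N n\<bar> \<le> \<bar>a n\<bar>" by (simp only: b_def abs_divide div_by_1)
        then show ?thesis by (simp add: abs_mult mult_right_mono)
      qed
      then show "\<forall>\<^sub>F (k, N) in sequentially \<times>\<^sub>F sequentially. norm (b N k * S k x) \<le> \<bar>a k * S k x\<bar>"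
        by (intro always_eventually) auto
      show "summable (\<lambda>k. \<bar>a k * S k x\<bar>)" using a x by (intro u_abs_summable) auto
    qed simp
    then show ?thesis by (simp add: u_def)
  qed
  have lim': "(\<lambda>N. u (b N) x / S 1 x) \<longlonglongrightarrow> u (\<lambda>n. a n * exp (- t * \<mu> n)) x / S 1 x" if x: "x \<in> {0<..<1}" for x
    using lim[OF x] S1_pos[OF x] by (intro tendsto_divide) auto
  show ?thesis unfolding good_def
  proof (intro conjI ballI)
    show "l2 (\<lambda>n. a n * exp (- t * \<mu> n))" using assms(2) \<mu>_nonneg by (intro l2_mult[OF a, of _ 1]) auto
    show "0 \<le> u (\<lambda>n. a n * exp (- t * \<mu> n)) x / S 1 x" if x: "x \<in> {0<..<1}" for x
      using gb x unfolding good_def by (intro LIMSEQ_le_const[OF lim'[OF x]]) auto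
    show "quasi_concave_on {0<..<1} (\<lambda>x. u (\<lambda>n. a n * exp (- t * \<mu> n)) x / S 1 x)"
      using gb by (intro quasi_concave_on_limit[OF _ lim']) (auto simp: good_def)
  qed
qed

end

section \<open>Hat functions and their divided differences\<close>

lemma quasi_concave_on_scale:
  assumes "0 \<le> c" "quasi_concave_on A f" shows "quasi_concave_on A (\<lambda>x. c * f x)"
  using assms unfolding quasi_concave_on_def
  by (metis min_mult_distrib_left mult_left_mono not_less)

lemma quasi_concave_on_unimodal:
  fixes g :: "real \<Rightarrow> real"
  assumes "\<And>x z. a < x \<Longrightarrow> x < z \<Longrightarrow> z \<le> m \<Longrightarrow> g x \<le> g z"
    and "\<And>x z. m \<le> x \<Longrightarrow> x < z \<Longrightarrow> z < b \<Longrightarrow> g z \<le> g x"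
  shows "quasi_concave_on {a<..<b} g"
  unfolding quasi_concave_on_def
proof (intro ballI allI impI)
  fix x z y assume xyz: "x \<in> {a<..<b}" "z \<in> {a<..<b}" "x < y \<and> y < z"
  show "min (g x) (g z) \<le> g y"
  proof (cases "y \<le> m")
    case True
    then have "g x \<le> g y" using assms(1)[of x y] xyz by auto
    then show ?thesis by simp
  next
    case False
    then have "g z \<le> g y" using assms(2)[of y z] xyz by auto
    then show ?thesis by simp
  qed
qed

lemma summable_square_add:
  fixes f g :: "nat \<Rightarrow> real"
  assumes "summable (\<lambda>n. (f n)\<^sup>2)" "summable (\<lambda>n. (g n)\<^sup>2)"
  shows "summable (\<lambda>n. (f n + g n)\<^sup>2)"
proof (rule summable_comparison_test'[where N = 0])
  show "summable (\<lambda>n. 2 * (f n)\<^sup>2 + 2 * (g n)\<^sup>2)" using assms by (intro summable_add summable_mult)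
  have sq: "(f n + g n)\<^sup>2 + (f n - g n)\<^sup>2 = 2 * (f n)\<^sup>2 + 2 * (g n)\<^sup>2" for n
    by (simp add: power2_eq_square algebra_simps)
  show "norm ((f n + g n)\<^sup>2) \<le> 2 * (f n)\<^sup>2 + 2 * (g n)\<^sup>2" for n
  proof -
    have "(f n + g n)\<^sup>2 \<le> 2 * (f n)\<^sup>2 + 2 * (g n)\<^sup>2"
      using sq[of n] zero_le_power2[of "f n - g n"] by linarith
    then show ?thesis by simp
  qed
qed

context dual_sturm_liouville
begin

text \<open>The second divided difference with respect to \<open>W = S 0\<close>. Applied to \<open>y \<mapsto> W (min x y)\<close> it is a
  hat function of \<open>x\<close>, and scaled by \<open>1 / h\<close> these hat functions approximate a point mass.\<close>

definition dd :: "(real \<Rightarrow> real) \<Rightarrow> real \<Rightarrow> real \<Rightarrow> real" where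
  "dd g y h = (g y - g (y - h)) / (S 0 y - S 0 (y - h)) - (g (y + h) - g y) / (S 0 (y + h) - S 0 y)"

text \<open>The hat is piecewise affine in \<open>S 0\<close> and vanishes outside
  \<open>{y - h<..<y + h}\<close>. Since \<open>S 1\<close> is positive and concave in
  \<open>S 0\<close>, the quotient of an affine function rising from 0 by \<open>S 1\<close>
  increases, and the mirrored statement holds on the other side; so the quotient rises up to y and
  falls afterwards.\<close>

lemma good_hat:
  assumes y: "0 < y - h" "y + h < 1" and h: "0 < h"
  shows "good (\<lambda>n. dd (S n) y h)"
proof -
  define \<alpha> where "\<alpha> = 1 / (S 0 y - S 0 (y - h))"
  define \<gamma> where "\<gamma> = 1 / (S 0 (y + h) - S 0 y)"
  have W: "S 0 (y - h) < S 0 y" "S 0 y < S 0 (y + h)" using W_strict_mono y h by auto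
  then have pos: "0 < \<alpha>" "0 < \<gamma>" by (auto simp: \<alpha>_def \<gamma>_def)
  have dd_eq: "dd g y h = \<alpha> * (g y - g (y - h)) - \<gamma> * (g (y + h) - g y)" for g
    by (simp add: dd_def \<alpha>_def \<gamma>_def)
  have sq: "summable (\<lambda>n. (c * S n x)\<^sup>2)" if "x \<in> {0..1}" for c x
    using S_product_sums[OF that that]
    by (auto simp: power2_eq_square mult_ac sums_iff intro!: summable_mult)
  have l2: "l2 (\<lambda>n. dd (S n) y h)"
    unfolding l2_def
  proof
    \<comment> \<open>Both difference quotients of \<open>S 0\<close> against itself are 1.\<close>
    show "dd (S 0) y h = 0" using W by (simp add: dd_def)
    have "summable (\<lambda>n. ((\<alpha> + \<gamma>) * S n y + (- \<alpha> * S n (y - h) + - \<gamma> * S n (y + h)))\<^sup>2)"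
      using y h by (intro summable_square_add sq) auto
    then show "summable (\<lambda>n. (dd (S n) y h)\<^sup>2)" by (simp add: dd_eq algebra_simps)
  qed
  define hat where "hat x = dd (\<lambda>y. S 0 (min y x)) y h" for x
  have u_eq: "u (\<lambda>n. dd (S n) y h) x = hat x" if x: "x \<in> {0..1}" for x
  proof -
    have "(\<lambda>n. S n y' * S n x) sums S 0 (min y' x)" if "y' \<in> {0..1}" for y' using S_product_sums[OF that x] .
    then have "(\<lambda>n. \<alpha> * (S n y * S n x - S n (y - h) * S n x) - \<gamma> * (S n (y + h) * S n x - S n y * S n x)) sums hat x"
      unfolding hat_def dd_eq using y h by (intro sums_diff sums_mult) auto
    moreover have "(\<lambda>n. \<alpha> * (S n y * S n x - S n (y - h) * S n x) - \<gamma> * (S n (y + h) * S n x - S n y * S n x))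
      = (\<lambda>n. dd (S n) y h * S n x)" by (simp add: dd_eq algebra_simps)
    ultimately show ?thesis by (simp add: u_def sums_iff)
  qed
  have left: "hat x = \<alpha> * (S 0 x - S 0 (min (y - h) x))" if "x \<le> y" for x
    using that h by (simp add: hat_def dd_eq min_def)
  have right: "hat x = \<gamma> * (S 0 (y + h) - S 0 (min (y + h) x))" if "y \<le> x" for x
  proof -
    have "\<alpha> * (S 0 y - S 0 (y - h)) = 1" "\<gamma> * (S 0 (y + h) - S 0 y) = 1" using W by (auto simp: \<alpha>_def \<gamma>_def)
    then show ?thesis using that h by (simp add: hat_def dd_eq min_def algebra_simps)
  qed
  have nonneg: "0 \<le> hat x" if x: "x \<in> {0<..<1}" for x
  proof (cases "x \<le> y")
    case True
    have "S 0 (min (y - h) x) \<le> S 0 x" using x y by (intro W_mono) auto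
    then show ?thesis using left[OF True] pos by simp
  next
    case False
    have "S 0 (min (y + h) x) \<le> S 0 (y + h)" using x y h by (intro W_mono) auto
    then show ?thesis using right[of x] False pos by simp
  qed
  have mono: "hat x / S 1 x \<le> hat z / S 1 z" if x: "0 < x" "x < z" "z \<le> y" for x z
  proof -
    have xz: "x \<in> {0<..<1}" "z \<in> {0<..<1}" using x y h by auto
    show ?thesis
    proof (cases "x \<le> y - h")
      case True
      then have "hat x = 0" using left[of x] x by simp
      then show ?thesis using nonneg[OF xz(2)] S1_pos[OF xz(2)] by simp
    next
      case False
      define p where "p = y - h"
      have p: "0 < p" "p < x" using False y by (auto simp: p_def)
      have 1: "S 1 z - S 1 x \<le> e 1 x * (S 0 z - S 0 x)" using S1_increment(2)[of x z] xz x by auto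
      \<comment> \<open>Slopes of chords of \<open>S 1\<close> against \<open>S 0\<close>: to the
        right of x they are at most \<open>e 1 x\<close>, to the left at least \<open>e 1 x\<close>,
        and there \<open>S 1 p > 0\<close> is dropped.\<close>
      have 2: "e 1 x * (S 0 x - S 0 p) \<le> S 1 x"
        using S1_increment(1)[of p x] S1_pos[of p] xz p by auto
      have Wp: "0 \<le> S 0 x - S 0 p" "0 \<le> S 0 z - S 0 x" using W_mono[of p x] W_mono[of x z] p xz x by auto
      have "(S 0 x - S 0 p) * (S 1 z - S 1 x) \<le> (S 0 x - S 0 p) * (e 1 x * (S 0 z - S 0 x))"
        using 1 Wp by (intro mult_left_mono)
      also have "\<dots> = (e 1 x * (S 0 x - S 0 p)) * (S 0 z - S 0 x)" by simp
      also have "\<dots> \<le> S 1 x * (S 0 z - S 0 x)" using 2 Wp by (intro mult_right_mono)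
      finally have "(S 0 x - S 0 p) * S 1 z \<le> (S 0 z - S 0 p) * S 1 x" by (simp add: algebra_simps)
      then have "(S 0 x - S 0 p) / S 1 x \<le> (S 0 z - S 0 p) / S 1 z"
        using S1_pos xz by (simp add: divide_simps mult.commute)
      then have "\<alpha> * ((S 0 x - S 0 p) / S 1 x) \<le> \<alpha> * ((S 0 z - S 0 p) / S 1 z)" using pos by (intro mult_left_mono) auto
      moreover have "hat x = \<alpha> * (S 0 x - S 0 p)" "hat z = \<alpha> * (S 0 z - S 0 p)"
        using left[of x] left[of z] x p by (auto simp: p_def min_def)
      ultimately show ?thesis by simp
    qed
  qed
  have anti: "hat z / S 1 z \<le> hat x / S 1 x" if x: "y \<le> x" "x < z" "z < 1" for x z
  proof -
    have xz: "x \<in> {0<..<1}" "z \<in> {0<..<1}" using x y h by auto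
    show ?thesis
    proof (cases "y + h \<le> z")
      case True
      then have "hat z = 0" using right[of z] x by simp
      then show ?thesis using nonneg[OF xz(1)] S1_pos[OF xz(1)] by simp
    next
      case False
      define p where "p = y + h"
      have p: "z < p" "p < 1" using False y by (auto simp: p_def)
      have 1: "e 1 z * (S 0 z - S 0 x) \<le> S 1 z - S 1 x" using S1_increment(1)[of x z] xz x by auto
      have 2: "- S 1 z \<le> e 1 z * (S 0 p - S 0 z)"
        using S1_increment(2)[of z p] S1_pos[of p] xz p by auto
      have Wp: "0 \<le> S 0 p - S 0 z" "0 \<le> S 0 z - S 0 x" using W_mono[of z p] W_mono[of x z] p xz x by auto
      have "- S 1 z * (S 0 z - S 0 x) \<le> (e 1 z * (S 0 p - S 0 z)) * (S 0 z - S 0 x)"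
        using 2 Wp by (intro mult_right_mono)
      also have "\<dots> = (S 0 p - S 0 z) * (e 1 z * (S 0 z - S 0 x))" by simp
      also have "\<dots> \<le> (S 0 p - S 0 z) * (S 1 z - S 1 x)" using 1 Wp by (intro mult_left_mono)
      finally have "(S 0 p - S 0 z) * S 1 x \<le> (S 0 p - S 0 x) * S 1 z" by (simp add: algebra_simps)
      then have "(S 0 p - S 0 z) / S 1 z \<le> (S 0 p - S 0 x) / S 1 x"
        using S1_pos xz by (simp add: divide_simps mult.commute)
      then have "\<gamma> * ((S 0 p - S 0 z) / S 1 z) \<le> \<gamma> * ((S 0 p - S 0 x) / S 1 x)" using pos by (intro mult_left_mono) auto
      moreover have "hat x = \<gamma> * (S 0 p - S 0 x)" "hat z = \<gamma> * (S 0 p - S 0 z)"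
        using right[of x] right[of z] x p by (auto simp: p_def min_def)
      ultimately show ?thesis by simp
    qed
  qed
  have "quasi_concave_on {0<..<1} (\<lambda>x. hat x / S 1 x)"
    using mono anti by (rule quasi_concave_on_unimodal)
  moreover have "quasi_concave_on {0<..<1} (\<lambda>x. u (\<lambda>n. dd (S n) y h) x / S 1 x) = quasi_concave_on {0<..<1} (\<lambda>x. hat x / S 1 x)"
    unfolding quasi_concave_on_def by (auto simp: u_eq)
  moreover have "0 \<le> u (\<lambda>n. dd (S n) y h) x / S 1 x" if x: "x \<in> {0<..<1}" for x
    using nonneg[OF x] S1_pos[OF x] u_eq[of x] x by simp
  ultimately show ?thesis using l2 by (simp add: good_def)
qed

text \<open>\<open>w\<close> is only continuous, so \<open>S n\<close> has no second-order Taylor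
  expansion. Subtracting \<open>e n y\<close> times the increment of \<open>S 0\<close> leaves
  \<open>\<psi>\<close>, with derivative \<open>w (y + t) * (e n (y + t) - e n y)\<close>, and
  l'Hopital's rule finds the limit of \<open>\<psi> t / t\<^sup>2\<close> from first derivatives
  alone. Both difference quotients then have the form \<open>e n y + t * r t\<close>, with the same
  limit of r from either side.\<close>

lemma divided_difference_tendsto:
  assumes y: "y \<in> {0<..<1}"
  shows "((\<lambda>h. dd (S n) y h / h) \<longlongrightarrow> \<mu> n * S n y / w y) (at_right 0)"
proof -
  define \<psi> where "\<psi> t = S n (y + t) - S n y - e n y * (S 0 (y + t) - S 0 y)" for t
  define r where "r t = \<psi> t / t\<^sup>2 / ((S 0 (y + t) - S 0 y) / t)" for t
  define \<delta> where "\<delta> = min y (1 - y)"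
  have \<delta>: "0 < \<delta>" using y by (simp add: \<delta>_def)
  have near: "y + t \<in> {0<..<1}" if "\<bar>t\<bar> < \<delta>" for t using that y by (auto simp: \<delta>_def)
  have ev: "eventually (\<lambda>t. \<bar>t\<bar> < \<delta>) (at 0)"
    using \<delta> by (auto simp: eventually_at intro!: exI[of _ \<delta>])
  have dS: "((\<lambda>t. S m (y + t)) has_real_derivative w (y + t) * e m (y + t)) (at t)" if "\<bar>t\<bar> < \<delta>" for t m
    using DERIV_shift[of "S m" _ t y] S_deriv[OF near[OF that], of m] by (simp add: add.commute)
  have d\<psi>: "(\<psi> has_real_derivative w (y + t) * (e n (y + t) - e n y)) (at t)" if "\<bar>t\<bar> < \<delta>" for t
  proof -
    have "(\<psi> has_real_derivative w (y + t) * e n (y + t) - 0 - e n y * (w (y + t) * e 0 (y + t) - 0)) (at t)"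
      unfolding \<psi>_def by (intro DERIV_diff DERIV_cmult DERIV_const dS that)
    then show ?thesis by (rule DERIV_cong) (use e_0[of "y + t"] near[OF that] in \<open>simp add: algebra_simps\<close>)
  qed
  have De: "((\<lambda>t. (e n (y + t) - e n y) / t) \<longlongrightarrow> De n y) (at 0)"
    using De_deriv[OF y, of n] by (simp add: DERIV_def)
  have W1: "((\<lambda>t. (S 0 (y + t) - S 0 y) / t) \<longlongrightarrow> w y) (at 0)"
    using S_deriv[OF y, of 0] e_0[of y] y by (simp add: DERIV_def)
  have wc: "((\<lambda>t. w (y + t)) \<longlongrightarrow> w y) (at 0)"
  proof -
    have "isCont w y" using w_cont y by (simp add: continuous_on_eq_continuous_at)
    then show ?thesis by (simp add: isCont_iff)
  qed
  have \<psi>2: "((\<lambda>t. \<psi> t / t\<^sup>2) \<longlongrightarrow> w y * De n y / 2) (at 0)"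
  proof (rule lhopital)
    have "isCont \<psi> 0" using DERIV_isCont[OF d\<psi>[of 0]] \<delta> by simp
    then show "(\<psi> \<longlongrightarrow> 0) (at 0)" by (simp add: isCont_def \<psi>_def)
    show "((\<lambda>t. t\<^sup>2) \<longlongrightarrow> 0) (at (0::real))" by (auto intro!: tendsto_eq_intros)
    show "\<forall>\<^sub>F t in at 0. t\<^sup>2 \<noteq> (0::real)" "\<forall>\<^sub>F t in at 0. 2 * t \<noteq> (0::real)" by (auto simp: eventually_at_filter)
    show "\<forall>\<^sub>F t in at 0. (\<psi> has_real_derivative w (y + t) * (e n (y + t) - e n y)) (at t)"
      using ev by eventually_elim (rule d\<psi>)
    show "\<forall>\<^sub>F t in at 0. ((\<lambda>t. t\<^sup>2) has_real_derivative 2 * t) (at (t::real))"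
      by (auto intro!: always_eventually derivative_eq_intros)
    have "((\<lambda>t. w (y + t) * ((e n (y + t) - e n y) / t) / 2) \<longlongrightarrow> w y * De n y / 2) (at 0)"
      by (intro tendsto_intros wc De) simp
    then show "((\<lambda>t. w (y + t) * (e n (y + t) - e n y) / (2 * t)) \<longlongrightarrow> w y * De n y / 2) (at 0)"
      by (simp add: mult.commute)
  qed
  have "(r \<longlongrightarrow> w y * De n y / 2 / w y) (at 0)"
    unfolding r_def using w_pos[OF y] by (intro tendsto_divide[OF \<psi>2 W1]) auto
  then have r: "(r \<longlongrightarrow> De n y / 2) (at 0)" using w_pos[OF y] by simp
  have r1: "((\<lambda>h. r h) \<longlongrightarrow> De n y / 2) (at_right 0)"
    using r by (simp add: filterlim_at_split)
  have "filterlim (\<lambda>h::real. - h) (at 0) (at_right 0)"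
    unfolding filterlim_at by (auto intro!: tendsto_eq_intros simp: eventually_at_filter)
  from filterlim_compose[OF r this] have r2: "((\<lambda>h. r (- h)) \<longlongrightarrow> De n y / 2) (at_right 0)" .
  have ratio: "(S n (y + t) - S n y) / (S 0 (y + t) - S 0 y) = e n y + t * r t" if t: "\<bar>t\<bar> < \<delta>" "t \<noteq> 0" for t
  proof -
    have "S 0 (y + t) - S 0 y \<noteq> 0"
      using W_strict_mono[of y "y + t"] W_strict_mono[of "y + t" y] near[OF t(1)] y t(2)
      by (cases "0 < t") auto
    then show ?thesis using t(2) by (simp add: r_def \<psi>_def field_simps power2_eq_square)
  qed
  have "((\<lambda>h. - (r (- h) + r h)) \<longlongrightarrow> - (De n y / 2 + De n y / 2)) (at_right 0)"
    by (intro tendsto_intros r1 r2)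
  moreover have "\<forall>\<^sub>F h in at_right 0. - (r (- h) + r h) = dd (S n) y h / h"
  proof -
    have "\<forall>\<^sub>F h in at_right 0. h \<in> {0<..<\<delta>}" using \<delta> by (rule eventually_at_right_real)
    then show ?thesis
    proof eventually_elim
      case (elim h)
      have "dd (S n) y h = (S n (y + - h) - S n y) / (S 0 (y + - h) - S 0 y) - (S n (y + h) - S n y) / (S 0 (y + h) - S 0 y)"
        unfolding dd_def by (metis add_uminus_conv_diff minus_diff_eq minus_divide_divide)
      also have "\<dots> = (e n y + - h * r (- h)) - (e n y + h * r h)" using elim by (subst (1 2) ratio) auto
      finally have "dd (S n) y h = h * (- (r (- h) + r h))" by (simp add: algebra_simps)
      then show ?case using elim by simp
    qed
  qed
  ultimately have "((\<lambda>h. dd (S n) y h / h) \<longlongrightarrow> - (De n y / 2 + De n y / 2)) (at_right 0)"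
    by (rule Lim_transform_eventually)
  then show ?thesis by (simp add: De_def)
qed

text \<open>Cauchy's mean value theorem turns each difference quotient against \<open>S 0\<close>
  into a value of \<open>e n\<close>. A further mean value step produces \<open>De n\<close>, which
  is linear in \<open>\<mu> n\<close> since \<open>\<bar>S n\<bar> \<le> 1\<close>.\<close>

lemma divided_difference_bound:
  assumes y: "0 < y - \<delta>" "y + \<delta> < 1" "0 < \<delta>"
  obtains C where "\<And>n h. 0 < h \<Longrightarrow> h \<le> \<delta> \<Longrightarrow> \<bar>dd (S n) y h / h\<bar> \<le> C * \<mu> n"
proof -
  have sub: "{y - \<delta>..y + \<delta>} \<subseteq> {0<..<1}" using y by auto
  have "continuous_on {y - \<delta>..y + \<delta>} w" using w_cont sub by (rule continuous_on_subset)
  then obtain p where p: "p \<in> {y - \<delta>..y + \<delta>}" "\<And>z. z \<in> {y - \<delta>..y + \<delta>} \<Longrightarrow> w p \<le> w z"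
    using continuous_attains_inf[of "{y - \<delta>..y + \<delta>}" w] y by auto
  have wp: "0 < w p" using p sub w_pos by auto
  have DeB: "\<bar>De n z\<bar> \<le> \<mu> n / w p" if z: "z \<in> {y - \<delta>..y + \<delta>}" for n z
  proof -
    have z01: "z \<in> {0<..<1}" using z sub by auto
    have "\<bar>De n z\<bar> = \<mu> n * \<bar>S n z\<bar> / w z" using \<mu>_nonneg[of n] w_pos[OF z01] by (simp add: De_def abs_mult)
    also have "\<dots> \<le> \<mu> n * 1 / w p"
      using abs_S_le_1[of z n] z01 \<mu>_nonneg[of n] wp p(2)[OF z] by (intro frac_le mult_left_mono) auto
    finally show ?thesis by simp
  qed
  have "\<bar>dd (S n) y h / h\<bar> \<le> 2 / w p * \<mu> n" if h: "0 < h" "h \<le> \<delta>" for n h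
  proof -
    have mean: "\<exists>\<xi>. a < \<xi> \<and> \<xi> < b \<and> (S n b - S n a) / (S 0 b - S 0 a) = e n \<xi>"
      if ab: "a < b" "a \<in> {y - \<delta>..y + \<delta>}" "b \<in> {y - \<delta>..y + \<delta>}" for a b
    proof -
      have ab01: "0 < a" "b < 1" using ab y by auto
      have "\<exists>\<xi>>a. \<xi> < b \<and> (S n b - S n a) * (w \<xi> * e 0 \<xi>) = (S 0 b - S 0 a) * (w \<xi> * e n \<xi>)"
        using ab01 by (intro GMVT'[OF ab(1)] S_deriv DERIV_isCont[OF S_deriv]) auto
      then obtain \<xi> where \<xi>: "a < \<xi>" "\<xi> < b" "(S n b - S n a) * (w \<xi> * e 0 \<xi>) = (S 0 b - S 0 a) * (w \<xi> * e n \<xi>)" by blast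
      have "w \<xi> \<noteq> 0" "e 0 \<xi> = 1" using w_pos[of \<xi>] e_0[of \<xi>] \<xi> ab01 by auto
      then have "S n b - S n a = (S 0 b - S 0 a) * e n \<xi>"
        using \<xi>(3) by (metis mult.commute mult.left_commute mult_cancel_left mult.right_neutral)
      moreover have "S 0 a < S 0 b" using W_strict_mono[of a b] ab01 ab by auto
      ultimately show ?thesis using \<xi> by (intro exI[of _ \<xi>]) auto
    qed
    obtain \<xi> where \<xi>: "y - h < \<xi>" "\<xi> < y" "(S n y - S n (y - h)) / (S 0 y - S 0 (y - h)) = e n \<xi>"
      using mean[of "y - h" y] h y by auto
    obtain \<zeta> where \<zeta>: "y < \<zeta>" "\<zeta> < y + h" "(S n (y + h) - S n y) / (S 0 (y + h) - S 0 y) = e n \<zeta>"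
      using mean[of y "y + h"] h y by auto
    have "\<exists>z. \<xi> < z \<and> z < \<zeta> \<and> e n \<zeta> - e n \<xi> = (\<zeta> - \<xi>) * De n z"
      using \<xi> \<zeta> h y by (intro MVT2 De_deriv) auto
    then obtain z where z: "\<xi> < z" "z < \<zeta>" "e n \<zeta> - e n \<xi> = (\<zeta> - \<xi>) * De n z" by blast
    have "\<bar>dd (S n) y h\<bar> = (\<zeta> - \<xi>) * \<bar>De n z\<bar>"
    proof -
      have "\<bar>dd (S n) y h\<bar> = \<bar>e n \<zeta> - e n \<xi>\<bar>"
        unfolding dd_def \<xi>(3) \<zeta>(3) by (rule abs_minus_commute)
      then show ?thesis unfolding z(3) abs_mult using \<xi>(2) \<zeta>(1) by simp
    qed
    also have "\<dots> \<le> (2 * h) * (\<mu> n / w p)"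
      using \<xi> \<zeta> z h DeB[of z n] by (intro mult_mono) auto
    finally show ?thesis using h by (simp add: field_simps)
  qed
  then show thesis by (rule that)
qed

section \<open>The heat kernel of the dual problem\<close>

definition k :: "real \<Rightarrow> real \<Rightarrow> real \<Rightarrow> real" where
  "k t x y = (\<Sum>n. \<mu> n * exp (- t * \<mu> n) * (S n x * S n y))"

lemma summable_\<mu>_exp:
  assumes "0 < t" shows "summable (\<lambda>n. \<mu> n * exp (- t * \<mu> n))"
proof (rule summable_comparison_test'[where N = 0])
  \<comment> \<open>From \<open>exp (t * \<mu> n) \<ge> (t * \<mu> n)^2 / 2\<close>. At n = 0 both
    sides are 0, as division by 0 gives 0.\<close>
  show "summable (\<lambda>n. 2 / t\<^sup>2 * (1 / \<mu> n))" by (intro summable_mult summable_inverse_\<mu>')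
  fix n
  show "norm (\<mu> n * exp (- t * \<mu> n)) \<le> 2 / t\<^sup>2 * (1 / \<mu> n)"
  proof (cases "n = 0")
    case False
    then have \<mu>: "0 < \<mu> n" using \<mu>_pos by simp
    have "1 + t * \<mu> n + (t * \<mu> n)\<^sup>2 / 2 \<le> exp (t * \<mu> n)"
      using exp_lower_Taylor_quadratic[of "t * \<mu> n"] assms \<mu> by simp
    moreover have "0 \<le> t * \<mu> n" using assms \<mu> by simp
    ultimately have "(t * \<mu> n)\<^sup>2 / 2 \<le> exp (t * \<mu> n)" by linarith
    then show ?thesis using assms \<mu> by (simp add: exp_minus field_simps power2_eq_square)
  qed (simp add: \<mu>_0)
qed

lemma \<mu>_exp_nonneg: "0 \<le> \<mu> n * exp (- t * \<mu> n)"
  using \<mu>_nonneg by simp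

lemma k_term_bound:
  assumes "x \<in> {0..1}" "y \<in> {0..1}"
  shows "norm (\<mu> n * exp (- t * \<mu> n) * (S n x * S n y)) \<le> \<mu> n * exp (- t * \<mu> n)"
proof -
  have "\<bar>S n x * S n y\<bar> \<le> 1 * 1" unfolding abs_mult by (intro mult_mono abs_S_le_1 assms) auto
  then have "(\<mu> n * exp (- t * \<mu> n)) * \<bar>S n x * S n y\<bar> \<le> (\<mu> n * exp (- t * \<mu> n)) * 1"
    by (intro mult_left_mono \<mu>_exp_nonneg) simp
  then show ?thesis using \<mu>_nonneg[of n] by (simp add: abs_mult)
qed

lemma k_summable:
  assumes "0 < t" "x \<in> {0..1}" "y \<in> {0..1}"
  shows "summable (\<lambda>n. \<mu> n * exp (- t * \<mu> n) * (S n x * S n y))"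
  by (rule summable_comparison_test'[OF summable_\<mu>_exp[OF assms(1)], of 0]) (rule k_term_bound[OF assms(2,3)])

lemma k_sym: "k t x y = k t y x" by (simp add: k_def mult.commute)

theorem k_nonneg_quasi_concave:
  assumes t: "0 < t" and y: "y \<in> {0<..<1}"
  shows "x \<in> {0<..<1} \<Longrightarrow> 0 \<le> k t x y"
    and "quasi_concave_on {0<..<1} (\<lambda>x. k t x y / S 1 x)"
proof -
  \<comment> \<open>With half the distance to the boundary, all the hats stay inside the
    interval.\<close>
  define \<delta> where "\<delta> = min y (1 - y) / 2"
  have \<delta>: "0 < \<delta>" "0 < y - \<delta>" "y + \<delta> < 1" using y by (auto simp: \<delta>_def min_def field_simps)
  define h where "h j = \<delta> / real (Suc j)" for j
  have h: "0 < h j" "h j \<le> \<delta>" for j using \<delta> by (auto simp: h_def divide_le_eq mult_le_cancel_left1)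
  have "h \<longlonglongrightarrow> 0" unfolding h_def using LIMSEQ_Suc[OF lim_const_over_n[of \<delta>]] by simp
  then have hlim: "filterlim h (at_right 0) sequentially"
    using h(1) less_imp_neq[OF h(1)] by (simp add: filterlim_at)
  obtain C where C: "\<And>n j. \<bar>dd (S n) y (h j) / h j\<bar> \<le> C * \<mu> n"
    using divided_difference_bound[OF \<delta>(2,3,1)] h by metis
  define a where "a j n = dd (S n) y (h j) * exp (- t * \<mu> n)" for j n
  have gd: "good (a j)" for j
    unfolding a_def using h[of j] \<delta> by (intro good_heat good_hat t) auto
  \<comment> \<open>Heat evolution of the scaled hats. The majorant
    \<open>C * (\<mu> n * exp (- t * \<mu> n))\<close> does not depend on the width, so the limit
    may be taken term by term.\<close>
  have lim: "(\<lambda>j. u (a j) x / h j) \<longlonglongrightarrow> k t x y / w y" if x: "x \<in> {0<..<1}" for x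
  proof -
    have "((\<lambda>j. \<Sum>n. dd (S n) y (h j) / h j * (exp (- t * \<mu> n) * S n x)) \<longlongrightarrow>
      (\<Sum>n. \<mu> n * S n y / w y * (exp (- t * \<mu> n) * S n x))) sequentially"
    proof (rule tannerys_theorem[THEN conjunct2, THEN conjunct2])
      show "(\<lambda>j. dd (S n) y (h j) / h j * (exp (- t * \<mu> n) * S n x)) \<longlonglongrightarrow> \<mu> n * S n y / w y * (exp (- t * \<mu> n) * S n x)" for n
        using filterlim_compose[OF divided_difference_tendsto[OF y, of n] hlim] by (intro tendsto_mult tendsto_const)
      have "norm (dd (S n) y (h j) / h j * (exp (- t * \<mu> n) * S n x)) \<le> C * (\<mu> n * exp (- t * \<mu> n))" for n j
      proof -
        have "norm (dd (S n) y (h j) / h j * (exp (- t * \<mu> n) * S n x)) = \<bar>dd (S n) y (h j) / h j\<bar> * (exp (- t * \<mu> n) * \<bar>S n x\<bar>)"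
          by (simp add: abs_mult)
        also have "\<dots> \<le> (C * \<mu> n) * (exp (- t * \<mu> n) * 1)"
          using C[of n j] abs_S_le_1[of x n] x
          by (intro mult_mono) (auto intro: order_trans[OF abs_ge_zero C])
        finally show ?thesis by simp
      qed
      then show "\<forall>\<^sub>F (n, j) in sequentially \<times>\<^sub>F sequentially.
          norm (dd (S n) y (h j) / h j * (exp (- t * \<mu> n) * S n x)) \<le> C * (\<mu> n * exp (- t * \<mu> n))"
        by (intro always_eventually) auto
      show "summable (\<lambda>n. C * (\<mu> n * exp (- t * \<mu> n)))" by (intro summable_mult summable_\<mu>_exp t)
    qed simp
    moreover have "(\<Sum>n. dd (S n) y (h j) / h j * (exp (- t * \<mu> n) * S n x)) = u (a j) x / h j" for j
    proof -
      have "summable (\<lambda>n. a j n * S n x)" using gd[of j] x by (intro u_summable) (auto simp: good_def)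
      from suminf_divide[OF this, of "h j"] show ?thesis by (simp add: u_def a_def mult_ac)
    qed
    moreover have "(\<Sum>n. \<mu> n * S n y / w y * (exp (- t * \<mu> n) * S n x)) = k t x y / w y"
      using suminf_divide[OF k_summable[OF t, of x y], of "w y"] x y by (simp add: k_def mult_ac)
    ultimately show ?thesis by simp
  qed
  have lim': "(\<lambda>j. w y / h j * (u (a j) x / S 1 x)) \<longlonglongrightarrow> k t x y / S 1 x" if x: "x \<in> {0<..<1}" for x
  proof -
    have "(\<lambda>j. w y * (u (a j) x / h j) / S 1 x) \<longlonglongrightarrow> w y * (k t x y / w y) / S 1 x"
      using S1_pos[OF x] by (intro tendsto_intros lim x) auto
    then show ?thesis using w_pos[OF y] by (simp add: mult_ac)
  qed
  show "0 \<le> k t x y" if x: "x \<in> {0<..<1}"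
  proof -
    have "0 \<le> w y / h j * (u (a j) x / S 1 x)" for j
      using gd[of j] x w_pos[OF y] h[of j] unfolding good_def by (intro mult_nonneg_nonneg) auto
    then have "0 \<le> k t x y / S 1 x" by (intro LIMSEQ_le_const[OF lim'[OF x]]) auto
    then show ?thesis using S1_pos[OF x] by (simp add: zero_le_divide_iff)
  qed
  show "quasi_concave_on {0<..<1} (\<lambda>x. k t x y / S 1 x)"
    using gd w_pos[OF y] h by (intro quasi_concave_on_limit[OF quasi_concave_on_scale lim']) (auto simp: good_def less_imp_le)
qed

section \<open>Comparison of the measure with its ground state transform\<close>

definition \<rho> :: "real \<Rightarrow> real" where "\<rho> x = S 1 x / w x"

text \<open>Up to the factor \<open>- \<mu> 1\<close>, \<open>\<rho>\<close> is the derivative of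
  \<open>e 1\<close>. An operator with kernel \<open>\<rho> x * \<rho> y * K\<close> against
  \<open>M\<close> becomes, after division of functions by \<open>\<rho>\<close>, the operator with
  kernel K against \<open>m\<close>.\<close>

definition m :: "real measure" where "m = density M (\<lambda>x. ennreal ((\<rho> x)\<^sup>2))"

lemma \<rho>_pos: "x \<in> {0<..<1} \<Longrightarrow> 0 < \<rho> x"
  using S1_pos w_pos by (simp add: \<rho>_def)

lemma bm_\<rho>: "bm \<rho>"
  unfolding \<rho>_def[abs_def] by (intro bm_S_over_w) simp

lemma \<rho>_measurable [measurable]: "\<rho> \<in> borel_measurable M"
  using bm_\<rho> by (simp add: bm_def measurable_M)

lemma interval_sets_M [measurable]: "0 \<le> a \<Longrightarrow> b \<le> 1 \<Longrightarrow> {a<..<b} \<in> sets M"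
  by (auto simp: sets_M sets_restrict_space_iff)

lemma emeasure_M_interval:
  assumes "0 \<le> a" "a \<le> b" "b \<le> 1" shows "emeasure M {a<..<b} = ennreal (S 0 b - S 0 a)"
  using measure_M_interval[OF assms] by (simp add: M.emeasure_eq_measure)

text \<open>The mean value theorem where the weight is comparable to its extremal size. The middle
  half is kept in the conclusion because \<open>\<rho>\<close> has its lower bound there
  too.\<close>

lemma W_lower:
  obtains c where "0 < c"
    "\<And>a b. 0 \<le> a \<Longrightarrow> a < b \<Longrightarrow> b \<le> 1 \<Longrightarrow> c * (b powr \<beta> * (1 - a)\<^sup>2 * (b - a)) \<le> S 0 (b - (b - a) / 4) - S 0 (a + (b - a) / 4)"
proof
  define c where "c = 4 powr (- \<bar>\<beta>\<bar>) / (16 * A) / 2"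
  show "0 < c" using A_pos by (simp add: c_def)
  fix a b :: real assume ab: "0 \<le> a" "a < b" "b \<le> 1"
  define p q where "p = a + (b - a) / 4" and "q = b - (b - a) / 4"
  have pq: "p < q" "q - p = (b - a) / 2" using ab by (auto simp: p_def q_def field_simps)
  have mid: "x \<in> {0<..<1}" "4 powr (- \<bar>\<beta>\<bar>) / (16 * A) * (b powr \<beta> * (1 - a)\<^sup>2) \<le> w x" if "p \<le> x" "x \<le> q" for x
    using middle_half_bounds[OF ab, of x] that by (auto simp: p_def q_def)
  have "\<exists>z>p. z < q \<and> S 0 q - S 0 p = (q - p) * (w z * e 0 z)"
    using pq mid(1) by (intro MVT2 S_deriv) auto
  then obtain z where z: "p < z" "z < q" "S 0 q - S 0 p = (q - p) * (w z * e 0 z)" by blast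
  have "c * (b powr \<beta> * (1 - a)\<^sup>2 * (b - a)) = (q - p) * (4 powr (- \<bar>\<beta>\<bar>) / (16 * A) * (b powr \<beta> * (1 - a)\<^sup>2))"
    unfolding pq(2) c_def by simp
  also have "\<dots> \<le> (q - p) * w z" using mid(2)[of z] z pq by (intro mult_left_mono) auto
  also have "\<dots> = S 0 q - S 0 p" using z e_0[of z] mid(1)[of z] by simp
  finally show "c * (b powr \<beta> * (1 - a)\<^sup>2 * (b - a)) \<le> S 0 (b - (b - a) / 4) - S 0 (a + (b - a) / 4)"
    by (simp add: p_def q_def)
qed

text \<open>Concavity of \<open>S 1\<close> as a function of \<open>S 0\<close>: near the endpoints
  it lies above lines with the slopes \<open>e 1 a\<close> and \<open>e 1 b\<close>, in between
  above its minimum.\<close>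

lemma S1_lower:
  obtains c where "0 < c" "\<And>x. x \<in> {0..1} \<Longrightarrow> c * (S 0 x * (1 - S 0 x)) \<le> S 1 x"
proof -
  have "\<exists>z. z \<in> node_set 1" using e_zeros[of 1] by (auto simp: node_set_def card_1_singleton_iff)
  then obtain z where z: "z \<in> {0<..<1}" "e 1 z = 0" by (auto simp: node_set_def)
  define a b where "a = z / 2" and "b = (z + 1) / 2"
  have ab: "0 < a" "a < z" "z < b" "b < 1" using z by (auto simp: a_def b_def)
  have ea: "0 < e 1 a" using e1_decreasing[of a z] ab z by auto
  have eb: "e 1 b < 0" using e1_decreasing[of z b] ab z by auto
  obtain q where q: "q \<in> {a..b}" "\<And>x. x \<in> {a..b} \<Longrightarrow> S 1 q \<le> S 1 x"
    using continuous_attains_inf[of "{a..b}" "S 1"] ab continuous_on_subset[OF S_cont[of 1], of "{a..b}"] by auto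
  have Sq: "0 < S 1 q" using S1_pos[of q] q ab by auto
  define c where "c = min (e 1 a) (min (- e 1 b) (S 1 q))"
  have c0: "0 < c" using ea eb Sq by (simp add: c_def)
  have "c * (S 0 x * (1 - S 0 x)) \<le> S 1 x" if x: "x \<in> {0..1}" for x
  proof -
    have W: "0 \<le> S 0 x" "S 0 x \<le> 1" using W_bounds[OF x] by auto
    have V: "S 0 x * (1 - S 0 x) \<le> S 0 x" "S 0 x * (1 - S 0 x) \<le> 1 - S 0 x" "0 \<le> S 0 x * (1 - S 0 x)"
      using W by (auto intro: mult_left_le mult_left_le_one_le)
    then have V1: "S 0 x * (1 - S 0 x) \<le> 1" using W by linarith
    consider "x < a" | "b < x" | "x \<in> {a..b}" by fastforce
    then show ?thesis
    proof cases
      case 1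
      have "c * (S 0 x * (1 - S 0 x)) \<le> e 1 a * S 0 x" using V c0 by (intro mult_mono) (auto simp: c_def)
      also have "\<dots> \<le> e 1 x * S 0 x" using e1_decreasing[of x a] 1 x ab W by (intro mult_right_mono) auto
      also have "\<dots> \<le> S 1 x" using S1_increment(1)[of 0 x] x S_0 by auto
      finally show ?thesis .
    next
      case 2
      have "c * (S 0 x * (1 - S 0 x)) \<le> - e 1 b * (1 - S 0 x)" using V c0 eb by (intro mult_mono) (auto simp: c_def)
      also have "\<dots> \<le> - e 1 x * (1 - S 0 x)" using e1_decreasing[of b x] 2 x ab W by (intro mult_right_mono) auto
      also have "\<dots> \<le> S 1 x" using S1_increment(2)[of x 1] x S_1[of 0] S_1[of 1] by auto
      finally show ?thesis .
    next
      case 3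
      have "c * (S 0 x * (1 - S 0 x)) \<le> S 1 q * 1" using V V1 c0 Sq by (intro mult_mono) (auto simp: c_def)
      also have "\<dots> \<le> S 1 x" using q(2)[OF 3] by simp
      finally show ?thesis .
    qed
  qed
  with c0 show thesis by (rule that)
qed

text \<open>A count of powers: \<open>S 1\<close> is at least of the size of
  \<open>x powr (\<beta> + 1) * (1 - x) ^ 3\<close>, while \<open>w\<close> is at most of the size
  of \<open>x powr \<beta> * (1 - x) ^ 2\<close>.\<close>

lemma \<rho>_lower:
  obtains c where "0 < c" "\<And>x. x \<in> {0<..<1} \<Longrightarrow> c * (x * (1 - x)) \<le> \<rho> x"
proof -
  obtain c1 where c1: "0 < c1" "\<And>a b. 0 \<le> a \<Longrightarrow> a < b \<Longrightarrow> b \<le> 1 \<Longrightarrow>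
      c1 * (b powr \<beta> * (1 - a)\<^sup>2 * (b - a)) \<le> S 0 (b - (b - a) / 4) - S 0 (a + (b - a) / 4)"
    using W_lower by blast
  have c1': "c1 * (b powr \<beta> * (1 - a)\<^sup>2 * (b - a)) \<le> S 0 b - S 0 a" if "0 \<le> a" "a < b" "b \<le> 1" for a b
    using c1(2)[OF that] W_mono[of "b - (b - a) / 4" b] W_mono[of a "a + (b - a) / 4"] that by (auto simp: field_simps)
  obtain c2 where c2: "0 < c2" "\<And>x. x \<in> {0..1} \<Longrightarrow> c2 * (S 0 x * (1 - S 0 x)) \<le> S 1 x"
    using S1_lower by blast
  show thesis
  proof (rule that[of "c2 * c1\<^sup>2 / A"])
    show "0 < c2 * c1\<^sup>2 / A" using c1 c2 A_pos by simp
    fix x :: real assume x: "x \<in> {0<..<1}"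
    have w: "0 < w x" using w_pos[OF x] .
    have "c2 * c1\<^sup>2 / A * (x * (1 - x)) * w x \<le> c2 * c1\<^sup>2 / A * (x * (1 - x)) * (A * (x powr \<beta> * (1 - x)\<^sup>2))"
      using w_upper[OF x] x c2 A_pos by (intro mult_left_mono) auto
    also have "\<dots> = c2 * ((c1 * (x powr \<beta> * x)) * (c1 * ((1 - x)\<^sup>2 * (1 - x))))"
      using A_pos by (simp add: power2_eq_square)
    also have "\<dots> \<le> c2 * (S 0 x * (1 - S 0 x))"
      using c1'[of 0 x] c1'[of x 1] x S_0[of 0] S_1[of 0] c1 c2 W_bounds[of x]
      by (intro mult_left_mono mult_mono) auto
    also have "\<dots> \<le> S 1 x" using c2(2)[of x] x by auto
    finally show "c2 * c1\<^sup>2 / A * (x * (1 - x)) \<le> \<rho> x" using w by (simp add: \<rho>_def pos_le_divide_eq)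
  qed
qed

lemma \<rho>_upper:
  obtains C where "0 < C" "\<And>x. x \<in> {0<..<1} \<Longrightarrow> \<rho> x \<le> C * (x * (1 - x))"
proof -
  obtain C where C: "0 < C" "\<And>x. x \<in> {0<..<1} \<Longrightarrow> \<bar>S 1 x\<bar> \<le> C * (x * (1 - x) * w x)"
    using S_le_w[of 1] by auto
  have "\<rho> x \<le> C * (x * (1 - x))" if x: "x \<in> {0<..<1}" for x
    using C(2)[OF x] S1_pos[OF x] w_pos[OF x] by (simp add: \<rho>_def divide_le_eq mult_ac)
  with C(1) show thesis by (rule that)
qed

lemma emeasure_m: "B \<in> sets M \<Longrightarrow> emeasure m B = (\<integral>\<^sup>+x\<in>B. ennreal ((\<rho> x)\<^sup>2) \<partial>M)"
  unfolding m_def by (rule emeasure_density) measurable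

text \<open>The reason is that, on the middle half of an interval, \<open>\<rho>\<close> is comparable to its supremum over
  the interval.\<close>

lemma \<rho>_reverse_doubling:
  obtains C where "0 < C"
    "\<And>a b x y. 0 \<le> a \<Longrightarrow> b \<le> 1 \<Longrightarrow> x \<in> {a<..<b} \<Longrightarrow> y \<in> {a<..<b} \<Longrightarrow>
       ennreal (\<rho> x * \<rho> y) * emeasure M {a<..<b} \<le> ennreal C * emeasure m {a<..<b}"
proof -
  obtain c1 where c1: "0 < c1" "\<And>a b. 0 \<le> a \<Longrightarrow> a < b \<Longrightarrow> b \<le> 1 \<Longrightarrow>
      c1 * (b powr \<beta> * (1 - a)\<^sup>2 * (b - a)) \<le> S 0 (b - (b - a) / 4) - S 0 (a + (b - a) / 4)"
    using W_lower by blast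
  obtain C1 where C1: "0 < C1" "\<And>a b. 0 \<le> a \<Longrightarrow> a \<le> b \<Longrightarrow> b \<le> 1 \<Longrightarrow> S 0 b - S 0 a \<le> C1 * (b powr \<beta> * (1 - a)\<^sup>2 * (b - a))"
    using W_upper by blast
  obtain c2 where c2: "0 < c2" "\<And>x. x \<in> {0<..<1} \<Longrightarrow> c2 * (x * (1 - x)) \<le> \<rho> x" using \<rho>_lower by blast
  obtain C2 where C2: "0 < C2" "\<And>x. x \<in> {0<..<1} \<Longrightarrow> \<rho> x \<le> C2 * (x * (1 - x))" using \<rho>_upper by blast
  define C where "C = C2\<^sup>2 * C1 / ((c2 / 16)\<^sup>2 * c1)"
  show thesis
  proof (rule that[of C])
    show "0 < C" using c1 C1 c2 C2 by (simp add: C_def)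
    fix a b x y :: real assume ab: "0 \<le> a" "b \<le> 1" and x: "x \<in> {a<..<b}" and y: "y \<in> {a<..<b}"
    have ab': "a < b" using x by auto
    \<comment> \<open>R bounds \<open>z * (1 - z)\<close> on the interval from above and
      \<open>R / 16\<close> from below on its middle half; P is the order of magnitude of the mass
      of the interval and of its middle half.\<close>
    define R P where "R = b * (1 - a)" and "P = b powr \<beta> * (1 - a)\<^sup>2 * (b - a)"
    define p q where "p = a + (b - a) / 4" and "q = b - (b - a) / 4"
    have pq: "0 \<le> p" "a \<le> p" "p \<le> q" "q \<le> b" "q \<le> 1" using ab ab' by (auto simp: p_def q_def field_simps)
    have RP: "0 \<le> R" "0 \<le> P" using ab ab' by (auto simp: R_def P_def)
    have "\<rho> z \<le> C2 * R" if "z \<in> {a<..<b}" for z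
    proof -
      have z: "z \<in> {0<..<1}" using that ab by auto
      have "z * (1 - z) \<le> R" unfolding R_def using that ab by (intro mult_mono) auto
      then show ?thesis using C2(1) by (intro order_trans[OF C2(2)[OF z]] mult_left_mono) auto
    qed
    then have "\<rho> x * \<rho> y \<le> (C2 * R) * (C2 * R)"
      using x y \<rho>_pos[of y] \<rho>_pos[of x] ab C2 RP by (intro mult_mono) (auto simp: less_imp_le)
    then have "(\<rho> x * \<rho> y) * (S 0 b - S 0 a) \<le> ((C2 * R) * (C2 * R)) * (C1 * P)"
    proof (rule mult_mono)
      show "S 0 b - S 0 a \<le> C1 * P" using C1(2)[of a b] ab ab' by (simp add: P_def)
    qed (use ab ab' W_mono[of a b] RP C2 in auto)
    also have "\<dots> = C * ((c2 * R / 16)\<^sup>2 * (c1 * P))"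
      using c1 c2 by (simp add: C_def power2_eq_square)
    also have "\<dots> \<le> C * ((c2 * R / 16)\<^sup>2 * (S 0 q - S 0 p))"
      using c1(2)[OF ab(1) ab' ab(2)] \<open>0 < C\<close> by (intro mult_left_mono) (auto simp: P_def p_def q_def)
    finally have main: "(\<rho> x * \<rho> y) * (S 0 b - S 0 a) \<le> C * ((c2 * R / 16)\<^sup>2 * (S 0 q - S 0 p))" .
    have low: "(c2 * R / 16)\<^sup>2 \<le> (\<rho> z)\<^sup>2" if "z \<in> {p<..<q}" for z
    proof (rule power_mono)
      have z: "b / 4 \<le> z" "(1 - a) / 4 \<le> 1 - z" "z \<in> {0<..<1}"
        using middle_half_bounds[OF ab(1) ab' ab(2), of z] that by (auto simp: p_def q_def)
      have "(b / 4) * ((1 - a) / 4) \<le> z * (1 - z)" using z ab ab' by (intro mult_mono) auto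
      then have "R / 16 \<le> z * (1 - z)" by (simp add: R_def)
      then have "c2 * (R / 16) \<le> c2 * (z * (1 - z))" using c2 by (intro mult_left_mono) auto
      then show "c2 * R / 16 \<le> \<rho> z" using c2(2)[OF z(3)] by simp
    qed (use RP c2 in simp)
    have [measurable]: "{p<..<q} \<in> sets M" "{a<..<b} \<in> sets M" using pq ab by auto
    have "ennreal (\<rho> x * \<rho> y) * emeasure M {a<..<b} = ennreal ((\<rho> x * \<rho> y) * (S 0 b - S 0 a))"
      using emeasure_M_interval[of a b] ab ab' \<rho>_pos[of x] \<rho>_pos[of y] x y
      by (simp add: ennreal_mult'[symmetric] less_imp_le)
    also have "\<dots> \<le> ennreal (C * ((c2 * R / 16)\<^sup>2 * (S 0 q - S 0 p)))" using main by (rule ennreal_leI)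
    also have "\<dots> = ennreal C * (ennreal ((c2 * R / 16)\<^sup>2) * emeasure M {p<..<q})"
      using emeasure_M_interval[of p q] pq \<open>0 < C\<close> W_mono[of p q] by (simp add: ennreal_mult)
    also have "ennreal ((c2 * R / 16)\<^sup>2) * emeasure M {p<..<q} \<le> emeasure m {a<..<b}"
    proof -
      have "ennreal ((c2 * R / 16)\<^sup>2) * emeasure M {p<..<q} = (\<integral>\<^sup>+z. ennreal ((c2 * R / 16)\<^sup>2) * indicator {p<..<q} z \<partial>M)"
        by (simp add: nn_integral_cmult_indicator)
      also have "\<dots> \<le> (\<integral>\<^sup>+z\<in>{a<..<b}. ennreal ((\<rho> z)\<^sup>2) \<partial>M)"
        using low pq by (intro nn_integral_mono) (auto simp: indicator_def intro: ennreal_leI)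
      also have "\<dots> = emeasure m {a<..<b}" by (subst emeasure_m) auto
      finally show ?thesis .
    qed
    finally show "ennreal (\<rho> x * \<rho> y) * emeasure M {a<..<b} \<le> ennreal C * emeasure m {a<..<b}"
      by (simp add: mult_left_mono)
  qed
qed

lemma singleton_M: assumes "x \<in> {0<..<1}" shows "{x} \<in> sets M" "emeasure M {x} = 0"
proof -
  show s: "{x} \<in> sets M" using assms by (simp add: sets_M sets_restrict_space_iff)
  have "emeasure M {x} = (\<integral>\<^sup>+z\<in>{x}. ennreal (w z) \<partial>Leb)"
    using s unfolding M_def by (subst emeasure_density) auto
  also have "\<dots> = ennreal (w x) * emeasure Leb {x}" using s by (simp add: nn_integral_indicator_singleton sets_M)
  also have "emeasure Leb {x} = 0" using assms by (subst emeasure_restrict_space) auto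
  finally show "emeasure M {x} = 0" by simp
qed

sublocale IM: interval_measure M
proof
  show "space M = {0<..<1}" by (rule space_M)
  show "0 \<le> a \<Longrightarrow> b \<le> 1 \<Longrightarrow> {a<..<b} \<in> sets M" for a b by (rule interval_sets_M)
  show "0 < emeasure M {a<..<b}" if "0 \<le> a" "a < b" "b \<le> 1" for a b
    using emeasure_M_interval[of a b] W_strict_mono[of a b] that by simp
  show "{x} \<in> sets M \<and> emeasure M {x} = 0" if "x \<in> {0<..<1}" for x using singleton_M that by simp
qed

lemma space_m: "space m = {0<..<1}" and sets_m: "sets m = sets M"
  by (simp_all add: m_def space_M)

lemma finite_m: "emeasure m (space m) \<noteq> \<infinity>"
proof -
  obtain C where C: "\<forall>x\<in>{0<..<1}. \<bar>\<rho> x\<bar> \<le> C" using bm_\<rho> unfolding bm_def by blast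
  have "emeasure m (space m) = (\<integral>\<^sup>+x. ennreal ((\<rho> x)\<^sup>2) \<partial>M)"
    unfolding space_m space_M[symmetric] by (subst emeasure_m) (auto intro!: nn_integral_cong simp: indicator_def)
  also have "\<dots> \<le> (\<integral>\<^sup>+x. ennreal (C\<^sup>2) \<partial>M)"
  proof (rule nn_integral_mono)
    fix x assume "x \<in> space M"
    then have "\<bar>\<rho> x\<bar>\<^sup>2 \<le> C\<^sup>2" using C by (intro power_mono) (auto simp: space_M)
    then show "ennreal ((\<rho> x)\<^sup>2) \<le> ennreal (C\<^sup>2)" by (simp add: ennreal_leI)
  qed
  also have "\<dots> < \<infinity>" using emeasure_M_space by simp
  finally show ?thesis by simp
qed

lemma interval_measure_m: "interval_measure m"
proof (intro interval_measure.intro finite_measureI interval_measure_axioms.intro)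
  show "emeasure m (space m) \<noteq> \<infinity>" by (rule finite_m)
  show "space m = {0<..<1}" by (rule space_m)
  show "0 \<le> a \<Longrightarrow> b \<le> 1 \<Longrightarrow> {a<..<b} \<in> sets m" for a b by (simp add: sets_m)
  show "0 < emeasure m {a<..<b}" if ab: "0 \<le> a" "a < b" "b \<le> 1" for a b
  proof -
    obtain C where C: "0 < C" "\<And>a b x y. 0 \<le> a \<Longrightarrow> b \<le> 1 \<Longrightarrow> x \<in> {a<..<b} \<Longrightarrow> y \<in> {a<..<b} \<Longrightarrow>
       ennreal (\<rho> x * \<rho> y) * emeasure M {a<..<b} \<le> ennreal C * emeasure m {a<..<b}"
      using \<rho>_reverse_doubling by blast
    define x where "x = (a + b) / 2"
    have x: "x \<in> {a<..<b}" using ab by (simp add: x_def)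
    have "0 < \<rho> x" using x ab by (intro \<rho>_pos) auto
    then have "0 < ennreal (\<rho> x * \<rho> x) * emeasure M {a<..<b}"
      using IM.pos_M[OF ab] by (simp add: ennreal_zero_less_mult_iff)
    also have "\<dots> \<le> ennreal C * emeasure m {a<..<b}" using C(2) x ab by blast
    finally show ?thesis by (simp add: ennreal_zero_less_mult_iff)
  qed
  show "{x} \<in> sets m \<and> emeasure m {x} = 0" if x: "x \<in> {0<..<1}" for x
    using singleton_M[OF x] by (simp add: sets_m emeasure_m nn_integral_indicator_singleton)
qed

section \<open>The transformed kernel\<close>

definition K :: "real \<Rightarrow> real \<Rightarrow> real \<Rightarrow> real" where "K t x y = k t x y / (S 1 x * S 1 y)"

lemma k_measurable [measurable]: "(\<lambda>y. k t x y) \<in> borel_measurable M"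
proof -
  have [measurable]: "S n \<in> borel_measurable M" for n using bm_S[of n] by (simp add: bm_def measurable_M)
  show ?thesis unfolding k_def by measurable
qed

lemma K_measurable: "K t x \<in> borel_measurable M"
proof -
  have [measurable]: "S n \<in> borel_measurable M" for n using bm_S[of n] by (simp add: bm_def measurable_M)
  show ?thesis unfolding K_def[abs_def] by measurable
qed

text \<open>By orthogonality of the \<open>S n / w\<close>, only n = 1 survives integration against
  \<open>S 1 / w\<close>, leaving \<open>exp (- t * \<mu> 1)\<close>. Bounds for the integrals of
  the absolute terms justify the exchange of sum and integral.\<close>

lemma K_mass:
  assumes t: "0 < t" and x: "x \<in> {0<..<1}"
  shows "(\<integral>\<^sup>+y. ennreal (K t x y) \<partial>m) \<le> 1"
proof -
  define f where "f n y = \<mu> n * exp (- t * \<mu> n) * S n x / S 1 x * (S n y / w y * (S 1 y / w y))" for n y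
  have S1x: "0 < S 1 x" using S1_pos[OF x] .
  have bf: "bm (f n)" for n
  proof (cases "n = 0")
    case False
    then show ?thesis unfolding f_def by (intro bm_mult bm_const bm_S_over_w) auto
  qed (simp add: f_def[abs_def] \<mu>_0)
  obtain B where B: "0 < B" "\<And>x. x \<in> {0<..<1} \<Longrightarrow> \<bar>S 1 x / w x\<bar> \<le> B" using S1_over_w_bound by blast
  have norm_int: "(LINT y|M. norm (f n y)) \<le> \<mu> n * exp (- t * \<mu> n) * (B / (S 1 x * sqrt (\<mu> 1)))" for n
  proof (cases "n = 0")
    case False
    then have n: "1 \<le> n" by simp
    have "(LINT y|M. norm (f n y)) \<le> (LINT y|M. \<mu> n * exp (- t * \<mu> n) / S 1 x * B * \<bar>S n y / w y\<bar>)"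
    proof (rule integral_mono)
      show "integrable M (\<lambda>y. norm (f n y))" using bm_integrable[OF bf[of n]] by (rule integrable_norm)
      show "integrable M (\<lambda>y. \<mu> n * exp (- t * \<mu> n) / S 1 x * B * \<bar>S n y / w y\<bar>)"
        by (intro integrable_mult_right integrable_abs bm_integrable bm_S_over_w n)
      fix y assume "y \<in> space M"
      then have y: "y \<in> {0<..<1}" by (simp add: space_M)
      have "norm (f n y) = \<mu> n * exp (- t * \<mu> n) * \<bar>S n x\<bar> / S 1 x * (\<bar>S n y / w y\<bar> * \<bar>S 1 y / w y\<bar>)"
        using S1x \<mu>_nonneg[of n] unfolding f_def real_norm_def abs_mult abs_divide[of "_ * _" "S 1 x"] by simp
      also have "\<dots> \<le> \<mu> n * exp (- t * \<mu> n) * 1 / S 1 x * (\<bar>S n y / w y\<bar> * B)"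
        using abs_S_le_1[of x n] x B(2)[OF y] S1x \<mu>_nonneg[of n]
        by (intro mult_mono divide_right_mono mult_left_mono) auto
      finally show "norm (f n y) \<le> \<mu> n * exp (- t * \<mu> n) / S 1 x * B * \<bar>S n y / w y\<bar>" by (simp add: mult_ac)
    qed
    also have "\<dots> = \<mu> n * exp (- t * \<mu> n) / S 1 x * B * (LINT y|M. \<bar>S n y / w y\<bar>)"
      by (simp only: integral_mult_right_zero)
    also have "\<dots> \<le> \<mu> n * exp (- t * \<mu> n) / S 1 x * B * (1 / sqrt (\<mu> 1))"
    proof (rule mult_left_mono)
      have "1 / sqrt (\<mu> n) \<le> 1 / sqrt (\<mu> 1)"
        using \<mu>_pos[of 1] n strict_mono_less_eq[OF \<mu>_strict, of 1 n] by (intro divide_left_mono) auto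
      then show "(LINT y|M. \<bar>S n y / w y\<bar>) \<le> 1 / sqrt (\<mu> 1)" using integral_abs_S_over_w[OF n] by simp
    qed (use B S1x \<mu>_nonneg in auto)
    finally show ?thesis by (simp add: mult_ac)
  qed (simp add: f_def \<mu>_0)
  have int_f: "integrable M (f n)" for n using bf by (rule bm_integrable)
  have sum_norm: "summable (\<lambda>n. LINT y|M. norm (f n y))"
  proof (rule summable_comparison_test'[where N = 0])
    show "summable (\<lambda>n. \<mu> n * exp (- t * \<mu> n) * (B / (S 1 x * sqrt (\<mu> 1))))"
      by (intro summable_mult2 summable_\<mu>_exp t)
    show "norm (LINT y|M. norm (f n y)) \<le> \<mu> n * exp (- t * \<mu> n) * (B / (S 1 x * sqrt (\<mu> 1)))" for n
      using norm_int[of n] by (simp only: real_norm_def abs_of_nonneg[OF integral_nonneg_AE] AE_I2 abs_ge_zero)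
  qed
  have f_sums: "f n y = \<mu> n * exp (- t * \<mu> n) * (S n x * S n y) * (S 1 y / (S 1 x * (w y)\<^sup>2))" for n y
    by (simp add: f_def power2_eq_square)
  have AE_sum: "AE y in M. summable (\<lambda>n. norm (f n y))"
  proof (rule AE_I2)
    fix y assume "y \<in> space M"
    then have y: "y \<in> {0..1}" by (simp add: space_M)
    have "summable (\<lambda>n. norm (\<mu> n * exp (- t * \<mu> n) * (S n x * S n y)))"
      by (rule summable_comparison_test'[OF summable_\<mu>_exp[OF t], of 0])
        (use k_term_bound[of x y] x y in simp)
    then show "summable (\<lambda>n. norm (f n y))" unfolding f_sums norm_mult[of "_ * (S _ x * S _ y)"] by (rule summable_mult2)
  qed
  have suminf_f: "(\<Sum>n. f n y) = (\<rho> y)\<^sup>2 * K t x y" if y: "y \<in> {0<..<1}" for y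
  proof -
    have "(\<Sum>n. f n y) = k t x y * (S 1 y / (S 1 x * (w y)\<^sup>2))"
      unfolding f_sums k_def using x y by (intro suminf_mult2[symmetric] k_summable t) auto
    then show ?thesis using S1_pos[OF y] by (simp add: \<rho>_def K_def power2_eq_square mult_ac)
  qed
  have "integrable M (\<lambda>y. \<Sum>n. f n y)" by (rule integrable_suminf[OF int_f AE_sum sum_norm])
  have "(\<integral>\<^sup>+y. ennreal (K t x y) \<partial>m) = (\<integral>\<^sup>+y. ennreal ((\<rho> y)\<^sup>2) * ennreal (K t x y) \<partial>M)"
    unfolding m_def using K_measurable by (intro nn_integral_density) auto
  also have "\<dots> = (\<integral>\<^sup>+y. ennreal (\<Sum>n. f n y) \<partial>M)"
    by (intro nn_integral_cong) (simp add: space_M suminf_f ennreal_mult')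
  also have "\<dots> = ennreal (LINT y|M. (\<Sum>n. f n y))"
  proof (rule nn_integral_eq_integral)
    show "AE y in M. 0 \<le> (\<Sum>n. f n y)"
    proof (rule AE_I2)
      fix y assume "y \<in> space M"
      then have y: "y \<in> {0<..<1}" by (simp add: space_M)
      have "0 \<le> K t x y" unfolding K_def
        using k_nonneg_quasi_concave(1)[OF t y x] S1_pos[OF x] S1_pos[OF y] by simp
      then show "0 \<le> (\<Sum>n. f n y)" by (simp add: suminf_f[OF y])
    qed
  qed fact
  also have "(LINT y|M. (\<Sum>n. f n y)) = (\<Sum>n. LINT y|M. f n y)"
    by (rule integral_suminf[OF int_f AE_sum sum_norm])
  also have "(\<lambda>n. LINT y|M. f n y) = (\<lambda>n. if n = 1 then exp (- t * \<mu> 1) else 0)"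
  proof
    fix n
    show "(LINT y|M. f n y) = (if n = 1 then exp (- t * \<mu> 1) else 0)"
    proof (cases "n = 0")
      case False
      then have "(LINT y|M. f n y) = \<mu> n * exp (- t * \<mu> n) * S n x / S 1 x * (if n = 1 then 1 / \<mu> 1 else 0)"
        unfolding f_def by (subst integral_mult_right_zero, subst S_orthogonal) auto
      then show ?thesis using S1x \<mu>_pos[of 1] by simp
    qed (simp add: f_def \<mu>_0)
  qed
  also have "(\<Sum>n. if n = 1 then exp (- t * \<mu> 1) else 0) = exp (- t * \<mu> 1)"
    using sums_single[of 1 "\<lambda>_. exp (- t * \<mu> 1)"] by (simp add: sums_iff)
  also have "ennreal (exp (- t * \<mu> 1)) \<le> 1" using t \<mu>_nonneg[of 1] by simp
  finally show ?thesis .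
qed

lemma unimodal_kernel_K:
  assumes t: "0 < t" shows "unimodal_kernel m (K t)"
proof (intro unimodal_kernel.intro interval_measure_m unimodal_kernel_axioms.intro)
  fix x :: real assume x: "x \<in> {0<..<1}"
  show "K t x \<in> borel_measurable m" using K_measurable by (simp add: m_def)
  show "(\<integral>\<^sup>+y. ennreal (K t x y) \<partial>m) \<le> 1" by (rule K_mass[OF t x])
  have "quasi_concave_on {0<..<1} (\<lambda>y. 1 / S 1 x * (k t y x / S 1 y))"
    by (rule quasi_concave_on_scale[OF _ k_nonneg_quasi_concave(2)[OF t x]]) (use S1_pos[OF x] in simp)
  moreover have "K t x = (\<lambda>y. 1 / S 1 x * (k t y x / S 1 y))" by (auto simp: K_def k_sym[of t x])
  ultimately show "quasi_concave_on {0<..<1} (K t x)" by (simp only:)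
  fix y :: real assume y: "y \<in> {0<..<1}"
  show "0 \<le> K t x y" unfolding K_def
    using k_nonneg_quasi_concave(1)[OF t y x] S1_pos[OF x] S1_pos[OF y] by simp
  show "K t x y = K t y x" by (simp add: K_def k_sym[of t x y] mult.commute)
  have "(k t x y)\<^sup>2 \<le> k t x x * k t y y"
    using sum_product_square_le[of "\<lambda>n. \<mu> n * exp (- t * \<mu> n)" "\<lambda>n. S n x" "\<lambda>n. S n y"]
      k_summable[OF t, of x x] k_summable[OF t, of x y] k_summable[OF t, of y y] x y \<mu>_exp_nonneg
    by (simp add: k_def power2_eq_square)
  then have "(k t x y)\<^sup>2 / (S 1 x * S 1 y)\<^sup>2 \<le> k t x x * k t y y / (S 1 x * S 1 y)\<^sup>2"
    by (rule divide_right_mono) simp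
  then show "(K t x y)\<^sup>2 \<le> K t x x * K t y y"
    by (simp add: K_def power_divide power2_eq_square mult_ac)
qed

section \<open>Domination of the heat operators by the maximal function\<close>

definition h :: "real \<Rightarrow> real \<Rightarrow> real \<Rightarrow> real" where "h t x y = k t x y / (w x * w y)"

text \<open>As \<open>De n = - \<mu> n * S n / w\<close>, \<open>h\<close> is the series of
  \<open>exp (- t * \<mu> n) * De n x * De n y / \<mu> n\<close>; in this form it can be compared
  with the transformed kernel.\<close>

lemma h_eq: "x \<in> {0<..<1} \<Longrightarrow> y \<in> {0<..<1} \<Longrightarrow> h t x y = \<rho> x * \<rho> y * K t x y"
  using S1_pos[of x] S1_pos[of y] by (simp add: h_def \<rho>_def K_def)

lemma h_nonneg: "0 < t \<Longrightarrow> x \<in> {0<..<1} \<Longrightarrow> y \<in> {0<..<1} \<Longrightarrow> 0 \<le> h t x y"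
  using k_nonneg_quasi_concave(1)[of t y x] w_pos[of x] w_pos[of y] by (simp add: h_def)

text \<open>Apply \<open>kernel_integral_le\<close> to \<open>K t\<close>, the measure
  \<open>m\<close> and the function \<open>cmod (f y) / \<rho> y\<close>. On an interval around x
  its \<open>m\<close>-integral is the \<open>M\<close>-integral of
  \<open>\<rho> y * cmod (f y)\<close>, and reverse doubling trades \<open>\<rho> y\<close> for
  \<open>C / \<rho> x\<close> and the ratio of the two masses. The factor \<open>\<rho> x\<close> in
  \<open>h\<close> cancels the denominator.\<close>

theorem heat_le_maximal:
  obtains C where "0 < C"
    "\<And>t x (f :: real \<Rightarrow> complex). 0 < t \<Longrightarrow> x \<in> {0<..<1} \<Longrightarrow> f \<in> borel_measurable M \<Longrightarrow>
       ennreal (cmod (LINT y|M. h t x y *\<^sub>R f y)) \<le> ennreal C * interval_maximal M (\<lambda>y. ennreal (cmod (f y))) x"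
proof -
  obtain C where C: "0 < C" "\<And>a b x y. 0 \<le> a \<Longrightarrow> b \<le> 1 \<Longrightarrow> x \<in> {a<..<b} \<Longrightarrow> y \<in> {a<..<b} \<Longrightarrow>
       ennreal (\<rho> x * \<rho> y) * emeasure M {a<..<b} \<le> ennreal C * emeasure m {a<..<b}"
    using \<rho>_reverse_doubling by blast
  show thesis
  proof (rule that[of "2 * C"])
    show "0 < 2 * C" using C by simp
    fix t x :: real and f :: "real \<Rightarrow> complex"
    assume t: "0 < t" and x: "x \<in> {0<..<1}" and f[measurable]: "f \<in> borel_measurable M"
    interpret UK: unimodal_kernel m "K t" by (rule unimodal_kernel_K[OF t])
    define F where "F y = ennreal (cmod (f y))" for y
    have [measurable]: "F \<in> borel_measurable M" unfolding F_def by measurable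
    define g where "g y = ennreal (1 / \<rho> y) * F y" for y
    have gM[measurable]: "g \<in> borel_measurable M" unfolding g_def by measurable
    then have gm: "g \<in> borel_measurable m" by (simp add: m_def)
    have Km[measurable]: "K t x \<in> borel_measurable M" by (rule K_measurable)
    have \<rho>x: "0 < \<rho> x" using \<rho>_pos[OF x] .
    define B where "B = ennreal (C / \<rho> x) * interval_maximal M F x"
    have ub: "(\<integral>\<^sup>+y. ennreal (K t x y) * g y \<partial>m) \<le> 2 * B"
    proof (rule UK.kernel_integral_le[OF x gm])
      fix a b assume ab: "0 \<le> a" "a < x" "x < b" "b \<le> 1"
      have ab_s[measurable]: "{a<..<b} \<in> sets M" using ab by simp
      have mpos: "emeasure M {a<..<b} \<noteq> 0" "emeasure M {a<..<b} \<noteq> \<infinity>"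
        using IM.pos_M[of a b] ab by (auto simp: less_top)
      \<comment> \<open>Reverse doubling with x kept fixed, solved for
        \<open>\<rho> y\<close>.\<close>
      have point: "ennreal (\<rho> y) \<le> ennreal (C / \<rho> x) * emeasure m {a<..<b} / emeasure M {a<..<b}" if y: "y \<in> {a<..<b}" for y
      proof -
        have y01: "y \<in> {0<..<1}" using y ab by auto
        have "ennreal (1 / \<rho> x) * (ennreal (\<rho> x * \<rho> y) * emeasure M {a<..<b}) \<le> ennreal (1 / \<rho> x) * (ennreal C * emeasure m {a<..<b})"
          using C(2)[of a b x y] ab y by (intro mult_left_mono) auto
        then have "ennreal (\<rho> y) * emeasure M {a<..<b} \<le> ennreal (C / \<rho> x) * emeasure m {a<..<b}"
          using \<rho>x \<rho>_pos[OF y01] C(1) by (simp add: mult.assoc[symmetric] ennreal_mult'[symmetric])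
        then have "ennreal (\<rho> y) * emeasure M {a<..<b} / emeasure M {a<..<b} \<le> ennreal (C / \<rho> x) * emeasure m {a<..<b} / emeasure M {a<..<b}"
          by (rule divide_right_mono_ennreal)
        then show ?thesis using mpos by (simp add: mult_divide_eq_ennreal)
      qed
      have "(\<integral>\<^sup>+y\<in>{a<..<b}. g y \<partial>m) = (\<integral>\<^sup>+y. ennreal ((\<rho> y)\<^sup>2) * (g y * indicator {a<..<b} y) \<partial>M)"
        unfolding m_def by (intro nn_integral_density) auto
      also have "\<dots> \<le> (\<integral>\<^sup>+y. (ennreal (C / \<rho> x) * emeasure m {a<..<b} / emeasure M {a<..<b}) * (F y * indicator {a<..<b} y) \<partial>M)"
      proof (rule nn_integral_mono)
        fix y
        show "ennreal ((\<rho> y)\<^sup>2) * (g y * indicator {a<..<b} y) \<le> (ennreal (C / \<rho> x) * emeasure m {a<..<b} / emeasure M {a<..<b}) * (F y * indicator {a<..<b} y)"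
        proof (cases "y \<in> {a<..<b}")
          case True
          then have "0 < \<rho> y" using ab by (intro \<rho>_pos) auto
          then have "ennreal ((\<rho> y)\<^sup>2) * g y = ennreal (\<rho> y) * F y"
            unfolding g_def by (simp add: mult.assoc[symmetric] ennreal_mult'[symmetric] power2_eq_square)
          then show ?thesis using True mult_right_mono[OF point[OF True], of "F y"] by simp
        qed simp
      qed
      also have "\<dots> = (ennreal (C / \<rho> x) * emeasure m {a<..<b} / emeasure M {a<..<b}) * (\<integral>\<^sup>+y\<in>{a<..<b}. F y \<partial>M)"
        by (rule nn_integral_cmult) measurable
      also have "\<dots> \<le> (ennreal (C / \<rho> x) * emeasure m {a<..<b} / emeasure M {a<..<b}) * (interval_maximal M F x * emeasure M {a<..<b})"
        using ab by (intro mult_left_mono IM.interval_integral_le_maximal) auto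
      also have "\<dots> = (ennreal (C / \<rho> x) * emeasure m {a<..<b}) / emeasure M {a<..<b} * emeasure M {a<..<b} * interval_maximal M F x"
        by (simp only: mult_ac)
      also have "\<dots> = B * emeasure m {a<..<b}"
        unfolding ennreal_divide_mult_cancel[OF mpos] B_def by (simp only: mult_ac)
      finally show "(\<integral>\<^sup>+y\<in>{a<..<b}. g y \<partial>m) \<le> B * emeasure m {a<..<b}" .
    qed
    have "(\<integral>\<^sup>+y. ennreal (K t x y) * g y \<partial>m) = (\<integral>\<^sup>+y. ennreal ((\<rho> y)\<^sup>2) * (ennreal (K t x y) * g y) \<partial>M)"
      unfolding m_def by (intro nn_integral_density) auto
    moreover have "ennreal (\<rho> x) * (\<integral>\<^sup>+y. ennreal ((\<rho> y)\<^sup>2) * (ennreal (K t x y) * g y) \<partial>M) = (\<integral>\<^sup>+y. ennreal (norm (h t x y *\<^sub>R f y)) \<partial>M)"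
    proof -
      have "ennreal (\<rho> x) * (\<integral>\<^sup>+y. ennreal ((\<rho> y)\<^sup>2) * (ennreal (K t x y) * g y) \<partial>M)
        = (\<integral>\<^sup>+y. ennreal (\<rho> x) * (ennreal ((\<rho> y)\<^sup>2) * (ennreal (K t x y) * g y)) \<partial>M)"
        by (rule nn_integral_cmult[symmetric]) measurable
      also have "\<dots> = (\<integral>\<^sup>+y. ennreal (norm (h t x y *\<^sub>R f y)) \<partial>M)"
      proof (rule nn_integral_cong)
        fix y assume "y \<in> space M"
        then have y: "y \<in> {0<..<1}" by (simp add: space_M)
        have "0 < \<rho> y" using \<rho>_pos[OF y] .
        have "norm (h t x y *\<^sub>R f y) = \<rho> x * ((\<rho> y)\<^sup>2 * (K t x y * (1 / \<rho> y * cmod (f y))))"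
          using h_nonneg[OF t x y] h_eq[OF x y, of t] \<open>0 < \<rho> y\<close> by (simp add: power2_eq_square)
        then show "ennreal (\<rho> x) * (ennreal ((\<rho> y)\<^sup>2) * (ennreal (K t x y) * g y)) = ennreal (norm (h t x y *\<^sub>R f y))"
        proof -
          have "ennreal p * (ennreal q * (ennreal r * (ennreal s * ennreal v))) = ennreal (p * (q * (r * (s * v))))"
            if "0 \<le> p" "0 \<le> q" "0 \<le> r" "0 \<le> s" "0 \<le> v" for p q r s v :: real
            using that by (simp add: ennreal_mult)
          from this[of "\<rho> x" "(\<rho> y)\<^sup>2" "K t x y" "1 / \<rho> y" "cmod (f y)"] show ?thesis
            using \<rho>x \<open>0 < \<rho> y\<close> UK.K_nonneg[OF x y]
            unfolding g_def F_def \<open>norm (h t x y *\<^sub>R f y) = _\<close> by simp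
        qed
      qed
      finally show ?thesis .
    qed
    ultimately have "(\<integral>\<^sup>+y. ennreal (norm (h t x y *\<^sub>R f y)) \<partial>M) = ennreal (\<rho> x) * (\<integral>\<^sup>+y. ennreal (K t x y) * g y \<partial>m)"
      by (simp only:)
    also have "\<dots> \<le> ennreal (\<rho> x) * (2 * B)" using ub by (rule mult_left_mono) simp
    also have "\<dots> = 2 * (ennreal (\<rho> x) * ennreal (C / \<rho> x)) * interval_maximal M F x"
      unfolding B_def by (simp only: mult_ac)
    also have "ennreal (\<rho> x) * ennreal (C / \<rho> x) = ennreal C"
      using \<rho>x C(1) by (simp add: ennreal_mult'[symmetric])
    also have "2 * ennreal C = ennreal (2 * C)" using C(1) by (simp add: ennreal_mult)
    finally have le: "(\<integral>\<^sup>+y. ennreal (norm (h t x y *\<^sub>R f y)) \<partial>M) \<le> ennreal (2 * C) * interval_maximal M F x" .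
    show "ennreal (cmod (LINT y|M. h t x y *\<^sub>R f y)) \<le> ennreal (2 * C) * interval_maximal M (\<lambda>y. ennreal (cmod (f y))) x"
    \<comment> \<open>A non-integrable integrand has integral 0 by convention, and the bound is
      trivial.\<close>
    proof (cases "integrable M (\<lambda>y. h t x y *\<^sub>R f y)")
      case True
      have "ennreal (norm (LINT y|M. h t x y *\<^sub>R f y)) \<le> (\<integral>\<^sup>+y. ennreal (norm (h t x y *\<^sub>R f y)) \<partial>M)"
        using True by (rule integral_norm_bound_ennreal)
      also note le
      finally show ?thesis by (simp add: F_def[abs_def])
    qed (simp add: not_integrable_integral_eq)
  qed
qed

section \<open>Continuity of the heat operators in the space variable\<close>

lemma k_continuous:
  assumes t: "0 < t" and y: "y \<in> {0..1}"
  shows "continuous_on {0..1} (\<lambda>x. k t x y)"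
  unfolding k_def
proof (rule uniform_limit_theorem)
  show "uniform_limit {0..1} (\<lambda>N x. \<Sum>n<N. \<mu> n * exp (- t * \<mu> n) * (S n x * S n y)) (\<lambda>x. \<Sum>n. \<mu> n * exp (- t * \<mu> n) * (S n x * S n y)) sequentially"
    by (rule Weierstrass_m_test[OF k_term_bound[OF _ y] summable_\<mu>_exp[OF t]])
  show "\<forall>\<^sub>F N in sequentially. continuous_on {0..1} (\<lambda>x. \<Sum>n<N. \<mu> n * exp (- t * \<mu> n) * (S n x * S n y))"
    by (intro always_eventually allI continuous_intros S_cont)
qed simp

lemma k_le: "0 < t \<Longrightarrow> x \<in> {0..1} \<Longrightarrow> y \<in> {0..1} \<Longrightarrow> k t x y \<le> (\<Sum>n. \<mu> n * exp (- t * \<mu> n))"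
proof -
  assume a: "0 < t" "x \<in> {0..1}" "y \<in> {0..1}"
  have "\<mu> n * exp (- t * \<mu> n) * (S n x * S n y) \<le> \<mu> n * exp (- t * \<mu> n)" for n
    using k_term_bound[OF a(2,3), of n t] by (simp only: real_norm_def abs_le_D1)
  then show ?thesis unfolding k_def by (intro suminf_le k_summable summable_\<mu>_exp a)
qed

text \<open>Off a neighbourhood of the compact set the kernel is controlled by its unimodality.\<close>

lemma K_locally_bounded:
  assumes t: "0 < t" and cd: "0 < c" "c \<le> d" "d < 1"
  obtains D where "\<And>x y. x \<in> {c..d} \<Longrightarrow> y \<in> {0<..<1} \<Longrightarrow> K t x y \<le> D"
proof -
  interpret UK: unimodal_kernel m "K t" by (rule unimodal_kernel_K[OF t])
  define c' d' where "c' = c / 2" and "d' = (d + 1) / 2"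
  have c'd': "0 < c'" "c' < c" "d < d'" "d' < 1" using cd by (auto simp: c'_def d'_def)
  obtain q where q: "q \<in> {c'..d'}" "\<And>x. x \<in> {c'..d'} \<Longrightarrow> S 1 q \<le> S 1 x"
    using continuous_attains_inf[of "{c'..d'}" "S 1"] c'd' cd continuous_on_subset[OF S_cont[of 1], of "{c'..d'}"] by auto
  have Sq: "0 < S 1 q" using S1_pos[of q] q c'd' by auto
  define Z where "Z = (\<Sum>n. \<mu> n * exp (- t * \<mu> n))"
  have Z0: "0 \<le> Z" unfolding Z_def by (intro suminf_nonneg summable_\<mu>_exp t \<mu>_exp_nonneg)
  have inner: "K t x y \<le> Z / (S 1 q * S 1 q)" if xy: "x \<in> {c'..d'}" "y \<in> {c'..d'}" for x y
  proof -
    have "K t x y \<le> Z / (S 1 x * S 1 y)" unfolding K_def Z_def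
      using k_le[OF t, of x y] xy c'd' S1_pos[of x] S1_pos[of y] by (intro divide_right_mono) auto
    also have "\<dots> \<le> Z / (S 1 q * S 1 q)"
      using q(2)[OF xy(1)] q(2)[OF xy(2)] Sq Z0 by (intro divide_left_mono mult_mono) auto
    finally show ?thesis .
  qed
  \<comment> \<open>If y lies outside the larger interval, one of the two collars separates it from
    x, and \<open>kernel_gap\<close> bounds the kernel by the reciprocal of the mass of that
    collar.\<close>
  define m0 where "m0 = min (measure m {c'<..<c}) (measure m {d<..<d'})"
  have m0: "0 < m0" unfolding m0_def
    using UK.pos_M[of c' c] UK.pos_M[of d d'] c'd' cd by (simp add: UK.emeasure_eq_measure)
  have "K t x y \<le> max (Z / (S 1 q * S 1 q)) (1 / m0)" if x: "x \<in> {c..d}" and y: "y \<in> {0<..<1}" for x y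
  proof (cases "y \<in> {c'..d'}")
    case True
    then show ?thesis using inner[of x y] x c'd' by auto
  next
    case False
    have x01: "x \<in> {0<..<1}" using x cd by auto
    show ?thesis
    proof (cases "K t x x < K t x y")
      case False
      then show ?thesis using inner[of x x] x c'd' by auto
    next
      case True
      have [measurable]: "{min x y<..<max x y} \<in> sets m" using UK.sets_M x01 y by auto
      have "{c'<..<c} \<subseteq> {min x y<..<max x y} \<or> {d<..<d'} \<subseteq> {min x y<..<max x y}"
        using False x y by auto
      then have "m0 \<le> measure m {min x y<..<max x y}"
        using UK.finite_measure_mono[of "{c'<..<c}" "{min x y<..<max x y}"]
          UK.finite_measure_mono[of "{d<..<d'}" "{min x y<..<max x y}"]
        unfolding m0_def by (auto intro: min.coboundedI1 min.coboundedI2)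
      then have "K t x y * m0 \<le> K t x y * measure m {min x y<..<max x y}"
        using UK.K_nonneg[OF x01 y] by (rule mult_left_mono)
      also have "\<dots> \<le> 1"
        using UK.kernel_gap[OF x01 y True] UK.K_nonneg[OF x01 y]
        by (simp add: UK.emeasure_eq_measure ennreal_mult'[symmetric] del: ennreal_1 flip: ennreal_1)
      finally have "K t x y \<le> 1 / m0" using m0 by (simp add: le_divide_eq)
      then show ?thesis by simp
    qed
  qed
  then show thesis by (rule that)
qed

text \<open>Dominated convergence; for an f that is merely integrable this needs a bound of the
  kernel uniform in y up to the endpoints, where \<open>S 1\<close> in the denominator of
  \<open>K\<close> vanishes. Continuity for each t is what makes the supremum over t
  measurable.\<close>

theorem heat_continuous:
  fixes f :: "real \<Rightarrow> complex"
  assumes t: "0 < t" and f: "integrable M f"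
  shows "continuous_on {0<..<1} (\<lambda>x. LINT y|M. h t x y *\<^sub>R f y)"
proof (rule continuous_on_sequentiallyI)
  fix X and a :: real assume X: "\<forall>n. X n \<in> {0<..<1}" and a: "a \<in> {0<..<1}" and lim: "X \<longlonglongrightarrow> a"
  define c d where "c = a / 2" and "d = (a + 1) / 2"
  have cd: "0 < c" "c < a" "a < d" "d < 1" using a by (auto simp: c_def d_def)
  obtain D where D: "\<And>x y. x \<in> {c..d} \<Longrightarrow> y \<in> {0<..<1} \<Longrightarrow> K t x y \<le> D"
    using K_locally_bounded[OF t, of c d] cd by auto
  obtain R where R: "\<forall>x\<in>{0<..<1}. \<bar>\<rho> x\<bar> \<le> R" using bm_\<rho> unfolding bm_def by blast
  have R0: "0 \<le> R" using R a by (meson abs_ge_zero order_trans)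
  have "eventually (\<lambda>n. X n \<in> {c<..<d}) sequentially"
    using lim cd by (intro topological_tendstoD) auto
  then obtain N where N: "\<And>n. N \<le> n \<Longrightarrow> X n \<in> {c<..<d}" by (auto simp: eventually_sequentially)
  have [measurable]: "f \<in> borel_measurable M" "w \<in> borel_measurable M" using borel_measurable_integrable[OF f] w_measurable by (simp_all add: measurable_M)
  have hm: "(\<lambda>y. h t x y *\<^sub>R f y) \<in> borel_measurable M" for x unfolding h_def by measurable
  have "(\<lambda>n. LINT y|M. h t (X (n + N)) y *\<^sub>R f y) \<longlonglongrightarrow> (LINT y|M. h t a y *\<^sub>R f y)"
  proof (rule integral_dominated_convergence[where w = "\<lambda>y. R * R * \<bar>D\<bar> * norm (f y)"])
    show "integrable M (\<lambda>y. R * R * \<bar>D\<bar> * norm (f y))" by (intro integrable_mult_right integrable_norm f)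
    show "AE y in M. (\<lambda>n. h t (X (n + N)) y *\<^sub>R f y) \<longlonglongrightarrow> h t a y *\<^sub>R f y"
    proof (rule AE_I2)
      fix y assume "y \<in> space M"
      then have y: "y \<in> {0<..<1}" by (simp add: space_M)
      have "continuous_on {0<..<1} (\<lambda>x. h t x y)" unfolding h_def
      proof (intro continuous_on_divide continuous_on_mult w_cont continuous_on_const ballI)
        show "continuous_on {0<..<1} (\<lambda>x. k t x y)" using y by (intro continuous_on_subset[OF k_continuous[OF t]]) auto
        show "w x * w y \<noteq> 0" if "x \<in> {0<..<1}" for x using w_pos[OF that] w_pos[OF y] by simp
      qed
      moreover have "(\<lambda>n. X (n + N)) \<longlonglongrightarrow> a" using lim by (rule LIMSEQ_ignore_initial_segment)
      ultimately have "(\<lambda>n. h t (X (n + N)) y) \<longlonglongrightarrow> h t a y"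
        using X a by (intro continuous_on_tendsto_compose[of "{0<..<1}" "\<lambda>x. h t x y"]) auto
      then show "(\<lambda>n. h t (X (n + N)) y *\<^sub>R f y) \<longlonglongrightarrow> h t a y *\<^sub>R f y" by (intro tendsto_intros)
    qed
    show "AE y in M. norm (h t (X (n + N)) y *\<^sub>R f y) \<le> R * R * \<bar>D\<bar> * norm (f y)" for n
    proof (rule AE_I2)
      fix y assume "y \<in> space M"
      then have y: "y \<in> {0<..<1}" by (simp add: space_M)
      have x: "X (n + N) \<in> {0<..<1}" "X (n + N) \<in> {c..d}" using X N[of "n + N"] by auto
      have K0: "0 \<le> K t (X (n + N)) y"
        using unimodal_kernel.K_nonneg[OF unimodal_kernel_K[OF t] x(1) y] .
      have "\<bar>h t (X (n + N)) y\<bar> = \<bar>\<rho> (X (n + N))\<bar> * \<bar>\<rho> y\<bar> * \<bar>K t (X (n + N)) y\<bar>"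
        unfolding h_eq[OF x(1) y] by (simp add: abs_mult)
      also have "\<dots> \<le> R * R * \<bar>D\<bar>"
        using R x(1) y D[OF x(2) y] K0 R0 by (intro mult_mono) auto
      finally show "norm (h t (X (n + N)) y *\<^sub>R f y) \<le> R * R * \<bar>D\<bar> * norm (f y)"
        by (simp add: mult_right_mono)
    qed
  qed (use hm in auto)
  then show "(\<lambda>n. LINT y|M. h t (X n) y *\<^sub>R f y) \<longlonglongrightarrow> (LINT y|M. h t a y *\<^sub>R f y)"
    by (rule LIMSEQ_offset)
qed

end

section \<open>Bessel functions\<close>

definition bessel_coeff :: "real \<Rightarrow> nat \<Rightarrow> real" where
  "bessel_coeff \<nu> k = (-1) ^ k / (fact k * Gamma (real k + \<nu> + 1))"

text \<open>The entire function with \<open>bessel_J \<nu> x = (x / 2) powr \<nu> * bessel_B \<nu> (x\<^sup>2 / 4)\<close>.\<close>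

definition bessel_B :: "real \<Rightarrow> real \<Rightarrow> real" where
  "bessel_B \<nu> z = (\<Sum>k. bessel_coeff \<nu> k * z ^ k)"

lemma bessel_coeff_Suc:
  assumes "-1 < \<nu>"
  shows "bessel_coeff \<nu> (Suc k) = - bessel_coeff \<nu> k / (real (Suc k) * (real k + \<nu> + 1))"
proof -
  have "real k + \<nu> + 1 > 0" using assms by simp
  then have "Gamma (real k + \<nu> + 1 + 1) = (real k + \<nu> + 1) * Gamma (real k + \<nu> + 1)"
    by (intro Gamma_plus1) (auto simp: nonpos_Ints_def)
  then have "Gamma (real (Suc k) + \<nu> + 1) = (real k + \<nu> + 1) * Gamma (real k + \<nu> + 1)" by (simp add: add_ac)
  then show ?thesis by (simp add: bessel_coeff_def mult_ac)
qed

lemma bessel_coeff_summable: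
  assumes "-1 < \<nu>"
  shows "summable (\<lambda>k. bessel_coeff \<nu> k * z ^ k)"
proof -
  obtain N :: nat where N: "2 * \<bar>z\<bar> + 1 \<le> real N" using real_arch_simple by blast
  show ?thesis
  proof (rule summable_ratio_test[of "1 / 2" N])
    fix k assume "N \<le> k"
    then have k: "2 * \<bar>z\<bar> \<le> real (Suc k)" "1 \<le> real k" using N by linarith+
    have p: "1 \<le> real k + \<nu> + 1" using k assms by linarith
    have "2 * \<bar>z\<bar> \<le> real (Suc k) * (real k + \<nu> + 1)"
      using mult_mono[OF k(1) p] by simp
    then have q: "\<bar>z\<bar> / (real (Suc k) * (real k + \<nu> + 1)) \<le> 1 / 2"
      using p by (simp add: divide_le_eq)
    have "norm (bessel_coeff \<nu> (Suc k) * z ^ Suc k) = \<bar>z\<bar> / (real (Suc k) * (real k + \<nu> + 1)) * norm (bessel_coeff \<nu> k * z ^ k)"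
      using p unfolding bessel_coeff_Suc[OF assms] by (simp add: abs_mult power_abs)
    also have "\<dots> \<le> 1 / 2 * norm (bessel_coeff \<nu> k * z ^ k)" by (rule mult_right_mono[OF q]) simp
    finally show "norm (bessel_coeff \<nu> (Suc k) * z ^ Suc k) \<le> 1 / 2 * norm (bessel_coeff \<nu> k * z ^ k)" .
  qed simp
qed

lemma bessel_coeff_diffs: "real (Suc k) * bessel_coeff \<nu> (Suc k) = - bessel_coeff (\<nu> + 1) k"
proof -
  have "real (Suc k) + \<nu> + 1 = real k + (\<nu> + 1) + 1" by simp
  then have "bessel_coeff \<nu> (Suc k) = (-1) ^ Suc k / (real (Suc k) * fact k * Gamma (real k + (\<nu> + 1) + 1))"
    by (simp only: bessel_coeff_def fact_Suc of_nat_mult)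
  then show ?thesis by (simp add: bessel_coeff_def del: of_nat_Suc)
qed

lemma bessel_B_deriv:
  assumes "-1 < \<nu>"
  shows "(bessel_B \<nu> has_real_derivative - bessel_B (\<nu> + 1) z) (at z)"
proof -
  have "(bessel_B \<nu> has_real_derivative (\<Sum>k. diffs (bessel_coeff \<nu>) k * z ^ k)) (at z)"
    unfolding bessel_B_def[abs_def] by (rule termdiffs_strong_converges_everywhere) (rule bessel_coeff_summable[OF assms])
  also have "(\<lambda>k. diffs (bessel_coeff \<nu>) k * z ^ k) = (\<lambda>k. - (bessel_coeff (\<nu> + 1) k * z ^ k))"
    by (simp add: diffs_def bessel_coeff_diffs del: of_nat_Suc)
  also have "(\<Sum>k. - (bessel_coeff (\<nu> + 1) k * z ^ k)) = - bessel_B (\<nu> + 1) z"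
    unfolding bessel_B_def by (rule suminf_minus) (use assms in \<open>simp add: bessel_coeff_summable\<close>)
  finally show ?thesis .
qed

text \<open>The three-term recurrence of Bessel functions of orders \<open>\<nu>\<close>,
  \<open>\<nu> + 1\<close>, \<open>\<nu> + 2\<close>, freed of its powers of x.\<close>

lemma bessel_B_recurrence:
  assumes \<nu>: "-1 < \<nu>"
  shows "z * bessel_B (\<nu> + 2) z = (\<nu> + 1) * bessel_B (\<nu> + 1) z - bessel_B \<nu> z"
proof -
  define c where "c k = (\<nu> + 1) * bessel_coeff (\<nu> + 1) k - bessel_coeff \<nu> k" for k
  have s: "summable (\<lambda>k. bessel_coeff (\<nu> + 1) k * z ^ k)" "summable (\<lambda>k. bessel_coeff \<nu> k * z ^ k)"
    "summable (\<lambda>k. bessel_coeff (\<nu> + 2) k * z ^ k)"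
    using \<nu> by (auto intro!: bessel_coeff_summable)
  have "(\<lambda>k. (\<nu> + 1) * (bessel_coeff (\<nu> + 1) k * z ^ k) - bessel_coeff \<nu> k * z ^ k) sums ((\<nu> + 1) * bessel_B (\<nu> + 1) z - bessel_B \<nu> z)"
    unfolding bessel_B_def by (intro sums_diff sums_mult summable_sums s)
  moreover have "(\<lambda>k. (\<nu> + 1) * (bessel_coeff (\<nu> + 1) k * z ^ k) - bessel_coeff \<nu> k * z ^ k) = (\<lambda>k. c k * z ^ k)"
    by (simp add: c_def algebra_simps)
  ultimately have c: "(\<lambda>k. c k * z ^ k) sums ((\<nu> + 1) * bessel_B (\<nu> + 1) z - bessel_B \<nu> z)" by simp
  have G: "Gamma (x + 1) = x * Gamma x" if "0 < x" for x :: real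
    using that by (intro Gamma_plus1) (auto simp: nonpos_Ints_def)
  have Gp: "0 < Gamma x" if "0 < x" for x :: real using that by (rule Gamma_real_pos)
  have c0: "c 0 = 0"
    using G[of "\<nu> + 1"] Gp[of "\<nu> + 1"] \<nu> by (simp add: c_def bessel_coeff_def add_ac)
  have cS: "c (Suc k) = bessel_coeff (\<nu> + 2) k" for k
  proof -
    define g where "g = Gamma (real k + \<nu> + 2)"
    define F where "F = (fact k :: real)"
    have p: "0 < real k + \<nu> + 2" using \<nu> by simp
    have g: "0 < g" and F: "0 < F" using Gp[OF p] by (auto simp: g_def F_def)
    have 1: "Gamma (real k + \<nu> + 3) = (real k + \<nu> + 2) * g"
      using G[OF p] by (simp add: g_def add_ac)
    have 2: "Gamma (real (Suc k) + (\<nu> + 1) + 1) = (real k + \<nu> + 2) * g" "Gamma (real (Suc k) + \<nu> + 1) = g"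
      "Gamma (real k + (\<nu> + 2) + 1) = (real k + \<nu> + 2) * g"
      using 1 by (simp_all add: g_def add_ac)
    have "c (Suc k) = (-1) ^ Suc k / ((1 + real k) * F * ((real k + \<nu> + 2) * g)) * ((\<nu> + 1) - (real k + \<nu> + 2))"
      unfolding c_def bessel_coeff_def 2 fact_Suc F_def[symmetric] using p g F by (simp add: divide_simps) (simp add: algebra_simps)
    also have "(\<nu> + 1) - (real k + \<nu> + 2) = - (1 + real k)" by simp
    also have "(-1) ^ Suc k / ((1 + real k) * F * ((real k + \<nu> + 2) * g)) * - (1 + real k) = (-1) ^ k / (F * ((real k + \<nu> + 2) * g))"
    proof -
      have cancel: "- r / (p * F * X) * - p = r / (F * X)" if "p \<noteq> 0" for p r X :: real using that by simp
      show ?thesis unfolding power_Suc mult_minus1 by (rule cancel) simp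
    qed
    finally show ?thesis unfolding bessel_coeff_def 2 F_def[symmetric] .
  qed
  have "(\<lambda>k. c (Suc k) * z ^ Suc k) sums ((\<nu> + 1) * bessel_B (\<nu> + 1) z - bessel_B \<nu> z)"
    using c by (subst sums_Suc_iff) (simp add: c0)
  moreover have "(\<lambda>k. z * (bessel_coeff (\<nu> + 2) k * z ^ k)) sums (z * bessel_B (\<nu> + 2) z)"
    unfolding bessel_B_def by (intro sums_mult summable_sums s)
  then have "(\<lambda>k. c (Suc k) * z ^ Suc k) sums (z * bessel_B (\<nu> + 2) z)" by (simp add: cS mult_ac)
  ultimately show ?thesis by (rule sums_unique2[symmetric])
qed

section \<open>The Bessel equation\<close>

locale bessel_order =
  fixes \<nu> :: real
  assumes \<nu>: "-1 < \<nu>"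
begin

definition j :: "real \<Rightarrow> real" where "j x = bessel_B \<nu> (x\<^sup>2 / 4)"

definition dj :: "real \<Rightarrow> real" where "dj x = - (x / 2) * bessel_B (\<nu> + 1) (x\<^sup>2 / 4)"

lemma j_deriv: "(j has_real_derivative dj x) (at x)"
proof -
  have "((\<lambda>x. bessel_B \<nu> (x\<^sup>2 / 4)) has_real_derivative - bessel_B (\<nu> + 1) (x\<^sup>2 / 4) * (2 * x / 4)) (at x)"
    by (rule DERIV_chain2[OF bessel_B_deriv[OF \<nu>]]) (auto intro!: derivative_eq_intros)
  then show ?thesis unfolding j_def[abs_def] by (rule DERIV_cong) (simp add: dj_def)
qed

text \<open>The Bessel equation for \<open>j\<close>, that is
  \<open>j'' + (2 * \<nu> + 1) / x * j' + j = 0\<close>; the recurrence eliminates the order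
  \<open>\<nu> + 2\<close>.\<close>

lemma dj_deriv:
  assumes "x \<noteq> 0" shows "(dj has_real_derivative - (2 * \<nu> + 1) / x * dj x - j x) (at x)"
proof -
  have d: "((\<lambda>x. bessel_B (\<nu> + 1) (x\<^sup>2 / 4)) has_real_derivative - bessel_B (\<nu> + 1 + 1) (x\<^sup>2 / 4) * (2 * x / 4)) (at x)"
    using \<nu> by (intro DERIV_chain2[OF bessel_B_deriv]) (auto intro!: derivative_eq_intros)
  have "(dj has_real_derivative - (1 / 2) * bessel_B (\<nu> + 1) (x\<^sup>2 / 4)
    + (- bessel_B (\<nu> + 1 + 1) (x\<^sup>2 / 4) * (2 * x / 4)) * - (x / 2)) (at x)"
    unfolding dj_def[abs_def] by (rule DERIV_mult[OF _ d]) (auto intro!: derivative_eq_intros)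
  moreover have "- (1 / 2) * bessel_B (\<nu> + 1) (x\<^sup>2 / 4) + (- bessel_B (\<nu> + 1 + 1) (x\<^sup>2 / 4) * (2 * x / 4)) * - (x / 2)
    = - (1 / 2) * bessel_B (\<nu> + 1) (x\<^sup>2 / 4) + x\<^sup>2 / 4 * bessel_B (\<nu> + 2) (x\<^sup>2 / 4)"
    by (simp add: power2_eq_square add.assoc)
  also have "\<dots> = - (2 * \<nu> + 1) / x * dj x - j x"
    unfolding bessel_B_recurrence[OF \<nu>] dj_def j_def using assms by (simp add: field_simps)
  ultimately show ?thesis by simp
qed

lemma j_cont: "continuous_on A j"
  using j_deriv by (intro continuous_at_imp_continuous_on ballI DERIV_isCont) 

lemma B1_cont: "continuous_on A (\<lambda>x. bessel_B (\<nu> + 1) (x\<^sup>2 / 4))"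
proof -
  have "continuous_on UNIV (bessel_B (\<nu> + 1))"
    using bessel_B_deriv[of "\<nu> + 1"] \<nu> by (intro continuous_at_imp_continuous_on ballI DERIV_isCont) auto
  then show ?thesis by (rule continuous_on_compose2) (auto intro!: continuous_intros)
qed

lemma dj_cont: "continuous_on A dj"
  unfolding dj_def by (intro continuous_intros B1_cont) auto

lemma j_0: "0 < j 0"
proof -
  have "j 0 = bessel_coeff \<nu> 0" unfolding j_def bessel_B_def by simp
  then show ?thesis using \<nu> by (simp add: bessel_coeff_def Gamma_real_pos)
qed

lemma bessel_J_eq: assumes "0 < x" shows "bessel_J \<nu> x = (x / 2) powr \<nu> * j x"
proof -
  have "(x / 2) powr (2 * real k + \<nu>) = (x / 2) powr \<nu> * (x\<^sup>2 / 4) ^ k" for k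
  proof -
    have "(x / 2) powr (2 * real k) = ((x / 2) powr real (2 * k))" by simp
    also have "\<dots> = (x / 2) ^ (2 * k)" using assms by (subst powr_realpow) auto
    also have "\<dots> = (x\<^sup>2 / 4) ^ k" by (simp add: power_mult power_divide)
    finally show ?thesis by (simp add: powr_add mult.commute)
  qed
  then have "bessel_J \<nu> x = (\<Sum>k. (x / 2) powr \<nu> * (bessel_coeff \<nu> k * (x\<^sup>2 / 4) ^ k))"
    unfolding bessel_J_def bessel_coeff_def by (simp add: mult_ac)
  also have "\<dots> = (x / 2) powr \<nu> * j x"
    unfolding j_def bessel_B_def by (rule suminf_mult) (rule bessel_coeff_summable[OF \<nu>])
  finally show ?thesis .
qed

lemma bessel_J_zero_iff: "0 < x \<Longrightarrow> bessel_J \<nu> x = 0 \<longleftrightarrow> j x = 0"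
  by (simp add: bessel_J_eq)

lemma bessel_J_Suc_eq: assumes "0 < x" shows "bessel_J (\<nu> + 1) x = - ((x / 2) powr \<nu> * dj x)"
proof -
  interpret S: bessel_order "\<nu> + 1" by standard (use \<nu> in simp)
  show ?thesis using assms by (simp add: S.bessel_J_eq S.j_def dj_def powr_add)
qed

text \<open>Uniqueness for the Bessel equation, by Gronwall's inequality for \<open>j\<^sup>2 + dj\<^sup>2\<close>.\<close>

lemma zeros_simple:
  assumes L: "0 < L" and z: "j L = 0"
  shows "dj L \<noteq> 0"
proof
  assume dz: "dj L = 0"
  have "isCont j 0" using j_deriv by (rule DERIV_isCont)
  then have "eventually (\<lambda>x. 0 < j x) (nhds 0)" using j_0 by (intro order_tendstoD) (auto simp: isCont_def tendsto_at_iff_tendsto_nhds)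
  then obtain d where d: "0 < d" "\<And>x. dist x 0 < d \<Longrightarrow> 0 < j x" unfolding eventually_nhds_metric by blast
  define \<epsilon> where "\<epsilon> = min (d / 2) L"
  have \<epsilon>: "0 < \<epsilon>" "\<epsilon> \<le> L" "0 < j \<epsilon>" using d L d(2)[of \<epsilon>] by (auto simp: \<epsilon>_def)
  \<comment> \<open>The equation is singular at 0, so the comparison starts at \<epsilon>, where
    \<open>j\<close> is still positive. C outweighs the coefficient of \<open>dj\<close> from
    \<epsilon> on.\<close>
  define C where "C = 2 * \<bar>2 * \<nu> + 1\<bar> / \<epsilon>"
  define E where "E x = ((j x)\<^sup>2 + (dj x)\<^sup>2) * exp (C * x)" for x
  have "E \<epsilon> \<le> E L"
  proof (rule DERIV_nonneg_imp_nondecreasing[OF \<epsilon>(2)])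
    fix x assume x: "\<epsilon> \<le> x" "x \<le> L"
    then have x0: "0 < x" using \<epsilon> by simp
    have "(E has_real_derivative
      (2 * j x * dj x + 2 * dj x * (- (2 * \<nu> + 1) / x * dj x - j x)) * exp (C * x) + C * exp (C * x) * ((j x)\<^sup>2 + (dj x)\<^sup>2)) (at x)"
      unfolding E_def using x0
      by (intro DERIV_mult DERIV_add) (auto intro!: derivative_eq_intros j_deriv dj_deriv)
    moreover have "0 \<le> (2 * j x * dj x + 2 * dj x * (- (2 * \<nu> + 1) / x * dj x - j x)) * exp (C * x) + C * exp (C * x) * ((j x)\<^sup>2 + (dj x)\<^sup>2)"
    proof -
      have "2 * (2 * \<nu> + 1) / x \<le> C"
      proof -
        have "2 * (2 * \<nu> + 1) / x \<le> 2 * \<bar>2 * \<nu> + 1\<bar> / x" using x0 by (intro divide_right_mono mult_left_mono abs_ge_self) auto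
        also have "\<dots> \<le> C" unfolding C_def using x \<epsilon> x0 by (intro divide_left_mono) auto
        finally show ?thesis .
      qed
      then have "2 * (2 * \<nu> + 1) / x * (dj x)\<^sup>2 \<le> C * (dj x)\<^sup>2" by (intro mult_right_mono) auto
      moreover have "0 \<le> C * (j x)\<^sup>2" using \<epsilon> by (simp add: C_def)
      moreover have "2 * j x * dj x + 2 * dj x * (- (2 * \<nu> + 1) / x * dj x - j x) = - (2 * (2 * \<nu> + 1) / x * (dj x)\<^sup>2)"
        using x0 by (simp add: field_simps power2_eq_square)
      ultimately have "0 \<le> (2 * j x * dj x + 2 * dj x * (- (2 * \<nu> + 1) / x * dj x - j x)) + C * ((j x)\<^sup>2 + (dj x)\<^sup>2)"
        by (simp add: distrib_left)
      then have "0 \<le> ((2 * j x * dj x + 2 * dj x * (- (2 * \<nu> + 1) / x * dj x - j x)) + C * ((j x)\<^sup>2 + (dj x)\<^sup>2)) * exp (C * x)"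
        by simp
      moreover have "(p + C * q) * r = p * r + C * r * q" for p q r :: real by (simp add: algebra_simps)
      ultimately show ?thesis by (simp only:)
    qed
    ultimately show "\<exists>y. (E has_real_derivative y) (at x) \<and> 0 \<le> y" by blast
  qed
  also have "E L = 0" using z dz by (simp add: E_def)
  finally have "(j \<epsilon>)\<^sup>2 + (dj \<epsilon>)\<^sup>2 \<le> 0" by (simp add: E_def mult_le_0_iff)
  then have "j \<epsilon> = 0" by (smt (verit) zero_le_power2 power2_eq_iff power_zero_numeral)
  then show False using \<epsilon> by simp
qed

section \<open>Oscillation and the sequence of positive zeros\<close>

lemma zeros_isolated:
  assumes "0 < L" "j L = 0"
  shows "eventually (\<lambda>x. j x \<noteq> 0) (at L)"
proof -
  have "((\<lambda>y. (j y - j L) / (y - L)) \<longlongrightarrow> dj L) (at L)"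
    using j_deriv[of L] by (simp add: has_field_derivative_iff)
  then have "eventually (\<lambda>y. (j y - j L) / (y - L) \<noteq> 0) (at L)"
    using zeros_simple[OF assms] by (rule tendsto_imp_eventually_ne)
  then show ?thesis by eventually_elim (auto simp: assms)
qed

text \<open>Sturm comparison of \<open>x powr (\<nu> + 1/2) * j x\<close> with \<open>sin (x / 2)\<close>.\<close>

lemma sturm_comparison:
  assumes \<sigma>: "\<sigma> = 1 \<or> \<sigma> = -1" and a: "0 < a" "4 * \<nu>\<^sup>2 \<le> 3 * a\<^sup>2"
    and pos: "\<And>x. a \<le> x \<Longrightarrow> x \<le> a + 2 * pi \<Longrightarrow> 0 < \<sigma> * j x"
  shows False
proof -
  \<comment> \<open>With this exponent u is a multiple of \<open>sqrt x * bessel_J \<nu> x\<close>,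
    and its equation has no first-order term.\<close>
  define q where "q = \<nu> + 1 / 2"
  define u where "u x = x powr q * (\<sigma> * j x)" for x
  define u' where "u' x = x powr q * (\<sigma> * (q * j x / x + dj x))" for x
  \<comment> \<open>The Wronskian of u and \<open>sin ((x - a) / 2)\<close>, whose half-period is
    \<open>2 * pi\<close>. The condition on a makes the coefficient of u at most
    \<open>- 1 / 4\<close>, so V cannot increase, yet it would pass from a negative to a positive
    value.\<close>
  define V where "V x = u' x * sin ((x - a) / 2) - u x * (cos ((x - a) / 2) / 2)" for x
  have du: "(u has_real_derivative u' x) (at x)" if "0 < x" for x
  proof -
    have "(u has_real_derivative (q * x powr (q - 1)) * (\<sigma> * j x) + (\<sigma> * dj x) * x powr q) (at x)"
      unfolding u_def using that by (intro DERIV_mult DERIV_cmult j_deriv) (auto intro!: derivative_eq_intros)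
    moreover have "x powr (q - 1) = x powr q / x" using that by (simp add: powr_diff)
    ultimately show ?thesis by (simp add: u'_def algebra_simps)
  qed
  have du': "(u' has_real_derivative ((\<nu>\<^sup>2 - 1 / 4) / x\<^sup>2 - 1) * u x) (at x)" if x: "0 < x" for x
  proof -
    have "((\<lambda>x. q * j x / x + dj x) has_real_derivative (q * dj x * x - q * j x * 1) / (x * x) + (- (2 * \<nu> + 1) / x * dj x - j x)) (at x)"
      using x by (intro DERIV_add DERIV_divide DERIV_cmult j_deriv dj_deriv DERIV_ident) auto
    then have "(u' has_real_derivative (q * x powr (q - 1)) * (\<sigma> * (q * j x / x + dj x))
      + (\<sigma> * ((q * dj x * x - q * j x * 1) / (x * x) + (- (2 * \<nu> + 1) / x * dj x - j x))) * x powr q) (at x)"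
      unfolding u'_def using x by (intro DERIV_mult DERIV_cmult) (auto intro!: derivative_eq_intros)
    moreover have "x powr (q - 1) = x powr q / x" using x by (simp add: powr_diff)
    moreover have "(q * (x powr q / x)) * (\<sigma> * (q * j x / x + dj x))
      + (\<sigma> * ((q * dj x * x - q * j x * 1) / (x * x) + (- (2 * \<nu> + 1) / x * dj x - j x))) * x powr q
      = ((\<nu>\<^sup>2 - 1 / 4) / x\<^sup>2 - 1) * u x"
    proof -
      define R1 where "R1 = q * j x / x + dj x"
      define R2 where "R2 = (q * dj x * x - q * j x * 1) / (x * x) + (- (2 * \<nu> + 1) / x * dj x - j x)"
      have "q * R1 / x + R2 = ((\<nu>\<^sup>2 - 1 / 4) / x\<^sup>2 - 1) * j x"
        using x by (simp add: R1_def R2_def q_def field_simps power2_eq_square)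
      moreover have "(q * (x powr q / x)) * (\<sigma> * R1) + (\<sigma> * R2) * x powr q = x powr q * \<sigma> * (q * R1 / x + R2)"
        by (simp add: algebra_simps)
      ultimately show ?thesis unfolding u_def R1_def[symmetric] R2_def[symmetric] by simp
    qed
    ultimately show ?thesis by simp
  qed
  have "V (a + 2 * pi) \<le> V a"
  proof (rule DERIV_nonpos_imp_nonincreasing[where f = V])
    fix x assume x: "a \<le> x" "x \<le> a + 2 * pi"
    then have x0: "0 < x" using a by simp
    have "(V has_real_derivative (((\<nu>\<^sup>2 - 1 / 4) / x\<^sup>2 - 1) * u x * sin ((x - a) / 2) + (cos ((x - a) / 2) * (1 / 2)) * u' x)
      - (u' x * (cos ((x - a) / 2) / 2) + (- sin ((x - a) / 2) * (1 / 2) / 2) * u x)) (at x)"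
      unfolding V_def using x0 by (intro DERIV_diff DERIV_mult du du') (auto intro!: derivative_eq_intros)
    then have "(V has_real_derivative ((\<nu>\<^sup>2 - 1 / 4) / x\<^sup>2 - 3 / 4) * u x * sin ((x - a) / 2)) (at x)"
      by (rule DERIV_cong) (simp add: algebra_simps)
    moreover have "((\<nu>\<^sup>2 - 1 / 4) / x\<^sup>2 - 3 / 4) * u x * sin ((x - a) / 2) \<le> 0"
    proof -
      have "a\<^sup>2 \<le> x\<^sup>2" using x a by (intro power_mono) auto
      then have "4 * \<nu>\<^sup>2 - 1 \<le> 3 * x\<^sup>2" using a(2) by linarith
      then have "(\<nu>\<^sup>2 - 1 / 4) / x\<^sup>2 - 3 / 4 \<le> 0" using x0 by (simp add: divide_le_eq)
      moreover have "0 \<le> u x" unfolding u_def using pos[OF x] by (simp add: less_imp_le)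
      moreover have "0 \<le> sin ((x - a) / 2)" using x by (intro sin_ge_zero) auto
      ultimately show ?thesis by (intro mult_nonpos_nonneg) auto
    qed
    ultimately show "\<exists>y. (V has_real_derivative y) (at x) \<and> y \<le> 0" by blast
  qed simp
  moreover have "V a = - u a / 2" by (simp add: V_def)
  moreover have "V (a + 2 * pi) = u (a + 2 * pi) / 2" by (simp add: V_def)
  moreover have "0 < u a" "0 < u (a + 2 * pi)" unfolding u_def using pos[of a] pos[of "a + 2 * pi"] a add_pos_pos[OF a(1), of "2 * pi"]
    by (auto intro!: mult_pos_pos)
  ultimately show False by linarith
qed

lemma zeros_unbounded: "\<exists>x>X. j x = 0"
proof (rule ccontr)
  assume "\<not> ?thesis"
  then have nz: "j x \<noteq> 0" if "X < x" for x using that by blast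
  define a where "a = max 1 (max (X + 1) (2 * \<bar>\<nu>\<bar>))"
  have a: "0 < a" "X < a" "2 * \<bar>\<nu>\<bar> \<le> a" by (auto simp: a_def)
  have "(2 * \<bar>\<nu>\<bar>)\<^sup>2 \<le> a\<^sup>2" using a by (intro power_mono) auto
  then have "4 * \<nu>\<^sup>2 \<le> a\<^sup>2" by (simp add: power_mult_distrib)
  then have a2: "4 * \<nu>\<^sup>2 \<le> 3 * a\<^sup>2" using zero_le_power2[of a] by linarith
  define \<sigma> where "\<sigma> = sgn (j a)"
  have \<sigma>: "\<sigma> = 1 \<or> \<sigma> = -1" using nz[of a] a by (auto simp: \<sigma>_def sgn_if)
  have "0 < \<sigma> * j x" if x: "a \<le> x" for x
  proof (rule ccontr)
    assume n: "\<not> 0 < \<sigma> * j x"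
    have "0 \<le> \<sigma> * j a" by (simp add: \<sigma>_def sgn_if)
    moreover have "\<sigma> * j x \<le> 0" using n by simp
    moreover have "continuous_on {a..x} (\<lambda>x. \<sigma> * j x)" by (intro continuous_intros j_cont)
    ultimately obtain y where "a \<le> y" "y \<le> x" "\<sigma> * j y = 0"
      using IVT2'[of "\<lambda>x. \<sigma> * j x" x 0 a] x by auto
    then show False using nz[of y] a \<sigma> by auto
  qed
  then show False using sturm_comparison[OF \<sigma> a(1) a2] by auto
qed

definition zr :: "nat \<Rightarrow> real" where "zr = bessel_zero \<nu>"

lemma zr_0: "zr 0 = 0" by (simp add: zr_def)

text \<open>Isolation of zeros, or \<open>0 < j 0\<close> if n = 0, keeps the later zeros at a
  positive distance from \<open>zr n\<close>. Their set is therefore closed and attains its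
  infimum.\<close>

lemma zr_step:
  assumes "0 \<le> zr n" "n = 0 \<or> j (zr n) = 0 \<and> 0 < zr n"
  shows "zr n < zr (Suc n)" "j (zr (Suc n)) = 0" "\<And>x. zr n < x \<Longrightarrow> j x = 0 \<Longrightarrow> zr (Suc n) \<le> x"
proof -
  define Z where "Z = {x. zr n < x \<and> j x = 0}"
  have "{x. zr n < x \<and> bessel_J \<nu> x = 0} = Z"
    unfolding Z_def using assms(1) bessel_J_zero_iff by force
  then have L: "zr (Suc n) = Inf Z" by (simp add: zr_def)
  have ne: "Z \<noteq> {}" using zeros_unbounded[of "zr n"] by (auto simp: Z_def)
  have bdd: "bdd_below Z" by (auto simp: Z_def intro!: bdd_belowI[of _ "zr n"])
  have "\<exists>d>0. \<forall>x\<in>Z. zr n + d \<le> x"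
  proof -
    have "eventually (\<lambda>x. j x \<noteq> 0) (at (zr n))"
    proof (cases "n = 0")
      case True
      have "(j \<longlongrightarrow> j 0) (at 0)" using DERIV_isCont[OF j_deriv[of 0]] by (simp add: isCont_def)
      then have "eventually (\<lambda>x. j x \<noteq> 0) (at 0)" using j_0 by (intro tendsto_imp_eventually_ne) auto
      then show ?thesis using True zr_0 by simp
    next
      case False
      then show ?thesis using assms(2) zeros_isolated by auto
    qed
    then obtain d where d: "0 < d" "\<And>x. x \<noteq> zr n \<Longrightarrow> dist x (zr n) < d \<Longrightarrow> j x \<noteq> 0" by (auto simp: eventually_at)
    have "zr n + d \<le> x" if "x \<in> Z" for x
    proof (rule ccontr)
      assume "\<not> zr n + d \<le> x"
      then show False using d(2)[of x] that by (auto simp: Z_def dist_real_def)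
    qed
    then show ?thesis using d(1) by blast
  qed
  then obtain d where d: "0 < d" "\<And>x. x \<in> Z \<Longrightarrow> zr n + d \<le> x" by blast
  have "Z = {zr n + d..} \<inter> j -` {0}" using d by (auto simp: Z_def)
  then have "closed Z" using j_cont by (simp add: continuous_closed_preimage)
  then have "Inf Z \<in> Z" using ne bdd by (intro closed_contains_Inf)
  then show "zr n < zr (Suc n)" "j (zr (Suc n)) = 0" unfolding L by (auto simp: Z_def)
  show "zr (Suc n) \<le> x" if "zr n < x" "j x = 0" for x unfolding L using that bdd by (intro cInf_lower) (auto simp: Z_def)
qed

lemma zr_invariant: "0 \<le> zr n \<and> (n = 0 \<or> j (zr n) = 0 \<and> 0 < zr n)"
proof (induction n)
  case (Suc n)
  then show ?case using zr_step[of n] by auto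
qed (simp add: zr_0)

lemma zr_less_Suc: "zr n < zr (Suc n)" and j_zr: "j (zr (Suc n)) = 0"
  and zr_Suc_le: "zr n < x \<Longrightarrow> j x = 0 \<Longrightarrow> zr (Suc n) \<le> x"
  using zr_step[of n] zr_invariant[of n] by auto

lemma zr_strict: "strict_mono zr"
  using zr_less_Suc by (simp add: strict_mono_Suc_iff)

lemma zr_pos: "0 < zr (Suc n)"
  using zr_invariant[of "Suc n"] by auto

lemma dj_zr: "dj (zr (Suc n)) \<noteq> 0"
  using zeros_simple[OF zr_pos j_zr] .

text \<open>A bounded sequence of increasing zeros would converge to a zero that is not
  isolated.\<close>

lemma zr_top: "filterlim zr at_top sequentially"
proof (rule ccontr)
  assume n: "\<not> filterlim zr at_top sequentially"
  have mono: "incseq zr" using zr_strict by (simp add: strict_mono_mono)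
  have "\<exists>B. \<forall>n. zr n \<le> B"
  proof (rule ccontr)
    assume "\<not> ?thesis"
    then have ex: "\<exists>n. B < zr n" for B by (meson not_le)
    have "eventually (\<lambda>n. B \<le> zr n) sequentially" for B
    proof -
      obtain N where "B < zr N" using ex by blast
      then have "B \<le> zr n" if "N \<le> n" for n using incseqD[OF mono that] by linarith
      then show ?thesis by (auto simp: eventually_sequentially)
    qed
    then show False using n by (simp add: filterlim_at_top)
  qed
  then obtain B where B: "\<And>n. zr n \<le> B" by blast
  then obtain L where L: "zr \<longlonglongrightarrow> L" "\<And>n. zr n \<le> L" using incseq_convergent[OF mono, of B] by blast
  have L0: "0 < L" using zr_pos[of 0] L(2)[of "Suc 0"] by linarith
  have "(\<lambda>n. j (zr (Suc n))) \<longlonglongrightarrow> j L"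
    using L(1) by (intro isCont_tendsto_compose[OF DERIV_isCont[OF j_deriv]] LIMSEQ_Suc)
  then have jL: "j L = 0" by (simp add: j_zr LIMSEQ_const_iff)
  have lt: "zr n < L" for n using zr_less_Suc[of n] L(2)[of "Suc n"] by linarith
  obtain d where d: "0 < d" "\<And>x. x \<noteq> L \<Longrightarrow> dist x L < d \<Longrightarrow> j x \<noteq> 0"
    using zeros_isolated[OF L0 jL] by (auto simp: eventually_at)
  obtain N where "dist (zr (Suc N)) L < d"
    using LIMSEQ_Suc[OF L(1)] d(1) by (auto simp: lim_sequentially)
  then show False using d(2)[of "zr (Suc N)"] lt[of "Suc N"] j_zr[of N] by auto
qed

lemma zero_in_range: assumes "0 < x" "j x = 0" obtains n where "x = zr (Suc n)"
proof -
  have "eventually (\<lambda>n. x \<le> zr n) sequentially" using zr_top by (simp add: filterlim_at_top)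
  then have ex: "\<exists>n. x \<le> zr n" by (auto simp: eventually_sequentially)
  define n where "n = (LEAST n. x \<le> zr n)"
  have n: "x \<le> zr n" unfolding n_def using LeastI_ex[OF ex] .
  then have "n \<noteq> 0" using assms zr_0 by (metis not_le)
  then obtain k where k: "n = Suc k" using not0_implies_Suc by blast
  have "\<not> x \<le> zr k" using not_less_Least[of k "\<lambda>n. x \<le> zr n"] k by (auto simp: n_def)
  then have "zr (Suc k) \<le> x" using assms by (intro zr_Suc_le) auto
  then show thesis using that[of k] n k by auto
qed

section \<open>Normalised eigenfunctions\<close>

definition lam :: "nat \<Rightarrow> real" where "lam n = zr (Suc n)"

lemma lam_pos: "0 < lam n" and j_lam: "j (lam n) = 0" and dj_lam: "dj (lam n) \<noteq> 0"
  by (simp_all add: lam_def zr_pos j_zr dj_zr)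

text \<open>The power in \<open>bessel_J (\<nu> + 1) (lam n) = - ((lam n / 2) powr \<nu> * dj (lam
  n))\<close> cancels against the one in \<open>bessel_J \<nu> (lam n * x)\<close>, so that only
  \<open>dj\<close> remains.\<close>

definition nc :: "nat \<Rightarrow> real" where "nc n = sqrt 2 / \<bar>dj (lam n)\<bar>"

lemma nc_pos: "0 < nc n" using dj_lam by (simp add: nc_def)

definition ph :: "nat \<Rightarrow> real \<Rightarrow> real" where "ph n x = nc n * j (lam n * x)"

definition dph :: "nat \<Rightarrow> real \<Rightarrow> real" where "dph n x = nc n * (lam n * dj (lam n * x))"

definition G :: "nat \<Rightarrow> real \<Rightarrow> real" where "G n x = x powr (2 * \<nu> + 1) * dph n x"

lemma bessel_phi_eq: assumes "0 < x" shows "bessel_phi \<nu> (Suc n) x = ph n x"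
proof -
  have p: "0 < lam n" "0 < lam n * x" "0 < (lam n / 2) powr \<nu>" using assms lam_pos[of n] by auto
  have "(lam n * x / 2) powr \<nu> = (lam n / 2) powr \<nu> * x powr \<nu>"
    using assms p by (simp add: powr_mult[symmetric])
  moreover have "x powr (- \<nu>) * x powr \<nu> = 1" using assms by (simp add: powr_add[symmetric])
  ultimately have "x powr (- \<nu>) * bessel_J \<nu> (lam n * x) = (lam n / 2) powr \<nu> * j (lam n * x)"
    by (simp add: bessel_J_eq[OF p(2)])
  moreover have "\<bar>bessel_J (\<nu> + 1) (lam n)\<bar> = (lam n / 2) powr \<nu> * \<bar>dj (lam n)\<bar>"
    by (simp add: bessel_J_Suc_eq[OF p(1)] abs_mult)
  moreover have "bessel_zero \<nu> (Suc n) = lam n" by (simp add: lam_def zr_def)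
  ultimately have "bessel_phi \<nu> (Suc n) x = sqrt 2 / ((lam n / 2) powr \<nu> * \<bar>dj (lam n)\<bar>) * ((lam n / 2) powr \<nu> * j (lam n * x))"
    by (simp only: bessel_phi_def mult.assoc)
  then show ?thesis using p by (simp add: ph_def nc_def)
qed

lemma ph_deriv: "(ph n has_real_derivative dph n x) (at x)"
proof -
  have "((\<lambda>x. j (lam n * x)) has_real_derivative dj (lam n * x) * lam n) (at x)"
    by (rule DERIV_chain2[OF j_deriv]) (auto intro!: derivative_eq_intros)
  from DERIV_cmult[OF this, of "nc n"] show ?thesis by (simp add: ph_def[abs_def] dph_def mult_ac)
qed

lemma dph_deriv:
  assumes "0 < x" shows "(dph n has_real_derivative - (2 * \<nu> + 1) / x * dph n x - (lam n)\<^sup>2 * ph n x) (at x)"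
proof -
  have lx: "lam n * x \<noteq> 0" using assms lam_pos[of n] by simp
  have "((\<lambda>x. dj (lam n * x)) has_real_derivative (- (2 * \<nu> + 1) / (lam n * x) * dj (lam n * x) - j (lam n * x)) * lam n) (at x)"
    by (rule DERIV_chain2[where f = dj and g = "\<lambda>x. lam n * x"], rule dj_deriv[OF lx])
      (auto intro!: derivative_eq_intros)
  from DERIV_cmult[OF DERIV_cmult[OF this, of "lam n"], of "nc n"]
  have "(dph n has_real_derivative nc n * (lam n * ((- (2 * \<nu> + 1) / (lam n * x) * dj (lam n * x) - j (lam n * x)) * lam n))) (at x)"
    by (simp add: dph_def[abs_def])
  then show ?thesis
    by (rule DERIV_cong) (use lam_pos[of n] assms in \<open>simp add: dph_def ph_def field_simps power2_eq_square\<close>)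
qed

lemma powr_deriv: "0 < x \<Longrightarrow> ((\<lambda>x. x powr q) has_real_derivative q * x powr q / x) (at x)"
  for q x :: real
proof -
  assume x: "0 < x"
  then have "((\<lambda>x. x powr q) has_real_derivative q * x powr (q - 1)) (at x)" by (auto intro!: derivative_eq_intros)
  then show ?thesis using x by (simp add: powr_diff)
qed

lemma G_deriv:
  assumes x: "0 < x" shows "(G n has_real_derivative - (lam n)\<^sup>2 * (x powr (2 * \<nu> + 1) * ph n x)) (at x)"
proof -
  have "(G n has_real_derivative ((2 * \<nu> + 1) * x powr (2 * \<nu> + 1) / x) * dph n x
    + (- (2 * \<nu> + 1) / x * dph n x - (lam n)\<^sup>2 * ph n x) * x powr (2 * \<nu> + 1)) (at x)"
    unfolding G_def[abs_def] by (intro DERIV_mult powr_deriv dph_deriv x)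
  then show ?thesis by (rule DERIV_cong) (use x in \<open>simp add: field_simps\<close>)
qed

lemma ph_cont: "continuous_on A (ph n)"
  using ph_deriv by (intro continuous_at_imp_continuous_on ballI DERIV_isCont)

lemma dph_cont: "continuous_on A (dph n)"
  unfolding dph_def by (intro continuous_intros continuous_on_compose2[OF dj_cont[of UNIV]]) auto

lemma powr_cont: "0 < q \<Longrightarrow> continuous_on {0..1} (\<lambda>x::real. x powr q)"
  by (intro continuous_on_powr' continuous_intros) auto

text \<open>The exponent \<open>2 * \<nu> + 1\<close> may be negative, but \<open>dph n\<close>
  contains a factor x; absorbing it makes the exponent \<open>2 * \<nu> + 2\<close>
  positive.\<close>

lemma G_cont: "continuous_on {0..1} (G n)"
proof -
  have "continuous_on {0..1} (\<lambda>x. x powr (2 * \<nu> + 2) * (nc n * (lam n * (- (lam n / 2) * bessel_B (\<nu> + 1) ((lam n * x)\<^sup>2 / 4)))))"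
    using \<nu> by (intro continuous_on_mult powr_cont continuous_on_const continuous_on_compose2[OF B1_cont[of UNIV], of _ "\<lambda>x. lam n * x"] continuous_on_id) auto
  moreover have "x powr (2 * \<nu> + 2) * (nc n * (lam n * (- (lam n / 2) * bessel_B (\<nu> + 1) ((lam n * x)\<^sup>2 / 4)))) = G n x" if "x \<in> {0..1}" for x
  proof (cases "x = 0")
    case False
    then have "x powr (2 * \<nu> + 2) = x powr (2 * \<nu> + 1) * x" using that powr_add[of x "2 * \<nu> + 1" 1] by (simp add: add.assoc)
    then show ?thesis by (simp add: G_def dph_def dj_def)
  qed (simp add: G_def)
  ultimately show ?thesis by (rule continuous_on_eq)
qed

lemma G_0: "G n 0 = 0" by (simp add: G_def)

lemma ph_1: "ph n 1 = 0" by (simp add: ph_def j_lam)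

lemma dph_1: "(dph n 1)\<^sup>2 = 2 * (lam n)\<^sup>2"
proof -
  have "(nc n)\<^sup>2 * (dj (lam n))\<^sup>2 = 2" using dj_lam[of n] by (simp add: nc_def power_divide)
  then show ?thesis by (simp add: dph_def power_mult_distrib)
qed

text \<open>An antiderivative of \<open>x powr (2 * \<nu> + 1) * (ph n x)\<^sup>2\<close>, by the Pohozaev identity.\<close>

definition Q :: "nat \<Rightarrow> real \<Rightarrow> real" where
  "Q n x = (x * (G n x * dph n x) / (lam n)\<^sup>2 + x powr (2 * \<nu> + 2) * (ph n x)\<^sup>2 + 2 * \<nu> / (lam n)\<^sup>2 * (ph n x * G n x)) / 2"

lemma Q_cont: "continuous_on {0..1} (Q n)"
  unfolding Q_def using \<nu> lam_pos[of n]
  by (intro continuous_on_divide continuous_on_add continuous_on_mult continuous_on_id G_cont dph_cont ph_cont continuous_on_power powr_cont continuous_on_const) auto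

lemma Q_0: "Q n 0 = 0" by (simp add: Q_def G_0)

text \<open>Unit norm: only the first summand survives at 1, where \<open>ph n\<close> vanishes, and
  the \<open>sqrt 2\<close> of the normalisation makes it \<open>2 / 2\<close>.\<close>

lemma Q_1: "Q n 1 = 1"
  using dph_1[of n] lam_pos[of n] by (simp add: Q_def ph_1 G_def power2_eq_square)

lemma Q_deriv:
  assumes x: "0 < x" shows "(Q n has_real_derivative x powr (2 * \<nu> + 1) * (ph n x)\<^sup>2) (at x)"
proof -
  define p where "p = x powr (2 * \<nu> + 1)"
  define l where "l = (lam n)\<^sup>2"
  have l: "l \<noteq> 0" using lam_pos[of n] by (simp add: l_def)
  have p2: "x powr (2 * \<nu> + 2) = x * p" using x powr_add[of x "2 * \<nu> + 1" 1] by (simp add: p_def add.assoc)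
  have Gx: "G n x = p * dph n x" by (simp add: G_def p_def)
  have d1: "((\<lambda>x. x * (G n x * dph n x) / l) has_real_derivative
    (1 * (G n x * dph n x) + (- l * (p * ph n x) * dph n x + (- (2 * \<nu> + 1) / x * dph n x - l * ph n x) * G n x) * x) / l) (at x)"
    unfolding l_def p_def by (intro DERIV_cdivide DERIV_mult DERIV_ident G_deriv dph_deriv x)
  have d2: "((\<lambda>x. x powr (2 * \<nu> + 2) * (ph n x)\<^sup>2) has_real_derivative
    ((2 * \<nu> + 2) * x powr (2 * \<nu> + 2) / x) * (ph n x)\<^sup>2 + 2 * ph n x * dph n x * x powr (2 * \<nu> + 2)) (at x)"
    by (intro DERIV_mult powr_deriv x) (auto intro!: derivative_eq_intros ph_deriv)
  have d3: "((\<lambda>x. 2 * \<nu> / l * (ph n x * G n x)) has_real_derivative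
    2 * \<nu> / l * (dph n x * G n x + - l * (p * ph n x) * ph n x)) (at x)"
    unfolding l_def p_def by (intro DERIV_cmult DERIV_mult ph_deriv G_deriv x)
  have "(Q n has_real_derivative
    ((1 * (G n x * dph n x) + (- l * (p * ph n x) * dph n x + (- (2 * \<nu> + 1) / x * dph n x - l * ph n x) * G n x) * x) / l
     + (((2 * \<nu> + 2) * x powr (2 * \<nu> + 2) / x) * (ph n x)\<^sup>2 + 2 * ph n x * dph n x * x powr (2 * \<nu> + 2))
     + 2 * \<nu> / l * (dph n x * G n x + - l * (p * ph n x) * ph n x)) / 2) (at x)"
    unfolding Q_def[abs_def] l_def[symmetric] by (intro DERIV_cdivide DERIV_add d1 d2 d3)
  then show ?thesis
  proof (rule DERIV_cong)
    show "((1 * (G n x * dph n x) + (- l * (p * ph n x) * dph n x + (- (2 * \<nu> + 1) / x * dph n x - l * ph n x) * G n x) * x) / l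
     + (((2 * \<nu> + 2) * x powr (2 * \<nu> + 2) / x) * (ph n x)\<^sup>2 + 2 * ph n x * dph n x * x powr (2 * \<nu> + 2))
     + 2 * \<nu> / l * (dph n x * G n x + - l * (p * ph n x) * ph n x)) / 2 = x powr (2 * \<nu> + 1) * (ph n x)\<^sup>2"
      unfolding p2 Gx p_def[symmetric] using x l by (simp add: field_simps power2_eq_square)
  qed
qed

section \<open>The Sturm-Liouville data of the quotients\<close>

definition w :: "real \<Rightarrow> real" where "w x = x powr (2 * \<nu> + 1) * (bessel_phi \<nu> 1 x)\<^sup>2"

lemma w_eq: "0 < x \<Longrightarrow> w x = x powr (2 * \<nu> + 1) * (ph 0 x)\<^sup>2"
  using bessel_phi_eq[of x 0] by (simp add: w_def)

lemma ph0_nz: assumes "0 < x" "x < 1" shows "ph 0 x \<noteq> 0"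
proof
  assume "ph 0 x = 0"
  then have "j (lam 0 * x) = 0" using nc_pos[of 0] by (simp add: ph_def)
  then have "zr (Suc 0) \<le> lam 0 * x" using assms lam_pos[of 0] by (intro zr_Suc_le) (auto simp: zr_0)
  then show False using assms lam_pos[of 0] by (simp add: lam_def mult_le_cancel_left1)
qed

lemma dph_1_nz: "dph n 1 \<noteq> 0"
  using nc_pos[of n] lam_pos[of n] dj_lam[of n] by (simp add: dph_def)

text \<open>The quotients \<open>ph n / ph 0\<close>, continued to the endpoint \<open>1\<close> where both vanish.\<close>

definition e :: "nat \<Rightarrow> real \<Rightarrow> real" where
  "e n x = (if x = 1 then dph n 1 / dph 0 1 else ph n x / ph 0 x)"

text \<open>For n > 0 Lagrange's identity gives the primitive in closed form, as a Wronskian of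
  \<open>ph n\<close> and \<open>ph 0\<close>. For n = 0 that expression is 0 / 0, and the
  antiderivative \<open>Q 0\<close> takes its place.\<close>

definition S :: "nat \<Rightarrow> real \<Rightarrow> real" where
  "S n x = (if n = 0 then Q 0 x else - (G n x * ph 0 x - ph n x * G 0 x) / ((lam n)\<^sup>2 - (lam 0)\<^sup>2))"

definition \<mu> :: "nat \<Rightarrow> real" where "\<mu> n = (lam n)\<^sup>2 - (lam 0)\<^sup>2"

lemma ph0_0: "ph n 0 \<noteq> 0" using nc_pos[of n] j_0 by (simp add: ph_def)

lemma e_cont: "continuous_on {0..1} (e n)"
proof (rule continuous_on_eq_continuous_within[THEN iffD2], rule ballI)
  fix x :: real assume x: "x \<in> {0..1}"
  show "continuous (at x within {0..1}) (e n)"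
  proof (cases "x = 1")
    case False
    then have nz: "ph 0 x \<noteq> 0" using x ph0_nz[of x] ph0_0[of 0] by (cases "x = 0") auto
    have "isCont (\<lambda>x. ph n x / ph 0 x) x"
      using nz by (intro isCont_divide DERIV_isCont[OF ph_deriv])
    moreover have ev: "eventually (\<lambda>y. ph n y / ph 0 y = e n y) (nhds x)"
      by (rule eventually_mono[OF t1_space_nhds[OF False]]) (simp add: e_def)
    ultimately have "isCont (e n) x" by (simp only: isCont_cong[OF ev])
    then show ?thesis by (rule continuous_at_imp_continuous_within)
  next
    case True
    have "((\<lambda>y. (ph n y - ph n 1) / (y - 1) / ((ph 0 y - ph 0 1) / (y - 1))) \<longlongrightarrow> dph n 1 / dph 0 1) (at 1)"
      using ph_deriv[of n 1] ph_deriv[of 0 1] dph_1_nz[of 0]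
      by (intro tendsto_divide) (simp_all add: has_field_derivative_iff)
    then have "(e n \<longlongrightarrow> e n 1) (at 1)"
      by (rule filterlim_cong[THEN iffD1, rotated -1]) (auto simp: eventually_at_filter e_def ph_1)
    then have "isCont (e n) x" using True by (simp only: isCont_def)
    then show ?thesis by (rule continuous_at_imp_continuous_within)
  qed
qed

lemma lam_strict: "strict_mono lam"
  unfolding lam_def using zr_strict by (simp add: strict_mono_def)

lemma \<mu>_strict: "strict_mono \<mu>"
proof (rule strict_monoI)
  fix m n :: nat assume "m < n"
  then have "lam m < lam n" using lam_strict by (simp add: strict_mono_def)
  then have "(lam m)\<^sup>2 < (lam n)\<^sup>2" using lam_pos[of m] by (intro power_strict_mono) auto
  then show "\<mu> m < \<mu> n" by (simp add: \<mu>_def)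
qed

lemma \<mu>_top: "filterlim \<mu> at_top sequentially"
proof -
  have "filterlim lam at_top sequentially"
    unfolding lam_def using zr_top by (rule filterlim_compose[OF _ filterlim_Suc])
  then have "filterlim (\<lambda>n. (lam n)\<^sup>2) at_top sequentially"
    by (intro filterlim_pow_at_top) auto
  from filterlim_tendsto_add_at_top[OF tendsto_const this, of "- (lam 0)\<^sup>2"]
  show ?thesis by (simp add: \<mu>_def[abs_def])
qed

lemma \<mu>_nz: "n \<noteq> 0 \<Longrightarrow> \<mu> n \<noteq> 0"
  using strict_monoD[OF \<mu>_strict, of 0 n] by (simp add: \<mu>_def)

lemma S_deriv:
  assumes x: "x \<in> {0<..<1}"
  shows "(S n has_real_derivative w x * e n x) (at x)"
proof -
  have x0: "0 < x" "x \<noteq> 1" and p0: "ph 0 x \<noteq> 0" using x ph0_nz by auto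
  have we: "w x * e n x = x powr (2 * \<nu> + 1) * (ph n x * ph 0 x)"
    using x0 p0 by (simp add: w_eq e_def power2_eq_square)
  show ?thesis
  proof (cases "n = 0")
    case True
    then show ?thesis using Q_deriv[OF x0(1), of 0] we by (simp add: S_def[abs_def] power2_eq_square)
  next
    case False
    have "((\<lambda>x. - (G n x * ph 0 x - ph n x * G 0 x) / ((lam n)\<^sup>2 - (lam 0)\<^sup>2)) has_real_derivative
      - ((- (lam n)\<^sup>2 * (x powr (2 * \<nu> + 1) * ph n x)) * ph 0 x + dph 0 x * G n x
         - (dph n x * G 0 x + (- (lam 0)\<^sup>2 * (x powr (2 * \<nu> + 1) * ph 0 x)) * ph n x)) / ((lam n)\<^sup>2 - (lam 0)\<^sup>2)) (at x)"
      by (intro DERIV_cdivide DERIV_minus DERIV_diff DERIV_mult G_deriv ph_deriv x0)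
    moreover have "- ((- (lam n)\<^sup>2 * (x powr (2 * \<nu> + 1) * ph n x)) * ph 0 x + dph 0 x * G n x
         - (dph n x * G 0 x + (- (lam 0)\<^sup>2 * (x powr (2 * \<nu> + 1) * ph 0 x)) * ph n x)) / ((lam n)\<^sup>2 - (lam 0)\<^sup>2) = w x * e n x"
    proof -
      have "- ((- (lam n)\<^sup>2 * (x powr (2 * \<nu> + 1) * ph n x)) * ph 0 x + dph 0 x * G n x
         - (dph n x * G 0 x + (- (lam 0)\<^sup>2 * (x powr (2 * \<nu> + 1) * ph 0 x)) * ph n x))
        = ((lam n)\<^sup>2 - (lam 0)\<^sup>2) * (w x * e n x)"
        unfolding we G_def by (simp add: algebra_simps)
      then show ?thesis using \<mu>_nz[OF False] by (simp add: \<mu>_def)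
    qed
    ultimately show ?thesis using False by (simp add: S_def[abs_def])
  qed
qed

lemma e_deriv:
  assumes x: "x \<in> {0<..<1}"
  shows "(e n has_real_derivative - (\<mu> n * S n x / w x)) (at x)"
proof -
  have x0: "0 < x" "x < 1" and p0: "ph 0 x \<noteq> 0" using x ph0_nz by auto
  have "((\<lambda>x. ph n x / ph 0 x) has_real_derivative (dph n x * ph 0 x - ph n x * dph 0 x) / (ph 0 x * ph 0 x)) (at x)"
    by (intro DERIV_divide ph_deriv p0)
  then have "(e n has_real_derivative (dph n x * ph 0 x - ph n x * dph 0 x) / (ph 0 x * ph 0 x)) (at x)"
    by (rule has_field_derivative_transform_within_open[of _ _ _ "{0<..<1}"]) (use x in \<open>auto simp: e_def\<close>)
  moreover have "(dph n x * ph 0 x - ph n x * dph 0 x) / (ph 0 x * ph 0 x) = - (\<mu> n * S n x / w x)"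
  proof (cases "n = 0")
    case False
    have "\<mu> n * S n x = - (G n x * ph 0 x - ph n x * G 0 x)"
      using \<mu>_nz[OF False] False by (simp add: S_def \<mu>_def)
    also have "\<dots> = - (x powr (2 * \<nu> + 1) * (dph n x * ph 0 x - ph n x * dph 0 x))"
      by (simp add: G_def algebra_simps)
    finally show ?thesis using x0 by (simp add: w_eq power2_eq_square)
  qed (simp add: \<mu>_def)
  ultimately show ?thesis by simp
qed

text \<open>Rescaling by \<open>lam n\<close> brings exactly the first n zeros of \<open>j\<close>
  into the open unit interval; this is the count that the oscillation argument needs.\<close>

lemma ph_zero_set: "{x \<in> {0<..<1}. ph n x = 0} = (\<lambda>k. lam k / lam n) ` {..<n}"
proof (intro set_eqI iffI)
  fix x assume "x \<in> {x \<in> {0<..<1}. ph n x = 0}"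
  then have x: "0 < x" "x < 1" "j (lam n * x) = 0" using nc_pos[of n] by (auto simp: ph_def)
  have "0 < lam n * x" using x lam_pos[of n] by simp
  then obtain k where k: "lam n * x = zr (Suc k)" using zero_in_range x(3) by blast
  then have "lam k = lam n * x" by (simp add: lam_def)
  moreover have "lam n * x < lam n * 1" using x lam_pos[of n] by (intro mult_strict_left_mono) auto
  ultimately have "k < n" using strict_mono_less[OF lam_strict, of k n] by simp
  then show "x \<in> (\<lambda>k. lam k / lam n) ` {..<n}"
    using \<open>lam k = lam n * x\<close> lam_pos[of n] by (intro image_eqI[of _ _ k]) auto
next
  fix x assume "x \<in> (\<lambda>k. lam k / lam n) ` {..<n}"
  then obtain k where k: "k < n" "x = lam k / lam n" by auto
  have "lam k < lam n" using k lam_strict by (simp add: strict_mono_def)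
  then show "x \<in> {x \<in> {0<..<1}. ph n x = 0}"
    using k lam_pos[of k] lam_pos[of n] j_lam[of k] by (auto simp: ph_def)
qed

lemma e_zero_iff: "x \<in> {0<..<1} \<Longrightarrow> e n x = 0 \<longleftrightarrow> ph n x = 0"
  using ph0_nz[of x] by (auto simp: e_def)

lemma card_e_zeros: "card {x \<in> {0<..<1}. e n x = 0} = n"
proof -
  have "{x \<in> {0<..<1}. e n x = 0} = (\<lambda>k. lam k / lam n) ` {..<n}"
    using ph_zero_set[of n] e_zero_iff[of _ n] by auto
  moreover have "inj_on (\<lambda>k. lam k / lam n) {..<n}"
    using lam_pos[of n] strict_mono_eq[OF lam_strict] by (intro inj_onI) auto
  ultimately show ?thesis by (simp add: card_image)
qed

lemma e_zero_simple:
  assumes n: "1 \<le> n" and x: "x \<in> {0<..<1}" and z: "e n x = 0"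
  shows "S n x \<noteq> 0"
proof -
  have p: "ph n x = 0" using z e_zero_iff[OF x] by simp
  then have "j (lam n * x) = 0" using nc_pos[of n] by (simp add: ph_def)
  then have "dj (lam n * x) \<noteq> 0" using x lam_pos[of n] by (intro zeros_simple) auto
  then have "dph n x \<noteq> 0" using nc_pos[of n] lam_pos[of n] by (simp add: dph_def)
  moreover have "(lam n)\<^sup>2 - (lam 0)\<^sup>2 \<noteq> 0" using \<mu>_nz[of n] n by (simp add: \<mu>_def)
  ultimately show ?thesis using n x p ph0_nz[of x] by (simp add: S_def G_def)
qed

text \<open>\<open>ph 0\<close> has a simple zero at 1 and no other in \<open>{0..1}\<close>, so its
  quotient by \<open>x - 1\<close> extends to a continuous function without zeros on a compact
  interval.\<close>

lemma w_comparable: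
  obtains A where "0 < A" "\<And>x. x \<in> {0<..<1} \<Longrightarrow> x powr (2 * \<nu> + 1) * (1 - x)\<^sup>2 \<le> A * w x"
    "\<And>x. x \<in> {0<..<1} \<Longrightarrow> w x \<le> A * (x powr (2 * \<nu> + 1) * (1 - x)\<^sup>2)"
proof -
  define g where "g x = (if x = 1 then dph 0 1 else (ph 0 x - ph 0 1) / (x - 1))" for x
  have cont: "continuous_on {0..1} (\<lambda>x. \<bar>g x\<bar>)"
  proof (rule continuous_on_rabs, rule continuous_on_eq_continuous_within[THEN iffD2], rule ballI)
    fix x :: real assume x: "x \<in> {0..1}"
    show "continuous (at x within {0..1}) g"
    proof (cases "x = 1")
      case False
      have "isCont (\<lambda>x. (ph 0 x - ph 0 1) / (x - 1)) x"
        using False by (intro isCont_divide isCont_diff DERIV_isCont[OF ph_deriv] continuous_const continuous_ident) auto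
      moreover have ev: "eventually (\<lambda>y. (ph 0 y - ph 0 1) / (y - 1) = g y) (nhds x)"
        by (rule eventually_mono[OF t1_space_nhds[OF False]]) (simp add: g_def)
      ultimately have "isCont g x" by (simp only: isCont_cong[OF ev])
      then show ?thesis by (rule continuous_at_imp_continuous_within)
    next
      case True
      have "((\<lambda>y. (ph 0 y - ph 0 1) / (y - 1)) \<longlongrightarrow> dph 0 1) (at 1)"
        using ph_deriv[of 0 1] by (simp add: has_field_derivative_iff)
      then have "(g \<longlongrightarrow> g 1) (at 1)"
        by (rule filterlim_cong[THEN iffD1, rotated -1]) (auto simp: eventually_at_filter g_def)
      then have "isCont g x" using True by (simp only: isCont_def)
      then show ?thesis by (rule continuous_at_imp_continuous_within)
    qed
  qed
  have nz: "g x \<noteq> 0" if "x \<in> {0..1}" for x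
    using that dph_1_nz[of 0] ph0_nz[of x] ph0_0[of 0] by (cases "x = 0") (auto simp: g_def ph_1)
  obtain p where p: "p \<in> {0..1}" "\<And>x. x \<in> {0..1} \<Longrightarrow> \<bar>g p\<bar> \<le> \<bar>g x\<bar>"
    using continuous_attains_inf[of "{0..1}" "\<lambda>x. \<bar>g x\<bar>"] cont by auto
  obtain q where q: "q \<in> {0..1}" "\<And>x. x \<in> {0..1} \<Longrightarrow> \<bar>g x\<bar> \<le> \<bar>g q\<bar>"
    using continuous_attains_sup[of "{0..1}" "\<lambda>x. \<bar>g x\<bar>"] cont by auto
  have gp: "0 < (g p)\<^sup>2" using nz[OF p(1)] by simp
  have gb: "(g p)\<^sup>2 \<le> (g x)\<^sup>2" "(g x)\<^sup>2 \<le> (g q)\<^sup>2" if "x \<in> {0..1}" for x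
    using p(2)[OF that] q(2)[OF that] by (simp_all add: abs_le_square_iff)
  define A where "A = max (1 / (g p)\<^sup>2) ((g q)\<^sup>2)"
  have w_g: "w x = x powr (2 * \<nu> + 1) * (1 - x)\<^sup>2 * (g x)\<^sup>2" if x: "x \<in> {0<..<1}" for x
  proof -
    have "ph 0 x = (x - 1) * g x" using x by (simp add: g_def ph_1)
    then have "(ph 0 x)\<^sup>2 = (1 - x)\<^sup>2 * (g x)\<^sup>2" by (simp add: power_mult_distrib power2_commute)
    then show ?thesis using x by (simp add: w_eq)
  qed
  show thesis
  proof (rule that[of A])
    show A0: "0 < A" using gp by (simp add: A_def less_max_iff_disj)
    fix x :: real assume x: "x \<in> {0<..<1}"
    define v where "v = x powr (2 * \<nu> + 1) * (1 - x)\<^sup>2"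
    have v: "0 \<le> v" by (simp add: v_def)
    have "1 / (g p)\<^sup>2 * (g p)\<^sup>2 \<le> A * (g x)\<^sup>2" using gb(1)[of x] x gp A0 by (intro mult_mono) (auto simp: A_def)
    then have "v * 1 \<le> v * (A * (g x)\<^sup>2)" using gp v by (intro mult_left_mono) auto
    then show "x powr (2 * \<nu> + 1) * (1 - x)\<^sup>2 \<le> A * w x" by (simp add: w_g[OF x] v_def mult_ac)
    have "(g x)\<^sup>2 \<le> A" using gb(2)[of x] x by (simp add: A_def le_max_iff_disj)
    then have "v * (g x)\<^sup>2 \<le> v * A" using v by (intro mult_left_mono)
    then show "w x \<le> A * (x powr (2 * \<nu> + 1) * (1 - x)\<^sup>2)" by (simp add: w_g[OF x] v_def mult_ac)
  qed
qed

lemma sturm_liouville: obtains A where "dual_sturm_liouville w e S \<mu> A (2 * \<nu> + 1)"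
proof -
  obtain A where A: "0 < A" "\<And>x. x \<in> {0<..<1} \<Longrightarrow> x powr (2 * \<nu> + 1) * (1 - x)\<^sup>2 \<le> A * w x"
    "\<And>x. x \<in> {0<..<1} \<Longrightarrow> w x \<le> A * (x powr (2 * \<nu> + 1) * (1 - x)\<^sup>2)"
    using w_comparable by blast
  have "dual_sturm_liouville w e S \<mu> A (2 * \<nu> + 1)"
  proof
    show "0 < A" by (rule A)
    show "-1 < 2 * \<nu> + 1" using \<nu> by simp
    show "continuous_on {0<..<1} w"
    proof -
      have "continuous_on {0<..<1} (\<lambda>x. x powr (2 * \<nu> + 1) * (ph 0 x)\<^sup>2)"
        by (intro continuous_intros ph_cont) auto
      then show ?thesis by (rule continuous_on_eq) (simp add: w_eq)
    qed
    show "x powr (2 * \<nu> + 1) * (1 - x)\<^sup>2 \<le> A * w x" "w x \<le> A * (x powr (2 * \<nu> + 1) * (1 - x)\<^sup>2)"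
      if "x \<in> {0<..<1}" for x using A that by auto
    show "continuous_on {0..1} (e n)" for n by (rule e_cont)
    show "e 0 x = 1" if "x \<in> {0..1}" for x
      using that dph_1_nz[of 0] ph0_nz[of x] ph0_0[of 0] by (cases "x = 0") (auto simp: e_def)
    show "0 < e n 0" for n using nc_pos j_0 by (simp add: e_def ph_def)
    show "e n 1 \<noteq> 0" for n using dph_1_nz by (simp add: e_def)
    show "continuous_on {0..1} (S n)" for n
    proof (cases "n = 0")
      case True
      then show ?thesis using Q_cont[of 0] by (simp add: S_def[abs_def])
    next
      case False
      have "continuous_on {0..1} (\<lambda>x. - (G n x * ph 0 x - ph n x * G 0 x) / ((lam n)\<^sup>2 - (lam 0)\<^sup>2))"
        using \<mu>_nz[OF False] by (intro continuous_intros G_cont ph_cont) (simp add: \<mu>_def)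
      then show ?thesis using False by (simp add: S_def[abs_def])
    qed
    show "S n 0 = 0" for n by (simp add: S_def Q_0 G_0)
    show "S n 1 = (if n = 0 then 1 else 0)" for n by (simp add: S_def Q_1 ph_1)
    show "(S n has_real_derivative w x * e n x) (at x)" if "x \<in> {0<..<1}" for n x using that by (rule S_deriv)
    show "(e n has_real_derivative - (\<mu> n * S n x / w x)) (at x)" if "x \<in> {0<..<1}" for n x using that by (rule e_deriv)
    show "((\<lambda>x. w x * (e n x)\<^sup>2) has_integral 1) {0..1}" for n
    proof -
      have "((\<lambda>x. w x * (e n x)\<^sup>2) has_integral Q n 1 - Q n 0) {0..1}"
      proof (rule fundamental_theorem_of_calculus_interior)
        fix x :: real assume x: "x \<in> {0<..<1}"
        have "w x * (e n x)\<^sup>2 = x powr (2 * \<nu> + 1) * (ph n x)\<^sup>2"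
          using x ph0_nz[of x] by (simp add: w_eq e_def power_divide)
        then show "(Q n has_vector_derivative w x * (e n x)\<^sup>2) (at x)"
          using Q_deriv[of x n] x by (simp add: has_real_derivative_iff_has_vector_derivative)
      qed (auto intro: Q_cont)
      then show ?thesis by (simp add: Q_0 Q_1)
    qed
    show "\<mu> 0 = 0" by (simp add: \<mu>_def)
    show "strict_mono \<mu>" by (rule \<mu>_strict)
    show "filterlim \<mu> at_top sequentially" by (rule \<mu>_top)
    show "card {x \<in> {0<..<1}. e n x = 0} = n" for n by (rule card_e_zeros)
    show "S n x \<noteq> 0" if "1 \<le> n" "x \<in> {0<..<1}" "e n x = 0" for n x using that by (rule e_zero_simple)
  qed
  then show thesis by (rule that)
qed

end

section \<open>Boundedness of the maximal operators\<close>

lemma enn_powr_mono: "a \<le> b \<Longrightarrow> 0 \<le> r \<Longrightarrow> enn_powr a r \<le> enn_powr b r"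
  by (cases a; cases b) (auto simp: enn_powr_def ennreal_le_iff powr_mono2 top_unique)

lemma enn_powr_ennreal: "0 \<le> x \<Longrightarrow> enn_powr (ennreal x) r = ennreal (x powr r)"
  by (simp add: enn_powr_def)

lemma enn_powr_mult:
  assumes "0 < D" shows "enn_powr (ennreal D * a) r = ennreal (D powr r) * enn_powr a r"
proof (cases a)
  case (real x)
  then have "ennreal D * a = ennreal (D * x)" using assms by (simp add: ennreal_mult)
  moreover have "enn_powr (ennreal (D * x)) r = ennreal (D powr r) * enn_powr (ennreal x) r"
    using real(1) assms by (subst (1 2) enn_powr_ennreal) (simp_all add: powr_mult ennreal_mult)
  ultimately show ?thesis by (simp only: real(2))
qed (use assms in \<open>simp add: enn_powr_def ennreal_mult_top\<close>)

lemma enn_powr_1: "enn_powr a 1 = a"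
  by (cases a) (auto simp: enn_powr_def)

lemma enn_powr_less_top: "enn_powr a r < \<infinity> \<Longrightarrow> a < \<infinity>"
  by (cases a) (auto simp: enn_powr_def)

lemma Lp_norm_ennreal:
  assumes "1 \<le> q" shows "Lp_norm M (ennreal q) g = enn_powr (\<integral>\<^sup>+x. enn_powr (g x) q \<partial>M) (1 / q)"
  using assms by (simp add: Lp_norm_def)

context interval_measure
begin

text \<open>Finite measure. Integrability gives continuity of the single operators, hence
  measurability of the maximal function.\<close>

lemma Lp_integrable:
  assumes "f \<in> Lp M p" "1 \<le> p" shows "integrable M f"
proof -
  have f[measurable]: "f \<in> borel_measurable M" and fin: "Lp_norm M p (\<lambda>x. ennreal (cmod (f x))) < \<infinity>"
    using assms(1) by (auto simp: Lp_def)
  show ?thesis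
  proof (cases p)
    case (real q)
    then have q: "1 \<le> q" using assms(2) by (simp add: ennreal_le_iff flip: ennreal_1)
    have "(\<integral>\<^sup>+x. enn_powr (ennreal (cmod (f x))) q \<partial>M) < \<infinity>"
      using fin unfolding real Lp_norm_ennreal[OF q] by (rule enn_powr_less_top)
    then have I: "(\<integral>\<^sup>+x. ennreal (cmod (f x) powr q) \<partial>M) < \<infinity>" by (simp add: enn_powr_ennreal)
    have "(\<integral>\<^sup>+x. ennreal (cmod (f x)) \<partial>M) \<le> (\<integral>\<^sup>+x. 1 + ennreal (cmod (f x) powr q) \<partial>M)"
    proof (rule nn_integral_mono)
      fix x
      have "cmod (f x) \<le> 1 + cmod (f x) powr q"
      proof (cases "cmod (f x) \<le> 1")
        case True
        then show ?thesis by (simp add: add_increasing2)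
      next
        case False
        then have "cmod (f x) powr 1 \<le> cmod (f x) powr q" using q by (intro powr_mono) auto
        then show ?thesis using False by simp
      qed
      then show "ennreal (cmod (f x)) \<le> 1 + ennreal (cmod (f x) powr q)"
        by (simp add: ennreal_leI ennreal_plus[symmetric] del: ennreal_plus flip: ennreal_1)
    qed
    also have "\<dots> = emeasure M (space M) + (\<integral>\<^sup>+x. ennreal (cmod (f x) powr q) \<partial>M)"
      by (subst nn_integral_add) auto
    also have "\<dots> < \<infinity>" using I by (simp add: ennreal_add_less_top emeasure_finite less_top[symmetric])
    finally show ?thesis by (intro integrableI_bounded) auto
  next
    case top
    then have "esssup M (\<lambda>x. ennreal (cmod (f x))) < \<infinity>" using fin by (simp add: Lp_norm_def)
    then obtain c where c: "0 \<le> c" "esssup M (\<lambda>x. ennreal (cmod (f x))) = ennreal c"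
      by (cases "esssup M (\<lambda>x. ennreal (cmod (f x)))") auto
    have "AE x in M. ennreal (cmod (f x)) \<le> ennreal c"
      using esssup_AE[of "\<lambda>x. ennreal (cmod (f x))" M] c by simp
    then have "AE x in M. norm (f x) \<le> c" using c by simp
    then show ?thesis by (intro integrable_const_bound) auto
  qed
qed

lemma interval_maximal_le_esssup:
  assumes [measurable]: "g \<in> borel_measurable M"
  shows "interval_maximal M g x \<le> esssup M g"
  unfolding interval_maximal_def
proof (intro SUP_least, clarify)
  fix a b assume ab: "0 \<le> a" "a < x" "x < b" "b \<le> 1"
  have [measurable]: "{a<..<b} \<in> sets M" using sets_M ab by auto
  have m: "emeasure M {a<..<b} \<noteq> 0" "emeasure M {a<..<b} \<noteq> \<infinity>" using pos_M[of a b] ab by (auto simp: less_top)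
  have "(\<integral>\<^sup>+y\<in>{a<..<b}. g y \<partial>M) \<le> (\<integral>\<^sup>+y. esssup M g * indicator {a<..<b} y \<partial>M)"
    using esssup_AE[of g M] by (intro nn_integral_mono_AE) (auto elim!: eventually_mono intro: mult_right_mono)
  also have "\<dots> = esssup M g * emeasure M {a<..<b}" by (rule nn_integral_cmult_indicator) measurable
  finally have "(\<integral>\<^sup>+y\<in>{a<..<b}. g y \<partial>M) / emeasure M {a<..<b} \<le> esssup M g * emeasure M {a<..<b} / emeasure M {a<..<b}"
    by (rule divide_right_mono_ennreal)
  then show "(\<integral>\<^sup>+y\<in>{a<..<b}. g y \<partial>M) / emeasure M {a<..<b} \<le> esssup M g"
    using m by (simp add: mult_divide_eq_ennreal)
qed

section \<open>From pointwise domination to operator bounds\<close>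

context
  fixes T :: "(real \<Rightarrow> complex) \<Rightarrow> real \<Rightarrow> ennreal" and C :: real
  assumes T_measurable: "\<And>f. integrable M f \<Longrightarrow> T f \<in> borel_measurable M"
    and T_le: "\<And>f x. f \<in> borel_measurable M \<Longrightarrow> x \<in> space M \<Longrightarrow> T f x \<le> ennreal C * interval_maximal M (\<lambda>y. ennreal (cmod (f y))) x"
    and C: "0 < C"
begin

lemma bounded_on_Lp_dominated:
  assumes p: "1 < p" shows "bounded_on_Lp M p T"
proof (cases p)
  case top
  have "T f \<in> borel_measurable M \<and> Lp_norm M p (T f) \<le> ennreal C * Lp_norm M p (\<lambda>x. ennreal (cmod (f x)))"
    if f: "f \<in> Lp M p" for f
  proof
    have fm[measurable]: "f \<in> borel_measurable M" using f by (simp add: Lp_def)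
    show m: "T f \<in> borel_measurable M" using Lp_integrable[OF f] p by (intro T_measurable) auto
    have "T f x \<le> ennreal C * esssup M (\<lambda>x. ennreal (cmod (f x)))" if "x \<in> space M" for x
    proof -
      have "T f x \<le> ennreal C * interval_maximal M (\<lambda>y. ennreal (cmod (f y))) x" using T_le[OF fm that] .
      also have "\<dots> \<le> ennreal C * esssup M (\<lambda>x. ennreal (cmod (f x)))"
        by (intro mult_left_mono interval_maximal_le_esssup) auto
      finally show ?thesis .
    qed
    then have "esssup M (T f) \<le> ennreal C * esssup M (\<lambda>x. ennreal (cmod (f x)))"
      by (intro esssup_I m AE_I2)
    then show "Lp_norm M p (T f) \<le> ennreal C * Lp_norm M p (\<lambda>x. ennreal (cmod (f x)))"
      using top by (simp add: Lp_norm_def)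
  qed
  then show ?thesis unfolding bounded_on_Lp_def using C by (intro exI[of _ C]) auto
next
  case (real q)
  then have q: "1 < q" using p by (simp add: ennreal_less_iff flip: ennreal_1)
  define D where "D = C powr q * (4 * q * 2 powr (q - 1) / (q - 1))"
  have D: "0 < D" using C q by (simp add: D_def)
  have "T f \<in> borel_measurable M \<and> Lp_norm M p (T f) \<le> ennreal (D powr (1 / q)) * Lp_norm M p (\<lambda>x. ennreal (cmod (f x)))"
    if f: "f \<in> Lp M p" for f
  proof
    have fm[measurable]: "f \<in> borel_measurable M" using f by (simp add: Lp_def)
    show m: "T f \<in> borel_measurable M" using Lp_integrable[OF f] p by (intro T_measurable) auto
    define N where "N = interval_maximal M (\<lambda>y. ennreal (cmod (f y)))"
    have "(\<integral>\<^sup>+x. enn_powr (T f x) q \<partial>M) \<le> (\<integral>\<^sup>+x. ennreal (C powr q) * enn_powr (N x) q \<partial>M)"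
    proof (rule nn_integral_mono)
      fix x assume "x \<in> space M"
      then have "enn_powr (T f x) q \<le> enn_powr (ennreal C * N x) q"
        unfolding N_def using q by (intro enn_powr_mono T_le fm) auto
      then show "enn_powr (T f x) q \<le> ennreal (C powr q) * enn_powr (N x) q" by (simp only: enn_powr_mult[OF C])
    qed
    also have "\<dots> = ennreal (C powr q) * (\<integral>\<^sup>+x. enn_powr (N x) q \<partial>M)"
    proof (rule nn_integral_cmult)
      have [measurable]: "N \<in> borel_measurable M" unfolding N_def by measurable
      show "(\<lambda>x. enn_powr (N x) q) \<in> borel_measurable M" unfolding enn_powr_def by measurable
    qed
    also have "\<dots> \<le> ennreal (C powr q) * (ennreal (4 * q * 2 powr (q - 1) / (q - 1)) * (\<integral>\<^sup>+x. ennreal (cmod (f x) powr q) \<partial>M))"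
      unfolding N_def using q by (intro mult_left_mono interval_maximal_strong_type) auto
    also have "\<dots> = ennreal D * (\<integral>\<^sup>+x. enn_powr (ennreal (cmod (f x))) q \<partial>M)"
    proof -
      have "ennreal D = ennreal (C powr q) * ennreal (4 * q * 2 powr (q - 1) / (q - 1))"
        unfolding D_def using q by (intro ennreal_mult) auto
      then show ?thesis by (simp only: mult.assoc enn_powr_ennreal norm_ge_zero)
    qed
    finally have "enn_powr (\<integral>\<^sup>+x. enn_powr (T f x) q \<partial>M) (1 / q) \<le> enn_powr (ennreal D * (\<integral>\<^sup>+x. enn_powr (ennreal (cmod (f x))) q \<partial>M)) (1 / q)"
      using q by (intro enn_powr_mono) auto
    then show "Lp_norm M p (T f) \<le> ennreal (D powr (1 / q)) * Lp_norm M p (\<lambda>x. ennreal (cmod (f x)))"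
      using q by (simp only: real Lp_norm_ennreal less_imp_le enn_powr_mult[OF D])
  qed
  then show ?thesis unfolding bounded_on_Lp_def by (intro exI[of _ "D powr (1 / q)"]) auto
qed

lemma bounded_L1_weak_L1_dominated: "bounded_L1_weak_L1 M T"
  unfolding bounded_L1_weak_L1_def
proof (intro exI[of _ "2 * C"] conjI ballI allI impI)
  show "0 \<le> 2 * C" using C by simp
  fix f assume f: "f \<in> Lp M 1"
  have fm[measurable]: "f \<in> borel_measurable M" using f by (simp add: Lp_def)
  show "T f \<in> borel_measurable M" using Lp_integrable[OF f] by (intro T_measurable) auto
  fix \<alpha> :: real assume \<alpha>: "0 < \<alpha>"
  define N where "N = interval_maximal M (\<lambda>y. ennreal (cmod (f y)))"
  have [measurable]: "N \<in> borel_measurable M" unfolding N_def by measurable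
  have "{x \<in> space M. ennreal \<alpha> < T f x} \<subseteq> {x \<in> space M. ennreal (\<alpha> / C) < N x}"
  proof safe
    fix x assume x: "x \<in> space M" "ennreal \<alpha> < T f x"
    then have less: "ennreal \<alpha> < ennreal C * N x" using T_le[OF fm x(1)] by (simp add: N_def)
    show "ennreal (\<alpha> / C) < N x"
    proof (rule ccontr)
      assume "\<not> ennreal (\<alpha> / C) < N x"
      then have "ennreal C * N x \<le> ennreal C * ennreal (\<alpha> / C)" by (intro mult_left_mono) auto
      also have "\<dots> = ennreal \<alpha>" using C \<alpha> by (simp add: ennreal_mult'[symmetric])
      finally show False using less by simp
    qed
  qed
  then have "ennreal \<alpha> * emeasure M {x \<in> space M. ennreal \<alpha> < T f x} \<le> ennreal \<alpha> * emeasure M {x \<in> space M. ennreal (\<alpha> / C) < N x}"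
    by (intro mult_left_mono emeasure_mono) auto
  also have "\<dots> = ennreal C * (ennreal (\<alpha> / C) * emeasure M {x \<in> space M. ennreal (\<alpha> / C) < N x})"
    using C \<alpha> by (simp add: mult.assoc[symmetric] ennreal_mult'[symmetric])
  also have "\<dots> \<le> ennreal C * (2 * (\<integral>\<^sup>+y. ennreal (cmod (f y)) \<partial>M))"
    unfolding N_def by (intro mult_left_mono interval_maximal_weak_type) auto
  also have "\<dots> = ennreal (2 * C) * Lp_norm M 1 (\<lambda>x. ennreal (cmod (f x)))"
    using C Lp_norm_ennreal[of 1 M "\<lambda>x. ennreal (cmod (f x))"]
    by (simp add: enn_powr_1 ennreal_mult mult_ac)
  finally show "ennreal \<alpha> * emeasure M {x \<in> space M. ennreal \<alpha> < T f x} \<le> ennreal (2 * C) * Lp_norm M 1 (\<lambda>x. ennreal (cmod (f x)))" .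
qed

end

text \<open>The index set may be uncountable, so measurability is obtained from superlevel sets
  being unions of open sets.\<close>

lemma measurable_SUP_continuous:
  fixes F :: "'t \<Rightarrow> real \<Rightarrow> complex"
  assumes "\<And>t. t \<in> I \<Longrightarrow> continuous_on {0<..<1} (F t)"
  shows "(\<lambda>x. SUP t\<in>I. ennreal (cmod (F t x))) \<in> borel_measurable M"
proof (rule borel_measurableI_greater)
  fix a :: ennreal
  have "open ((\<lambda>x. ennreal (cmod (F t x))) -` {a<..} \<inter> {0<..<1})" if "t \<in> I" for t
  proof -
    have "open ({0<..<1} \<inter> (\<lambda>x. ennreal (cmod (F t x))) -` {a<..})"
      by (intro continuous_open_preimage continuous_on_ennreal continuous_intros assms that open_greaterThan open_greaterThanLessThan)
    then show ?thesis by (simp only: Int_commute)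
  qed
  then have "open (\<Union>t\<in>I. (\<lambda>x. ennreal (cmod (F t x))) -` {a<..} \<inter> {0<..<1})" by (intro open_UN) auto
  moreover have "{x \<in> space M. a < (SUP t\<in>I. ennreal (cmod (F t x)))} = (\<Union>t\<in>I. (\<lambda>x. ennreal (cmod (F t x))) -` {a<..} \<inter> {0<..<1})"
    by (auto simp: less_SUP_iff space_M)
  ultimately show "{x \<in> space M. (SUP t\<in>I. ennreal (cmod (F t x))) > a} \<in> sets M"
    by (intro open_Int_sets) (auto simp: space_M)
qed

end

theorem corollary7p15:
  fixes \<nu> :: real
  assumes "-1 < \<nu>"
  shows "(\<forall>p::ennreal. 1 < p \<and> p \<le> \<infinity> \<longrightarrow>
            bounded_on_Lp (eta \<nu>) p (H_max \<nu>) \<and> bounded_on_Lp (eta \<nu>) p (HM_max \<nu>)) \<and>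
         bounded_L1_weak_L1 (eta \<nu>) (H_max \<nu>) \<and> bounded_L1_weak_L1 (eta \<nu>) (HM_max \<nu>)"
proof -
  interpret B: bessel_order \<nu> by standard (rule assms)
  obtain A where "dual_sturm_liouville B.w B.e B.S B.\<mu> A (2 * \<nu> + 1)" by (rule B.sturm_liouville)
  then interpret L: dual_sturm_liouville B.w B.e B.S B.\<mu> A "2 * \<nu> + 1" .
  have M: "eta \<nu> = L.M" by (simp add: eta_def L.M_def B.w_def)
  have zero: "bessel_zero \<nu> (Suc n) = B.lam n" for n by (simp add: B.lam_def B.zr_def)
  \<comment> \<open>\<open>bessel_varphi\<close> and \<open>B.e\<close> agree on the open interval,
    which is enough for derivatives inside; at 1 the former is 0 / 0.\<close>
  have deriv: "deriv (bessel_varphi \<nu> (Suc n)) x = - (B.\<mu> n * B.S n x / B.w x)" if x: "x \<in> {0<..<1}" for n x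
  proof (rule DERIV_imp_deriv)
    show "(bessel_varphi \<nu> (Suc n) has_real_derivative - (B.\<mu> n * B.S n x / B.w x)) (at x)"
    proof (rule has_field_derivative_transform_within_open[OF L.e_deriv[OF x]])
      fix y :: real assume "y \<in> {0<..<1}"
      then show "B.e n y = bessel_varphi \<nu> (Suc n) y"
        using B.bessel_phi_eq[of y n] B.bessel_phi_eq[of y 0] by (simp add: bessel_varphi_def B.e_def)
    qed (use x in auto)
  qed
  have HM: "HM_kernel \<nu> t x y = L.h t x y" if t: "0 < t" and x: "x \<in> {0<..<1}" and y: "y \<in> {0<..<1}" for t x y
  proof -
    define F where "F n = B.\<mu> n * exp (- t * B.\<mu> n) * (B.S n x * B.S n y)" for n
    have sF: "summable F" unfolding F_def using x y by (intro L.k_summable t) auto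
    have w: "B.w x \<noteq> 0" "B.w y \<noteq> 0" using L.w_pos[OF x] L.w_pos[OF y] by auto
    have "exp ((B.lam 0)\<^sup>2 * t) * (let n = m + 2 in exp (- (bessel_zero \<nu> n)\<^sup>2 * t) *
        (deriv (bessel_varphi \<nu> n) x * deriv (bessel_varphi \<nu> n) y) / ((bessel_zero \<nu> n)\<^sup>2 - (bessel_zero \<nu> 1)\<^sup>2))
      = F (Suc m) / (B.w x * B.w y)" for m
    proof -
      have mu: "(bessel_zero \<nu> (m + 2))\<^sup>2 - (bessel_zero \<nu> 1)\<^sup>2 = B.\<mu> (Suc m)" "bessel_zero \<nu> (m + 2) = B.lam (Suc m)"
        using zero[of "Suc m"] zero[of 0] by (simp_all add: B.\<mu>_def)
      have d: "deriv (bessel_varphi \<nu> (m + 2)) z = - (B.\<mu> (Suc m) * B.S (Suc m) z / B.w z)" if "z \<in> {0<..<1}" for z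
        using deriv[OF that, of "Suc m"] by simp
      \<comment> \<open>The modifying factor shifts the exponents from \<open>(B.lam n)^2\<close> to
        \<open>B.\<mu> n\<close>.\<close>
      have ex: "exp ((B.lam 0)\<^sup>2 * t) * exp (- (B.lam (Suc m))\<^sup>2 * t) = exp (- t * B.\<mu> (Suc m))"
        by (simp add: exp_add[symmetric] B.\<mu>_def algebra_simps)
      have "0 < B.\<mu> (Suc m)" by (rule L.\<mu>_pos) simp
      then show ?thesis
        unfolding Let_def d[OF x] d[OF y] mu(1) F_def ex[symmetric]
        unfolding mu(2) using w by (simp add: field_simps)
    qed
    then have "HM_kernel \<nu> t x y = (\<Sum>m. F (Suc m) / (B.w x * B.w y))"
    proof -
      assume eq: "\<And>m. exp ((B.lam 0)\<^sup>2 * t) * (let n = m + 2 in exp (- (bessel_zero \<nu> n)\<^sup>2 * t) *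
        (deriv (bessel_varphi \<nu> n) x * deriv (bessel_varphi \<nu> n) y) / ((bessel_zero \<nu> n)\<^sup>2 - (bessel_zero \<nu> 1)\<^sup>2))
        = F (Suc m) / (B.w x * B.w y)"
      define f where "f m = (let n = m + 2 in exp (- (bessel_zero \<nu> n)\<^sup>2 * t) *
        (deriv (bessel_varphi \<nu> n) x * deriv (bessel_varphi \<nu> n) y) / ((bessel_zero \<nu> n)\<^sup>2 - (bessel_zero \<nu> 1)\<^sup>2))" for m
      have ef: "exp ((B.lam 0)\<^sup>2 * t) * f m = F (Suc m) / (B.w x * B.w y)" for m using eq[of m] by (simp only: f_def)
      have "summable (\<lambda>m. F (Suc m))" using sF by (simp add: summable_Suc_iff)
      then have "summable (\<lambda>m. exp ((B.lam 0)\<^sup>2 * t) * f m)" unfolding ef by (rule summable_divide)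
      then have "summable f" by (simp add: summable_cmult_iff)
      then have "(\<Sum>m. exp ((B.lam 0)\<^sup>2 * t) * f m) = exp ((B.lam 0)\<^sup>2 * t) * (\<Sum>m. f m)" by (rule suminf_mult)
      moreover have "HM_kernel \<nu> t x y = exp ((B.lam 0)\<^sup>2 * t) * (\<Sum>m. f m)"
        using zero[of 0] by (simp add: HM_kernel_def H_kernel_def f_def)
      ultimately show ?thesis by (simp add: ef)
    qed
    also have "\<dots> = (\<Sum>m. F (Suc m)) / (B.w x * B.w y)"
      using sF by (intro suminf_divide) (simp add: summable_Suc_iff)
    \<comment> \<open>The kernel starts with the second eigenfunction, index 1 in the present
      numbering; index 0 contributes nothing because \<open>B.\<mu> 0 = 0\<close>.\<close>
    also have "(\<Sum>m. F (Suc m)) = (\<Sum>n. F n)"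
      using suminf_split_head[OF sF] by (simp add: F_def[of 0] L.\<mu>_0)
    finally show ?thesis by (simp add: L.h_def L.k_def F_def)
  qed
  have HM_op: "HM_op \<nu> t f x = (LINT y|L.M. L.h t x y *\<^sub>R f y)" if "0 < t" "x \<in> {0<..<1}" for t f x
    unfolding HM_op_def M using that by (intro Bochner_Integration.integral_cong) (auto simp: HM L.space_M)
  have H_op: "H_op \<nu> t f x = exp (- ((B.lam 0)\<^sup>2 * t)) *\<^sub>R HM_op \<nu> t f x" for t f x
  proof -
    have eq: "H_kernel \<nu> t x y *\<^sub>R f y = exp (- ((B.lam 0)\<^sup>2 * t)) *\<^sub>R (HM_kernel \<nu> t x y *\<^sub>R f y)" for y
      using zero[of 0] by (simp add: HM_kernel_def exp_minus)
    show ?thesis unfolding H_op_def HM_op_def eq by (rule integral_scaleR_right)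
  qed
  have HM_cont: "continuous_on {0<..<1} (HM_op \<nu> t f)" if "0 < t" "integrable L.M f" for t f
    using L.heat_continuous[OF that] by (rule continuous_on_eq) (simp add: HM_op that)
  have H_cont: "continuous_on {0<..<1} (H_op \<nu> t f)" if "0 < t" "integrable L.M f" for t f
    unfolding H_op by (intro continuous_intros HM_cont that)
  obtain C where C: "0 < C" "\<And>t x (f :: real \<Rightarrow> complex). 0 < t \<Longrightarrow> x \<in> {0<..<1} \<Longrightarrow> f \<in> borel_measurable L.M \<Longrightarrow>
       ennreal (cmod (LINT y|L.M. L.h t x y *\<^sub>R f y)) \<le> ennreal C * interval_maximal L.M (\<lambda>y. ennreal (cmod (f y))) x"
    using L.heat_le_maximal by blast
  have HM_le: "HM_max \<nu> f x \<le> ennreal C * interval_maximal L.M (\<lambda>y. ennreal (cmod (f y))) x"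
    if "f \<in> borel_measurable L.M" "x \<in> space L.M" for f x
    unfolding HM_max_def using that C(2) by (intro SUP_least) (auto simp: HM_op L.space_M)
  have H_le_HM: "H_max \<nu> f x \<le> HM_max \<nu> f x" for f x
    unfolding H_max_def HM_max_def
  proof (rule SUP_subset_mono[OF order_refl])
    fix t :: real assume t: "t \<in> {0<..}"
    then have "exp (- ((B.lam 0)\<^sup>2 * t)) \<le> 1" by simp
    then have "cmod (H_op \<nu> t f x) \<le> cmod (HM_op \<nu> t f x)"
      unfolding H_op by (simp add: mult_left_le_one_le)
    then show "ennreal (cmod (H_op \<nu> t f x)) \<le> ennreal (cmod (HM_op \<nu> t f x))" by (rule ennreal_leI)
  qed
  have HM_meas: "HM_max \<nu> f \<in> borel_measurable L.M" if "integrable L.M f" for f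
    unfolding HM_max_def[abs_def] using that by (intro L.IM.measurable_SUP_continuous HM_cont) auto
  have H_meas: "H_max \<nu> f \<in> borel_measurable L.M" if "integrable L.M f" for f
    unfolding H_max_def[abs_def] using that by (intro L.IM.measurable_SUP_continuous H_cont) auto
  have H_le: "H_max \<nu> f x \<le> ennreal C * interval_maximal L.M (\<lambda>y. ennreal (cmod (f y))) x"
    if "f \<in> borel_measurable L.M" "x \<in> space L.M" for f x
    using H_le_HM HM_le[OF that] by (rule order_trans)
  show ?thesis unfolding M
    using L.IM.bounded_on_Lp_dominated[OF H_meas H_le C(1)] L.IM.bounded_on_Lp_dominated[OF HM_meas HM_le C(1)]
      L.IM.bounded_L1_weak_L1_dominated[OF H_meas H_le C(1)] L.IM.bounded_L1_weak_L1_dominated[OF HM_meas HM_le C(1)]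
    by blast
qed

end
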